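(* Let $\sigma>0$, $T>0$, $L>0$, let $f,\gamma_1,\dots,\gamma_q:[0,T]\times\mathbf{R}^n\to\mathbf{R}^n$ be sufficiently smooth deterministic functions, $L$-periodic in each spatial coordinate, with $\operatorname{div}\gamma_r=0$, $r=1,\dots,q$, and let $\varphi:\mathbf{R}^n\to\mathbf{R}^n$ be deterministic and $L$-periodic in each coordinate. Consider the stochastic Navier-Stokes equations with additive noise $$dv(t)=\Big[\tfrac{\sigma^2}{2}\Delta v-(v,\nabla)v-\nabla p+f(t,x)\Big]dt+\sum_{r=1}^q\gamma_r(t,x)\,dw_r(t),\quad \operatorname{div}v=0,\quad 0\le t\le T,\ x\in\mathbf{R}^n,$$ with $v(0,x)=\varphi(x)$ and $v,p$ being $L$-periodic in each spatial coordinate. Assume that this problem has a unique classical solution $v(t,x),p(t,x)$, $(t,x)\in[0,T]\times\mathbf{R}^n$, which has continuous derivatives in $x$ ($v$ up to order four, $p$ up to order three), and that the solution and these derivatives have moments of every order $m\ge2$ bounded uniformly in $(t,x)$. For $N\in\{1,2,\dots\}$ let $h=T/N$, $t_k=kh$, and define the layer method $$\bar v(0,x)=\varphi(x),\qquad \bar v(t_{k+1},x)=P\breve v(t_k,x)+Pf(t_k,x)h+\sum_{r=1}^q\gamma_r(t_k,x)\,\big(w_r(t_{k+1})-w_r(t_k)\big),\quad k=0,\dots,N-1,$$ $$\breve v(t_k,x)=2^{-n}\sum_{j=1}^{2^n}\bar v\big(t_k,\,x-\bar v(t_k,x)h+\sigma\sqrt h\,\xi_j\big).$$ Assume that $\bar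 v(t_k,x)$, $k=0,\dots,N$, have continuous first-order spatial derivatives and that $$|\bar v(t_k,x)|\le C_0(\omega),\qquad |\partial\bar v(t_k,x)/\partial x^i|\le C_0(\omega),\quad i=1,\dots,n,$$ where $C_0(\omega)>0$ is an a.s. finite constant independent of $x,h,k$. Then for almost every trajectory $w(\cdot)$ and any $0<\varepsilon<1/2$ there exists a constant $C(\omega)>0$, independent of $h$ and $k$, such that $$\|\bar v(t_k,\cdot)-v(t_k,\cdot)\|\le C(\omega)h^{1/2-\varepsilon},$$ i.e. the layer method converges with order $1/2-\varepsilon$ a.s.
   Context: $(\Omega,\mathcal{F},P)$ is a probability space, $w(t)=(w_1(t),\dots,w_q(t))^\top$ is a $q$-dimensional standard Wiener process on it, and $\mathcal{F}^w_t$, $0\le t\le T$, is the filtration generated by $w$. The dynamics is understood in the Ito integral sense pointwise in $x$; $v\in\mathbf{R}^n$ is the velocity, $p$ is the scalar pressure, and $(v,p)$ is $\mathcal{F}^w_t$-adapted. Here $(v,\nabla)v=\sum_i v^i\,\partial v/\partial x^i$. "Sufficiently smooth" means continuous together with all partial derivatives in $(t,x)$ up to some sufficiently large finite order. Since the solution is classical with continuous space derivatives and the problem is periodic, $v$, $p$ and these derivatives are a.s. bounded on $[0,T]\times Q$ (a standing convention). $Q=(0,L)^n$. For $u:Q\to\mathbf{R}^n$, $\|u\|=\|u(\cdot)\|=\big(\int_Q\sum_{i=1}^n(u^i(x))^2dx\big)^{1/2}$ is the $\mathbf{L}^2(Q)$-norm in the space variable; $|\cdot|$ is the Euclidean length.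 As an operator on functions, $P$ (not to be confused with the probability measure) is the Leray projection: the orthogonal projection of $Q$-periodic vector fields onto divergence-free ones. If $u(x)=\sum_{\mathbf{n}\in\mathbf{Z}^n}u_{\mathbf{n}}e^{i(2\pi/L)(\mathbf{n},x)}$, then $(Pu)_{\mathbf{n}}=u_{\mathbf{n}}-\frac{u_{\mathbf{n}}^\top\mathbf{n}}{|\mathbf{n}|^2}\mathbf{n}$ for $\mathbf{n}\ne\mathbf{0}$ and $(Pu)_{\mathbf{0}}=u_{\mathbf{0}}$. $P$ acts in the variable $x$. $\xi_1,\dots,\xi_{2^n}$ are the $2^n$ elements of $\{-1,1\}^n$. The pressure is normalized to have zero mean over $Q$. *)

theory Defs
  imports "HOL-Probability.Probability"
begin

section \<open>Wiener process and Ito integral\<close>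

text \<open>The raw filtration generated by the process, without completion by null sets.\<close>

definition natural_filtration ::
    "'a measure \<Rightarrow> (real \<Rightarrow> 'a \<Rightarrow> 'b::topological_space) \<Rightarrow> real \<Rightarrow> 'a measure" where
  "natural_filtration M w t =
     sigma (space M) (\<Union>s\<in>{0..t}. {w s -` A \<inter> space M | A. A \<in> sets borel})"

text \<open>Standard Wiener process with values in \<open>real^'q\<close> on the time interval \<open>[0,T]\<close>.\<close>

definition standard_wiener_process ::
    "'a measure \<Rightarrow> real \<Rightarrow> (real \<Rightarrow> 'a \<Rightarrow> real^'q) \<Rightarrow> bool" where
  "standard_wiener_process M T w \<longleftrightarrow>
     (\<forall>t\<in>{0..T}. w t \<in> borel_measurable M) \<and>
     (AE \<omega> in M. w 0 \<omega> = 0) \<and>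
     (AE \<omega> in M. continuous_on {0..T} (\<lambda>t. w t \<omega>)) \<and>
     (\<forall>s t. 0 \<le> s \<and> s < t \<and> t \<le> T \<longrightarrow>
        (\<forall>r. distributed M lborel (\<lambda>\<omega>. (w t \<omega> - w s \<omega>) $ r) (normal_density 0 (sqrt (t - s)))) \<and>
        prob_space.indep_vars M (\<lambda>_. borel) (\<lambda>r \<omega>. (w t \<omega> - w s \<omega>) $ r) UNIV \<and>
        prob_space.indep_set M (sets (natural_filtration M w s))
          (sets (vimage_algebra (space M) (\<lambda>\<omega>. w t \<omega> - w s \<omega>) borel)))"

text \<open>
  An elementary process on \<open>[0,t]\<close> is given by times \<open>\<tau> 0 \<le> \<dots> \<le> \<tau> m\<close> and bounded coefficients
  \<open>e i\<close>, known at time \<open>\<tau> i\<close>, which are its values on \<open>(\<tau> i, \<tau> (i+1)]\<close>.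
\<close>

definition elementary ::
    "(real \<Rightarrow> 'a measure) \<Rightarrow> real \<Rightarrow> (nat \<Rightarrow> real) \<Rightarrow> nat \<Rightarrow> (nat \<Rightarrow> 'a \<Rightarrow> 'b::euclidean_space) \<Rightarrow> bool" where
  "elementary F t \<tau> m e \<longleftrightarrow>
     0 \<le> \<tau> 0 \<and> (\<forall>i<m. \<tau> i \<le> \<tau> (Suc i)) \<and> \<tau> m \<le> t \<and>
     (\<forall>i<m. e i \<in> borel_measurable (F (\<tau> i)) \<and> (\<exists>K. \<forall>\<omega>\<in>space (F (\<tau> i)). norm (e i \<omega>) \<le> K))"

definition elementary_process ::
    "(nat \<Rightarrow> real) \<Rightarrow> nat \<Rightarrow> (nat \<Rightarrow> 'a \<Rightarrow> 'b::euclidean_space) \<Rightarrow> real \<Rightarrow> 'a \<Rightarrow> 'b" where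
  "elementary_process \<tau> m e s \<omega> = (\<Sum>i<m. indicator {\<tau> i<..\<tau> (Suc i)} s *\<^sub>R e i \<omega>)"

definition elementary_integral ::
    "(real \<Rightarrow> 'a \<Rightarrow> real) \<Rightarrow> (nat \<Rightarrow> real) \<Rightarrow> nat \<Rightarrow> (nat \<Rightarrow> 'a \<Rightarrow> 'b::euclidean_space) \<Rightarrow> 'a \<Rightarrow> 'b" where
  "elementary_integral W \<tau> m e \<omega> = (\<Sum>i<m. (W (\<tau> (Suc i)) \<omega> - W (\<tau> i) \<omega>) *\<^sub>R e i \<omega>)"

text \<open>
  \<open>has_ito_integral M F W t H I\<close>: the random variable \<open>I\<close> is (a version of) the Ito integral of \<open>H\<close>
  with respect to the scalar Brownian motion \<open>W\<close> over \<open>[0,t]\<close>, i.e. the mean-square limit of the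
  integrals of elementary processes converging to \<open>H\<close> in mean square on \<open>[0,t] \<times> \<Omega>\<close>.
\<close>

definition has_ito_integral ::
    "'a measure \<Rightarrow> (real \<Rightarrow> 'a measure) \<Rightarrow> (real \<Rightarrow> 'a \<Rightarrow> real) \<Rightarrow> real \<Rightarrow>
     (real \<Rightarrow> 'a \<Rightarrow> 'b::euclidean_space) \<Rightarrow> ('a \<Rightarrow> 'b) \<Rightarrow> bool" where
  "has_ito_integral M F W t H I \<longleftrightarrow>
     (\<lambda>(s, \<omega>). H s \<omega>) \<in> borel_measurable (restrict_space borel {0..t} \<Otimes>\<^sub>M M) \<and>
     I \<in> borel_measurable M \<and>
     (\<exists>\<tau> m e.
        (\<forall>k::nat. elementary F t (\<tau> k) (m k) (e k)) \<and>
        (\<lambda>k. \<integral>\<^sup>+\<omega>. (\<integral>\<^sup>+s\<in>{0..t}. ennreal ((norm (H s \<omega> - elementary_process (\<tau> k) (m k) (e k) s \<omega>))\<^sup>2)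
               \<partial>lborel) \<partial>M) \<longlonglongrightarrow> 0 \<and>
        (\<lambda>k. \<integral>\<^sup>+\<omega>. ennreal ((norm (I \<omega> - elementary_integral W (\<tau> k) (m k) (e k) \<omega>))\<^sup>2) \<partial>M)
          \<longlonglongrightarrow> 0)"


section \<open>Partial derivatives and smoothness\<close>

definition spartial :: "'n::finite \<Rightarrow> (real^'n \<Rightarrow> 'b::real_normed_vector) \<Rightarrow> real^'n \<Rightarrow> 'b" where
  "spartial i g x = vector_derivative (\<lambda>s. g (x + s *\<^sub>R axis i 1)) (at 0)"

definition has_spartial :: "'n::finite \<Rightarrow> (real^'n \<Rightarrow> 'b::real_normed_vector) \<Rightarrow> real^'n \<Rightarrow> bool" where
  "has_spartial i g x \<longleftrightarrow> (\<lambda>s. g (x + s *\<^sub>R axis i 1)) differentiable (at 0)"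

text \<open>
  Fields on \<open>[0,T] \<times> R^n\<close>: direction \<open>None\<close> is time (one-sided derivatives at \<open>0\<close> and \<open>T\<close>),
  direction \<open>Some i\<close> is the \<open>i\<close>-th space coordinate.
\<close>

fun tpartial :: "real \<Rightarrow> 'n::finite option \<Rightarrow> (real \<Rightarrow> real^'n \<Rightarrow> 'b::real_normed_vector) \<Rightarrow> real \<Rightarrow> real^'n \<Rightarrow> 'b" where
  "tpartial T None u t x = vector_derivative (\<lambda>s. u s x) (at t within {0..T})"
| "tpartial T (Some i) u t x = spartial i (u t) x"

fun has_tpartial :: "real \<Rightarrow> 'n::finite option \<Rightarrow> (real \<Rightarrow> real^'n \<Rightarrow> 'b::real_normed_vector) \<Rightarrow> real \<Rightarrow> real^'n \<Rightarrow> bool" where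
  "has_tpartial T None u t x \<longleftrightarrow> (\<lambda>s. u s x) differentiable (at t within {0..T})"
| "has_tpartial T (Some i) u t x \<longleftrightarrow> has_spartial i (u t) x"

definition tpartials ::
    "real \<Rightarrow> 'n::finite option list \<Rightarrow> (real \<Rightarrow> real^'n \<Rightarrow> 'b::real_normed_vector) \<Rightarrow> real \<Rightarrow> real^'n \<Rightarrow> 'b" where
  "tpartials T ds u = foldr (tpartial T) ds u"

text \<open>
  \<open>smooth_in D k T u\<close>: all iterated partial derivatives of \<open>u\<close> of order at most \<open>k\<close> in directions
  from \<open>D\<close> exist and are jointly continuous in \<open>(t,x)\<close> on \<open>[0,T] \<times> R^n\<close>.
\<close>

definition smooth_in ::
    "'n::finite option set \<Rightarrow> nat \<Rightarrow> real \<Rightarrow> (real \<Rightarrow> real^'n \<Rightarrow> 'b::real_normed_vector) \<Rightarrow> bool" where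
  "smooth_in D k T u \<longleftrightarrow>
     (\<forall>ds. set ds \<subseteq> D \<and> length ds \<le> k \<longrightarrow>
        continuous_on ({0..T} \<times> UNIV) (\<lambda>(t, x). tpartials T ds u t x) \<and>
        (length ds < k \<longrightarrow>
          (\<forall>d\<in>D. \<forall>t\<in>{0..T}. \<forall>x. has_tpartial T d (tpartials T ds u) t x)))"

abbreviation smooth_tx ::
    "nat \<Rightarrow> real \<Rightarrow> (real \<Rightarrow> real^'n::finite \<Rightarrow> 'b::real_normed_vector) \<Rightarrow> bool" where
  "smooth_tx \<equiv> smooth_in UNIV"

abbreviation smooth_x ::
    "nat \<Rightarrow> real \<Rightarrow> (real \<Rightarrow> real^'n::finite \<Rightarrow> 'b::real_normed_vector) \<Rightarrow> bool" where
  "smooth_x \<equiv> smooth_in (range Some)"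

definition C1_space :: "(real^'n::finite \<Rightarrow> 'b::real_normed_vector) \<Rightarrow> bool" where
  "C1_space g \<longleftrightarrow>
     continuous_on UNIV g \<and> (\<forall>i. (\<forall>x. has_spartial i g x) \<and> continuous_on UNIV (spartial i g))"

text \<open>
  The random field \<open>u\<close> and its space derivatives up to order \<open>k\<close> have moments of every order
  \<open>m \<ge> 2\<close>, bounded uniformly in \<open>(t,x)\<close>.
\<close>

definition bounded_moments ::
    "'a measure \<Rightarrow> nat \<Rightarrow> real \<Rightarrow> (real \<Rightarrow> real^'n::finite \<Rightarrow> 'a \<Rightarrow> 'b::real_normed_vector) \<Rightarrow> bool" where
  "bounded_moments M k T u \<longleftrightarrow>
     (\<forall>ds. set ds \<subseteq> range Some \<and> length ds \<le> k \<longrightarrow>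
        (\<forall>m::nat. 2 \<le> m \<longrightarrow>
          (\<exists>K::real. \<forall>t\<in>{0..T}. \<forall>x.
             (\<integral>\<^sup>+\<omega>. ennreal (norm (tpartials T ds (\<lambda>t x. u t x \<omega>) t x) ^ m) \<partial>M) \<le> ennreal K)))"

definition grad :: "(real^'n::finite \<Rightarrow> real) \<Rightarrow> real^'n \<Rightarrow> real^'n" where
  "grad g x = (\<chi> i. spartial i g x)"

definition divergence :: "(real^'n::finite \<Rightarrow> real^'n) \<Rightarrow> real^'n \<Rightarrow> real" where
  "divergence u x = (\<Sum>i\<in>UNIV. spartial i u x $ i)"

definition laplacian :: "(real^'n::finite \<Rightarrow> real^'n) \<Rightarrow> real^'n \<Rightarrow> real^'n" where
  "laplacian u x = (\<Sum>i\<in>UNIV. spartial i (spartial i u) x)"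

definition convection :: "(real^'n::finite \<Rightarrow> real^'n) \<Rightarrow> real^'n \<Rightarrow> real^'n" where
  "convection u x = (\<Sum>i\<in>UNIV. (u x $ i) *\<^sub>R spartial i u x)"


section \<open>Periodic fields and the Leray projection\<close>

definition periodic :: "real \<Rightarrow> (real^'n::finite \<Rightarrow> 'b) \<Rightarrow> bool" where
  "periodic L g \<longleftrightarrow> (\<forall>x i. g (x + L *\<^sub>R axis i 1) = g x)"

definition cell :: "real \<Rightarrow> (real^'n::finite) set" where
  "cell L = {x. \<forall>i. 0 < x $ i \<and> x $ i < L}"

definition L2_norm :: "real \<Rightarrow> (real^'n::finite \<Rightarrow> real^'n) \<Rightarrow> real" where
  "L2_norm L u = sqrt (LINT x:cell L|lborel. (\<Sum>i\<in>UNIV. (u x $ i)\<^sup>2))"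

definition L2_periodic :: "real \<Rightarrow> (real^'n::finite \<Rightarrow> real^'n) \<Rightarrow> bool" where
  "L2_periodic L u \<longleftrightarrow> periodic L u \<and> u \<in> borel_measurable lebesgue \<and>
     set_integrable lebesgue (cell L) (\<lambda>x. \<Sum>i\<in>UNIV. (u x $ i)\<^sup>2)"

definition fourier_coeff :: "real \<Rightarrow> (real^'n::finite \<Rightarrow> real^'n) \<Rightarrow> int^'n \<Rightarrow> complex^'n" where
  "fourier_coeff L u k = (\<chi> i. complex_of_real (1 / L ^ CARD('n)) *
     (LINT x:cell L|lebesgue.
        complex_of_real (u x $ i) * cis (- (2 * pi / L) * (\<Sum>j\<in>UNIV. real_of_int (k $ j) * x $ j))))"

definition leray_symbol :: "int^'n::finite \<Rightarrow> complex^'n \<Rightarrow> complex^'n" where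
  "leray_symbol k c = (if k = 0 then c else
     (\<chi> i. c $ i - (\<Sum>j\<in>UNIV. c $ j * of_int (k $ j)) / of_int (\<Sum>j\<in>UNIV. (k $ j)\<^sup>2) * of_int (k $ i)))"

text \<open>
  \<open>leray_projection L u g\<close> says that \<open>g\<close> is a version of \<open>P u\<close>. A relation is used because \<open>P u\<close> is
  determined by its Fourier coefficients only up to null sets.
\<close>

definition leray_projection ::
    "real \<Rightarrow> (real^'n::finite \<Rightarrow> real^'n) \<Rightarrow> (real^'n \<Rightarrow> real^'n) \<Rightarrow> bool" where
  "leray_projection L u g \<longleftrightarrow> L2_periodic L u \<and> L2_periodic L g \<and>
     (\<forall>k. fourier_coeff L g k = leray_symbol k (fourier_coeff L u k))"


section \<open>The stochastic Navier-Stokes problem and the layer method\<close>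

definition classical_solution ::
    "'a measure \<Rightarrow> (real \<Rightarrow> 'a \<Rightarrow> real^'q::finite) \<Rightarrow> real \<Rightarrow> real \<Rightarrow> real \<Rightarrow>
     (real \<Rightarrow> real^'n::finite \<Rightarrow> real^'n) \<Rightarrow> ('q \<Rightarrow> real \<Rightarrow> real^'n \<Rightarrow> real^'n) \<Rightarrow> (real^'n \<Rightarrow> real^'n) \<Rightarrow>
     (real \<Rightarrow> real^'n \<Rightarrow> 'a \<Rightarrow> real^'n) \<Rightarrow> (real \<Rightarrow> real^'n \<Rightarrow> 'a \<Rightarrow> real) \<Rightarrow> bool" where
  "classical_solution M w \<sigma> T L f \<gamma> \<phi> v p \<longleftrightarrow>
     (\<forall>t\<in>{0..T}. \<forall>x. v t x \<in> borel_measurable (natural_filtration M w t) \<and>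
                     p t x \<in> borel_measurable (natural_filtration M w t)) \<and>
     (AE \<omega> in M.
        smooth_x 2 T (\<lambda>t x. v t x \<omega>) \<and> smooth_x 1 T (\<lambda>t x. p t x \<omega>) \<and>
        (\<forall>x. v 0 x \<omega> = \<phi> x) \<and>
        (\<forall>t\<in>{0..T}.
           (\<forall>x. divergence (\<lambda>y. v t y \<omega>) x = 0) \<and>
           periodic L (\<lambda>x. v t x \<omega>) \<and> periodic L (\<lambda>x. p t x \<omega>) \<and>
           (LINT x:cell L|lborel. p t x \<omega>) = 0)) \<and>
     (\<forall>t\<in>{0..T}. \<forall>x. \<exists>I.
        (\<forall>r. has_ito_integral M (natural_filtration M w) (\<lambda>s \<omega>. w s \<omega> $ r) t (\<lambda>s _. \<gamma> r s x) (I r)) \<and>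
        (AE \<omega> in M. v t x \<omega> = \<phi> x +
           integral {0..t} (\<lambda>s. (\<sigma>\<^sup>2 / 2) *\<^sub>R laplacian (\<lambda>y. v s y \<omega>) x - convection (\<lambda>y. v s y \<omega>) x
             - grad (\<lambda>y. p s y \<omega>) x + f s x) +
           (\<Sum>r\<in>UNIV. I r \<omega>)))"

text \<open>Uniqueness is understood up to indistinguishability.\<close>

definition unique_classical_solution ::
    "'a measure \<Rightarrow> (real \<Rightarrow> 'a \<Rightarrow> real^'q::finite) \<Rightarrow> real \<Rightarrow> real \<Rightarrow> real \<Rightarrow>
     (real \<Rightarrow> real^'n::finite \<Rightarrow> real^'n) \<Rightarrow> ('q \<Rightarrow> real \<Rightarrow> real^'n \<Rightarrow> real^'n) \<Rightarrow> (real^'n \<Rightarrow> real^'n) \<Rightarrow>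
     (real \<Rightarrow> real^'n \<Rightarrow> 'a \<Rightarrow> real^'n) \<Rightarrow> (real \<Rightarrow> real^'n \<Rightarrow> 'a \<Rightarrow> real) \<Rightarrow> bool" where
  "unique_classical_solution M w \<sigma> T L f \<gamma> \<phi> v p \<longleftrightarrow>
     classical_solution M w \<sigma> T L f \<gamma> \<phi> v p \<and>
     (\<forall>v' p'. classical_solution M w \<sigma> T L f \<gamma> \<phi> v' p' \<longrightarrow>
        (AE \<omega> in M. \<forall>t\<in>{0..T}. \<forall>x. v' t x \<omega> = v t x \<omega> \<and> p' t x \<omega> = p t x \<omega>))"

definition signs :: "(real^'n::finite) set" where
  "signs = {\<xi>. \<forall>i. \<xi> $ i = -1 \<or> \<xi> $ i = 1}"

definition layer_average :: "real \<Rightarrow> real \<Rightarrow> (real^'n::finite \<Rightarrow> real^'n) \<Rightarrow> real^'n \<Rightarrow> real^'n" where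
  "layer_average \<sigma> h u x =
     (1 / 2 ^ CARD('n)) *\<^sub>R (\<Sum>\<xi>\<in>signs. u (x - h *\<^sub>R u x + (\<sigma> * sqrt h) *\<^sub>R \<xi>))"

text \<open>
  \<open>layer_method \<sigma> T L f \<gamma> \<phi> W N V\<close>: for the driving path \<open>W\<close>, the fields \<open>V 0, \<dots>, V N\<close> are the
  layers of the method with \<open>N\<close> steps of length \<open>h = T / N\<close>.
\<close>

definition layer_method ::
    "real \<Rightarrow> real \<Rightarrow> real \<Rightarrow> (real \<Rightarrow> real^'n::finite \<Rightarrow> real^'n) \<Rightarrow>
     ('q::finite \<Rightarrow> real \<Rightarrow> real^'n \<Rightarrow> real^'n) \<Rightarrow> (real^'n \<Rightarrow> real^'n) \<Rightarrow>
     (real \<Rightarrow> real^'q) \<Rightarrow> nat \<Rightarrow> (nat \<Rightarrow> real^'n \<Rightarrow> real^'n) \<Rightarrow> bool" where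
  "layer_method \<sigma> T L f \<gamma> \<phi> W N V \<longleftrightarrow>
     (let h = T / real N; t = (\<lambda>k::nat. real k * h) in
        (\<forall>x. V 0 x = \<phi> x) \<and>
        (\<forall>k<N. \<exists>Pu Pf.
           leray_projection L (layer_average \<sigma> h (V k)) Pu \<and>
           leray_projection L (f (t k)) Pf \<and>
           (\<forall>x. V (Suc k) x = Pu x + h *\<^sub>R Pf x +
              (\<Sum>r\<in>UNIV. (W (t (Suc k)) $ r - W (t k) $ r) *\<^sub>R \<gamma> r (t k) x))))"

end

theory Submission imports Defs begin

text \<open>Along almost every path the problem becomes deterministic, and the order of convergence is
  the Hoelder exponent of the Wiener path.

  The noise coefficients are deterministic and differentiable in time, so the Ito integral can be
  integrated by parts (\<open>ito_integral_by_parts\<close>). Outside one null set the stochastic equation is then,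
  for all times and places at once, an ordinary integral equation driven by a continuous path
  (\<open>solution_path_representation\<close>). What remains of the velocity \<open>v\<close> after subtraction of
  \<open>\<Sum> w_r \<gamma>_r\<close> is Lipschitz in time together with its space derivatives up to order two; hence \<open>v\<close>
  and these derivatives are Hoelder continuous in time with any exponent \<open>\<alpha> < 1/2\<close> that the Wiener
  path admits (\<open>wiener_paths_hoelder\<close>, \<open>path_satisfies_locale\<close>).

  Local error: by Taylor's formula the average over the sign vectors is one Euler step of the
  convection-diffusion operator up to \<open>O(h^(3/2))\<close>, and freezing the operator, the force and the
  noise coefficients at the left end of the step costs \<open>O(h^(1+\<alpha>))\<close> (\<open>local_error\<close>). The gradient
  of the pressure need not be small: the Leray projection annihilates gradients, fixes
  divergence-free fields and contracts the norm of \<open>L^2\<close>, so it removes the pressure from the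
  comparison of one step of the method with the exact solution (\<open>leray_step\<close>).

  Stability: replacing the approximate velocity \<open>V\<close> by the exact one inside the average leaves the
  error evaluated at the points \<open>x - h V(x) + \<sigma> sqrt h \<xi>\<close>, plus \<open>O(h)\<close> times the error at \<open>x\<close>. The
  derivatives of \<open>V\<close> are bounded, so for small \<open>h\<close> the map \<open>x - h V(x)\<close> is injective with Jacobian
  \<open>1 + O(h)\<close>, and by periodicity it changes the integral over a period cell of a nonnegative
  function at most by a factor \<open>1 + O(h)\<close> (\<open>transported_integral_le\<close>). The squared error
  thus satisfies \<open>E_(k+1) \<le> (1 + D h) E_k + X h^(1 + 2 \<alpha>)\<close> (\<open>energy_step\<close>), and the discrete Gronwall
  inequality gives \<open>E_k = O(h^(2 \<alpha>))\<close> uniformly in \<open>k\<close>. If \<open>h\<close> is not small, boundedness of both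
  velocities suffices. A sequence of exponents \<open>\<alpha>\<close> increasing to \<open>1/2\<close> yields one null set for all
  \<open>\<epsilon>\<close>.\<close>

section \<open>Partial derivatives and total derivatives\<close>

lemma has_spartial_line:
  assumes "has_spartial i g (x + s *\<^sub>R axis i 1)"
  shows "((\<lambda>s. g (x + s *\<^sub>R axis i 1)) has_vector_derivative spartial i g (x + s *\<^sub>R axis i 1)) (at s)"
proof -
  let ?y = "x + s *\<^sub>R axis i 1"
  have "((\<lambda>r. g (?y + r *\<^sub>R axis i 1)) has_vector_derivative spartial i g ?y) (at 0)"
    using assms unfolding has_spartial_def spartial_def by (simp add: vector_derivative_works)
  then have "((\<lambda>r. g (?y + r *\<^sub>R axis i 1)) \<circ> (\<lambda>r. r - s) has_vector_derivative (1::real) *\<^sub>R spartial i g ?y) (at s)"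
    by (intro vector_diff_chain_at) (auto intro!: derivative_eq_intros)
  then show ?thesis by (simp add: o_def algebra_simps)
qed

lemma has_spartialI:
  assumes "((\<lambda>s. g (x + s *\<^sub>R axis i 1)) has_vector_derivative D) (at 0)"
  shows "has_spartial i g x" "spartial i g x = D"
  using assms unfolding has_spartial_def spartial_def
  by (auto simp: vector_derivative_at intro: differentiableI_vector)

lemma has_spartialD:
  assumes "has_spartial i g x"
  shows "((\<lambda>s. g (x + s *\<^sub>R axis i 1)) has_vector_derivative spartial i g x) (at 0)"
  using has_spartial_line[of i g x 0] assms by simp

text \<open>Changing one coordinate at a time, the mean value inequality applies to each partial
  derivative, which by continuity stays close to its value at the base point.\<close>

lemma C1_space_has_derivative:
  fixes g :: "real^'n::finite \<Rightarrow> 'b::real_normed_vector"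
  assumes "C1_space g"
  shows "(g has_derivative (\<lambda>y. \<Sum>i\<in>UNIV. (y $ i) *\<^sub>R spartial i g x)) (at x)"
proof -
  have sp: "has_spartial i g y" for i y using assms by (auto simp: C1_space_def)
  have ct: "continuous_on UNIV (spartial i g)" for i using assms by (auto simp: C1_space_def)
  let ?pr = "\<lambda>(I::'n set) (y::real^'n). \<Sum>i\<in>I. (y $ i) *\<^sub>R axis i (1::real)"
  have prnorm: "norm (?pr I y) \<le> real (card I) * norm y" for I y
  proof -
    have "norm (?pr I y) \<le> (\<Sum>i\<in>I. norm ((y $ i) *\<^sub>R axis i (1::real) :: real^'n))" by (rule norm_sum)
    also have "\<dots> \<le> (\<Sum>i\<in>I. norm y)" by (intro sum_mono) (simp add: component_le_norm_cart)
    finally show ?thesis by simp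
  qed
  have "finite I \<Longrightarrow> \<forall>e>0. \<exists>d>0. \<forall>y. norm y < d \<longrightarrow>
     norm (g (x + ?pr I y) - g x - (\<Sum>i\<in>I. (y $ i) *\<^sub>R spartial i g x)) \<le> e * norm y" for I
  proof (induction I rule: finite_induct)
    case empty
    show ?case by (auto intro!: exI[of _ 1])
  next
    case (insert j I)
    show ?case
    proof (intro allI impI)
      fix e :: real assume "e > 0"
      then have e2: "e/2 > 0" by simp
      from insert.IH[rule_format, OF e2] obtain d1 where d1: "d1 > 0" and
        D1: "\<And>y. norm y < d1 \<Longrightarrow> norm (g (x + ?pr I y) - g x - (\<Sum>i\<in>I. (y $ i) *\<^sub>R spartial i g x)) \<le> e/2 * norm y"
        by blast
      have "isCont (spartial j g) x" using ct by (simp add: continuous_on_eq_continuous_at)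
      then obtain d2 where d2: "d2 > 0" and
        D2: "\<And>z. norm (z - x) < d2 \<Longrightarrow> norm (spartial j g z - spartial j g x) \<le> e/2"
        unfolding continuous_at_eps_delta using e2 by (metis dist_norm less_imp_le)
      \<comment> \<open>The point moves by at most \<open>c\<close> times the norm of \<open>y\<close> while the coordinates in \<open>I\<close> and \<open>j\<close> change.\<close>
      define c where "c = real (card I) + 1"
      have c: "c > 0" by (simp add: c_def add_nonneg_pos)
      show "\<exists>d>0. \<forall>y. norm y < d \<longrightarrow>
        norm (g (x + ?pr (insert j I) y) - g x - (\<Sum>i\<in>insert j I. (y $ i) *\<^sub>R spartial i g x)) \<le> e * norm y"
      proof (intro exI[of _ "min d1 (d2 / c)"] conjI allI impI)
        show "min d1 (d2 / c) > 0" using d1 d2 c by simp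
        fix y :: "real^'n" assume y: "norm y < min d1 (d2 / c)"
        let ?z = "x + ?pr I y"
        let ?k = "\<lambda>s. g (?z + s *\<^sub>R axis j 1) - s *\<^sub>R spartial j g x"
        have der: "(?k has_derivative (\<lambda>r. r *\<^sub>R (spartial j g (?z + s *\<^sub>R axis j 1) - spartial j g x)))
             (at s within closed_segment 0 (y$j))" for s
          unfolding has_vector_derivative_def[symmetric]
          by (intro has_vector_derivative_diff has_vector_derivative_at_within[OF has_spartial_line[OF sp]])
             (auto intro!: derivative_eq_intros)
        have bd: "norm (spartial j g (?z + s *\<^sub>R axis j 1) - spartial j g x) \<le> e/2"
          if "s \<in> closed_segment 0 (y$j)" for s
        proof (rule D2)
          have s: "\<bar>s\<bar> \<le> norm y" using that component_le_norm_cart[of y j]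
            by (auto simp: closed_segment_eq_real_ivl split: if_splits)
          have "norm (?z + s *\<^sub>R axis j 1 - x) \<le> norm (?pr I y) + norm (s *\<^sub>R axis j (1::real) :: real^'n)"
            by (simp add: add.assoc norm_triangle_le)
          also have "\<dots> \<le> real (card I) * norm y + norm y"
            using prnorm[where I=I and y=y] s by simp
          also have "\<dots> = c * norm y" by (simp add: c_def algebra_simps)
          also have "\<dots> < d2" using y c by (simp add: field_simps)
          finally show "norm (?z + s *\<^sub>R axis j 1 - x) < d2" .
        qed
        have "norm (?k (y$j) - ?k 0) \<le> e/2 * norm (y$j - 0)"
        proof (rule differentiable_bound[OF _ der])
          show "onorm (\<lambda>r. r *\<^sub>R (spartial j g (?z + s *\<^sub>R axis j 1) - spartial j g x)) \<le> e/2"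
            if "s \<in> closed_segment 0 (y$j)" for s
            by (rule onorm_le) (use mult_right_mono[OF bd[OF that], of "norm r" for r :: real] in \<open>simp add: mult.commute\<close>)
        qed auto
        then have A: "norm (?k (y$j) - ?k 0) \<le> e/2 * norm y"
          using component_le_norm_cart[of y j] e2 by (smt (verit) mult_left_mono diff_zero real_norm_def)
        have eq: "g (x + ?pr (insert j I) y) - g x - (\<Sum>i\<in>insert j I. (y $ i) *\<^sub>R spartial i g x)
           = (?k (y$j) - ?k 0) + (g (x + ?pr I y) - g x - (\<Sum>i\<in>I. (y $ i) *\<^sub>R spartial i g x))"
          using insert.hyps by (simp add: algebra_simps)
        show "norm (g (x + ?pr (insert j I) y) - g x - (\<Sum>i\<in>insert j I. (y $ i) *\<^sub>R spartial i g x)) \<le> e * norm y"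
          unfolding eq using norm_triangle_le[OF add_mono[OF A D1[of y]]] y by simp
      qed
    qed
  qed
  from this[of UNIV] have *: "\<forall>e>0. \<exists>d>0. \<forall>y. norm y < d \<longrightarrow>
     norm (g (x + y) - g x - (\<Sum>i\<in>UNIV. (y $ i) *\<^sub>R spartial i g x)) \<le> e * norm y"
    using basis_expansion[where 'a=real and 'n='n, unfolded scalar_mult_eq_scaleR] by simp
  have bl: "bounded_linear (\<lambda>y::real^'n. \<Sum>i\<in>UNIV. (y $ i) *\<^sub>R spartial i g x)"
    by (intro bounded_linear_sum bounded_linear_scaleR_const[OF bounded_linear_vec_nth])
  show ?thesis
    unfolding has_derivative_at_alt
  proof (intro conjI bl allI impI)
    fix e :: real assume "e > 0"
    with * obtain d where "d > 0" and d: "\<And>y. norm y < d \<Longrightarrow>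
     norm (g (x + y) - g x - (\<Sum>i\<in>UNIV. (y $ i) *\<^sub>R spartial i g x)) \<le> e * norm y" by blast
    show "\<exists>d>0. \<forall>y. norm (y - x) < d \<longrightarrow>
      norm (g y - g x - (\<Sum>i\<in>UNIV. ((y - x) $ i) *\<^sub>R spartial i g x)) \<le> e * norm (y - x)"
      using \<open>d > 0\<close> d[of "_ - x"] by (intro exI[of _ d]) (auto simp: algebra_simps)
  qed
qed

lemma C1_space_lipschitz:
  fixes g :: "real^'n::finite \<Rightarrow> 'b::real_normed_vector"
  assumes "C1_space g" "\<And>i x. norm (spartial i g x) \<le> K"
  shows "norm (g y - g x) \<le> real CARD('n) * K * norm (y - x)"
proof -
  have K: "norm (\<Sum>i\<in>UNIV. (y $ i) *\<^sub>R spartial i g x) \<le> real CARD('n) * K * norm y" for x y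
  proof -
    have "norm (\<Sum>i\<in>UNIV. (y $ i) *\<^sub>R spartial i g x) \<le> (\<Sum>i\<in>(UNIV::'n set). norm y * K)"
      by (intro order.trans[OF norm_sum] sum_mono)
         (auto intro!: mult_mono assms(2) component_le_norm_cart)
    then show ?thesis by (simp add: algebra_simps)
  qed
  show ?thesis
    by (rule differentiable_bound[of UNIV g "\<lambda>x y. \<Sum>i\<in>UNIV. (y $ i) *\<^sub>R spartial i g x"])
       (auto intro!: onorm_le K C1_space_has_derivative assms)
qed

section \<open>Fields with space derivatives that are Hoelder continuous in time\<close>

definition hoelder_field ::
    "real \<Rightarrow> real \<Rightarrow> (real \<Rightarrow> real^'n::finite \<Rightarrow> 'b::real_normed_vector) \<Rightarrow> bool" where
  "hoelder_field \<alpha> T u \<longleftrightarrow> continuous_on ({0..T} \<times> UNIV) (\<lambda>(t, x). u t x) \<and>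
     (\<exists>K. \<forall>t\<in>{0..T}. \<forall>x. norm (u t x) \<le> K \<and>
        (\<forall>s\<in>{0..T}. norm (u s x - u t x) \<le> K * \<bar>s - t\<bar> powr \<alpha>))"

text \<open>Recursion over the order keeps the closure properties short. Exponent \<open>0\<close> asks only for
  boundedness, which makes the same notion serve for fields without time regularity.\<close>

primrec hoelder_jet ::
    "real \<Rightarrow> real \<Rightarrow> nat \<Rightarrow> (real \<Rightarrow> real^'n::finite \<Rightarrow> 'b::real_normed_vector) \<Rightarrow> bool" where
  "hoelder_jet \<alpha> T 0 u \<longleftrightarrow> hoelder_field \<alpha> T u"
| "hoelder_jet \<alpha> T (Suc k) u \<longleftrightarrow> hoelder_field \<alpha> T u \<and>
     (\<forall>i. (\<forall>t\<in>{0..T}. \<forall>x. has_spartial i (u t) x) \<and> hoelder_jet \<alpha> T k (\<lambda>t. spartial i (u t)))"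

lemma hoelder_jet_field: "hoelder_jet \<alpha> T k u \<Longrightarrow> hoelder_field \<alpha> T u"
  by (cases k) auto

lemma hoelder_jet_Suc_lower: "hoelder_jet \<alpha> T (Suc k) u \<Longrightarrow> hoelder_jet \<alpha> T k u"
proof (induction k arbitrary: u)
  case (Suc k)
  from Suc.prems have f: "hoelder_field \<alpha> T u" and s: "\<And>i t x. t \<in> {0..T} \<Longrightarrow> has_spartial i (u t) x"
    and j: "\<And>i. hoelder_jet \<alpha> T (Suc k) (\<lambda>t. spartial i (u t))"
    by (simp_all only: hoelder_jet.simps(2)[of _ _ "Suc k"] simp_thms)
  show ?case unfolding hoelder_jet.simps(2)[of _ _ k] using f s Suc.IH[OF j] by blast
qed simp

lemma hoelder_jet_mono: "hoelder_jet \<alpha> T k u \<Longrightarrow> j \<le> k \<Longrightarrow> hoelder_jet \<alpha> T j u"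
proof (induction k)
  case (Suc k)
  then show ?case using hoelder_jet_Suc_lower[of \<alpha> T k u] by (cases "j = Suc k") auto
qed simp

lemma hoelder_fieldI:
  assumes "continuous_on ({0..T} \<times> UNIV) (\<lambda>(t, x). u t x)"
    "\<And>t x. t \<in> {0..T} \<Longrightarrow> norm (u t x) \<le> K"
    "\<And>s t x. s \<in> {0..T} \<Longrightarrow> t \<in> {0..T} \<Longrightarrow> norm (u s x - u t x) \<le> K' * \<bar>s - t\<bar> powr \<alpha>"
  shows "hoelder_field \<alpha> T u"
  unfolding hoelder_field_def
proof (intro conjI exI[of _ "max K K'"] ballI allI)
  fix s t x assume t: "t \<in> {0..T}" and s: "s \<in> {0..T}"
  show "norm (u s x - u t x) \<le> max K K' * \<bar>s - t\<bar> powr \<alpha>"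
    by (rule order.trans[OF assms(3)[OF s t]]) (auto intro: mult_right_mono)
qed (use assms in \<open>auto intro: max.coboundedI1\<close>)

lemma hoelder_fieldD:
  assumes "hoelder_field \<alpha> T u"
  obtains K where "K > 0" "\<And>t x. t \<in> {0..T} \<Longrightarrow> norm (u t x) \<le> K"
    "\<And>s t x. s \<in> {0..T} \<Longrightarrow> t \<in> {0..T} \<Longrightarrow> norm (u s x - u t x) \<le> K * \<bar>s - t\<bar> powr \<alpha>"
proof -
  from assms obtain K where K: "\<And>t x. t \<in> {0..T} \<Longrightarrow> norm (u t x) \<le> K"
    "\<And>s t x. s \<in> {0..T} \<Longrightarrow> t \<in> {0..T} \<Longrightarrow> norm (u s x - u t x) \<le> K * \<bar>s - t\<bar> powr \<alpha>"
    unfolding hoelder_field_def by blast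
  show ?thesis
  proof (rule that[of "max K 1"])
    show "norm (u s x - u t x) \<le> max K 1 * \<bar>s - t\<bar> powr \<alpha>" if "s \<in> {0..T}" "t \<in> {0..T}" for s t x
      by (rule order.trans[OF K(2)[OF that]]) (auto intro: mult_right_mono)
  qed (use K in \<open>auto intro: max.coboundedI1\<close>)
qed

lemma hoelder_field_continuous:
  "hoelder_field \<alpha> T u \<Longrightarrow> continuous_on ({0..T} \<times> UNIV) (\<lambda>(t, x). u t x)"
  by (simp add: hoelder_field_def)

lemma hoelder_field_space_continuous:
  assumes "hoelder_field \<alpha> T u" "t \<in> {0..T}" shows "continuous_on S (u t)"
proof -
  have "continuous_on S (\<lambda>x. (\<lambda>(t, x). u t x) (t, x))"
    by (rule continuous_on_compose2[OF hoelder_field_continuous[OF assms(1)]])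
       (use assms(2) in \<open>auto intro!: continuous_on_Pair continuous_on_const continuous_on_id\<close>)
  then show ?thesis by simp
qed

lemma hoelder_field_time_continuous:
  assumes "hoelder_field \<alpha> T u" "S \<subseteq> {0..T}" shows "continuous_on S (\<lambda>t. u t x)"
proof -
  have "continuous_on S (\<lambda>t. (\<lambda>(t, x). u t x) (t, x))"
    by (rule continuous_on_compose2[OF hoelder_field_continuous[OF assms(1)]])
       (use assms(2) in \<open>auto intro!: continuous_on_Pair continuous_on_const continuous_on_id\<close>)
  then show ?thesis by simp
qed

lemma hoelder_jet_C1_space:
  "hoelder_jet \<alpha> T (Suc k) u \<Longrightarrow> t \<in> {0..T} \<Longrightarrow> C1_space (u t)"
  unfolding C1_space_def
  using hoelder_field_space_continuous[of \<alpha> T u t UNIV]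
    hoelder_field_space_continuous[OF hoelder_jet_field, of \<alpha> T k "\<lambda>t. spartial i (u t)" t UNIV for i] by auto

lemma hoelder_jet_spartial:
  "hoelder_jet \<alpha> T (Suc k) u \<Longrightarrow> hoelder_jet \<alpha> T k (\<lambda>t. spartial i (u t))"
  by simp

lemma hoelder_field_cong:
  assumes "\<And>t. t \<in> {0..T} \<Longrightarrow> u t = u' t" shows "hoelder_field \<alpha> T u = hoelder_field \<alpha> T u'"
proof -
  have "continuous_on ({0..T} \<times> UNIV) (\<lambda>(t, x). u t x) = continuous_on ({0..T} \<times> UNIV) (\<lambda>(t, x). u' t x)"
    by (rule continuous_on_cong) (use assms in auto)
  then show ?thesis unfolding hoelder_field_def using assms by simp
qed

lemma hoelder_jet_cong:
  assumes "\<And>t. t \<in> {0..T} \<Longrightarrow> u t = u' t" shows "hoelder_jet \<alpha> T k u = hoelder_jet \<alpha> T k u'"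
  using assms
proof (induction k arbitrary: u u')
  case 0
  then show ?case using hoelder_field_cong[of T u u' \<alpha>] by simp
next
  case (Suc k)
  have "hoelder_jet \<alpha> T k (\<lambda>t. spartial i (u t)) = hoelder_jet \<alpha> T k (\<lambda>t. spartial i (u' t))" for i
    by (rule Suc.IH) (simp add: Suc.prems)
  then show ?case using hoelder_field_cong[of T u u' \<alpha>] Suc.prems by simp
qed

lemma hoelder_field_add:
  assumes "hoelder_field \<alpha> T u" "hoelder_field \<alpha> T v"
  shows "hoelder_field \<alpha> T (\<lambda>t x. u t x + v t x)"
proof -
  obtain K where K: "K > 0" "\<And>t x. t \<in> {0..T} \<Longrightarrow> norm (u t x) \<le> K"
    "\<And>s t x. s \<in> {0..T} \<Longrightarrow> t \<in> {0..T} \<Longrightarrow> norm (u s x - u t x) \<le> K * \<bar>s - t\<bar> powr \<alpha>"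
    using hoelder_fieldD[OF assms(1)] by blast
  obtain K' where K': "K' > 0" "\<And>t x. t \<in> {0..T} \<Longrightarrow> norm (v t x) \<le> K'"
    "\<And>s t x. s \<in> {0..T} \<Longrightarrow> t \<in> {0..T} \<Longrightarrow> norm (v s x - v t x) \<le> K' * \<bar>s - t\<bar> powr \<alpha>"
    using hoelder_fieldD[OF assms(2)] by blast
  show ?thesis
  proof (rule hoelder_fieldI)
    show "continuous_on ({0..T} \<times> UNIV) (\<lambda>(t, x). u t x + v t x)"
      using assms[THEN hoelder_field_continuous] by (auto simp: case_prod_unfold intro: continuous_on_add)
    show "norm (u t x + v t x) \<le> K + K'" if "t \<in> {0..T}" for t x
      by (rule norm_triangle_le) (use K K' that in \<open>simp add: add_mono\<close>)
    show "norm (u s x + v s x - (u t x + v t x)) \<le> (K + K') * \<bar>s - t\<bar> powr \<alpha>" if "s \<in> {0..T}" "t \<in> {0..T}" for s t x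
      using norm_triangle_le[OF add_mono[OF K(3)[OF that, of x] K'(3)[OF that, of x]]] by (simp add: algebra_simps)
  qed
qed

lemma hoelder_field_bilinear:
  assumes "bounded_bilinear B" "hoelder_field \<alpha> T u" "hoelder_field \<alpha> T v"
  shows "hoelder_field \<alpha> T (\<lambda>t x. B (u t x) (v t x))"
proof -
  interpret bounded_bilinear B by fact
  obtain K where K: "K > 0" "\<And>t x. t \<in> {0..T} \<Longrightarrow> norm (u t x) \<le> K"
    "\<And>s t x. s \<in> {0..T} \<Longrightarrow> t \<in> {0..T} \<Longrightarrow> norm (u s x - u t x) \<le> K * \<bar>s - t\<bar> powr \<alpha>"
    using hoelder_fieldD[OF assms(2)] by blast
  obtain K' where K': "K' > 0" "\<And>t x. t \<in> {0..T} \<Longrightarrow> norm (v t x) \<le> K'"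
    "\<And>s t x. s \<in> {0..T} \<Longrightarrow> t \<in> {0..T} \<Longrightarrow> norm (v s x - v t x) \<le> K' * \<bar>s - t\<bar> powr \<alpha>"
    using hoelder_fieldD[OF assms(3)] by blast
  obtain c where c: "c > 0" "\<And>a b. norm (B a b) \<le> norm a * norm b * c" using pos_bounded by blast
  show ?thesis
  proof (rule hoelder_fieldI)
    show "continuous_on ({0..T} \<times> UNIV) (\<lambda>(t, x). B (u t x) (v t x))"
      using assms(2,3)[THEN hoelder_field_continuous] by (auto simp: case_prod_unfold intro: continuous_on)
    show "norm (B (u t x) (v t x)) \<le> K * K' * c" if "t \<in> {0..T}" for t x
      using K(1) K'(1) c(1) by (intro order.trans[OF c(2)] mult_mono) (auto intro: K K' that)
    show "norm (B (u s x) (v s x) - B (u t x) (v t x)) \<le> (2 * K * K' * c) * \<bar>s - t\<bar> powr \<alpha>"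
      if "s \<in> {0..T}" "t \<in> {0..T}" for s t x
    proof -
      have "norm (B (u s x - u t x) (v s x)) \<le> (K * \<bar>s - t\<bar> powr \<alpha>) * K' * c"
        using K(1) K'(1) c(1) by (intro order.trans[OF c(2)] mult_mono) (auto intro: K K' that)
      moreover have "norm (B (u t x) (v s x - v t x)) \<le> K * (K' * \<bar>s - t\<bar> powr \<alpha>) * c"
        using K(1) K'(1) c(1) by (intro order.trans[OF c(2)] mult_mono) (auto intro: K K' that)
      moreover have "B (u s x) (v s x) - B (u t x) (v t x) = B (u s x - u t x) (v s x) + B (u t x) (v s x - v t x)"
        by (simp add: diff_left diff_right)
      ultimately show ?thesis using norm_triangle_ineq[of "B (u s x - u t x) (v s x)" "B (u t x) (v s x - v t x)"]
        by (simp add: algebra_simps)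
    qed
  qed
qed

lemma spartial_add:
  assumes "has_spartial i u x" "has_spartial i v x"
  shows "has_spartial i (\<lambda>x. u x + v x) x" "spartial i (\<lambda>x. u x + v x) x = spartial i u x + spartial i v x"
  using has_spartialI[OF has_vector_derivative_add[OF assms[THEN has_spartialD]]] by auto

lemma spartial_bilinear:
  assumes "bounded_bilinear B" "has_spartial i u x" "has_spartial i v x"
  shows "has_spartial i (\<lambda>x. B (u x) (v x)) x"
    "spartial i (\<lambda>x. B (u x) (v x)) x = B (u x) (spartial i v x) + B (spartial i u x) (v x)"
proof -
  have "((\<lambda>s. B (u (x + s *\<^sub>R axis i 1)) (v (x + s *\<^sub>R axis i 1))) has_vector_derivative
      B (u (x + 0 *\<^sub>R axis i 1)) (spartial i v x) + B (spartial i u x) (v (x + 0 *\<^sub>R axis i 1))) (at 0)"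
    using has_spartialD[OF assms(2)] has_spartialD[OF assms(3)] unfolding has_vector_derivative_def
    by (rule has_derivative_eq_rhs[OF bounded_bilinear.FDERIV[OF assms(1)]])
       (simp add: bounded_bilinear.scaleR_left[OF assms(1)] bounded_bilinear.scaleR_right[OF assms(1)] scaleR_add_right)
  from has_spartialI[OF this] show "has_spartial i (\<lambda>x. B (u x) (v x)) x"
    "spartial i (\<lambda>x. B (u x) (v x)) x = B (u x) (spartial i v x) + B (spartial i u x) (v x)" by auto
qed

lemma spartial_const: "has_spartial i (\<lambda>x. c) x" "spartial i (\<lambda>x. c) = (\<lambda>x. 0)"
  using has_spartialI[OF has_vector_derivative_const, where i=i] by (auto simp: fun_eq_iff)

lemma hoelder_jet_add:
  assumes "hoelder_jet \<alpha> T k u" "hoelder_jet \<alpha> T k v"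
  shows "hoelder_jet \<alpha> T k (\<lambda>t x. u t x + v t x)"
  using assms
proof (induction k arbitrary: u v)
  case (Suc k)
  have "hoelder_jet \<alpha> T k (\<lambda>t. spartial i (\<lambda>x. u t x + v t x))" for i
    by (subst hoelder_jet_cong[of T _ "\<lambda>t x. spartial i (u t) x + spartial i (v t) x"])
       (use Suc in \<open>auto simp: spartial_add\<close>)
  then show ?case using Suc.prems by (auto intro: hoelder_field_add spartial_add)
qed (simp add: hoelder_field_add)

lemma hoelder_jet_bilinear:
  assumes B: "bounded_bilinear B" and "hoelder_jet \<alpha> T k u" "hoelder_jet \<alpha> T k v"
  shows "hoelder_jet \<alpha> T k (\<lambda>t x. B (u t x) (v t x))"
  using assms(2-)
proof (induction k arbitrary: u v)
  case (Suc k)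
  have "hoelder_jet \<alpha> T k (\<lambda>t. spartial i (\<lambda>x. B (u t x) (v t x)))" for i
  proof (subst hoelder_jet_cong[of T _ "\<lambda>t x. B (u t x) (spartial i (v t) x) + B (spartial i (u t) x) (v t x)"])
    show "hoelder_jet \<alpha> T k (\<lambda>t x. B (u t x) (spartial i (v t) x) + B (spartial i (u t) x) (v t x))"
      by (intro hoelder_jet_add Suc.IH Suc.prems[THEN hoelder_jet_Suc_lower] Suc.prems[THEN hoelder_jet_spartial])
  qed (use Suc.prems in \<open>auto simp: spartial_bilinear[OF B]\<close>)
  then show ?case using Suc.prems by (auto intro: hoelder_field_bilinear[OF B] spartial_bilinear[OF B])
qed (simp add: hoelder_field_bilinear[OF B])

lemma hoelder_field_const: "hoelder_field \<alpha> T (\<lambda>t x. c)"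
  by (rule hoelder_fieldI[where K="norm c" and K'=0]) auto

text \<open>Scalar functions of time, such as a component of the Wiener path, enter products of fields in
  this form.\<close>

lemma hoelder_jet_space_const:
  fixes g :: "real \<Rightarrow> 'b::real_normed_vector"
  assumes "hoelder_field \<alpha> T (\<lambda>t (x::real^'n::finite). g t)"
  shows "hoelder_jet \<alpha> T k (\<lambda>t (x::real^'n). g t)"
proof -
  have z: "hoelder_jet \<alpha> T j (\<lambda>t (x::real^'n). 0 :: 'b)" for j
    by (induction j) (simp_all add: hoelder_field_const spartial_const)
  show ?thesis using assms z by (cases k) (simp_all add: spartial_const)
qed

lemma hoelder_jet_const: "hoelder_jet \<alpha> T k (\<lambda>t x. c)"
  by (intro hoelder_jet_space_const hoelder_field_const)

lemma hoelder_jet_scaleR: "hoelder_jet \<alpha> T k u \<Longrightarrow> hoelder_jet \<alpha> T k (\<lambda>t x. c *\<^sub>R u t x)"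
  by (rule hoelder_jet_bilinear[OF bounded_bilinear_scaleR hoelder_jet_const])

lemma hoelder_jet_diff:
  "hoelder_jet \<alpha> T k u \<Longrightarrow> hoelder_jet \<alpha> T k v \<Longrightarrow> hoelder_jet \<alpha> T k (\<lambda>t x. u t x - v t x)"
  using hoelder_jet_add[of \<alpha> T k u "\<lambda>t x. (-1) *\<^sub>R v t x"] hoelder_jet_scaleR[of \<alpha> T k v "-1"] by simp

lemma hoelder_jet_sum:
  "finite I \<Longrightarrow> (\<And>i. i \<in> I \<Longrightarrow> hoelder_jet \<alpha> T k (u i)) \<Longrightarrow> hoelder_jet \<alpha> T k (\<lambda>t x. \<Sum>i\<in>I. u i t x)"
  by (induction I rule: finite_induct) (auto simp: hoelder_jet_const intro: hoelder_jet_add)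

lemma hoelder_jet_linear:
  assumes l: "bounded_linear l" and "hoelder_jet \<alpha> T k u"
  shows "hoelder_jet \<alpha> T k (\<lambda>t x. l (u t x))"
proof -
  have "bounded_bilinear (\<lambda>(a::real) b. a *\<^sub>R l b)"
    by (rule bounded_bilinear.comp[OF bounded_bilinear_scaleR bounded_linear_ident l])
  from hoelder_jet_bilinear[OF this hoelder_jet_const[of \<alpha> T k 1] assms(2)] show ?thesis by simp
qed

text \<open>A lower exponent is weaker because the time interval is bounded.\<close>

lemma hoelder_field_weaken:
  assumes "hoelder_field \<beta> T u" "\<alpha> \<le> \<beta>" "T > 0"
  shows "hoelder_field \<alpha> T u"
proof -
  obtain K where K: "K > 0" "\<And>t x. t \<in> {0..T} \<Longrightarrow> norm (u t x) \<le> K"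
    "\<And>s t x. s \<in> {0..T} \<Longrightarrow> t \<in> {0..T} \<Longrightarrow> norm (u s x - u t x) \<le> K * \<bar>s - t\<bar> powr \<beta>"
    using hoelder_fieldD[OF assms(1)] by blast
  show ?thesis
  proof (rule hoelder_fieldI[OF hoelder_field_continuous[OF assms(1)] K(2)])
    show "norm (u s x - u t x) \<le> (K * T powr (\<beta> - \<alpha>)) * \<bar>s - t\<bar> powr \<alpha>" if "s \<in> {0..T}" "t \<in> {0..T}" for s t x
    proof -
      have "\<bar>s - t\<bar> powr \<beta> = \<bar>s - t\<bar> powr (\<beta> - \<alpha>) * \<bar>s - t\<bar> powr \<alpha>" by (simp add: powr_add[symmetric])
      also have "\<dots> \<le> T powr (\<beta> - \<alpha>) * \<bar>s - t\<bar> powr \<alpha>"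
        using that assms by (intro mult_right_mono powr_mono2) auto
      finally show ?thesis using K(3)[OF that, of x] K(1)
        by (smt (verit, best) mult.assoc mult_left_mono)
    qed
  qed
qed

lemma hoelder_jet_weaken:
  "hoelder_jet \<beta> T k u \<Longrightarrow> \<alpha> \<le> \<beta> \<Longrightarrow> T > 0 \<Longrightarrow> hoelder_jet \<alpha> T k u"
  by (induction k arbitrary: u) (auto intro: hoelder_field_weaken[of \<beta>])

section \<open>Periodic fields\<close>

lemma periodic_lattice:
  assumes "periodic L g"
  shows "g (x + (\<chi> i. L * of_int (k $ i))) = g (x :: real^'n::finite)"
proof -
  have nat: "g (x + real m *\<^sub>R (L *\<^sub>R axis i 1)) = g x" for i m x
  proof (induction m arbitrary: x)
    case (Suc m)
    have "g (x + real (Suc m) *\<^sub>R (L *\<^sub>R axis i 1)) = g ((x + real m *\<^sub>R (L *\<^sub>R axis i 1)) + L *\<^sub>R axis i 1)"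
      by (simp add: algebra_simps)
    then show ?case using assms Suc by (simp add: periodic_def)
  qed simp
  have int: "g (x + of_int m *\<^sub>R (L *\<^sub>R axis i 1)) = g x" for i m x
  proof (cases "m \<ge> 0")
    case True then show ?thesis using nat[of x "nat m" i] by simp
  next
    case False
    then show ?thesis using nat[of "x + of_int m *\<^sub>R (L *\<^sub>R axis i 1)" "nat (-m)" i] by simp
  qed
  have "finite I \<Longrightarrow> g (x + (\<Sum>i\<in>I. of_int (k $ i) *\<^sub>R (L *\<^sub>R axis i 1))) = g x" for I
  proof (induction I rule: finite_induct)
    case (insert j I)
    have eq: "x + (\<Sum>i\<in>insert j I. of_int (k $ i) *\<^sub>R (L *\<^sub>R axis i 1)) =
      (x + (\<Sum>i\<in>I. of_int (k $ i) *\<^sub>R (L *\<^sub>R axis i 1))) + of_int (k $ j) *\<^sub>R (L *\<^sub>R axis j 1)"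
      using insert.hyps by (simp add: algebra_simps)
    show ?case unfolding eq int by (rule insert.IH)
  qed simp
  from this[of UNIV] have "g (x + (\<Sum>i\<in>UNIV. of_int (k $ i) *\<^sub>R (L *\<^sub>R axis i 1))) = g x" by simp
  moreover have "(\<Sum>i\<in>UNIV. of_int (k $ i) *\<^sub>R (L *\<^sub>R axis i 1)) = (\<chi> i. L * of_int (k $ i))"
    by (simp add: vec_eq_iff axis_def if_distrib cong: if_cong)
  ultimately show ?thesis by simp
qed

lemma periodic_representative:
  assumes "periodic L g" "L > 0"
  obtains y :: "real^'n::finite" where "y \<in> cbox 0 (\<chi> i. L)" "g x = g y"
proof -
  define k :: "int^'n" where "k = (\<chi> i. - \<lfloor>x $ i / L\<rfloor>)"
  let ?y = "x + (\<chi> i. L * of_int (k $ i))"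
  have "0 \<le> ?y $ i \<and> ?y $ i \<le> L" for i
  proof -
    have "of_int \<lfloor>x $ i / L\<rfloor> \<le> x $ i / L" "x $ i / L < of_int \<lfloor>x $ i / L\<rfloor> + 1" by linarith+
    then have "of_int \<lfloor>x $ i / L\<rfloor> * L \<le> x $ i" "x $ i < (of_int \<lfloor>x $ i / L\<rfloor> + 1) * L"
      unfolding pos_le_divide_eq[OF assms(2)] pos_divide_less_eq[OF assms(2)] .
    then show ?thesis by (simp add: k_def algebra_simps)
  qed
  then have "?y \<in> cbox 0 (\<chi> i. L)" by (simp add: mem_box_cart)
  then show ?thesis using that periodic_lattice[OF assms(1), of x k] by metis
qed

lemma periodic_spartial: "periodic L g \<Longrightarrow> periodic L (spartial i g)"
proof -
  assume "periodic L g"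
  then have "(\<lambda>s. g (x + L *\<^sub>R axis j 1 + s *\<^sub>R axis i 1)) = (\<lambda>s. g (x + s *\<^sub>R axis i 1))" for x j
    unfolding periodic_def by (metis (no_types, opaque_lifting) add.assoc add.commute)
  then show ?thesis unfolding periodic_def spartial_def by simp
qed

text \<open>By periodicity all values are attained over one closed cell, and a continuous function is bounded
  on its product with the time interval.\<close>

lemma periodic_field_bounded:
  fixes u :: "real \<Rightarrow> real^'n::finite \<Rightarrow> 'b::real_normed_vector"
  assumes "continuous_on ({0..T} \<times> UNIV) (\<lambda>(t, x). u t x)" "\<And>t. t \<in> {0..T} \<Longrightarrow> periodic L (u t)" "L > 0"
  obtains K where "\<And>t x. t \<in> {0..T} \<Longrightarrow> norm (u t x) \<le> K"
proof -
  have "compact ((\<lambda>(t, x). u t x) ` ({0..T} \<times> cbox 0 (\<chi> i. L)))"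
    by (intro compact_continuous_image continuous_on_subset[OF assms(1)] compact_Times) auto
  then obtain K where K: "\<And>t x. t \<in> {0..T} \<Longrightarrow> x \<in> cbox 0 (\<chi> i. L) \<Longrightarrow> norm (u t x) \<le> K"
    by (force dest: compact_imp_bounded simp: bounded_iff)
  show ?thesis
  proof (rule that)
    fix t x assume t: "t \<in> {0..T}"
    obtain y where "y \<in> cbox 0 (\<chi> i. L)" "u t x = u t y" by (rule periodic_representative[OF assms(2)[OF t] assms(3), of x])
    then show "norm (u t x) \<le> K" using K[OF t] by simp
  qed
qed

lemma smooth_in_deriv:
  assumes "smooth_in D (Suc k) T u" "d \<in> D"
  shows "smooth_in D k T (tpartial T d u)" "\<And>t x. t \<in> {0..T} \<Longrightarrow> has_tpartial T d u t x"
proof -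
  have eq: "tpartials T ds (tpartial T d u) = tpartials T (ds @ [d]) u" for ds
    by (simp add: tpartials_def)
  show "smooth_in D k T (tpartial T d u)"
    unfolding smooth_in_def eq
  proof (intro allI impI)
    fix ds assume "set ds \<subseteq> D \<and> length ds \<le> k"
    then show "continuous_on ({0..T} \<times> UNIV) (\<lambda>(t, x). tpartials T (ds @ [d]) u t x) \<and>
          (length ds < k \<longrightarrow> (\<forall>da\<in>D. \<forall>t\<in>{0..T}. \<forall>x. has_tpartial T da (tpartials T (ds @ [d]) u) t x))"
      using assms(1)[unfolded smooth_in_def, rule_format, of "ds @ [d]"] assms(2) by auto
  qed
  show "has_tpartial T d u t x" if "t \<in> {0..T}" for t x
    using assms(1)[unfolded smooth_in_def, rule_format, of "[]"] assms(2) that by (auto simp: tpartials_def)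
qed

lemma smooth_in_continuous:
  "smooth_in D k T u \<Longrightarrow> continuous_on ({0..T} \<times> UNIV) (\<lambda>(t, x). u t x)"
  unfolding smooth_in_def by (drule spec[of _ "[]"]) (simp add: tpartials_def)

text \<open>Smoothness asks only for continuity on an unbounded set; periodicity supplies the bounds.\<close>

lemma smooth_in_hoelder_jet:
  assumes "smooth_in D k T u" "range Some \<subseteq> D" "\<And>t. t \<in> {0..T} \<Longrightarrow> periodic L (u t)" "L > 0"
  shows "hoelder_jet 0 T k u"
  using assms(1,3)
proof (induction k arbitrary: u)
  have field: "hoelder_field 0 T u" if ct: "continuous_on ({0..T} \<times> UNIV) (\<lambda>(t, x). u t x)"
    and pe: "\<And>t. t \<in> {0..T} \<Longrightarrow> periodic L (u t)" for u :: "real \<Rightarrow> real^'a \<Rightarrow> 'b"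
  proof -
    obtain K where K: "\<And>t x. t \<in> {0..T} \<Longrightarrow> norm (u t x) \<le> K"
      using periodic_field_bounded[OF ct pe assms(4)] by metis
    show ?thesis
    proof (rule hoelder_fieldI[OF ct K])
      show "norm (u s x - u t x) \<le> (K + K) * \<bar>s - t\<bar> powr 0" if "s \<in> {0..T}" "t \<in> {0..T}" for s t x
        using norm_triangle_le_diff[OF add_mono[OF K[OF that(1)] K[OF that(2)]], of x x] by auto
    qed
  qed
  {
    case 0
    show ?case using field[OF smooth_in_continuous[OF 0(1)] 0(2)] by simp
  next
    case (Suc k)
    have *: "tpartial T (Some i) u = (\<lambda>t. spartial i (u t))" for i by (intro ext) simp
    have D: "Some i \<in> D" for i using assms(2) by auto
    have "hoelder_jet 0 T k (\<lambda>t. spartial i (u t))" for i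
      by (rule Suc.IH) (use smooth_in_deriv(1)[OF Suc.prems(1) D, of i] Suc.prems(2) in \<open>auto simp: * intro: periodic_spartial\<close>)
    moreover have "has_spartial i (u t) x" if "t \<in> {0..T}" for t x i
      using smooth_in_deriv(2)[OF Suc.prems(1) D that, of i] by simp
    ultimately show ?case using field[OF smooth_in_continuous[OF Suc.prems(1)] Suc.prems(2)] by simp
  }
qed

lemma spartial_time_integral:
  fixes H :: "real \<Rightarrow> real^'n::finite \<Rightarrow> 'b::euclidean_space"
  assumes H: "hoelder_jet 0 T (Suc 0) H" and ts: "0 \<le> t" "s \<le> T"
  shows "((\<lambda>\<sigma>. integral {t..s} (\<lambda>r. H r (x + \<sigma> *\<^sub>R axis i 1))) has_vector_derivative
              integral {t..s} (\<lambda>r. spartial i (H r) x)) (at 0)"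
proof -
  have "((\<lambda>\<sigma>. integral (cbox t s) (\<lambda>r. H r (x + \<sigma> *\<^sub>R axis i 1))) has_vector_derivative
          integral (cbox t s) (\<lambda>r. spartial i (H r) (x + 0 *\<^sub>R axis i 1))) (at 0 within UNIV)"
  proof (rule leibniz_rule_vector_derivative)
    show "((\<lambda>\<sigma>. H r (x + \<sigma> *\<^sub>R axis i 1)) has_vector_derivative spartial i (H r) (x + \<sigma> *\<^sub>R axis i 1))
          (at \<sigma> within UNIV)" if "r \<in> cbox t s" for \<sigma> r
      using H that ts by (intro has_spartial_line) auto
    show "(\<lambda>r. H r (x + \<sigma> *\<^sub>R axis i 1)) integrable_on cbox t s" for \<sigma>
      using hoelder_field_time_continuous[OF hoelder_jet_field[OF H]] ts
      by (intro integrable_continuous) auto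
    have "continuous_on (UNIV \<times> cbox t s)
        (\<lambda>z. (\<lambda>(r, y). spartial i (H r) y) (snd z, x + fst z *\<^sub>R axis i 1))"
      by (rule continuous_on_compose2[OF hoelder_field_continuous[OF hoelder_jet_field[OF hoelder_jet_spartial[OF H]]]])
         (use ts in \<open>auto intro!: continuous_intros\<close>)
    then show "continuous_on (UNIV \<times> cbox t s) (\<lambda>(\<sigma>, r). spartial i (H r) (x + \<sigma> *\<^sub>R axis i 1))"
      by (simp add: case_prod_unfold)
  qed auto
  then show ?thesis by simp
qed

text \<open>Space derivatives commute with the time integral, so a field with bounded time integrand
  has Lipschitz derivatives as far as the integrand is smooth.\<close>

lemma hoelder_jet_of_integral:
  fixes u H :: "real \<Rightarrow> real^'n::finite \<Rightarrow> 'b::euclidean_space"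
  assumes "hoelder_jet 0 T k u" "hoelder_jet 0 T k H" "\<alpha> \<le> 1" "0 < T"
    "\<And>s t x. 0 \<le> t \<Longrightarrow> t \<le> s \<Longrightarrow> s \<le> T \<Longrightarrow> u s x - u t x = integral {t..s} (\<lambda>r. H r x)"
  shows "hoelder_jet \<alpha> T k u"
proof -
  have field: "hoelder_field 1 T u" if u: "hoelder_field 0 T u" and H: "hoelder_field 0 T H"
    and rep: "\<And>s t x. 0 \<le> t \<Longrightarrow> t \<le> s \<Longrightarrow> s \<le> T \<Longrightarrow> u s x - u t x = integral {t..s} (\<lambda>r. H r x)"
    for u H :: "real \<Rightarrow> real^'n \<Rightarrow> 'b"
  proof -
    obtain K where K: "K > 0" "\<And>t x. t \<in> {0..T} \<Longrightarrow> norm (u t x) \<le> K" using hoelder_fieldD[OF u] by metis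
    obtain K' where K': "K' > 0" "\<And>t x. t \<in> {0..T} \<Longrightarrow> norm (H t x) \<le> K'" using hoelder_fieldD[OF H] by metis
    have le: "norm (u s x - u t x) \<le> K' * (s - t)" if "0 \<le> t" "t \<le> s" "s \<le> T" for s t x
      unfolding rep[OF that]
      by (rule integral_bound) (use that K' hoelder_field_time_continuous[OF H] in auto)
    show ?thesis
    proof (rule hoelder_fieldI[OF hoelder_field_continuous[OF u] K(2)])
      show "norm (u s x - u t x) \<le> K' * \<bar>s - t\<bar> powr 1" if "s \<in> {0..T}" "t \<in> {0..T}" for s t x
        using le[of s t x] le[of t s x] that by (cases "s \<le> t") (auto simp: norm_minus_commute)
    qed
  qed
  have "hoelder_jet 1 T k u" using assms(1,2,5)
  proof (induction k arbitrary: u H)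
    case 0
    then show ?case using field by auto
  next
    case (Suc k)
    have "hoelder_jet 1 T k (\<lambda>t. spartial i (u t))" for i
    proof (rule Suc.IH[where H="\<lambda>t. spartial i (H t)"])
      fix s t x assume st: "0 \<le> t" "t \<le> s" "s \<le> T"
      have "hoelder_jet 0 T (Suc 0) H" by (rule hoelder_jet_mono[OF Suc.prems(2)]) simp
      then have *: "((\<lambda>\<sigma>. u s (x + \<sigma> *\<^sub>R axis i 1) - u t (x + \<sigma> *\<^sub>R axis i 1)) has_vector_derivative
              integral {t..s} (\<lambda>r. spartial i (H r) x)) (at 0)"
        unfolding Suc.prems(3)[OF st] by (rule spartial_time_integral) (use st in auto)
      have "((\<lambda>\<sigma>. u s (x + \<sigma> *\<^sub>R axis i 1) - u t (x + \<sigma> *\<^sub>R axis i 1)) has_vector_derivative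
              spartial i (u s) x - spartial i (u t) x) (at 0)"
        using Suc.prems(1) st by (intro has_vector_derivative_diff has_spartialD) auto
      from vector_derivative_unique_at[OF this *]
      show "spartial i (u s) x - spartial i (u t) x = integral {t..s} (\<lambda>r. spartial i (H r) x)" .
    qed (use Suc.prems in auto)
    then show ?case using Suc.prems field[of u H] by auto
  qed
  then show ?thesis using hoelder_jet_weaken assms(3,4) by blast
qed

section \<open>Taylor expansion of the layer average\<close>

definition directional :: "real^'n::finite \<Rightarrow> (real^'n \<Rightarrow> 'b::real_normed_vector) \<Rightarrow> real^'n \<Rightarrow> 'b" where
  "directional \<delta> U x = (\<Sum>i\<in>UNIV. (\<delta> $ i) *\<^sub>R spartial i U x)"

lemma directional_derivative:
  assumes "C1_space U"
  shows "((\<lambda>s. U (x + s *\<^sub>R \<delta>)) has_vector_derivative directional \<delta> U (x + s *\<^sub>R \<delta>)) (at s)"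
proof -
  have "((\<lambda>s. x + s *\<^sub>R \<delta>) has_derivative (\<lambda>r. r *\<^sub>R \<delta>)) (at s)" by (auto intro!: derivative_eq_intros)
  from diff_chain_at[OF this C1_space_has_derivative[OF assms]] show ?thesis
    unfolding has_vector_derivative_def directional_def o_def
    by (simp add: scaleR_sum_right)
qed

lemma norm_lincomb_le:
  fixes c :: "'n::finite \<Rightarrow> 'b::real_normed_vector" and \<delta> :: "real^'n"
  assumes "\<And>i. norm (c i) \<le> K"
  shows "norm (\<Sum>i\<in>UNIV. (\<delta> $ i) *\<^sub>R c i) \<le> (real CARD('n) * norm \<delta>) * K"
proof -
  have "norm (\<Sum>i\<in>UNIV. (\<delta> $ i) *\<^sub>R c i) \<le> (\<Sum>i\<in>(UNIV::'n set). norm \<delta> * K)"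
    by (intro order.trans[OF norm_sum] sum_mono)
       (auto intro!: mult_mono assms component_le_norm_cart)
  then show ?thesis by simp
qed

lemma C1_space_lincomb:
  assumes "\<And>i. C1_space (g i)"
  shows "C1_space (\<lambda>x. \<Sum>i\<in>UNIV. c i *\<^sub>R g i x)"
    "spartial j (\<lambda>x. \<Sum>i\<in>UNIV. c i *\<^sub>R g i x) = (\<lambda>x. \<Sum>i\<in>UNIV. c i *\<^sub>R spartial j (g i) x)"
proof -
  have d: "((\<lambda>s. \<Sum>i\<in>UNIV. c i *\<^sub>R g i (x + s *\<^sub>R axis j 1)) has_vector_derivative
      (\<Sum>i\<in>UNIV. c i *\<^sub>R spartial j (g i) x)) (at 0)" for x j
    by (intro has_vector_derivative_sum bounded_linear.has_vector_derivative[OF bounded_linear_scaleR_right] has_spartialD)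
       (use assms in \<open>auto simp: C1_space_def\<close>)
  show eq: "spartial j (\<lambda>x. \<Sum>i\<in>UNIV. c i *\<^sub>R g i x) = (\<lambda>x. \<Sum>i\<in>UNIV. c i *\<^sub>R spartial j (g i) x)" for j
    using has_spartialI(2)[OF d] by (simp add: fun_eq_iff)
  show "C1_space (\<lambda>x. \<Sum>i\<in>UNIV. c i *\<^sub>R g i x)"
    unfolding C1_space_def eq using assms has_spartialI(1)[OF d]
    by (auto simp: C1_space_def intro!: continuous_on_sum continuous_on_scaleR continuous_on_const)
qed

lemma directional_fun: "directional \<delta> U = (\<lambda>x. \<Sum>i\<in>UNIV. (\<delta> $ i) *\<^sub>R spartial i U x)"
  by (simp add: directional_def fun_eq_iff)

lemma bound_by_derivative:
  fixes f :: "real \<Rightarrow> 'b::real_normed_vector"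
  assumes "\<And>s. (f has_vector_derivative f' s) (at s)" "f 0 = 0" "\<And>s. s \<in> {0..1} \<Longrightarrow> norm (f' s) \<le> K" "s \<in> {0..1}"
  shows "norm (f s) \<le> K"
proof -
  have K: "K \<ge> 0" using assms(3)[OF assms(4)] norm_ge_zero order.trans by blast
  have "norm (f s - f 0) \<le> K * norm (s - 0)"
  proof (rule differentiable_bound[of "{0..1}" f "\<lambda>s r. r *\<^sub>R f' s"])
    show "(f has_derivative (\<lambda>r. r *\<^sub>R f' s)) (at s within {0..1})" for s
      using assms(1)[of s] unfolding has_vector_derivative_def by (rule has_derivative_at_withinI)
    show "onorm (\<lambda>r. r *\<^sub>R f' s) \<le> K" if "s \<in> {0..1}" for s
      by (rule onorm_le) (use mult_right_mono[OF assms(3)[OF that], of "norm r" for r :: real] in \<open>simp add: mult.commute\<close>)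
  qed (use assms in auto)
  also have "\<dots> \<le> K" using K assms(4) by (simp add: mult_left_le)
  finally show ?thesis using assms(2) by simp
qed

text \<open>Along the segment to \<open>x + \<delta>\<close> the third directional derivative is bounded by the right-hand side;
  integrating this bound three times from the base point gives the remainder, with the factor
  \<open>1/6\<close> given away.\<close>

lemma taylor_second_order:
  fixes U :: "real^'n::finite \<Rightarrow> 'b::real_normed_vector"
  assumes "C1_space U" "\<And>i. C1_space (spartial i U)" "\<And>i j. C1_space (spartial j (spartial i U))"
    and K: "\<And>i j k x. norm (spartial k (spartial j (spartial i U)) x) \<le> K"
  shows "norm (U (x + \<delta>) - U x - directional \<delta> U x
      - (1/2) *\<^sub>R (\<Sum>j\<in>UNIV. (\<delta> $ j) *\<^sub>R (\<Sum>i\<in>UNIV. (\<delta> $ i) *\<^sub>R spartial j (spartial i U) x)))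
    \<le> (real CARD('n) * norm \<delta>) ^ 3 * K"
proof -
  let ?D = "directional \<delta>"
  note lin2 = C1_space_lincomb[where g="\<lambda>i. spartial i U" and c="\<lambda>i. \<delta> $ i", OF assms(2), folded directional_fun]
  note lin3 = C1_space_lincomb[where g="\<lambda>i. spartial j (spartial i U)" and c="\<lambda>i. \<delta> $ i" for j, OF assms(3), folded lin2(2)]
  note lin3' = C1_space_lincomb[where g="\<lambda>j. spartial j (?D U)" and c="\<lambda>i. \<delta> $ i", OF lin3(1), folded directional_fun]
  define R where "R = (real CARD('n) * norm \<delta>) ^ 3 * K"
  have third: "norm (?D (?D (?D U)) y) \<le> R" for y
  proof -
    have "norm (spartial k (spartial j (?D U)) y) \<le> (real CARD('n) * norm \<delta>) * K" for j k
      unfolding lin3(2) by (rule norm_lincomb_le) (rule K)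
    then have "norm (spartial k (?D (?D U)) y) \<le> (real CARD('n) * norm \<delta>) * ((real CARD('n) * norm \<delta>) * K)" for k
      unfolding lin3'(2) by (intro norm_lincomb_le)
    then have "norm (?D (?D (?D U)) y) \<le> (real CARD('n) * norm \<delta>) * ((real CARD('n) * norm \<delta>) * ((real CARD('n) * norm \<delta>) * K))"
      unfolding directional_fun[of \<delta> "?D (?D U)"] by (intro norm_lincomb_le)
    then show ?thesis by (simp add: R_def power3_eq_cube mult.assoc)
  qed
  note der = directional_derivative[where x=x and \<delta>=\<delta>, OF assms(1)] directional_derivative[where x=x and \<delta>=\<delta>, OF lin2(1)]
    directional_derivative[where x=x and \<delta>=\<delta>, OF lin3'(1)]
  let ?y = "\<lambda>s. x + s *\<^sub>R \<delta>"
  have lin: "((\<lambda>s. s *\<^sub>R c) has_vector_derivative c) (at s)"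
       "((\<lambda>s. (s\<^sup>2/2) *\<^sub>R c) has_vector_derivative s *\<^sub>R c) (at s)" for c :: 'b and s :: real
    by (rule has_vector_derivative_eq_rhs, rule has_vector_derivative_scaleR[OF _ has_vector_derivative_const],
        rule derivative_eq_intros, auto intro!: derivative_eq_intros)+
  have sub: "((\<lambda>s. f s - c) has_vector_derivative f') (at s)" if "(f has_vector_derivative f') (at s)"
    for f :: "real \<Rightarrow> 'b" and f' c s
    using has_vector_derivative_diff[OF that has_vector_derivative_const[of c]] by simp
  have b2: "norm (?D (?D U) (?y s) - ?D (?D U) x) \<le> R" if "s \<in> {0..1}" for s
    by (rule bound_by_derivative[where f="\<lambda>s. ?D (?D U) (?y s) - ?D (?D U) x", OF sub[OF der(3)]])
       (use that third in auto)
  have b1: "norm (?D U (?y s) - ?D U x - s *\<^sub>R ?D (?D U) x) \<le> R" if "s \<in> {0..1}" for s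
    by (rule bound_by_derivative[where f="\<lambda>s. ?D U (?y s) - ?D U x - s *\<^sub>R ?D (?D U) x",
          OF has_vector_derivative_diff[OF sub[OF der(2)] lin(1)]])
       (use that b2 in auto)
  have b0: "norm (U (?y s) - U x - s *\<^sub>R ?D U x - (s\<^sup>2/2) *\<^sub>R ?D (?D U) x) \<le> R" if "s \<in> {0..1}" for s
    by (rule bound_by_derivative[where f="\<lambda>s. U (?y s) - U x - s *\<^sub>R ?D U x - (s\<^sup>2/2) *\<^sub>R ?D (?D U) x",
          OF has_vector_derivative_diff[OF has_vector_derivative_diff[OF sub[OF der(1)] lin(1)] lin(2)]])
       (use that b1 in auto)
  show ?thesis using b0[of 1] unfolding R_def directional_fun[of \<delta> "?D U"] lin2(2) by simp
qed

section \<open>Averages over the sign vectors\<close>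

text \<open>Symmetry of the sign vectors under a change of one sign, which makes the first moments and
  the mixed second moments vanish.\<close>

lemma signs_flip:
  fixes F :: "real^'n::finite \<Rightarrow> 'b::comm_monoid_add"
  shows "(\<Sum>\<xi>\<in>signs. F \<xi>) = (\<Sum>\<xi>\<in>signs. F (\<chi> j. if j = i then - \<xi> $ j else \<xi> $ j))"
proof -
  let ?f = "\<lambda>\<xi>::real^'n. \<chi> j. if j = i then - \<xi> $ j else \<xi> $ j"
  have inv: "?f (?f \<xi>) = \<xi>" for \<xi> by (simp add: vec_eq_iff)
  have sg: "?f \<xi> \<in> signs" if "\<xi> \<in> signs" for \<xi> using that by (auto simp: signs_def)
  show ?thesis by (rule sum.reindex_bij_witness[of _ ?f ?f]) (simp_all only: inv sg)
qed

lemma finite_signs_card: "finite (signs :: (real^'n::finite) set)" "card (signs :: (real^'n) set) = 2 ^ CARD('n)"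
proof -
  have "bij_betw (\<lambda>I::'n set. (\<chi> i. if i \<in> I then 1 else -1) :: real^'n) (Pow UNIV) signs"
    by (rule bij_betw_byWitness[where f'="\<lambda>\<xi>. {i. \<xi> $ i = 1}"]) (auto simp: signs_def vec_eq_iff, metis)
  from bij_betw_finite[OF this] bij_betw_same_card[OF this]
  show "finite (signs :: (real^'n::finite) set)" "card (signs :: (real^'n) set) = 2 ^ CARD('n)"
    by (simp_all add: card_Pow)
qed

lemma signs_first_moment: "(\<Sum>\<xi>\<in>signs. \<xi> $ i) = (0::real)"
  using signs_flip[of "\<lambda>\<xi>. \<xi> $ i" i] by (simp add: sum_negf)

lemma signs_second_moment:
  "(\<Sum>\<xi>\<in>(signs::(real^'n::finite) set). \<xi> $ i * \<xi> $ j) = (if i = j then 2 ^ CARD('n) else 0)"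
proof (cases "i = j")
  case True
  have "(\<Sum>\<xi>\<in>(signs::(real^'n) set). \<xi> $ i * \<xi> $ j) = (\<Sum>\<xi>\<in>(signs::(real^'n) set). 1)"
  proof (rule sum.cong)
    fix \<xi> :: "real^'n" assume "\<xi> \<in> signs"
    then have "\<xi> $ j = -1 \<or> \<xi> $ j = 1" by (simp add: signs_def)
    then show "\<xi> $ i * \<xi> $ j = 1" using True by auto
  qed simp
  then show ?thesis using True finite_signs_card(2)[where 'n='n] by simp
next
  case False
  then show ?thesis using signs_flip[of "\<lambda>\<xi>::real^'n. \<xi> $ i * \<xi> $ j" i] by (simp add: sum_negf)
qed

lemma signs_norm: "\<xi> \<in> signs \<Longrightarrow> norm (\<xi> :: real^'n::finite) \<le> real CARD('n)"
proof -
  assume "\<xi> \<in> signs"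
  then have "(\<Sum>i\<in>UNIV. \<bar>\<xi> $ i\<bar>) = (\<Sum>i\<in>(UNIV::'n set). 1)"
    by (intro sum.cong) (auto simp: signs_def abs_eq_iff')
  then show ?thesis using norm_le_l1_cart[of \<xi>] by simp
qed

text \<open>The shifts \<open>- h u + \<sigma> sqrt h \<xi>\<close> have mean \<open>- h u\<close> and covariance \<open>\<sigma>^2 h\<close> times the
  identity, so averaging the second order expansion produces one Euler step of the
  convection-diffusion operator, up to the drift squared and the third order remainder.\<close>

lemma layer_average_expansion:
  fixes U :: "real^'n::finite \<Rightarrow> real^'n"
  assumes C: "C1_space U" "\<And>i. C1_space (spartial i U)" "\<And>i j. C1_space (spartial j (spartial i U))"
    and K: "K \<ge> 0" "\<And>x. norm (U x) \<le> K" "\<And>i j x. norm (spartial j (spartial i U) x) \<le> K"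
       "\<And>i j k x. norm (spartial k (spartial j (spartial i U)) x) \<le> K"
    and h: "0 < h" "h \<le> T" and \<sigma>: "\<sigma> > 0"
  shows "norm (layer_average \<sigma> h U x - U x - h *\<^sub>R ((\<sigma>\<^sup>2 / 2) *\<^sub>R laplacian U x - convection U x))
     \<le> ((real CARD('n) * (sqrt T * K + \<sigma> * real CARD('n))) ^ 3 * K + sqrt T * (real CARD('n) * K)\<^sup>2 * K) * h powr (3/2)"
proof -
  let ?N = "2 ^ CARD('n) :: real"
  define a where "a = - h *\<^sub>R U x"
  define b where "b = \<sigma> * sqrt h"
  define \<delta> where "\<delta> \<xi> = a + b *\<^sub>R \<xi>" for \<xi> :: "real^'n"
  define H where "H j i = spartial j (spartial i U) x" for i j
  define rem where "rem \<xi> = U (x + \<delta> \<xi>) - U x - directional (\<delta> \<xi>) U x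
      - (1/2) *\<^sub>R (\<Sum>j\<in>UNIV. (\<delta> \<xi> $ j) *\<^sub>R (\<Sum>i\<in>UNIV. (\<delta> \<xi> $ i) *\<^sub>R H j i))" for \<xi>
  have m1: "(\<Sum>\<xi>\<in>signs. \<delta> \<xi> $ i) = ?N * a $ i" for i
    using finite_signs_card(2)[where 'n='n]
    by (simp add: \<delta>_def sum.distrib sum_distrib_left[symmetric] signs_first_moment)
  have m2: "(\<Sum>\<xi>\<in>signs. \<delta> \<xi> $ j * \<delta> \<xi> $ i) = ?N * (a $ j * a $ i + (if j = i then b\<^sup>2 else 0))" for i j
  proof -
    have "(\<Sum>\<xi>\<in>signs. \<delta> \<xi> $ j * \<delta> \<xi> $ i) = (\<Sum>\<xi>\<in>signs. a $ j * a $ i + a $ j * b * (\<xi> $ i) + a $ i * b * (\<xi> $ j) + b\<^sup>2 * (\<xi> $ j * \<xi> $ i))"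
      by (simp add: \<delta>_def algebra_simps power2_eq_square)
    also have "\<dots> = ?N * (a $ j * a $ i + (if j = i then b\<^sup>2 else 0))"
      by (simp only: sum.distrib sum_distrib_left[symmetric] signs_first_moment signs_second_moment)
         (simp add: finite_signs_card(2) algebra_simps)
    finally show ?thesis .
  qed
  have b2: "b\<^sup>2 = \<sigma>\<^sup>2 * h" using h by (simp add: b_def power_mult_distrib)
  have "(\<Sum>\<xi>\<in>signs. U (x + \<delta> \<xi>)) = (\<Sum>\<xi>\<in>signs. rem \<xi> + U x + directional (\<delta> \<xi>) U x
      + (1/2) *\<^sub>R (\<Sum>j\<in>UNIV. (\<delta> \<xi> $ j) *\<^sub>R (\<Sum>i\<in>UNIV. (\<delta> \<xi> $ i) *\<^sub>R H j i)))"
    by (simp add: rem_def)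
  also have "\<dots> = (\<Sum>\<xi>\<in>signs. rem \<xi>) + ?N *\<^sub>R U x + (\<Sum>\<xi>\<in>signs. directional (\<delta> \<xi>) U x)
      + (1/2) *\<^sub>R (\<Sum>\<xi>\<in>signs. \<Sum>j\<in>UNIV. (\<delta> \<xi> $ j) *\<^sub>R (\<Sum>i\<in>UNIV. (\<delta> \<xi> $ i) *\<^sub>R H j i))"
    using finite_signs_card(2)[where 'n='n]
    by (simp add: sum.distrib scaleR_sum_right[symmetric] sum_constant_scaleR del: sum_constant)
  also have "(\<Sum>\<xi>\<in>signs. directional (\<delta> \<xi>) U x) = ?N *\<^sub>R directional a U x"
    unfolding directional_def
    by (subst sum.swap) (simp add: scaleR_sum_left[symmetric] m1 scaleR_sum_right)
  also have "(\<Sum>\<xi>\<in>signs. \<Sum>j\<in>UNIV. (\<delta> \<xi> $ j) *\<^sub>R (\<Sum>i\<in>UNIV. (\<delta> \<xi> $ i) *\<^sub>R H j i))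
      = (\<Sum>j\<in>UNIV. \<Sum>i\<in>UNIV. (\<Sum>\<xi>\<in>signs. \<delta> \<xi> $ j * \<delta> \<xi> $ i) *\<^sub>R H j i)"
    by (subst sum.swap, rule sum.cong[OF refl], simp only: scaleR_sum_right scaleR_scaleR,
        subst sum.swap, simp add: scaleR_sum_left)
  also have "\<dots> = ?N *\<^sub>R ((\<Sum>j\<in>UNIV. (a $ j) *\<^sub>R (\<Sum>i\<in>UNIV. (a $ i) *\<^sub>R H j i)) + b\<^sup>2 *\<^sub>R laplacian U x)"
  proof -
    have "(\<Sum>j\<in>UNIV. \<Sum>i\<in>UNIV. (if j = i then b\<^sup>2 else 0) *\<^sub>R H j i) = b\<^sup>2 *\<^sub>R laplacian U x"
      by (simp add: laplacian_def H_def scaleR_sum_right if_distrib[of "\<lambda>c. c *\<^sub>R _"] sum.delta cong: if_cong)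
    moreover have "(\<Sum>j\<in>UNIV. \<Sum>i\<in>UNIV. (?N * (a $ j * a $ i + (if j = i then b\<^sup>2 else 0))) *\<^sub>R H j i)
       = ?N *\<^sub>R ((\<Sum>j\<in>UNIV. \<Sum>i\<in>UNIV. (a $ j * a $ i) *\<^sub>R H j i) + (\<Sum>j\<in>UNIV. \<Sum>i\<in>UNIV. (if j = i then b\<^sup>2 else 0) *\<^sub>R H j i))"
      by (simp only: scaleR_scaleR[symmetric] scaleR_sum_right[symmetric] scaleR_add_left sum.distrib)
    ultimately show ?thesis by (simp add: m2 scaleR_sum_right)
  qed
  finally have "(1 / ?N) *\<^sub>R (\<Sum>\<xi>\<in>signs. U (x + \<delta> \<xi>)) = (1 / ?N) *\<^sub>R (\<Sum>\<xi>\<in>signs. rem \<xi>) + U x + directional a U x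
      + (1/2) *\<^sub>R ((\<Sum>j\<in>UNIV. (a $ j) *\<^sub>R (\<Sum>i\<in>UNIV. (a $ i) *\<^sub>R H j i)) + b\<^sup>2 *\<^sub>R laplacian U x)"
    by (simp add: scaleR_add_right)
  moreover have "directional a U x = - h *\<^sub>R convection U x"
    by (simp add: directional_def a_def convection_def scaleR_sum_right sum_negf)
  moreover have "layer_average \<sigma> h U x = (1 / ?N) *\<^sub>R (\<Sum>\<xi>\<in>signs. U (x + \<delta> \<xi>))"
    by (simp add: layer_average_def \<delta>_def a_def b_def algebra_simps)
  ultimately have eq: "layer_average \<sigma> h U x - U x - h *\<^sub>R ((\<sigma>\<^sup>2 / 2) *\<^sub>R laplacian U x - convection U x)
     = (1 / ?N) *\<^sub>R (\<Sum>\<xi>\<in>signs. rem \<xi>) + (1/2) *\<^sub>R (\<Sum>j\<in>UNIV. (a $ j) *\<^sub>R (\<Sum>i\<in>UNIV. (a $ i) *\<^sub>R H j i))"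
    unfolding b2 by (simp add: algebra_simps)
  define n where "n = real CARD('n)"
  have n: "n \<ge> 0" by (simp add: n_def)
  have sq: "sqrt h \<le> sqrt T" "sqrt h > 0" "sqrt h * sqrt h = h" using h by auto
  have h32: "h powr (3/2) = sqrt h ^ 3"
    using h by (simp add: powr_half_sqrt[symmetric] powr_power)
  have "norm (rem \<xi>) \<le> (n * (sqrt h * (sqrt T * K + \<sigma> * n))) ^ 3 * K" if "\<xi> \<in> signs" for \<xi>
  proof -
    have "norm (\<delta> \<xi>) \<le> norm a + norm (b *\<^sub>R \<xi>)" unfolding \<delta>_def by (rule norm_triangle_ineq)
    also have "\<dots> \<le> h * K + b * n"
      using h \<sigma> K(2)[of x] signs_norm[OF that] by (intro add_mono) (auto simp: a_def b_def n_def mult_left_mono)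
    also have "h * K \<le> sqrt h * (sqrt T * K)"
      using mult_right_mono[OF mult_left_mono[OF sq(1), of "sqrt h"] K(1)] sq by (simp add: mult.assoc)
    finally have "norm (\<delta> \<xi>) \<le> sqrt h * (sqrt T * K + \<sigma> * n)" by (simp add: b_def algebra_simps)
    then have "(n * norm (\<delta> \<xi>)) ^ 3 * K \<le> (n * (sqrt h * (sqrt T * K + \<sigma> * n))) ^ 3 * K"
      using n K(1) by (intro mult_right_mono power_mono mult_left_mono) auto
    with taylor_second_order[OF C K(4), of x "\<delta> \<xi>"] show ?thesis
      unfolding rem_def H_def n_def by linarith
  qed
  then have "norm (\<Sum>\<xi>\<in>signs. rem \<xi>) \<le> (\<Sum>\<xi>\<in>(signs::(real^'n) set). (n * (sqrt h * (sqrt T * K + \<sigma> * n))) ^ 3 * K)"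
    by (rule sum_norm_le)
  also have "\<dots> = ?N * ((n * (sqrt T * K + \<sigma> * n)) ^ 3 * K * h powr (3/2))"
    by (simp add: h32 finite_signs_card(2) power_mult_distrib mult.commute mult.left_commute)
  finally have 1: "norm ((1 / ?N) *\<^sub>R (\<Sum>\<xi>\<in>signs. rem \<xi>)) \<le> (n * (sqrt T * K + \<sigma> * n)) ^ 3 * K * h powr (3/2)"
    by (simp add: pos_divide_le_eq mult.commute)
  have na: "norm a \<le> h * K" using h K(2)[of x] by (simp add: a_def mult_left_mono)
  have "norm (\<Sum>j\<in>UNIV. (a $ j) *\<^sub>R (\<Sum>i\<in>UNIV. (a $ i) *\<^sub>R H j i)) \<le> (n * norm a) * ((n * norm a) * K)"
    unfolding n_def by (intro norm_lincomb_le) (simp add: H_def K)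
  also have "\<dots> \<le> (n * (h * K)) * ((n * (h * K)) * K)"
    using n K(1) h na by (intro mult_mono) auto
  also have "\<dots> = h\<^sup>2 * ((n * K)\<^sup>2 * K)" by (simp add: power2_eq_square algebra_simps)
  also have "h\<^sup>2 = sqrt h * h powr (3/2)" unfolding h32 using sq(3) by (simp add: power2_eq_square power3_eq_cube)
  also have "\<dots> * ((n * K)\<^sup>2 * K) \<le> sqrt T * h powr (3/2) * ((n * K)\<^sup>2 * K)"
    using sq K(1) by (intro mult_right_mono) auto
  finally have 2: "norm (\<Sum>j\<in>UNIV. (a $ j) *\<^sub>R (\<Sum>i\<in>UNIV. (a $ i) *\<^sub>R H j i)) \<le> sqrt T * (n * K)\<^sup>2 * K * h powr (3/2)"
    by (simp add: algebra_simps)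
  have 3: "norm ((1/2) *\<^sub>R (\<Sum>j\<in>UNIV. (a $ j) *\<^sub>R (\<Sum>i\<in>UNIV. (a $ i) *\<^sub>R H j i))) \<le> sqrt T * (n * K)\<^sup>2 * K * h powr (3/2)"
    by (rule order.trans[OF _ 2]) simp
  show ?thesis unfolding eq n_def[symmetric] using norm_triangle_le[OF add_mono[OF 1 3]] by (simp add: algebra_simps)
qed

section \<open>Integrals of periodic functions over a period cell\<close>

abbreviation lattice_shift :: "real \<Rightarrow> int^'n::finite \<Rightarrow> real^'n" where
  "lattice_shift L k \<equiv> (\<chi> i. L * of_int (k $ i))"

lemma cell_eq_box: "cell L = box 0 (\<chi> i. L)"
  by (auto simp: cell_def mem_box_cart)

lemma cell_measurable [measurable, simp]: "cell L \<in> sets borel"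
  by (simp add: cell_eq_box)

lemma prod_Basis_cart: "(\<Prod>b\<in>Basis. (x::real^'n::finite) \<bullet> b) = (\<Prod>i\<in>UNIV. x $ i)"
  unfolding Basis_vec_def by (subst prod.UNION_disjoint) (auto simp: inner_axis axis_eq_axis)

lemma measure_cell:
  assumes "L > 0" shows "measure lborel (cell L :: (real^'n::finite) set) = L ^ CARD('n)"
    "emeasure lborel (cell L :: (real^'n::finite) set) = ennreal (L ^ CARD('n))"
proof -
  have p: "(\<Prod>b\<in>Basis. ((\<chi> i. L) - 0 :: real^'n) \<bullet> b) = L ^ CARD('n)" unfolding prod_Basis_cart by simp
  have b: "0 \<bullet> b \<le> (\<chi> i. L :: real^'n) \<bullet> b" if "b \<in> Basis" for b
    using that assms by (auto simp: Basis_vec_def inner_axis)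
  show 1: "emeasure lborel (cell L :: (real^'n::finite) set) = ennreal (L ^ CARD('n))"
    unfolding cell_eq_box by (subst emeasure_lborel_box) (use b p in auto)
  show "measure lborel (cell L :: (real^'n::finite) set) = L ^ CARD('n)"
    using assms by (simp add: measure_def 1)
qed

text \<open>Adding the lower faces to the cell makes its lattice translates tile the space exactly; the
  faces are negligible.\<close>

definition half_open_cell :: "real \<Rightarrow> (real^'n::finite) set" where
  "half_open_cell L = {x. \<forall>i. 0 \<le> x $ i \<and> x $ i < L}"

lemma half_open_cell_measurable [measurable, simp]: "half_open_cell L \<in> sets borel"
  unfolding half_open_cell_def by measurable

lemma half_open_cell_ae: "AE x::real^'n::finite in lborel. (x \<in> half_open_cell L) = (x \<in> cell L)"
proof -
  let ?N = "cbox 0 (\<chi> i. L) - box 0 (\<chi> i. L) :: (real^'n) set"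
  have "negligible ?N" by (rule negligible_frontier_interval)
  then have "?N \<in> null_sets lborel"
    using null_sets_completion_iff[of ?N lborel] by (simp add: negligible_iff_null_sets)
  moreover have "cell L \<subseteq> (half_open_cell L :: (real^'n) set)" "(half_open_cell L :: (real^'n) set) \<subseteq> cbox 0 (\<chi> i. L)"
    by (auto simp: half_open_cell_def cell_def mem_box_cart less_imp_le)
  then have "{x \<in> space lborel. \<not> ((x \<in> half_open_cell L) = (x \<in> cell L))} \<subseteq> ?N" by (auto simp: cell_eq_box)
  ultimately show ?thesis by (rule AE_I')
qed

lemma half_open_cell_tile:
  assumes "L > 0"
  shows "\<exists>!k. x - lattice_shift L k \<in> half_open_cell L"
proof -
  have "x - lattice_shift L k \<in> half_open_cell L \<longleftrightarrow> k = (\<chi> i. \<lfloor>x $ i / L\<rfloor>)" for k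
  proof -
    have "0 \<le> x $ i - L * of_int (k $ i) \<and> x $ i - L * of_int (k $ i) < L \<longleftrightarrow> k $ i = \<lfloor>x $ i / L\<rfloor>" for i
    proof -
      have "k $ i = \<lfloor>x $ i / L\<rfloor> \<longleftrightarrow> of_int (k $ i) \<le> x $ i / L \<and> x $ i / L < of_int (k $ i) + 1" by linarith
      also have "\<dots> \<longleftrightarrow> of_int (k $ i) * L \<le> x $ i \<and> x $ i < (of_int (k $ i) + 1) * L"
        unfolding pos_le_divide_eq[OF assms] pos_divide_less_eq[OF assms] ..
      finally show ?thesis by (auto simp: algebra_simps)
    qed
    then show ?thesis by (simp add: half_open_cell_def vec_eq_iff)
  qed
  then show ?thesis by simp
qed

lemma cell_translates_disjoint:
  assumes L: "L > 0" and x: "x \<in> cell L" "x + lattice_shift L k \<in> cell L"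
  shows "k = 0"
proof -
  have "k $ i = 0" for i
  proof -
    have "0 < x $ i" "x $ i < L" "0 < x $ i + L * of_int (k $ i)" "x $ i + L * of_int (k $ i) < L"
      using x by (auto simp: cell_def)
    then have "L * of_int (k $ i) < L * 1" "L * (-1) < L * of_int (k $ i)" by linarith+
    then have "of_int (k $ i) < (1::real)" "(-1::real) < of_int (k $ i)"
      unfolding mult_less_cancel_left_pos[OF L] .
    then show ?thesis by linarith
  qed
  then show "k = 0" by (simp add: vec_eq_iff)
qed

lemma nn_integral_lborel_shift:
  fixes f :: "'b::euclidean_space \<Rightarrow> ennreal"
  assumes "f \<in> borel_measurable borel"
  shows "(\<integral>\<^sup>+x. f (c + x) \<partial>lborel) = (\<integral>\<^sup>+x. f x \<partial>lborel)"
proof -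
  have "(\<integral>\<^sup>+x. f x \<partial>lborel) = (\<integral>\<^sup>+x. f x \<partial>distr lborel borel ((+) c))" by (simp add: lborel_distr_plus)
  also have "\<dots> = (\<integral>\<^sup>+x. f (c + x) \<partial>lborel)" by (rule nn_integral_distr) (use assms in auto)
  finally show ?thesis by simp
qed

text \<open>Cut a set along the tiling and move all pieces into one cell. If the lattice translates
  of the set are disjoint, the pieces do not overlap.\<close>

lemma nn_integral_packing_le:
  fixes f :: "real^'n::finite \<Rightarrow> ennreal"
  assumes L: "L > 0" and f[measurable]: "f \<in> borel_measurable borel" and per: "periodic L f" and S[measurable]: "S \<in> sets borel"
    and pack: "\<And>x k. x \<in> S \<Longrightarrow> x + lattice_shift L k \<in> S \<Longrightarrow> k = 0"
  shows "(\<integral>\<^sup>+x\<in>S. f x \<partial>lborel) \<le> (\<integral>\<^sup>+x\<in>cell L. f x \<partial>lborel)"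
proof -
  let ?H = "half_open_cell L :: (real^'n) set"
  have one: "(\<integral>\<^sup>+k. indicator {k. P k} k \<partial>count_space UNIV) = (if \<exists>k. P k then 1 else (0::ennreal))"
    if "\<And>k k'. P k \<Longrightarrow> P k' \<Longrightarrow> k = k'" for P :: "int^'n \<Rightarrow> bool"
  proof (cases "\<exists>k. P k")
    case True
    then obtain k where "P k" by blast
    then have "{k. P k} = {k}" using that by auto
    then show ?thesis using True by simp
  qed (auto simp: indicator_def)
  \<comment> \<open>Insert the tiling as a sum over lattice vectors, exchange sum and integral, shift each piece into the cell, and exchange back.\<close>
  have "(\<integral>\<^sup>+x\<in>S. f x \<partial>lborel) = (\<integral>\<^sup>+x. (\<integral>\<^sup>+k. f x * indicator S x * indicator {k. x - lattice_shift L k \<in> ?H} k \<partial>count_space UNIV) \<partial>lborel)"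
  proof (rule nn_integral_cong)
    fix x
    have "(\<integral>\<^sup>+k. indicator {k. x - lattice_shift L k \<in> ?H} k \<partial>count_space UNIV) = (1::ennreal)"
      using half_open_cell_tile[OF L, of x] by (subst one) auto
    then show "f x * indicator S x = (\<integral>\<^sup>+k. f x * indicator S x * indicator {k. x - lattice_shift L k \<in> ?H} k \<partial>count_space UNIV)"
      by (subst nn_integral_cmult) auto
  qed
  also have "\<dots> = (\<integral>\<^sup>+x. (\<integral>\<^sup>+k. f x * indicator S x * indicator ?H (x - lattice_shift L k) \<partial>count_space UNIV) \<partial>lborel)"
    by (intro nn_integral_cong) (auto simp: indicator_def)
  also have "\<dots> = (\<integral>\<^sup>+k. (\<integral>\<^sup>+x. f x * indicator S x * indicator ?H (x - lattice_shift L k) \<partial>lborel) \<partial>count_space UNIV)"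
    by (rule nn_integral_count_space_nn_integral) auto
  also have "\<dots> = (\<integral>\<^sup>+k. (\<integral>\<^sup>+x. f x * indicator S (x + lattice_shift L k) * indicator ?H x \<partial>lborel) \<partial>count_space UNIV)"
  proof (rule nn_integral_cong)
    fix k :: "int^'n"
    have "(\<integral>\<^sup>+x. f x * indicator S x * indicator ?H (x - lattice_shift L k) \<partial>lborel)
      = (\<integral>\<^sup>+x. f (lattice_shift L k + x) * indicator S (lattice_shift L k + x) * indicator ?H (lattice_shift L k + x - lattice_shift L k) \<partial>lborel)"
      by (subst nn_integral_lborel_shift[of "\<lambda>x. f x * indicator S x * indicator ?H (x - lattice_shift L k)"]) auto
    also have "\<dots> = (\<integral>\<^sup>+x. f x * indicator S (x + lattice_shift L k) * indicator ?H x \<partial>lborel)"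
      using periodic_lattice[OF per, of _ k] by (simp add: add.commute)
    finally show "(\<integral>\<^sup>+x. f x * indicator S x * indicator ?H (x - lattice_shift L k) \<partial>lborel)
      = (\<integral>\<^sup>+x. f x * indicator S (x + lattice_shift L k) * indicator ?H x \<partial>lborel)" .
  qed
  also have "\<dots> = (\<integral>\<^sup>+x. (\<integral>\<^sup>+k. f x * indicator S (x + lattice_shift L k) * indicator ?H x \<partial>count_space UNIV) \<partial>lborel)"
    by (rule nn_integral_count_space_nn_integral[symmetric]) auto
  also have "\<dots> \<le> (\<integral>\<^sup>+x. f x * indicator ?H x \<partial>lborel)"
  proof (rule nn_integral_mono)
    fix x
    have "(\<integral>\<^sup>+k. f x * indicator S (x + lattice_shift L k) * indicator ?H x \<partial>count_space UNIV)
      = (\<integral>\<^sup>+k. f x * indicator ?H x * indicator {k. x + lattice_shift L k \<in> S} k \<partial>count_space UNIV)"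
      by (intro nn_integral_cong) (auto simp: indicator_def)
    also have "\<dots> = f x * indicator ?H x * (\<integral>\<^sup>+k. indicator {k. x + lattice_shift L k \<in> S} k \<partial>count_space UNIV)"
      by (subst nn_integral_cmult) auto
    also have "\<dots> \<le> f x * indicator ?H x * 1"
    proof (rule mult_left_mono, subst one)
      fix k k' assume k: "x + lattice_shift L k \<in> S" "x + lattice_shift L k' \<in> S"
      have "x + lattice_shift L k + lattice_shift L (k' - k) = x + lattice_shift L k'"
        by (simp add: vec_eq_iff algebra_simps)
      then have "x + lattice_shift L k + lattice_shift L (k' - k) \<in> S" using k(2) by (simp only:)
      then have "k' - k = 0" by (rule pack[OF k(1)])
      then show "k = k'" by simp
    qed auto
    finally show "(\<integral>\<^sup>+k. f x * indicator S (x + lattice_shift L k) * indicator ?H x \<partial>count_space UNIV) \<le> f x * indicator ?H x"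
      by simp
  qed
  also have "\<dots> = (\<integral>\<^sup>+x\<in>cell L. f x \<partial>lborel)"
    by (rule nn_integral_cong_AE, rule AE_mp[OF half_open_cell_ae[of L]]) (auto simp: indicator_def)
  finally show ?thesis .
qed

lemma nn_integral_cell_shift_le:
  fixes f :: "real^'n::finite \<Rightarrow> ennreal"
  assumes L: "L > 0" and f[measurable]: "f \<in> borel_measurable borel" and per: "periodic L f"
  shows "(\<integral>\<^sup>+x\<in>cell L. f (x + c) \<partial>lborel) \<le> (\<integral>\<^sup>+x\<in>cell L. f x \<partial>lborel)"
proof -
  let ?S = "(\<lambda>x. x - c) -` cell L"
  have S: "?S \<in> sets borel" using measurable_sets[of "\<lambda>x. x - c" borel borel "cell L"] by simp
  have "(\<integral>\<^sup>+x\<in>cell L. f (x + c) \<partial>lborel) = (\<integral>\<^sup>+x. f (c + x) * indicator ?S (c + x) \<partial>lborel)"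
    by (intro nn_integral_cong) (auto simp: add.commute indicator_def)
  also have "\<dots> = (\<integral>\<^sup>+x\<in>?S. f x \<partial>lborel)"
    by (rule nn_integral_lborel_shift[of "\<lambda>x. f x * indicator ?S x"]) (use S in measurable)
  also have "\<dots> \<le> (\<integral>\<^sup>+x\<in>cell L. f x \<partial>lborel)"
  proof (rule nn_integral_packing_le[OF L f per S])
    fix x k assume x: "x \<in> ?S" "x + lattice_shift L k \<in> ?S"
    then have "x - c \<in> cell L" "(x - c) + lattice_shift L k \<in> cell L" by (simp_all add: algebra_simps)
    then show "k = 0" by (rule cell_translates_disjoint[OF L])
  qed
  finally show ?thesis .
qed

lemma periodic_shift: "periodic L f \<Longrightarrow> periodic L (\<lambda>x. f (x + c))"
  unfolding periodic_def by (metis add.assoc add.commute)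

lemma nn_integral_cell_shift:
  fixes f :: "real^'n::finite \<Rightarrow> ennreal"
  assumes L: "L > 0" and f[measurable]: "f \<in> borel_measurable borel" and per: "periodic L f"
  shows "(\<integral>\<^sup>+x\<in>cell L. f (x + c) \<partial>lborel) = (\<integral>\<^sup>+x\<in>cell L. f x \<partial>lborel)"
proof (rule antisym[OF nn_integral_cell_shift_le[OF assms]])
  have "(\<integral>\<^sup>+x\<in>cell L. f (x + (-c) + c) \<partial>lborel) \<le> (\<integral>\<^sup>+x\<in>cell L. f (x + c) \<partial>lborel)"
    by (rule nn_integral_cell_shift_le[OF L _ periodic_shift[OF per], of c "-c"]) measurable
  then show "(\<integral>\<^sup>+x\<in>cell L. f x \<partial>lborel) \<le> (\<integral>\<^sup>+x\<in>cell L. f (x + c) \<partial>lborel)" by simp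
qed

lemma continuous_cell_integrable:
  fixes F :: "real^'n::finite \<Rightarrow> 'b::{banach, second_countable_topology}"
  assumes "continuous_on UNIV F" shows "set_integrable lborel (cell L) F"
proof -
  have "set_integrable lborel (cbox 0 (\<chi> i. L)) F"
    unfolding set_integrable_def
    by (rule borel_integrable_compact) (auto intro: continuous_on_subset[OF assms])
  then show ?thesis by (rule set_integrable_subset) (auto simp: cell_eq_box box_subset_cbox)
qed

lemma periodic_bounded:
  fixes F :: "real^'n::finite \<Rightarrow> 'b::real_normed_vector"
  assumes "continuous_on UNIV F" "periodic L F" "L > 0"
  obtains K where "\<And>x. norm (F x) \<le> K"
proof -
  have "continuous_on ({0..0::real} \<times> UNIV) (\<lambda>(t, x). F x)"
    unfolding case_prod_unfold by (rule continuous_on_compose2[OF assms(1)]) (auto intro!: continuous_intros)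
  from periodic_field_bounded[OF this assms(2,3)] that show ?thesis by force
qed

lemma set_integral_nonneg_eq_nn:
  fixes F :: "real^'n::finite \<Rightarrow> real"
  assumes "continuous_on UNIV F" "\<And>x. F x \<ge> 0"
  shows "ennreal (LINT x:cell L|lborel. F x) = (\<integral>\<^sup>+x\<in>cell L. ennreal (F x) \<partial>lborel)"
proof -
  have "(\<integral>\<^sup>+x. ennreal (indicator (cell L) x *\<^sub>R F x) \<partial>lborel) = ennreal (LINT x:cell L|lborel. F x)"
    unfolding set_lebesgue_integral_def
    by (rule nn_integral_eq_integral) (use continuous_cell_integrable[OF assms(1)] assms(2) in \<open>auto simp: set_integrable_def\<close>)
  moreover have "(\<integral>\<^sup>+x. ennreal (indicator (cell L) x *\<^sub>R F x) \<partial>lborel) = (\<integral>\<^sup>+x\<in>cell L. ennreal (F x) \<partial>lborel)"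
    by (intro nn_integral_cong) (auto simp: indicator_def)
  ultimately show ?thesis by simp
qed

text \<open>The translation formula for nonnegative functions extends to bounded ones by adding a bound.\<close>

lemma cell_integral_shift_real:
  fixes F :: "real^'n::finite \<Rightarrow> real"
  assumes L: "L > 0" and F: "continuous_on UNIV F" "periodic L F"
  shows "(LINT x:cell L|lborel. F (x + c)) = (LINT x:cell L|lborel. F x)"
proof -
  obtain K where K: "\<And>x. norm (F x) \<le> K" using periodic_bounded[OF F L] by metis
  have nn: "0 \<le> F x + K" for x using K[of x] by (simp add: abs_le_iff)
  have c1: "continuous_on UNIV (\<lambda>x. F (x + c))" by (rule continuous_on_compose2[OF F(1)]) (auto intro!: continuous_intros)
  have eq: "(LINT x:cell L|lborel. G x + K) = (LINT x:cell L|lborel. G x) + (LINT x:(cell L::(real^'n) set)|lborel. K)"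
    if "continuous_on UNIV G" for G :: "real^'n \<Rightarrow> real"
    by (intro set_integral_add continuous_cell_integrable that) auto
  have "ennreal (LINT x:cell L|lborel. F (x + c) + K) = (\<integral>\<^sup>+x\<in>cell L. ennreal (F (x + c) + K) \<partial>lborel)"
    by (rule set_integral_nonneg_eq_nn) (auto intro!: continuous_intros c1 nn)
  also have "\<dots> = (\<integral>\<^sup>+x\<in>cell L. ennreal (F x + K) \<partial>lborel)"
    by (rule nn_integral_cell_shift[OF L, of "\<lambda>x. ennreal (F x + K)"])
       (use borel_measurable_continuous_onI[OF F(1)] F(2) in \<open>auto simp: periodic_def\<close>)
  also have "\<dots> = ennreal (LINT x:cell L|lborel. F x + K)"
    by (rule set_integral_nonneg_eq_nn[symmetric]) (auto intro!: continuous_intros F nn)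
  finally have "(LINT x:cell L|lborel. F (x + c) + K) = (LINT x:cell L|lborel. F x + K)"
    by (subst (asm) ennreal_inj) (auto simp: set_lebesgue_integral_def intro!: Bochner_Integration.integral_nonneg nn mult_nonneg_nonneg)
  then show ?thesis using eq[OF c1] eq[OF F(1)] by simp
qed

lemma cell_integral_shift:
  fixes F :: "real^'n::finite \<Rightarrow> complex"
  assumes L: "L > 0" and F: "continuous_on UNIV F" "periodic L F"
  shows "(LINT x:cell L|lborel. F (x + c)) = (LINT x:cell L|lborel. F x)"
proof -
  have c1: "continuous_on UNIV (\<lambda>x. F (x + c))" by (rule continuous_on_compose2[OF F(1)]) (auto intro!: continuous_intros)
  have re: "Re (LINT x:cell L|lborel. G x) = (LINT x:cell L|lborel. Re (G x))"
    "Im (LINT x:cell L|lborel. G x) = (LINT x:cell L|lborel. Im (G x))" if "continuous_on UNIV G" for G :: "real^'n \<Rightarrow> complex"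
    using continuous_cell_integrable[OF that, of L]
    unfolding set_lebesgue_integral_def set_integrable_def by (simp_all add: integral_Re[symmetric] integral_Im[symmetric])
  have "(LINT x:cell L|lborel. Re (F (x + c))) = (LINT x:cell L|lborel. Re (F x))"
    "(LINT x:cell L|lborel. Im (F (x + c))) = (LINT x:cell L|lborel. Im (F x))"
    by (rule cell_integral_shift_real[OF L]; use F in \<open>auto intro!: continuous_intros simp: periodic_def\<close>)+
  then show ?thesis using re[OF c1] re[OF F(1)] by (simp add: complex_eq_iff)
qed

text \<open>The difference quotients have integral zero by translation invariance, and the partial
  derivative is their bounded limit.\<close>

lemma cell_integral_spartial:
  fixes F :: "real^'n::finite \<Rightarrow> complex"
  assumes L: "L > 0" and C: "C1_space F" and per: "periodic L F"
  shows "(LINT x:cell L|lborel. spartial i F x) = 0"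
proof -
  have F: "continuous_on UNIV F" and dF: "continuous_on UNIV (spartial i F)" and sp: "\<And>x. has_spartial i F x"
    using C by (auto simp: C1_space_def)
  obtain K where K: "\<And>x. norm (spartial i F x) \<le> K" using periodic_bounded[OF dF periodic_spartial[OF per] L] by metis
  define e where "e m = ((1 / real (Suc m)) *\<^sub>R axis i 1 :: real^'n)" for m
  define D where "D m x = real (Suc m) *\<^sub>R (F (x + e m) - F x)" for m x
  have cD: "continuous_on UNIV (D m)" for m unfolding D_def
    by (intro continuous_intros F continuous_on_compose2[OF F, of _ "\<lambda>x. x + e m"]) auto
  have ce: "continuous_on UNIV (\<lambda>x. F (x + e m))" for m
    by (rule continuous_on_compose2[OF F]) (auto intro!: continuous_intros)
  have zero: "(LINT x:cell L|lborel. D m x) = 0" for m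
    unfolding D_def
    by (simp add: set_integral_diff[OF continuous_cell_integrable[OF ce] continuous_cell_integrable[OF F]]
          cell_integral_shift[OF L F per] del: of_nat_Suc)
  have lim: "(\<lambda>m. D m x) \<longlonglongrightarrow> spartial i F x" for x
  proof -
    have "((\<lambda>s. norm (F (x + (0 + s) *\<^sub>R axis i 1) - F (x + 0 *\<^sub>R axis i 1) - s *\<^sub>R spartial i F x) / norm s) \<longlongrightarrow> 0) (at 0)"
      using has_spartialD[OF sp] unfolding has_vector_derivative_def has_derivative_at by blast
    moreover have "filterlim (\<lambda>m. 1 / real (Suc m)) (at 0) sequentially"
      using LIMSEQ_Suc[OF lim_1_over_n[where 'a=real]] by (auto simp: filterlim_at simp del: of_nat_Suc)
    ultimately have "(\<lambda>m. norm (F (x + (0 + 1 / real (Suc m)) *\<^sub>R axis i 1) - F (x + 0 *\<^sub>R axis i 1) - (1 / real (Suc m)) *\<^sub>R spartial i F x) / norm (1 / real (Suc m))) \<longlonglongrightarrow> 0"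
      by (rule filterlim_compose)
    moreover have "norm (F (x + (0 + 1 / real (Suc m)) *\<^sub>R axis i 1) - F (x + 0 *\<^sub>R axis i 1) - (1 / real (Suc m)) *\<^sub>R spartial i F x) / norm (1 / real (Suc m))
        = norm (D m x - spartial i F x)" for m
    proof -
      have eq: "D m x - spartial i F x = real (Suc m) *\<^sub>R (F (x + (0 + 1 / real (Suc m)) *\<^sub>R axis i 1) - F (x + 0 *\<^sub>R axis i 1) - (1 / real (Suc m)) *\<^sub>R spartial i F x)"
        by (simp add: D_def e_def scaleR_diff_right del: of_nat_Suc)
      show ?thesis unfolding eq norm_scaleR by (simp add: mult.commute del: of_nat_Suc)
    qed
    ultimately show ?thesis by (simp add: tendsto_norm_zero_iff LIM_zero_iff)
  qed
  have bd: "norm (D m x) \<le> K" for m x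
  proof -
    have "norm (F (x + (1 / real (Suc m)) *\<^sub>R axis i 1) - F (x + 0 *\<^sub>R axis i 1)) \<le> K * norm (1 / real (Suc m) - 0)"
    proof (rule differentiable_bound[of UNIV "\<lambda>s. F (x + s *\<^sub>R axis i 1)" "\<lambda>s r. r *\<^sub>R spartial i F (x + s *\<^sub>R axis i 1)"])
      show "((\<lambda>s. F (x + s *\<^sub>R axis i 1)) has_derivative (\<lambda>r. r *\<^sub>R spartial i F (x + s *\<^sub>R axis i 1))) (at s within UNIV)" for s
        using has_spartial_line[OF sp] by (simp add: has_vector_derivative_def)
      show "onorm (\<lambda>r. r *\<^sub>R spartial i F (x + s *\<^sub>R axis i 1)) \<le> K" for s
        by (rule onorm_le) (use mult_right_mono[OF K, of "norm r" for r :: real] in \<open>simp add: mult.commute\<close>)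
    qed auto
    then show ?thesis unfolding D_def e_def norm_scaleR by (simp add: field_simps del: of_nat_Suc)
  qed
  have "(\<lambda>m. LINT x:cell L|lborel. D m x) \<longlonglongrightarrow> (LINT x:cell L|lborel. spartial i F x)"
    unfolding set_lebesgue_integral_def
  proof (rule integral_dominated_convergence[where w="\<lambda>x. indicator (cell L) x *\<^sub>R K"])
    show "integrable lborel (\<lambda>x. indicator (cell L) x *\<^sub>R K)"
      using continuous_cell_integrable[of "\<lambda>x. K" L] by (simp add: set_integrable_def)
    show "AE x in lborel. norm (indicator (cell L) x *\<^sub>R D m x) \<le> indicator (cell L) x *\<^sub>R K" for m
      using bd by (auto simp: indicator_def)
  qed (use borel_measurable_continuous_onI[OF dF] borel_measurable_continuous_onI[OF cD] lim in
       \<open>auto intro!: tendsto_intros borel_measurable_scaleR\<close>)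
  then show ?thesis unfolding zero by (simp add: LIMSEQ_const_iff)
qed

section \<open>Fourier series\<close>

definition wave :: "real \<Rightarrow> int^'n::finite \<Rightarrow> real^'n \<Rightarrow> complex" where
  "wave L k x = cis ((2 * pi / L) * (\<Sum>j\<in>UNIV. real_of_int (k $ j) * x $ j))"

definition fourier_scalar :: "real \<Rightarrow> (real^'n::finite \<Rightarrow> complex) \<Rightarrow> int^'n \<Rightarrow> complex" where
  "fourier_scalar L F k = complex_of_real (1 / L ^ CARD('n)) * (LINT x:cell L|lborel. F x * wave L (- k) x)"

lemma wave_mult: "wave L k x * wave L l x = wave L (k + l) x"
  by (simp add: wave_def cis_mult sum.distrib algebra_simps)

lemma wave_zero [simp]: "wave L 0 x = 1"
  by (simp add: wave_def)

lemma norm_wave [simp]: "norm (wave L k x) = 1"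
  by (simp add: wave_def)

lemma cnj_wave: "cnj (wave L k x) = wave L (- k) x"
  by (simp add: wave_def cis_cnj[symmetric] sum_negf)

lemma wave_axis_shift: "wave L k (x + s *\<^sub>R axis i 1) = cis ((2 * pi / L) * (of_int (k $ i) * s)) * wave L k x"
proof -
  have "(x + s *\<^sub>R axis i 1) $ j = x $ j + (if j = i then s else 0)" for j by (simp add: axis_def)
  then have "(\<Sum>j\<in>UNIV. real_of_int (k $ j) * (x + s *\<^sub>R axis i 1) $ j)
      = (\<Sum>j\<in>UNIV. (if j = i then real_of_int (k $ j) * s else 0) + real_of_int (k $ j) * x $ j)"
    by (intro sum.cong) (auto simp: distrib_left)
  also have "\<dots> = of_int (k $ i) * s + (\<Sum>j\<in>UNIV. real_of_int (k $ j) * x $ j)"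
    by (simp only: sum.distrib sum.delta[OF finite]) simp
  finally have "(\<Sum>j\<in>UNIV. real_of_int (k $ j) * (x + s *\<^sub>R axis i 1) $ j) = of_int (k $ i) * s + (\<Sum>j\<in>UNIV. real_of_int (k $ j) * x $ j)" .
  then show ?thesis by (simp add: wave_def cis_mult distrib_left)
qed

lemma continuous_wave [continuous_intros]: "continuous_on S (wave L k)"
  unfolding wave_def[abs_def] by (intro continuous_intros)

lemma periodic_wave: "L > 0 \<Longrightarrow> periodic L (wave L k)"
proof -
  assume L: "L > 0"
  have "cis ((2 * pi / L) * (of_int m * L)) = 1" for m :: int
    using cis_multiple_2pi[of "of_int m"] L by (simp add: mult.commute)
  then show ?thesis by (simp add: periodic_def wave_axis_shift)
qed

text \<open>For \<open>k \<noteq> 0\<close> a shift by half a wave length changes the sign of the wave, but not its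
  integral over a period.\<close>

lemma cell_integral_wave:
  assumes L: "L > 0"
  shows "(LINT x:cell L|lborel. wave L k x) = (if k = (0::int^'n::finite) then complex_of_real (L ^ CARD('n)) else 0)"
proof (cases "k = 0")
  case True
  then show ?thesis using measure_cell(1)[OF L, where 'n='n] measure_cell(2)[OF L, where 'n='n]
    by (simp add: set_lebesgue_integral_def scaleR_conv_of_real)
next
  case False
  then obtain i where i: "k $ i \<noteq> 0" by (auto simp: vec_eq_iff)
  let ?c = "(L / (2 * of_int (k $ i))) *\<^sub>R axis i 1 :: real^'n"
  have "wave L k (x + ?c) = - wave L k x" for x
  proof -
    have "(2 * pi / L) * (of_int (k $ i) * (L / (2 * of_int (k $ i)))) = pi" using L i by simp
    then show ?thesis unfolding wave_axis_shift by simp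
  qed
  then have "- (LINT x:cell L|lborel. wave L k x) = (LINT x:cell L|lborel. wave L k x)"
    using cell_integral_shift[OF L continuous_wave periodic_wave[OF L], of k ?c]
    by (simp add: set_lebesgue_integral_def)
  then have "(LINT x:cell L|lborel. wave L k x) = 0" by (simp add: complex_eq_iff)
  then show ?thesis using False by simp
qed

lemma continuous_times_wave:
  "continuous_on UNIV F \<Longrightarrow> set_integrable lborel (cell L) (\<lambda>x. F x * wave L k x)"
  by (intro continuous_cell_integrable continuous_intros)

lemma fourier_scalar_minus_wave:
  assumes L: "L > 0" and F: "continuous_on UNIV F"
  shows "fourier_scalar L (\<lambda>x. F x - a * wave L l x) k = fourier_scalar L F k - (if k = (l::int^'n::finite) then a else 0)"
proof -
  have "(LINT x:cell L|lborel. (F x - a * wave L l x) * wave L (- k) x)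
      = (LINT x:cell L|lborel. F x * wave L (- k) x) - (LINT x:cell L|lborel. a * wave L (l - k) x)"
    by (subst set_integral_diff(2)[symmetric])
       (auto intro!: continuous_cell_integrable continuous_intros F simp: wave_mult left_diff_distrib mult.assoc)
  also have "\<dots> = (LINT x:cell L|lborel. F x * wave L (- k) x) - a * (if k = l then complex_of_real (L ^ CARD('n)) else 0)"
    by (simp add: cell_integral_wave[OF L] eq_commute[of l k])
  finally show ?thesis using L by (simp add: fourier_scalar_def right_diff_distrib)
qed

lemma norm_minus_wave:
  assumes L: "L > 0" and F: "continuous_on UNIV F"
  shows "(LINT x:cell L|lborel. (norm (F x - a * wave L k x))\<^sup>2) = (LINT x:cell L|lborel. (norm (F x))\<^sup>2)
     + L ^ CARD('n) * ((norm (a - fourier_scalar L F k))\<^sup>2 - (norm (fourier_scalar L F (k::int^'n::finite)))\<^sup>2)"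
proof -
  let ?V = "L ^ CARD('n)"
  let ?c = "fourier_scalar L F k"
  have pw: "(norm (F x - a * wave L k x))\<^sup>2 = (norm (F x))\<^sup>2 + ((norm a)\<^sup>2 - 2 * Re (cnj a * (F x * wave L (- k) x)))" for x
  proof -
    have w: "wave L k x * wave L (- k) x = 1" by (simp add: wave_mult)
    have "complex_of_real ((norm (F x - a * wave L k x))\<^sup>2) = (F x - a * wave L k x) * (cnj (F x) - cnj a * wave L (- k) x)"
      by (simp add: complex_norm_square cnj_wave del: of_real_power)
    also have "\<dots> = F x * cnj (F x) + a * cnj a * (wave L k x * wave L (- k) x) - (cnj a * (F x * wave L (- k) x) + cnj (cnj a * (F x * wave L (- k) x)))"
      by (simp add: algebra_simps cnj_wave)
    also have "\<dots> = complex_of_real ((norm (F x))\<^sup>2 + ((norm a)\<^sup>2 - 2 * Re (cnj a * (F x * wave L (- k) x))))"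
      unfolding w complex_add_cnj by (simp add: complex_norm_square[symmetric])
    finally show ?thesis by (simp only: of_real_eq_iff)
  qed
  have int: "set_integrable lborel (cell L) (\<lambda>x. cnj a * (F x * wave L (- k) x))"
    by (intro continuous_cell_integrable continuous_intros F)
  have re: "(LINT x:cell L|lborel. Re (cnj a * (F x * wave L (- k) x))) = Re (cnj a * (complex_of_real ?V * ?c))"
  proof -
    have "(LINT x:cell L|lborel. Re (cnj a * (F x * wave L (- k) x))) = Re (LINT x:cell L|lborel. cnj a * (F x * wave L (- k) x))"
      using int unfolding set_lebesgue_integral_def set_integrable_def by (simp add: integral_Re[symmetric])
    also have "(LINT x:cell L|lborel. cnj a * (F x * wave L (- k) x)) = cnj a * (complex_of_real ?V * ?c)"
      using L by (simp add: fourier_scalar_def)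
    finally show ?thesis .
  qed
  have "(LINT x:cell L|lborel. (norm (F x - a * wave L k x))\<^sup>2) = (LINT x:cell L|lborel. (norm (F x))\<^sup>2)
     + ((LINT x:(cell L::(real^'n) set)|lborel. (norm a)\<^sup>2) - (LINT x:cell L|lborel. 2 * Re (cnj a * (F x * wave L (- k) x))))"
    unfolding pw
    by (subst set_integral_add(2), (intro continuous_cell_integrable continuous_intros F)+,
        subst set_integral_diff(2), (intro continuous_cell_integrable continuous_intros F)+) (rule refl)
  also have "(LINT x:(cell L::(real^'n) set)|lborel. (norm a)\<^sup>2) = ?V * (norm a)\<^sup>2"
    using measure_cell[OF L, where 'n='n] by (simp add: set_lebesgue_integral_def)
  also have "(LINT x:cell L|lborel. 2 * Re (cnj a * (F x * wave L (- k) x))) = ?V * (2 * Re (cnj a * ?c))"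
  proof -
    have "(LINT x:cell L|lborel. 2 * Re (cnj a * (F x * wave L (- k) x))) = 2 * Re (cnj a * (complex_of_real ?V * ?c))"
      by (simp only: set_integral_mult_right re)
    also have "cnj a * (complex_of_real ?V * ?c) = complex_of_real ?V * (cnj a * ?c)" by (simp only: mult.left_commute)
    also have "2 * Re (complex_of_real ?V * (cnj a * ?c)) = ?V * (2 * Re (cnj a * ?c))" by (simp add: algebra_simps flip: of_real_power)
    finally show ?thesis .
  qed
  also have "?V * (norm a)\<^sup>2 - ?V * (2 * Re (cnj a * ?c)) = ?V * ((norm (a - ?c))\<^sup>2 - (norm ?c)\<^sup>2)"
    unfolding cmod_power2 by (simp add: power2_eq_square algebra_simps)
  finally show ?thesis .
qed

text \<open>Completing the square, one wave at a time: subtracting a wave changes only its own Fourier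
  coefficient. Bessel's inequality and, for an approximation by waves, its approximate converse are
  both read off from this identity.\<close>

lemma norm_minus_wave_sum:
  assumes L: "L > 0" and F: "continuous_on UNIV F" and A: "finite (A :: (int^'n::finite) set)"
  shows "(LINT x:cell L|lborel. (norm (F x - (\<Sum>k\<in>A. a k * wave L k x)))\<^sup>2) = (LINT x:cell L|lborel. (norm (F x))\<^sup>2)
     + L ^ CARD('n) * (\<Sum>k\<in>A. (norm (a k - fourier_scalar L F k))\<^sup>2 - (norm (fourier_scalar L F k))\<^sup>2)"
  using A F
proof (induction A arbitrary: F rule: finite_induct)
  case (insert l A)
  let ?F = "\<lambda>x. F x - a l * wave L l x"
  have cF: "continuous_on UNIV ?F" by (intro continuous_intros insert.prems)
  have "(LINT x:cell L|lborel. (norm (F x - (\<Sum>k\<in>insert l A. a k * wave L k x)))\<^sup>2)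
      = (LINT x:cell L|lborel. (norm (?F x - (\<Sum>k\<in>A. a k * wave L k x)))\<^sup>2)"
    using insert.hyps by (simp add: algebra_simps)
  also have "\<dots> = (LINT x:cell L|lborel. (norm (?F x))\<^sup>2)
     + L ^ CARD('n) * (\<Sum>k\<in>A. (norm (a k - fourier_scalar L ?F k))\<^sup>2 - (norm (fourier_scalar L ?F k))\<^sup>2)"
    by (rule insert.IH[OF cF])
  also have "(\<Sum>k\<in>A. (norm (a k - fourier_scalar L ?F k))\<^sup>2 - (norm (fourier_scalar L ?F k))\<^sup>2)
     = (\<Sum>k\<in>A. (norm (a k - fourier_scalar L F k))\<^sup>2 - (norm (fourier_scalar L F k))\<^sup>2)"
    by (intro sum.cong refl) (use insert.hyps fourier_scalar_minus_wave[OF L insert.prems, of "a l" l] in auto)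
  also have "(LINT x:cell L|lborel. (norm (?F x))\<^sup>2) = (LINT x:cell L|lborel. (norm (F x))\<^sup>2)
     + L ^ CARD('n) * ((norm (a l - fourier_scalar L F l))\<^sup>2 - (norm (fourier_scalar L F l))\<^sup>2)"
    by (rule norm_minus_wave[OF L insert.prems])
  finally show ?case using insert.hyps by (simp add: algebra_simps)
qed simp

lemma bessel_inequality:
  assumes L: "L > 0" and F: "continuous_on UNIV F" and A: "finite (A :: (int^'n::finite) set)"
  shows "L ^ CARD('n) * (\<Sum>k\<in>A. (norm (fourier_scalar L F k))\<^sup>2) \<le> (LINT x:cell L|lborel. (norm (F x))\<^sup>2)"
proof -
  have "0 \<le> (LINT x:cell L|lborel. (norm (F x - (\<Sum>k\<in>A. fourier_scalar L F k * wave L k x)))\<^sup>2)"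
    unfolding set_lebesgue_integral_def by (intro Bochner_Integration.integral_nonneg) auto
  also have "\<dots> = (LINT x:cell L|lborel. (norm (F x))\<^sup>2) - L ^ CARD('n) * (\<Sum>k\<in>A. (norm (fourier_scalar L F k))\<^sup>2)"
    using norm_minus_wave_sum[OF assms, of "fourier_scalar L F"] by (simp add: sum_negf)
  finally show ?thesis by simp
qed

lemma energy_le_fourier_plus_error:
  assumes L: "L > 0" and F: "continuous_on UNIV F" and A: "finite (A :: (int^'n::finite) set)"
    and err: "\<And>x. norm (F x - (\<Sum>k\<in>A. a k * wave L k x)) \<le> \<eta>"
  shows "(LINT x:cell L|lborel. (norm (F x))\<^sup>2) \<le> L ^ CARD('n) * (\<Sum>k\<in>A. (norm (fourier_scalar L F k))\<^sup>2) + L ^ CARD('n) * \<eta>\<^sup>2"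
proof -
  have "(LINT x:cell L|lborel. (norm (F x - (\<Sum>k\<in>A. a k * wave L k x)))\<^sup>2) \<le> (LINT x:(cell L::(real^'n) set)|lborel. \<eta>\<^sup>2)"
    by (rule set_integral_mono)
       (auto intro!: continuous_cell_integrable continuous_intros F power_mono err)
  also have "\<dots> = L ^ CARD('n) * \<eta>\<^sup>2"
    using measure_cell[OF L, where 'n='n] by (simp add: set_lebesgue_integral_def)
  finally have "(LINT x:cell L|lborel. (norm (F x))\<^sup>2)
     + L ^ CARD('n) * (\<Sum>k\<in>A. (norm (a k - fourier_scalar L F k))\<^sup>2 - (norm (fourier_scalar L F k))\<^sup>2) \<le> L ^ CARD('n) * \<eta>\<^sup>2"
    using norm_minus_wave_sum[OF L F A, of a] by simp
  moreover have "L ^ CARD('n) * (\<Sum>k\<in>A. (norm (a k - fourier_scalar L F k))\<^sup>2) \<ge> 0" using L by (simp add: sum_nonneg)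
  ultimately show ?thesis by (simp add: sum_subtractf right_diff_distrib)
qed

section \<open>Uniform approximation by trigonometric polynomials\<close>

inductive trig_polynomial :: "real \<Rightarrow> (real^'n::finite \<Rightarrow> complex) \<Rightarrow> bool" for L where
  wave: "trig_polynomial L (\<lambda>x. a * wave L k x)"
| add: "trig_polynomial L F \<Longrightarrow> trig_polynomial L G \<Longrightarrow> trig_polynomial L (\<lambda>x. F x + G x)"

lemma trig_polynomial_const: "trig_polynomial L (\<lambda>x. a)"
  using trig_polynomial.wave[of L a 0] by simp

lemma trig_polynomial_sum:
  "finite I \<Longrightarrow> (\<And>i. i \<in> I \<Longrightarrow> trig_polynomial L (F i)) \<Longrightarrow> trig_polynomial L (\<lambda>x. \<Sum>i\<in>I. F i x)"
  by (induction I rule: finite_induct) (auto simp: trig_polynomial_const intro: trig_polynomial.add)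

lemma trig_polynomial_mult:
  assumes "trig_polynomial L F" "trig_polynomial L G"
  shows "trig_polynomial L (\<lambda>x. F x * G x)"
  using assms(1)
proof induction
  case (wave a k)
  show ?case using assms(2)
  proof induction
    case (wave b l)
    have "(\<lambda>x. a * wave L k x * (b * wave L l x)) = (\<lambda>x. (a * b) * wave L (k + l) x)"
      by (simp add: wave_mult[symmetric] algebra_simps)
    then show ?case by (metis trig_polynomial.wave)
  qed (auto simp: distrib_left intro: trig_polynomial.add)
qed (auto simp: distrib_right intro: trig_polynomial.add)

lemma trig_polynomial_repr:
  assumes "trig_polynomial L F"
  shows "\<exists>A a. finite A \<and> F = (\<lambda>x. \<Sum>k\<in>A. a k * wave L k x)"
  using assms
proof induction
  case (wave a k)
  show ?case by (intro exI[of _ "{k}"] exI[of _ "\<lambda>_. a"]) simp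
next
  case (add F G)
  then obtain A a B b where AB: "finite A" "F = (\<lambda>x. \<Sum>k\<in>A. a k * wave L k x)" "finite B" "G = (\<lambda>x. \<Sum>k\<in>B. b k * wave L k x)"
    by blast
  have ext: "(\<Sum>k\<in>A. a k * wave L k x) = (\<Sum>k\<in>A \<union> B. (if k \<in> A then a k else 0) * wave L k x)"
    "(\<Sum>k\<in>B. b k * wave L k x) = (\<Sum>k\<in>A \<union> B. (if k \<in> B then b k else 0) * wave L k x)" for x
    using AB by (auto intro!: sum.mono_neutral_cong_left)
  have "(\<lambda>x. F x + G x) = (\<lambda>x. \<Sum>k\<in>A \<union> B. ((if k \<in> A then a k else 0) + (if k \<in> B then b k else 0)) * wave L k x)"
    unfolding AB(2,4) ext by (simp add: sum.distrib distrib_right)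
  then show ?case using AB(1,3)
    by (intro exI[of _ "A \<union> B"] exI[of _ "\<lambda>k. (if k \<in> A then a k else 0) + (if k \<in> B then b k else 0)"] conjI) (simp_all only: finite_Un)
qed

definition torus_point :: "real \<Rightarrow> real^'n::finite \<Rightarrow> complex^'n" where
  "torus_point L x = (\<chi> i. cis ((2 * pi / L) * x $ i))"

lemma torus_point_eq_periodic:
  assumes L: "L > 0" and per: "periodic L g" and eq: "torus_point L x = torus_point L y"
  shows "g x = g y"
proof -
  have "\<exists>m::int. x $ i = y $ i + L * of_int m" for i
  proof -
    have "cis ((2 * pi / L) * x $ i) = cis ((2 * pi / L) * y $ i)" using eq by (auto simp: torus_point_def vec_eq_iff)
    then have "sin ((2 * pi / L) * x $ i) = sin ((2 * pi / L) * y $ i)" "cos ((2 * pi / L) * x $ i) = cos ((2 * pi / L) * y $ i)"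
      by (auto simp: complex_eq_iff)
    then obtain m :: int where "(2 * pi / L) * x $ i = (2 * pi / L) * y $ i + 2 * pi * of_int m"
      using sin_cos_eq_iff by blast
    then have "(2 * pi / L) * x $ i = (2 * pi / L) * (y $ i + L * of_int m)" using L by (simp add: field_simps)
    then show ?thesis using L by auto
  qed
  then obtain m where "\<And>i. x $ i = y $ i + L * of_int (m i)" by metis
  then have "x = y + lattice_shift L (\<chi> i. m i)" by (simp add: vec_eq_iff)
  then show ?thesis using periodic_lattice[OF per, of y "\<chi> i. m i"] by simp
qed

lemma trig_polynomial_coordinates:
  "trig_polynomial L (\<lambda>x. complex_of_real (Re (torus_point L x $ i)))" (is ?re)
  "trig_polynomial L (\<lambda>x. complex_of_real (Im (torus_point L x $ i)))" (is ?im)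
proof -
  have w: "wave L (axis i 1) x = torus_point L x $ i" for x
  proof -
    have "(\<Sum>j\<in>UNIV. real_of_int (axis i 1 $ j) * x $ j) = x $ i"
      by (simp add: axis_def if_distrib[of real_of_int] if_distrib[of "\<lambda>c. c * _"] cong: if_cong)
    then show ?thesis by (simp add: wave_def torus_point_def)
  qed
  have "complex_of_real (Re z) = (1/2) * z + (1/2) * cnj z" "complex_of_real (Im z) = (-\<i>/2) * z + (\<i>/2) * cnj z" for z
    by (auto simp: complex_eq_iff)
  then have "(\<lambda>x. complex_of_real (Re (torus_point L x $ i))) = (\<lambda>x. (1/2) * wave L (axis i 1) x + (1/2) * wave L (- axis i 1) x)"
    "(\<lambda>x. complex_of_real (Im (torus_point L x $ i))) = (\<lambda>x. (-\<i>/2) * wave L (axis i 1) x + (\<i>/2) * wave L (- axis i 1) x)"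
    unfolding cnj_wave[symmetric] w by (simp_all only:)
  note eq = this
  show ?re unfolding eq(1) by (intro trig_polynomial.intros)
  show ?im unfolding eq(2) by (intro trig_polynomial.intros)
qed

lemma trig_polynomial_of_real_polynomial:
  assumes "real_polynomial_function q"
  shows "trig_polynomial L (\<lambda>x. complex_of_real (q (torus_point L x)))"
  using assms
proof induction
  case (linear f)
  interpret bounded_linear f by fact
  have eq: "f z = (\<Sum>i\<in>UNIV. Re (z $ i) * f (axis i 1) + Im (z $ i) * f (axis i \<i>))" for z
  proof -
    have "z = (\<Sum>i\<in>UNIV. Re (z $ i) *\<^sub>R axis i 1 + Im (z $ i) *\<^sub>R axis i \<i>)"
      by (simp add: vec_eq_iff axis_def if_distrib complex_eq_iff cong: if_cong)
    then have "f z = f (\<Sum>i\<in>UNIV. Re (z $ i) *\<^sub>R axis i 1 + Im (z $ i) *\<^sub>R axis i \<i>)" by simp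
    then show ?thesis by (simp add: sum add scaleR)
  qed
  have "trig_polynomial L (\<lambda>x. complex_of_real (Re (torus_point L x $ i)) * complex_of_real (f (axis i 1))
      + complex_of_real (Im (torus_point L x $ i)) * complex_of_real (f (axis i \<i>)))" for i
    by (rule trig_polynomial.add; rule trig_polynomial_mult; rule trig_polynomial_coordinates trig_polynomial_const)
  from trig_polynomial_sum[where I=UNIV, OF finite this] show ?case
    by (subst eq) (simp only: of_real_sum of_real_add of_real_mult)
next
  case (const c)
  show ?case by (rule trig_polynomial_const)
next
  case (add f g)
  then show ?case unfolding of_real_add by (intro trig_polynomial.add)
next
  case (mult f g)
  then show ?case unfolding of_real_mult by (intro trig_polynomial_mult)
qed

text \<open>A periodic function is a function on the torus, a compact subset of \<open>complex^'n\<close>; the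
  polynomials in the coordinates of this space are trigonometric polynomials in \<open>x\<close>.\<close>

lemma trig_polynomial_approximation:
  fixes g :: "real^'n::finite \<Rightarrow> real"
  assumes L: "L > 0" and g: "continuous_on UNIV g" and per: "periodic L g" and \<eta>: "\<eta> > 0"
  obtains A a where "finite A" "\<And>x. norm (complex_of_real (g x) - (\<Sum>k\<in>A. a k * wave L k x)) \<le> \<eta>"
proof -
  let ?E = "torus_point L :: real^'n \<Rightarrow> complex^'n"
  let ?B = "cbox 0 (\<chi> i. L) :: (real^'n) set"
  let ?K = "?E ` ?B"
  \<comment> \<open>The function induced by \<open>g\<close> on the torus. It is continuous because \<open>?E\<close> maps compact sets to closed ones.\<close>
  define G where "G y = g (SOME x. x \<in> ?B \<and> ?E x = y)" for y
  have GE: "G (?E x) = g x" if "x \<in> ?B" for x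
  proof -
    have "(SOME x'. x' \<in> ?B \<and> ?E x' = ?E x) \<in> ?B \<and> ?E (SOME x'. x' \<in> ?B \<and> ?E x' = ?E x) = ?E x"
      by (rule someI[of _ x]) (use that in auto)
    then show ?thesis unfolding G_def by (intro torus_point_eq_periodic[OF L per]) auto
  qed
  have cE: "continuous_on UNIV ?E" unfolding torus_point_def by (intro continuous_intros)
  have K: "compact ?K" by (intro compact_continuous_image continuous_on_subset[OF cE]) auto
  have "continuous_on ?K G"
    unfolding continuous_on_closed_vimage[OF compact_imp_closed[OF K]]
  proof (intro allI impI)
    fix C :: "real set" assume C: "closed C"
    have "G -` C \<inter> ?K = ?E ` (g -` C \<inter> ?B)" using GE by auto
    moreover have "closed (g -` C)" using continuous_closed_vimage[OF C, where f=g] g by (simp add: continuous_on_eq_continuous_at)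
    then have "compact (g -` C \<inter> ?B)" by (intro closed_Int_compact) auto
    then have "compact (?E ` (g -` C \<inter> ?B))" by (intro compact_continuous_image continuous_on_subset[OF cE]) auto
    ultimately show "closed (G -` C \<inter> ?K)" by (simp add: compact_imp_closed)
  qed
  then obtain q where q: "real_polynomial_function q" "\<And>y. y \<in> ?K \<Longrightarrow> \<bar>G y - q y\<bar> < \<eta>"
    using Stone_Weierstrass_real_polynomial_function[OF K _ \<eta>] by metis
  obtain A a where A: "finite A" "(\<lambda>x. complex_of_real (q (?E x))) = (\<lambda>x. \<Sum>k\<in>A. a k * wave L k x)"
    using trig_polynomial_repr[OF trig_polynomial_of_real_polynomial[OF q(1)]] by metis
  show ?thesis
  proof (rule that[OF A(1)])
    fix x
    have per': "periodic L (\<lambda>x. (g x, ?E x))"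
    proof -
      have "cis ((2 * pi / L) * (x + L *\<^sub>R axis i 1) $ j) = cis ((2 * pi / L) * x $ j)" for x :: "real^'n" and i j
        using L by (cases "i = j") (auto simp: axis_def distrib_left cis_mult[symmetric])
      then show ?thesis using per by (simp add: periodic_def torus_point_def vec_eq_iff)
    qed
    obtain y where y: "y \<in> ?B" "(g x, ?E x) = (g y, ?E y)" by (rule periodic_representative[OF per' L, of x])
    have "norm (complex_of_real (g x) - (\<Sum>k\<in>A. a k * wave L k x)) = norm (complex_of_real (g x) - complex_of_real (q (?E x)))"
      using fun_cong[OF A(2), of x] by simp
    also have "\<dots> = \<bar>G (?E y) - q (?E y)\<bar>" using y GE[OF y(1)] by (simp flip: of_real_diff)
    also have "\<dots> \<le> \<eta>" using q(2)[of "?E y"] y(1) by auto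
    finally show "norm (complex_of_real (g x) - (\<Sum>k\<in>A. a k * wave L k x)) \<le> \<eta>" .
  qed
qed

section \<open>The Leray projection\<close>

lemma norm_vec_square: "(norm (c :: 'b::real_normed_vector^'n::finite))\<^sup>2 = (\<Sum>i\<in>UNIV. (norm (c $ i))\<^sup>2)"
  by (simp add: norm_vec_def L2_set_def sum_nonneg)

text \<open>The symbol is the orthogonal projection onto the complement of the wave vector: with \<open>s\<close> the coefficient of the
  removed part and \<open>D\<close> the squared length of \<open>k\<close>, the squared norm drops by \<open>|s|^2 D\<close>.\<close>

lemma leray_symbol_norm_le: "norm (leray_symbol k c) \<le> norm (c :: complex^'n::finite)"
proof (cases "k = 0")
  case False
  define D where "D = (\<Sum>j\<in>UNIV. real_of_int ((k $ j)\<^sup>2))"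
  define s where "s = (\<Sum>j\<in>UNIV. c $ j * of_int (k $ j)) / complex_of_real D"
  obtain i where "k $ i \<noteq> 0" using False by (auto simp: vec_eq_iff)
  then have "0 < real_of_int ((k $ i)\<^sup>2)" by simp
  also have "\<dots> \<le> D" unfolding D_def by (rule member_le_sum) auto
  finally have D: "D > 0" .
  have p: "(\<Sum>j\<in>UNIV. c $ j * of_int (k $ j)) = s * D" using D by (simp add: s_def)
  have p': "(\<Sum>j\<in>UNIV. cnj (c $ j) * of_int (k $ j)) = cnj s * D" using arg_cong[OF p, of cnj] by simp
  have ls: "leray_symbol k c $ i = c $ i - s * of_int (k $ i)" for i
    using False by (simp add: leray_symbol_def s_def D_def)
  have "complex_of_real ((norm (leray_symbol k c))\<^sup>2) = (\<Sum>i\<in>UNIV. (c $ i - s * of_int (k $ i)) * (cnj (c $ i) - cnj s * of_int (k $ i)))"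
    unfolding norm_vec_square of_real_sum by (simp add: complex_norm_square ls del: of_real_power)
  also have "\<dots> = (\<Sum>i\<in>UNIV. c $ i * cnj (c $ i) - s * (cnj (c $ i) * of_int (k $ i)) - cnj s * (c $ i * of_int (k $ i))
      + s * cnj s * of_int ((k $ i)\<^sup>2))"
    by (simp add: algebra_simps power2_eq_square)
  also have "\<dots> = (\<Sum>i\<in>UNIV. c $ i * cnj (c $ i)) - s * (cnj s * D) - cnj s * (s * D) + s * cnj s * D"
    by (simp only: sum.distrib sum_subtractf sum_distrib_left[symmetric] p p') (simp add: D_def)
  also have "\<dots> = complex_of_real ((norm c)\<^sup>2 - (norm s)\<^sup>2 * D)"
    unfolding norm_vec_square of_real_diff of_real_sum of_real_mult by (simp add: complex_norm_square del: of_real_power)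
  finally have "(norm (leray_symbol k c))\<^sup>2 = (norm c)\<^sup>2 - (norm s)\<^sup>2 * D" by (simp only: of_real_eq_iff)
  moreover have "0 \<le> (norm s)\<^sup>2 * D" using D by simp
  ultimately have "(norm (leray_symbol k c))\<^sup>2 \<le> (norm c)\<^sup>2" by linarith
  then show ?thesis by (rule power2_le_imp_le) simp
qed (simp add: leray_symbol_def)

lemma leray_symbol_lincomb:
  "leray_symbol k (\<chi> i. a $ i + t * b $ i) = (\<chi> i. leray_symbol k a $ i + t * leray_symbol k b $ i)"
  by (simp add: leray_symbol_def vec_eq_iff sum.distrib sum_distrib_left add_divide_distrib algebra_simps)

lemma fourier_coeff_scalar:
  assumes "continuous_on UNIV u"
  shows "fourier_coeff L u k $ i = fourier_scalar L (\<lambda>x. complex_of_real (u x $ i)) k"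
proof -
  have "(\<lambda>x. complex_of_real (u x $ i) * wave L (- k) x) \<in> borel_measurable borel"
    by (intro borel_measurable_continuous_onI continuous_intros assms)
  then have "(LINT x:cell L|lebesgue. complex_of_real (u x $ i) * wave L (- k) x) = (LINT x:cell L|lborel. complex_of_real (u x $ i) * wave L (- k) x)"
    unfolding set_lebesgue_integral_def
    by (intro integral_completion borel_measurable_scaleR borel_measurable_indicator) auto
  then show ?thesis by (simp add: fourier_coeff_def fourier_scalar_def wave_def sum_negf)
qed

lemma cell_integral_norm_square:
  fixes u :: "real^'n::finite \<Rightarrow> real^'n"
  assumes "continuous_on UNIV u"
  shows "(LINT x:cell L|lborel. (norm (u x))\<^sup>2) = (\<Sum>i\<in>UNIV. LINT x:cell L|lborel. (norm (complex_of_real (u x $ i)))\<^sup>2)"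
  unfolding norm_vec_square set_lebesgue_integral_def scaleR_sum_right
  by (subst Bochner_Integration.integral_sum)
     (auto simp: set_integrable_def[symmetric] simp del: real_scaleR_def intro!: continuous_cell_integrable continuous_intros assms)

text \<open>Parseval's inequality for \<open>g\<close>, up to the error of a trigonometric approximation, meets
  Bessel's inequality for \<open>u\<close>, because the symbol is a contraction for each wave vector.\<close>

lemma leray_contraction:
  fixes g u :: "real^'n::finite \<Rightarrow> real^'n"
  assumes L: "L > 0" and g: "continuous_on UNIV g" "periodic L g" and u: "continuous_on UNIV u"
    and eq: "\<And>k. fourier_coeff L g k = leray_symbol k (fourier_coeff L u k)"
  shows "(LINT x:cell L|lborel. (norm (g x))\<^sup>2) \<le> (LINT x:cell L|lborel. (norm (u x))\<^sup>2)"
proof (rule field_le_epsilon)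
  fix e :: real assume e: "e > 0"
  let ?V = "L ^ CARD('n)"
  \<comment> \<open>The \<open>n\<close> components contribute \<open>?V * \<eta>^2\<close> each, which makes \<open>e\<close> in total.\<close>
  define \<eta> where "\<eta> = sqrt (e / (real CARD('n) * ?V))"
  have \<eta>: "\<eta> > 0" "\<eta>\<^sup>2 = e / (real CARD('n) * ?V)" using e L by (auto simp: \<eta>_def)
  let ?g = "\<lambda>i x. complex_of_real (g x $ i)"
  let ?u = "\<lambda>i x. complex_of_real (u x $ i)"
  have "\<exists>A a. finite A \<and> (\<forall>x. norm (?g i x - (\<Sum>k\<in>A. a k * wave L k x)) \<le> \<eta>)" for i
  proof -
    have "continuous_on UNIV (\<lambda>x. g x $ i)" "periodic L (\<lambda>x. g x $ i)"
      using g by (auto intro!: continuous_intros simp: periodic_def)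
    from trig_polynomial_approximation[OF L this \<eta>(1)] show ?thesis by metis
  qed
  then obtain A a where A: "\<And>i. finite (A i)" "\<And>i x. norm (?g i x - (\<Sum>k\<in>A i. a i k * wave L k x)) \<le> \<eta>"
    by metis
  define B where "B = (\<Union>i. A i)"
  have B: "finite B" using A(1) by (auto simp: B_def)
  have cg: "continuous_on UNIV (?g i)" and cu: "continuous_on UNIV (?u i)" for i
    by (intro continuous_intros g u)+
  have fg: "fourier_scalar L (?g i) k = fourier_coeff L g k $ i" and fu: "fourier_scalar L (?u i) k = fourier_coeff L u k $ i" for i k
    by (simp_all add: fourier_coeff_scalar g u)
  have "(LINT x:cell L|lborel. (norm (g x))\<^sup>2) = (\<Sum>i\<in>UNIV. LINT x:cell L|lborel. (norm (?g i x))\<^sup>2)"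
    by (rule cell_integral_norm_square[OF g(1)])
  also have "\<dots> \<le> (\<Sum>i\<in>(UNIV::'n set). ?V * (\<Sum>k\<in>A i. (norm (fourier_scalar L (?g i) k))\<^sup>2) + ?V * \<eta>\<^sup>2)"
    by (intro sum_mono energy_le_fourier_plus_error[OF L cg A(1) A(2)])
  also have "\<dots> \<le> (\<Sum>i\<in>(UNIV::'n set). ?V * (\<Sum>k\<in>B. (norm (fourier_scalar L (?g i) k))\<^sup>2) + ?V * \<eta>\<^sup>2)"
    using L by (intro sum_mono add_mono mult_left_mono sum_mono2[OF B]) (auto simp: B_def)
  also have "\<dots> = ?V * (\<Sum>k\<in>B. (norm (fourier_coeff L g k))\<^sup>2) + e"
    using L by (simp add: sum.distrib sum_distrib_left[symmetric] fg norm_vec_square \<eta>(2)) (rule sum.swap)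
  also have "\<dots> \<le> ?V * (\<Sum>k\<in>B. (norm (fourier_coeff L u k))\<^sup>2) + e"
    using L by (intro add_right_mono mult_left_mono sum_mono) (auto simp: eq intro!: power_mono leray_symbol_norm_le)
  also have "?V * (\<Sum>k\<in>B. (norm (fourier_coeff L u k))\<^sup>2) = (\<Sum>i\<in>(UNIV::'n set). ?V * (\<Sum>k\<in>B. (norm (fourier_scalar L (?u i) k))\<^sup>2))"
    by (simp add: sum_distrib_left[symmetric] fu norm_vec_square) (rule disjI2, rule sum.swap)
  also have "\<dots> \<le> (\<Sum>i\<in>UNIV. LINT x:cell L|lborel. (norm (?u i x))\<^sup>2)"
    by (intro sum_mono bessel_inequality[OF L cu B])
  also have "\<dots> = (LINT x:cell L|lborel. (norm (u x))\<^sup>2)"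
    by (rule cell_integral_norm_square[OF u, symmetric])
  finally show "(LINT x:cell L|lborel. (norm (g x))\<^sup>2) \<le> (LINT x:cell L|lborel. (norm (u x))\<^sup>2) + e" by simp
qed

lemma spartial_wave: "has_spartial i (wave L k) x" "spartial i (wave L k) x = \<i> * complex_of_real ((2 * pi / L) * of_int (k $ i)) * wave L k x"
proof -
  let ?c = "(2 * pi / L) * of_int (k $ i)"
  have "((\<lambda>s. cis (c * s)) has_vector_derivative (\<i> * complex_of_real c)) (at 0)" for c :: real
  proof -
    have "((\<lambda>s. cis (c * s)) has_derivative (\<lambda>t. (c * t) *\<^sub>R (\<i> * cis (c * 0)))) (at 0)"
      by (rule has_derivative_cis) (auto intro!: derivative_eq_intros)
    then show ?thesis
      unfolding has_vector_derivative_def by (rule has_derivative_eq_rhs) (auto simp: scaleR_conv_of_real)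
  qed
  then have "((\<lambda>s. cis (?c * s)) has_vector_derivative (\<i> * complex_of_real ?c)) (at 0)" .
  from has_vector_derivative_mult_left[OF this, of "wave L k x"]
  have "((\<lambda>s. wave L k (x + s *\<^sub>R axis i 1)) has_vector_derivative (\<i> * complex_of_real ?c * wave L k x)) (at 0)"
    by (simp add: wave_axis_shift mult.assoc)
  from has_spartialI[OF this] show "has_spartial i (wave L k) x" "spartial i (wave L k) x = \<i> * complex_of_real ?c * wave L k x" by auto
qed

lemma C1_space_bilinear:
  assumes B: "bounded_bilinear B" and u: "C1_space u" and v: "C1_space v"
  shows "C1_space (\<lambda>x. B (u x) (v x))"
proof -
  have su: "has_spartial i u x" and sv: "has_spartial i v x" and cu: "continuous_on UNIV u" and cv: "continuous_on UNIV v"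
    and du: "continuous_on UNIV (spartial i u)" and dv: "continuous_on UNIV (spartial i v)" for i x
    using u v by (auto simp: C1_space_def)
  have eq: "spartial i (\<lambda>x. B (u x) (v x)) = (\<lambda>x. B (u x) (spartial i v x) + B (spartial i u x) (v x))" for i
    by (rule ext) (rule spartial_bilinear(2)[OF B su sv])
  note cB = bounded_bilinear.continuous_on[OF B]
  show ?thesis unfolding C1_space_def eq
    by (intro conjI allI cB[OF cu cv] spartial_bilinear(1)[OF B su sv] continuous_on_add[OF cB[OF cu dv] cB[OF du cv]])
qed

text \<open>Integration by parts: the integral of the derivative of the periodic function \<open>F wave\<close>
  vanishes.\<close>

lemma fourier_scalar_spartial:
  fixes F :: "real^'n::finite \<Rightarrow> real"
  assumes L: "L > 0" and F: "C1_space F" "periodic L F"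
  shows "fourier_scalar L (\<lambda>x. complex_of_real (spartial i F x)) k
    = \<i> * complex_of_real ((2 * pi / L) * of_int (k $ i)) * fourier_scalar L (\<lambda>x. complex_of_real (F x)) k"
proof -
  let ?P = "\<lambda>x. F x *\<^sub>R wave L (- k) x"
  let ?a = "\<i> * complex_of_real ((2 * pi / L) * of_int (k $ i))"
  have cF: "continuous_on UNIV F" "continuous_on UNIV (spartial i F)" "\<And>x. has_spartial i F x" using F by (auto simp: C1_space_def)
  have w: "C1_space (wave L (- k))"
  proof -
    have "spartial i (wave L (- k)) = (\<lambda>x. \<i> * complex_of_real ((2 * pi / L) * of_int ((- k) $ i)) * wave L (- k) x)" for i
      by (rule ext) (rule spartial_wave(2))
    note eq = this
    show ?thesis unfolding C1_space_def eq
      by (intro conjI allI continuous_wave spartial_wave(1) continuous_on_mult continuous_on_const)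
  qed
  have "0 = (LINT x:cell L|lborel. spartial i ?P x)"
    by (rule cell_integral_spartial[OF L, symmetric])
       (use F periodic_wave[OF L, of "- k"] in \<open>auto intro!: C1_space_bilinear[OF bounded_bilinear_scaleR] w simp: periodic_def\<close>)
  also have "\<dots> = (LINT x:cell L|lborel. complex_of_real (spartial i F x) * wave L (- k) x - ?a * (complex_of_real (F x) * wave L (- k) x))"
  proof -
    have "spartial i ?P x = F x *\<^sub>R (- ?a * wave L (- k) x) + spartial i F x *\<^sub>R wave L (- k) x" for x
      by (subst spartial_bilinear(2)[OF bounded_bilinear_scaleR cF(3) spartial_wave(1)]) (simp add: spartial_wave(2))
    then have "spartial i ?P x = complex_of_real (spartial i F x) * wave L (- k) x - ?a * (complex_of_real (F x) * wave L (- k) x)" for x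
      by (simp add: scaleR_conv_of_real mult.left_commute)
    then show ?thesis by (simp only:)
  qed
  also have "\<dots> = (LINT x:cell L|lborel. complex_of_real (spartial i F x) * wave L (- k) x) - (LINT x:cell L|lborel. ?a * (complex_of_real (F x) * wave L (- k) x))"
    by (rule set_integral_diff(2); intro continuous_cell_integrable continuous_on_mult continuous_on_const continuous_wave continuous_on_of_real cF)
  also have "(LINT x:cell L|lborel. ?a * (complex_of_real (F x) * wave L (- k) x)) = ?a * (LINT x:cell L|lborel. complex_of_real (F x) * wave L (- k) x)"
    by (rule set_integral_mult_right)
  finally have X: "(LINT x:cell L|lborel. complex_of_real (spartial i F x) * wave L (- k) x) = ?a * (LINT x:cell L|lborel. complex_of_real (F x) * wave L (- k) x)"
    by (simp only: eq_iff_diff_eq_0[symmetric] eq_commute[of 0])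
  show ?thesis unfolding fourier_scalar_def X by (rule mult.left_commute)
qed

lemma spartial_component:
  assumes "has_spartial i u x"
  shows "has_spartial i (\<lambda>x. u x $ j) x" "spartial i (\<lambda>x. u x $ j) x = spartial i u x $ j"
  using has_spartialI[OF bounded_linear.has_vector_derivative[OF bounded_linear_vec_nth has_spartialD[OF assms]]] by auto

lemma C1_space_component: "C1_space u \<Longrightarrow> C1_space (\<lambda>x. u x $ j)"
proof -
  assume u: "C1_space u"
  then have "spartial i (\<lambda>x. u x $ j) = (\<lambda>x. spartial i u x $ j)" for i
    by (auto simp: C1_space_def spartial_component fun_eq_iff)
  then show ?thesis using u by (auto simp: C1_space_def spartial_component intro!: continuous_intros)
qed

text \<open>In Fourier variables a divergence-free field is orthogonal to the wave vector and a
  gradient is parallel to it.\<close>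

lemma leray_symbol_solenoidal_plus_gradient:
  fixes g :: "real^'n::finite \<Rightarrow> real^'n" and \<pi> :: "real^'n \<Rightarrow> real"
  assumes L: "L > 0" and g: "C1_space g" "periodic L g" "\<And>x. divergence g x = 0" and \<pi>: "C1_space \<pi>" "periodic L \<pi>"
  shows "leray_symbol k (fourier_coeff L (\<lambda>x. g x + grad \<pi> x) k) = fourier_coeff L g k"
proof -
  let ?g = "\<lambda>i x. complex_of_real (g x $ i)"
  have cg: "continuous_on UNIV g" and c\<pi>: "continuous_on UNIV (grad \<pi>)" "continuous_on UNIV (spartial i \<pi>)" for i
    using g \<pi> by (auto simp: C1_space_def grad_def[abs_def] intro!: continuous_intros)
  have ci: "continuous_on UNIV (\<lambda>x. spartial i g x $ j)" for i j
    using g(1) by (auto simp: C1_space_def intro!: continuous_intros)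
  define b where "b = \<i> * complex_of_real (2 * pi / L)"
  define P where "P = fourier_scalar L (\<lambda>x. complex_of_real (\<pi> x)) k"
  have G: "fourier_coeff L g k $ i = fourier_scalar L (?g i) k" for i by (rule fourier_coeff_scalar[OF cg])
  have U: "fourier_coeff L (\<lambda>x. g x + grad \<pi> x) k $ i = fourier_coeff L g k $ i + b * of_int (k $ i) * P" for i
  proof -
    have "fourier_coeff L (\<lambda>x. g x + grad \<pi> x) k $ i = fourier_scalar L (\<lambda>x. ?g i x + complex_of_real (spartial i \<pi> x)) k"
      by (subst fourier_coeff_scalar) (auto intro!: continuous_intros cg c\<pi> simp: grad_def)
    also have "\<dots> = fourier_scalar L (?g i) k + fourier_scalar L (\<lambda>x. complex_of_real (spartial i \<pi> x)) k"
      unfolding fourier_scalar_def distrib_left[symmetric] distrib_right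
      by (subst set_integral_add(2)) (auto intro!: continuous_times_wave continuous_intros cg c\<pi>)
    finally show ?thesis using fourier_scalar_spartial[OF L \<pi>, of i k] by (simp add: G b_def P_def)
  qed
  have div: "(\<Sum>j\<in>UNIV. fourier_coeff L g k $ j * of_int (k $ j)) = 0"
  proof -
    have "b * (\<Sum>j\<in>UNIV. fourier_coeff L g k $ j * of_int (k $ j)) = (\<Sum>j\<in>UNIV. fourier_scalar L (\<lambda>x. complex_of_real (spartial j g x $ j)) k)"
    proof -
      have "fourier_scalar L (\<lambda>x. complex_of_real (spartial j g x $ j)) k = b * (fourier_coeff L g k $ j * of_int (k $ j))" for j
        using fourier_scalar_spartial[OF L C1_space_component[OF g(1)], of j j k] g(1,2)
        by (simp add: G b_def spartial_component C1_space_def periodic_def algebra_simps)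
      then show ?thesis by (simp add: sum_distrib_left)
    qed
    also have "\<dots> = complex_of_real (1 / L ^ CARD('n)) * (LINT x:cell L|lborel. (\<Sum>j\<in>UNIV. complex_of_real (spartial j g x $ j) * wave L (- k) x))"
      unfolding fourier_scalar_def sum_distrib_left[symmetric] set_lebesgue_integral_def scaleR_sum_right
      by (subst Bochner_Integration.integral_sum)
         (auto simp: set_integrable_def[symmetric] intro!: continuous_times_wave continuous_intros ci)
    also have "(\<lambda>x. (\<Sum>j\<in>UNIV. complex_of_real (spartial j g x $ j) * wave L (- k) x)) = (\<lambda>x. 0)"
      using g(3) by (simp add: sum_distrib_right[symmetric] divergence_def flip: of_real_sum)
    finally show ?thesis using L by (simp add: b_def set_lebesgue_integral_def)
  qed
  show ?thesis
  proof (cases "k = 0")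
    case True
    then show ?thesis by (simp add: leray_symbol_def vec_eq_iff U)
  next
    case False
    define D where "D = (\<Sum>j\<in>UNIV. (k $ j)\<^sup>2)"
    obtain i where "k $ i \<noteq> 0" using False by (auto simp: vec_eq_iff)
    then have "0 < (k $ i)\<^sup>2" by simp
    also have "\<dots> \<le> D" unfolding D_def by (rule member_le_sum) auto
    finally have D: "D \<noteq> 0" by simp
    have "(\<Sum>j\<in>UNIV. (fourier_coeff L g k $ j + b * of_int (k $ j) * P) * of_int (k $ j)) = b * P * of_int D"
      unfolding D_def using div by (simp add: distrib_right sum.distrib sum_distrib_left power2_eq_square algebra_simps)
    then show ?thesis using False D by (simp add: leray_symbol_def vec_eq_iff U D_def[symmetric])
  qed
qed

lemma L2_periodic_times_bounded:
  fixes u :: "real^'n::finite \<Rightarrow> real^'n"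
  assumes L: "L > 0" and u: "L2_periodic L u"
  shows "set_integrable lebesgue (cell L) (\<lambda>x. complex_of_real (u x $ i) * wave L k x)"
proof -
  have m: "u \<in> borel_measurable lebesgue" and s: "set_integrable lebesgue (cell L) (\<lambda>x. \<Sum>i\<in>UNIV. (u x $ i)\<^sup>2)"
    using u by (auto simp: L2_periodic_def)
  have mw: "wave L k \<in> borel_measurable lebesgue"
    by (intro measurable_completion) (simp add: borel_measurable_continuous_onI continuous_wave)
  have mc: "(\<lambda>x. complex_of_real (u x $ i)) \<in> borel_measurable lebesgue"
    using measurable_compose[OF m, of "\<lambda>y. complex_of_real (y $ i)" borel]
    by (simp add: borel_measurable_continuous_onI continuous_intros)
  have one: "set_integrable lebesgue (cell L :: (real^'n) set) (\<lambda>x. 1 :: real)"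
    using continuous_cell_integrable[of "\<lambda>x::real^'n. 1::real" L] unfolding set_integrable_def
    by (intro integrable_completion[THEN iffD2]) auto
  have int: "set_integrable lebesgue (cell L) (\<lambda>x. 1 + (\<Sum>i\<in>UNIV. (u x $ i)\<^sup>2))"
    by (rule set_integral_add(1)[OF one s])
  show ?thesis
  proof (rule set_integrable_bound[OF int])
    show "set_borel_measurable lebesgue (cell L) (\<lambda>x. complex_of_real (u x $ i) * wave L k x)"
      unfolding set_borel_measurable_def
      by (intro borel_measurable_scaleR borel_measurable_times mc mw borel_measurable_indicator) (simp add: sets_completionI_sets)
    show "AE x in lebesgue. x \<in> cell L \<longrightarrow> norm (complex_of_real (u x $ i) * wave L k x) \<le> norm (1 + (\<Sum>i\<in>UNIV. (u x $ i)\<^sup>2))"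
    proof (intro AE_I2 impI)
      fix x
      have "\<bar>u x $ i\<bar> \<le> 1 + (u x $ i)\<^sup>2"
        using sum_power2_ge_zero[of "\<bar>u x $ i\<bar> - 1/2" 0] by (simp add: power2_eq_square algebra_simps)
      also have "(u x $ i)\<^sup>2 \<le> (\<Sum>i\<in>UNIV. (u x $ i)\<^sup>2)" by (rule member_le_sum) auto
      finally show "norm (complex_of_real (u x $ i) * wave L k x) \<le> norm (1 + (\<Sum>i\<in>UNIV. (u x $ i)\<^sup>2))"
        by (simp add: norm_mult)
    qed
  qed
qed

lemma continuous_L2_periodic:
  fixes u :: "real^'n::finite \<Rightarrow> real^'n"
  assumes "continuous_on UNIV u" "periodic L u"
  shows "L2_periodic L u"
  unfolding L2_periodic_def
proof (intro conjI assms(2))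
  show "u \<in> borel_measurable lebesgue"
    by (intro measurable_completion) (simp add: borel_measurable_continuous_onI assms(1))
  have "set_integrable lborel (cell L) (\<lambda>x. \<Sum>i\<in>UNIV. (u x $ i)\<^sup>2)"
    by (intro continuous_cell_integrable continuous_intros assms(1))
  then show "set_integrable lebesgue (cell L) (\<lambda>x. \<Sum>i\<in>UNIV. (u x $ i)\<^sup>2)"
    unfolding set_integrable_def by (intro integrable_completion[THEN iffD2]) auto
qed

lemma fourier_coeff_lincomb:
  fixes u v :: "real^'n::finite \<Rightarrow> real^'n"
  assumes L: "L > 0" and u: "L2_periodic L u" and v: "L2_periodic L v"
  shows "fourier_coeff L (\<lambda>x. u x + c *\<^sub>R v x) k = (\<chi> i. fourier_coeff L u k $ i + complex_of_real c * fourier_coeff L v k $ i)"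
proof -
  have w: "cis (- (2 * pi / L) * (\<Sum>j\<in>UNIV. real_of_int (k $ j) * x $ j)) = wave L (- k) x" for x
    by (simp add: wave_def sum_negf)
  have "(LINT x:cell L|lebesgue. complex_of_real ((u x + c *\<^sub>R v x) $ i) * wave L (- k) x)
     = (LINT x:cell L|lebesgue. complex_of_real (u x $ i) * wave L (- k) x) + complex_of_real c * (LINT x:cell L|lebesgue. complex_of_real (v x $ i) * wave L (- k) x)" for i
  proof -
    have "(LINT x:cell L|lebesgue. complex_of_real ((u x + c *\<^sub>R v x) $ i) * wave L (- k) x)
      = (LINT x:cell L|lebesgue. complex_of_real (u x $ i) * wave L (- k) x + complex_of_real c * (complex_of_real (v x $ i) * wave L (- k) x))"
      by (simp add: algebra_simps)
    also have "\<dots> = (LINT x:cell L|lebesgue. complex_of_real (u x $ i) * wave L (- k) x) + (LINT x:cell L|lebesgue. complex_of_real c * (complex_of_real (v x $ i) * wave L (- k) x))"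
      by (rule set_integral_add(2)) (auto intro!: L2_periodic_times_bounded L u v)
    finally show ?thesis by simp
  qed
  then show ?thesis unfolding fourier_coeff_def w by (simp add: vec_eq_iff distrib_left mult.left_commute)
qed

text \<open>One step of the method and the exact solution satisfy the same relation between Fourier
  coefficients up to the projection: \<open>G\<close> is the projection of \<open>G + grad \<pi>\<close>. By linearity the difference
  on the left is the projection of the difference on the right, which cannot have larger norm. The
  two projected fields are merely square integrable; it is their sum, the new velocity without
  noise, that is continuous.\<close>

lemma leray_step:
  fixes A F PA PF G :: "real^'n::finite \<Rightarrow> real^'n"
  assumes L: "L > 0" and A: "continuous_on UNIV A" and F: "continuous_on UNIV F"
    and PA: "leray_projection L A PA" and PF: "leray_projection L F PF"
    and cP: "continuous_on UNIV (\<lambda>x. PA x + h *\<^sub>R PF x)"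
    and G: "C1_space G" "periodic L G" "\<And>x. divergence G x = 0" and \<pi>: "C1_space \<pi>" "periodic L \<pi>"
  shows "(LINT x:cell L|lborel. (norm (PA x + h *\<^sub>R PF x - G x))\<^sup>2)
    \<le> (LINT x:cell L|lborel. (norm (A x + h *\<^sub>R F x - (G x + grad \<pi> x)))\<^sup>2)"
proof -
  have L2: "L2_periodic L A" "L2_periodic L PA" "L2_periodic L F" "L2_periodic L PF"
    using PA PF by (auto simp: leray_projection_def)
  have cG: "continuous_on UNIV G" and cg: "continuous_on UNIV (\<lambda>x. G x + grad \<pi> x)"
    using G(1) \<pi>(1) by (auto simp: C1_space_def grad_def[abs_def] intro!: continuous_intros)
  have pg: "periodic L (\<lambda>x. G x + grad \<pi> x)"
    using G(2) periodic_spartial[OF \<pi>(2)] by (simp add: periodic_def grad_def)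
  let ?p = "\<lambda>x. PA x + h *\<^sub>R PF x" and ?a = "\<lambda>x. A x + h *\<^sub>R F x"
  have pp: "periodic L ?p" "periodic L ?a" using L2 by (auto simp: L2_periodic_def periodic_def)
  have ca: "continuous_on UNIV ?a" by (intro continuous_intros A F)
  note c = continuous_L2_periodic[OF cP pp(1)] continuous_L2_periodic[OF ca pp(2)]
    continuous_L2_periodic[OF cG G(2)] continuous_L2_periodic[OF cg pg]
  show ?thesis
  proof (rule leray_contraction[OF L])
    fix k
    have 1: "fourier_coeff L ?p k = leray_symbol k (fourier_coeff L ?a k)"
      unfolding fourier_coeff_lincomb[OF L L2(2,4)] fourier_coeff_lincomb[OF L L2(1,3)] leray_symbol_lincomb
      using PA PF by (simp add: leray_projection_def)
    have "fourier_coeff L (\<lambda>x. ?p x + (-1) *\<^sub>R G x) k = leray_symbol k (fourier_coeff L (\<lambda>x. ?a x + (-1) *\<^sub>R (G x + grad \<pi> x)) k)"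
      unfolding fourier_coeff_lincomb[OF L c(1,3)] fourier_coeff_lincomb[OF L c(2,4)] leray_symbol_lincomb 1
        leray_symbol_solenoidal_plus_gradient[OF L G \<pi>] ..
    then show "fourier_coeff L (\<lambda>x. ?p x - G x) k = leray_symbol k (fourier_coeff L (\<lambda>x. ?a x - (G x + grad \<pi> x)) k)"
      by (simp only: scaleR_minus_left scaleR_one diff_conv_add_uminus)
  qed (use pp G(2) in \<open>auto intro!: continuous_on_diff cP cG ca cg simp: periodic_def\<close>)
qed

section \<open>Transport of the energy by a short step\<close>

text \<open>Compare the two Leibniz expansions term by term. Halving the entries makes them bounded by one,
  so that the difference of two products is at most the sum of the differences of the factors; this
  produces the factor \<open>2 ^ n\<close>.\<close>

lemma det_near_identity:
  fixes B :: "real^'n::finite^'n"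
  assumes d: "0 \<le> d" "d \<le> 1" and B: "\<And>i j. \<bar>B $ i $ j - (if i = j then 1 else 0)\<bar> \<le> d"
  shows "\<bar>det B - 1\<bar> \<le> fact CARD('n) * 2 ^ CARD('n) * real CARD('n) * d"
proof -
  let ?I = "mat 1 :: real^'n^'n"
  let ?P = "{p. p permutes (UNIV :: 'n set)}"
  have perm: "\<bar>of_int (sign p) * (\<Prod>i\<in>UNIV. B $ i $ p i) - of_int (sign p) * (\<Prod>i\<in>UNIV. ?I $ i $ p i)\<bar>
     \<le> 2 ^ CARD('n) * real CARD('n) * d" for p
  proof -
    have b: "\<bar>B $ i $ j / 2 - ?I $ i $ j / 2\<bar> \<le> d / 2" "\<bar>B $ i $ j / 2\<bar> \<le> 1" "\<bar>?I $ i $ j / 2\<bar> \<le> 1" for i j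
      using B[of i j] d by (auto simp: mat_def abs_if split: if_splits)
    have "\<bar>(\<Prod>i\<in>UNIV. B $ i $ p i / 2) - (\<Prod>i\<in>UNIV. ?I $ i $ p i / 2)\<bar> \<le> (\<Sum>i\<in>(UNIV::'n set). \<bar>B $ i $ p i / 2 - ?I $ i $ p i / 2\<bar>)"
      using norm_prod_diff[of UNIV "\<lambda>i. B $ i $ p i / 2" "\<lambda>i. ?I $ i $ p i / 2"] b by simp
    also have "\<dots> \<le> (\<Sum>i\<in>(UNIV::'n set). d / 2)" by (intro sum_mono b)
    finally have "\<bar>(\<Prod>i\<in>UNIV. B $ i $ p i) - (\<Prod>i\<in>UNIV. ?I $ i $ p i)\<bar> / 2 ^ CARD('n) \<le> real CARD('n) * (d / 2)"
      by (simp add: prod_dividef flip: diff_divide_distrib)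
    also have "\<dots> \<le> real CARD('n) * d" using d by (intro mult_left_mono) auto
    finally have "\<bar>(\<Prod>i\<in>UNIV. B $ i $ p i) - (\<Prod>i\<in>UNIV. ?I $ i $ p i)\<bar> \<le> 2 ^ CARD('n) * real CARD('n) * d"
      by (simp add: field_simps)
    moreover have "\<bar>of_int (sign p) :: real\<bar> = 1" by (simp add: sign_def)
    ultimately show ?thesis by (simp add: abs_mult flip: right_diff_distrib)
  qed
  have "\<bar>det B - det ?I\<bar> \<le> (\<Sum>p\<in>?P. 2 ^ CARD('n) * real CARD('n) * d)"
    unfolding det_def sum_subtractf[symmetric]
    by (rule order.trans[OF sum_abs]) (intro sum_mono perm)
  also have "\<dots> = fact CARD('n) * 2 ^ CARD('n) * real CARD('n) * d"
    by (simp add: card_permutations[OF refl finite] mult.assoc)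
  finally show ?thesis by (simp add: det_I)
qed

text \<open>The bound of \<open>det_near_identity\<close> for the Jacobian matrix of \<open>x - h V x\<close>, divided by \<open>h\<close>, when the partial
  derivatives of \<open>V\<close> are at most \<open>K\<close>.\<close>

definition jacobian_const :: "'n::finite itself \<Rightarrow> real \<Rightarrow> real" where
  "jacobian_const _ K = fact CARD('n) * 2 ^ CARD('n) * real CARD('n) * K"

lemma jacobian_const_ge:
  assumes "K \<ge> 0"
  shows "real CARD('n::finite) * K \<le> jacobian_const TYPE('n) K" "K \<le> jacobian_const TYPE('n) K"
proof -
  have "1 * 1 \<le> fact CARD('n) * (2 ^ CARD('n) :: real)"
    by (intro mult_mono) auto
  from mult_right_mono[OF this, of "real CARD('n) * K"] assms
  show 1: "real CARD('n) * K \<le> jacobian_const TYPE('n) K"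
    by (simp add: jacobian_const_def mult.assoc)
  have "1 * K \<le> real CARD('n) * K" using assms by (intro mult_right_mono) (auto simp: Suc_le_eq)
  with 1 show "K \<le> jacobian_const TYPE('n) K" by simp
qed

text \<open>The map \<open>x - h V x\<close> commutes with lattice translations and is injective for small \<open>h\<close>, so
  it maps a cell onto a set with disjoint lattice translates, over which a periodic function has at
  most the integral over a cell. The Jacobian is at least \<open>1 - O(h)\<close>, which turns the integral over
  the image into one over the cell.\<close>

lemma transported_integral_le_wellorder:
  fixes V :: "(real, 'n::{finite,wellorder}) vec \<Rightarrow> (real, 'n) vec" and f :: "(real, 'n) vec \<Rightarrow> real"
  assumes L: "L > 0" and V: "C1_space V" "periodic L V" "\<And>i x. norm (spartial i V x) \<le> K"
    and f: "continuous_on UNIV f" "periodic L f" "\<And>x. f x \<ge> 0"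
    and h: "0 < h" "jacobian_const TYPE('n) K * h \<le> 1/2"
  shows "(LINT x:cell L|lborel. f (x - h *\<^sub>R V x)) \<le> (1 + 2 * jacobian_const TYPE('n) K * h) * (LINT x:cell L|lborel. f x)"
proof -
  let ?C = "jacobian_const TYPE('n) K"
  let ?S = "cell L :: ((real, 'n) vec) set"
  have K: "K \<ge> 0" using V(3)[of undefined undefined] norm_ge_zero[of "spartial undefined V undefined"] by linarith
  define g where "g x = x - h *\<^sub>R V x" for x
  define g' where "g' x y = y - h *\<^sub>R (\<Sum>i\<in>UNIV. (y $ i) *\<^sub>R spartial i V x)" for x y
  have der: "(g has_derivative g' x) (at x within A)" for x A
    unfolding g_def[abs_def] g'_def[abs_def]
    by (rule has_derivative_at_withinI, intro has_derivative_diff has_derivative_ident has_derivative_scaleR_right C1_space_has_derivative V)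
  have cg: "continuous_on A g" for A
    by (rule has_derivative_continuous_on[OF der])
  have hC: "h * ?C \<le> 1/2" using h(2) by (simp add: mult.commute)
  have nK: "h * (real CARD('n) * K) < 1"
    by (rule order.strict_trans1[OF mult_left_mono[OF jacobian_const_ge(1)[OF K] less_imp_le[OF h(1)]]]) (use hC in linarith)
  have inj: "x = y" if "g x = g y" for x y
  proof -
    have "y - x = h *\<^sub>R (V y - V x)" using that by (simp add: g_def algebra_simps)
    then have "norm (y - x) = norm (h *\<^sub>R (V y - V x))" by (rule arg_cong)
    also have "\<dots> \<le> h * (real CARD('n) * K * norm (y - x))"
      using h C1_space_lipschitz[OF V(1,3), of y x] by (simp add: mult_left_mono)
    finally have "norm (y - x) * (1 - h * (real CARD('n) * K)) \<le> 0" by (simp add: algebra_simps)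
    then show "x = y" using nK by (simp add: mult_le_0_iff)
  qed
  have ion: "inj_on g A" for A by (rule inj_onI) (rule inj)
  have opn: "open (g ` ?S)"
    by (rule invariance_of_domain) (auto simp: cg cell_eq_box ion)
  have shift: "g (x + lattice_shift L k) = g x + lattice_shift L k" for x k
    using periodic_lattice[OF V(2), of x k] by (simp add: g_def)
  have pack: "k = 0" if yS: "y \<in> g ` ?S" "y + lattice_shift L k \<in> g ` ?S" for y k
  proof -
    obtain x x' where x: "x \<in> ?S" "x' \<in> ?S" "g x' = g x + lattice_shift L k"
      using yS by (auto simp: image_iff)
    then have eq: "x' = x + lattice_shift L k" by (metis inj shift)
    then show "k = 0" using cell_translates_disjoint[OF L x(1)] x(2) by simp
  qed
  have mf: "f \<in> borel_measurable borel" by (rule borel_measurable_continuous_onI[OF f(1)])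
  have "bounded (g ` cbox 0 (\<chi> i. L))"
    by (intro compact_imp_bounded compact_continuous_image cg) auto
  then have "bounded (g ` ?S)" by (rule bounded_subset) (auto simp: cell_eq_box intro!: imageI box_subset_cbox[THEN subsetD])
  then obtain a b where ab: "g ` ?S \<subseteq> cbox a b" using bounded_subset_cbox_symmetric by blast
  have sif: "set_integrable lborel (g ` ?S) f"
  proof (rule set_integrable_subset[of _ "cbox a b"])
    show "set_integrable lborel (cbox a b) f"
      unfolding set_integrable_def by (rule borel_integrable_compact) (auto intro: continuous_on_subset[OF f(1)])
  qed (use opn ab in auto)
  have nn: "ennreal (LINT x:A|lborel. f x) = (\<integral>\<^sup>+x\<in>A. ennreal (f x) \<partial>lborel)" if "set_integrable lborel A f" for A
  proof -
    have "(\<integral>\<^sup>+x. ennreal (indicator A x *\<^sub>R f x) \<partial>lborel) = ennreal (LINT x:A|lborel. f x)"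
      unfolding set_lebesgue_integral_def
      by (rule nn_integral_eq_integral) (use that f(3) in \<open>auto simp: set_integrable_def\<close>)
    moreover have "(\<integral>\<^sup>+x. ennreal (indicator A x *\<^sub>R f x) \<partial>lborel) = (\<integral>\<^sup>+x\<in>A. ennreal (f x) \<partial>lborel)"
      by (intro nn_integral_cong) (auto simp: indicator_def)
    ultimately show ?thesis by simp
  qed
  have "(\<integral>\<^sup>+x\<in>g ` ?S. ennreal (f x) \<partial>lborel) \<le> (\<integral>\<^sup>+x\<in>cell L. ennreal (f x) \<partial>lborel)"
    by (rule nn_integral_packing_le[OF L])
       (use mf f(2) opn pack in \<open>auto simp: periodic_def\<close>)
  then have "ennreal (LINT x:g ` ?S|lborel. f x) \<le> ennreal (LINT x:cell L|lborel. f x)"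
    by (simp add: nn sif continuous_cell_integrable[OF f(1)])
  then have pk: "(LINT x:g ` ?S|lborel. f x) \<le> (LINT x:cell L|lborel. f x)"
    by (subst (asm) ennreal_le_iff) (auto simp: set_lebesgue_integral_def intro!: Bochner_Integration.integral_nonneg mult_nonneg_nonneg f(3))
  have jac: "1 - ?C * h \<le> \<bar>det (matrix (g' x))\<bar>" for x
  proof -
    have "\<bar>matrix (g' x) $ i $ j - (if i = j then 1 else 0)\<bar> \<le> h * K" for i j
    proof -
      have "(\<Sum>l\<in>UNIV. (axis j 1 $ l) *\<^sub>R spartial l V x) = spartial j V x"
        by (simp add: axis_def if_distrib[of "\<lambda>c. c *\<^sub>R _"] cong: if_cong)
      then have "g' x (axis j 1) = axis j 1 - h *\<^sub>R spartial j V x" by (simp only: g'_def)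
      then have "matrix (g' x) $ i $ j - (if i = j then 1 else 0) = - (h * (spartial j V x $ i))"
        by (simp add: matrix_def axis_def)
      moreover have "\<bar>spartial j V x $ i\<bar> \<le> K" using component_le_norm_cart[of "spartial j V x" i] V(3)[of j x] by linarith
      ultimately show ?thesis using h by (simp add: abs_mult mult_left_mono)
    qed
    moreover have "h * K \<le> 1"
      by (rule order.trans[OF mult_left_mono[OF jacobian_const_ge(2)[OF K, where 'n='n] less_imp_le[OF h(1)]]]) (use hC in linarith)
    ultimately have "\<bar>det (matrix (g' x)) - 1\<bar> \<le> fact CARD('n) * 2 ^ CARD('n) * real CARD('n) * (h * K)"
      using h K by (intro det_near_identity) auto
    also have "\<dots> = ?C * h" by (simp add: jacobian_const_def)
    finally show ?thesis by linarith
  qed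
  have fa: "f absolutely_integrable_on (g ` ?S)"
    using sif unfolding set_integrable_def
    by (intro integrable_completion[THEN iffD2] borel_measurable_integrable)
  have cov: "(\<lambda>x. \<bar>det (matrix (g' x))\<bar> *\<^sub>R vec (f (g x)) :: real^1) absolutely_integrable_on ?S \<and>
      integral ?S (\<lambda>x. \<bar>det (matrix (g' x))\<bar> *\<^sub>R vec (f (g x)) :: real^1) = vec (integral (g ` ?S) f)"
  proof (rule iffD2[OF has_absolute_integral_change_of_variables[of ?S g g' "\<lambda>x. vec (f x) :: real^1"]])
    show "(\<lambda>x. vec (f x) :: real^1) absolutely_integrable_on g ` ?S \<and> integral (g ` ?S) (\<lambda>x. vec (f x) :: real^1) = vec (integral (g ` ?S) f)"
      using fa by (simp add: absolutely_integrable_on_1_iff integral_on_1_eq)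
  qed (auto simp: der ion cell_eq_box)
  have i1: "(\<lambda>x. \<bar>det (matrix (g' x))\<bar> * f (g x)) integrable_on ?S"
    and e1: "integral ?S (\<lambda>x. \<bar>det (matrix (g' x))\<bar> * f (g x)) = integral (g ` ?S) f"
    using cov by (simp_all add: absolutely_integrable_on_1_iff integral_on_1_eq absolutely_integrable_on_def vec_eq_iff)
  have cfg: "continuous_on UNIV (\<lambda>x. f (g x))" by (rule continuous_on_compose2[OF f(1) cg]) auto
  note sfg = set_borel_integral_eq_integral[OF continuous_cell_integrable[OF cfg, of L]]
  have "(1 - ?C * h) * (LINT x:cell L|lborel. f (g x)) = integral ?S (\<lambda>x. (1 - ?C * h) * f (g x))"
    using sfg by simp
  also have "\<dots> \<le> integral ?S (\<lambda>x. \<bar>det (matrix (g' x))\<bar> * f (g x))"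
    by (rule integral_le[OF integrable_on_mult_right[OF sfg(1)] i1]) (auto intro!: mult_right_mono jac f(3))
  also have "\<dots> = (LINT x:g ` ?S|lborel. f x)" unfolding e1 by (rule set_borel_integral_eq_integral(2)[OF sif, symmetric])
  also have "\<dots> \<le> (LINT x:cell L|lborel. f x)" by (rule pk)
  finally have main: "(1 - ?C * h) * (LINT x:cell L|lborel. f (g x)) \<le> (LINT x:cell L|lborel. f x)" .
  have C: "?C \<ge> 0" using jacobian_const_ge(2)[OF K, where 'n='n] K by linarith
  have "1 \<le> (1 + 2 * ?C * h) * (1 - ?C * h)"
    using mult_nonneg_nonneg[of "?C * h" "1 - 2 * (?C * h)"] C h by (simp add: algebra_simps)
  moreover have I0: "0 \<le> (LINT x:cell L|lborel. f (g x))"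
    by (auto simp: set_lebesgue_integral_def intro!: Bochner_Integration.integral_nonneg mult_nonneg_nonneg f(3))
  ultimately have "1 * (LINT x:cell L|lborel. f (g x)) \<le> ((1 + 2 * ?C * h) * (1 - ?C * h)) * (LINT x:cell L|lborel. f (g x))"
    by (rule mult_right_mono)
  also have "\<dots> = (1 + 2 * ?C * h) * ((1 - ?C * h) * (LINT x:cell L|lborel. f (g x)))" by (simp only: mult.assoc)
  also have "\<dots> \<le> (1 + 2 * ?C * h) * (LINT x:cell L|lborel. f x)"
    using main C h by (intro mult_left_mono) auto
  finally show ?thesis by (simp add: g_def)
qed

text \<open>A finite index type has a copy that carries a well-order. Relabelling the coordinates by this
  copy preserves Lebesgue measure, the cell, periodicity and the norm, so the bound passes from
  well-ordered index types to all finite ones.\<close>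

typedef 'n ordered_copy = "UNIV :: 'n set" by simp

instance ordered_copy :: (finite) finite
proof
  have "(UNIV :: 'a ordered_copy set) = Abs_ordered_copy ` UNIV"
    by (rule type_definition.Abs_image[OF type_definition_ordered_copy, symmetric])
  then show "finite (UNIV :: 'a ordered_copy set)" by (metis finite finite_imageI)
qed

instantiation ordered_copy :: (finite) wellorder
begin

definition less_eq_ordered_copy :: "'a ordered_copy \<Rightarrow> 'a ordered_copy \<Rightarrow> bool" where
  "x \<le> y \<longleftrightarrow> to_nat (Rep_ordered_copy x) \<le> to_nat (Rep_ordered_copy y)"

definition less_ordered_copy :: "'a ordered_copy \<Rightarrow> 'a ordered_copy \<Rightarrow> bool" where
  "x < y \<longleftrightarrow> to_nat (Rep_ordered_copy x) < to_nat (Rep_ordered_copy y)"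

instance
proof
  fix P and a :: "'a ordered_copy"
  assume step: "\<And>x :: 'a ordered_copy. (\<And>y. y < x \<Longrightarrow> P y) \<Longrightarrow> P x"
  show "P a"
    by (induction a rule: measure_induct_rule[of "\<lambda>x. to_nat (Rep_ordered_copy x)"])
       (rule step, simp add: less_ordered_copy_def)
qed (auto simp: less_eq_ordered_copy_def less_ordered_copy_def Rep_ordered_copy_inject)

end

definition relabel :: "real^'n::finite \<Rightarrow> real^('n ordered_copy)" where
  "relabel x = (\<chi> i. x $ Rep_ordered_copy i)"

definition unlabel :: "real^('n ordered_copy) \<Rightarrow> real^'n::finite" where
  "unlabel y = (\<chi> i. y $ Abs_ordered_copy i)"

lemma bij_Rep_ordered_copy: "bij_betw Rep_ordered_copy UNIV UNIV"
  by (rule bij_betwI[where g=Abs_ordered_copy]) (auto simp: Rep_ordered_copy_inverse Abs_ordered_copy_inverse)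

lemma relabel_inverse [simp]: "unlabel (relabel x) = x" "relabel (unlabel y) = y"
  by (auto simp: relabel_def unlabel_def vec_eq_iff Abs_ordered_copy_inverse Rep_ordered_copy_inverse)

lemma relabel_nth [simp]: "relabel x $ i = x $ Rep_ordered_copy i" "unlabel y $ j = y $ Abs_ordered_copy j"
  by (simp_all add: relabel_def unlabel_def)

lemma card_ordered_copy: "CARD('n::finite ordered_copy) = CARD('n)"
  using bij_betw_same_card[OF bij_Rep_ordered_copy] by metis

lemma norm_relabel: "norm (relabel x) = norm x"
  unfolding norm_vec_def L2_set_def
  by (simp add: sum.reindex_bij_betw[OF bij_Rep_ordered_copy, of "\<lambda>i. (x $ i)\<^sup>2"])

lemma bounded_linear_relabel: "bounded_linear relabel"
  by (rule bounded_linear_intro[of _ 1]) (auto simp: vec_eq_iff norm_relabel)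

lemma bounded_linear_unlabel: "bounded_linear (unlabel :: _ \<Rightarrow> real^'n::finite)"
proof (rule bounded_linear_intro[of _ 1])
  show "norm (unlabel y) \<le> norm y * 1" for y :: "real^('n ordered_copy)"
    using norm_relabel[of "unlabel y :: real^'n"] by simp
qed (auto simp: vec_eq_iff)

lemma unlabel_axis: "unlabel (axis i 1) = axis (Rep_ordered_copy i) 1"
  by (auto simp: vec_eq_iff axis_def Rep_ordered_copy_inverse Abs_ordered_copy_inverse)

lemma lborel_relabel: "lborel = distr lborel borel (relabel :: real^'n::finite \<Rightarrow> _)"
proof (rule lborel_eqI)
  fix l u :: "real^('n ordered_copy)"
  assume lu: "\<And>b. b \<in> Basis \<Longrightarrow> l \<bullet> b \<le> u \<bullet> b"
  have m: "(relabel :: real^'n \<Rightarrow> _) \<in> borel_measurable borel"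
    by (intro borel_measurable_continuous_onI linear_continuous_on bounded_linear_relabel)
  have "relabel -` box l u = box (unlabel l) (unlabel u)"
  proof -
    have "(\<forall>i. l $ i < x $ Rep_ordered_copy i \<and> x $ Rep_ordered_copy i < u $ i)
        \<longleftrightarrow> (\<forall>j. l $ Abs_ordered_copy j < x $ j \<and> x $ j < u $ Abs_ordered_copy j)" for x :: "real^'n"
      by (metis Abs_ordered_copy_inverse Rep_ordered_copy_inverse UNIV_I)
    then show ?thesis by (auto simp: mem_box_cart)
  qed
  then have "emeasure (distr lborel borel relabel) (box l u) = emeasure lborel (box (unlabel l) (unlabel u :: real^'n))"
    using m by (subst emeasure_distr) auto
  also have "\<dots> = ennreal (\<Prod>b\<in>Basis. (unlabel u - unlabel l :: real^'n) \<bullet> b)"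
  proof (rule emeasure_lborel_box)
    fix b :: "real^'n" assume "b \<in> Basis"
    then obtain j where b: "b = axis j 1" by (auto simp: Basis_vec_def)
    have "l \<bullet> axis (Abs_ordered_copy j) 1 \<le> u \<bullet> axis (Abs_ordered_copy j) 1" by (rule lu) (auto simp: Basis_vec_def)
    then show "unlabel l \<bullet> b \<le> unlabel u \<bullet> b" by (simp add: b inner_axis)
  qed
  also have "(\<Prod>b\<in>Basis. (unlabel u - unlabel l :: real^'n) \<bullet> b) = (\<Prod>b\<in>Basis. (u - l) \<bullet> b)"
    unfolding prod_Basis_cart
    by (subst prod.reindex_bij_betw[OF bij_Rep_ordered_copy, symmetric]) (simp add: Rep_ordered_copy_inverse)
  finally show "emeasure (distr lborel borel relabel) (box l u) = ennreal (\<Prod>b\<in>Basis. (u - l) \<bullet> b)" .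
qed simp

lemma cell_integral_relabel:
  fixes F :: "real^'n::finite \<Rightarrow> real"
  assumes "continuous_on UNIV F"
  shows "(LINT y:cell L|lborel. F (unlabel y)) = (LINT x:cell L|lborel. F x)"
proof -
  have m: "(relabel :: real^'n \<Rightarrow> _) \<in> borel_measurable borel" "(unlabel :: _ \<Rightarrow> real^'n) \<in> borel_measurable borel"
    by (intro borel_measurable_continuous_onI linear_continuous_on bounded_linear_relabel bounded_linear_unlabel)+
  have c: "(relabel x \<in> cell L) = (x \<in> cell L)" for x :: "real^'n"
    unfolding cell_def by simp (metis Abs_ordered_copy_inverse UNIV_I)
  have "(LINT y:cell L|lborel. F (unlabel y)) = (LINT y|distr lborel borel (relabel :: real^'n \<Rightarrow> _). indicator (cell L) y *\<^sub>R F (unlabel y))"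
    by (simp add: set_lebesgue_integral_def lborel_relabel[symmetric])
  also have "\<dots> = (LINT x|lborel. indicator (cell L) (relabel x) *\<^sub>R F (unlabel (relabel x)))"
  proof (rule integral_distr)
    have "F \<in> borel_measurable borel" by (rule borel_measurable_continuous_onI[OF assms])
    then have "(\<lambda>y. F (unlabel y)) \<in> borel_measurable borel" using m(2) by measurable
    then show "(\<lambda>y. indicator (cell L) y *\<^sub>R F (unlabel y)) \<in> borel_measurable borel"
      by (intro borel_measurable_scaleR borel_measurable_indicator) auto
  qed (use m in auto)
  also have "\<dots> = (LINT x:cell L|lborel. F x)" by (simp add: set_lebesgue_integral_def c indicator_def)
  finally show ?thesis .
qed

lemma transported_integral_le:
  fixes V :: "real^'n::finite \<Rightarrow> real^'n" and f :: "real^'n \<Rightarrow> real"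
  assumes L: "L > 0" and V: "C1_space V" "periodic L V" "\<And>i x. norm (spartial i V x) \<le> K"
    and f: "continuous_on UNIV f" "periodic L f" "\<And>x. f x \<ge> 0"
    and h: "0 < h" "jacobian_const TYPE('n) K * h \<le> 1/2"
  shows "(LINT x:cell L|lborel. f (x - h *\<^sub>R V x)) \<le> (1 + 2 * jacobian_const TYPE('n) K * h) * (LINT x:cell L|lborel. f x)"
proof -
  interpret r: bounded_linear "relabel :: real^'n \<Rightarrow> _" by (rule bounded_linear_relabel)
  interpret u: bounded_linear "unlabel :: _ \<Rightarrow> real^'n" by (rule bounded_linear_unlabel)
  let ?V = "\<lambda>y. relabel (V (unlabel y))"
  have cu: "continuous_on UNIV (unlabel :: _ \<Rightarrow> real^'n)" by (rule linear_continuous_on[OF bounded_linear_unlabel])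
  have J: "jacobian_const TYPE('n ordered_copy) K = jacobian_const TYPE('n) K" by (simp add: jacobian_const_def card_ordered_copy)
  have d: "((\<lambda>s. ?V (y + s *\<^sub>R axis i 1)) has_vector_derivative relabel (spartial (Rep_ordered_copy i) V (unlabel y))) (at 0)" for y i
    unfolding u.add u.scaleR unlabel_axis
    by (intro r.has_vector_derivative has_spartialD) (use V(1) in \<open>auto simp: C1_space_def\<close>)
  have sp: "spartial i ?V = (\<lambda>y. relabel (spartial (Rep_ordered_copy i) V (unlabel y)))" for i
    using has_spartialI(2)[OF d] by (simp add: fun_eq_iff)
  have comp: "continuous_on UNIV (\<lambda>y. G (unlabel y))" if "continuous_on UNIV G" for G :: "real^'n \<Rightarrow> 'c::topological_space"
    by (rule continuous_on_compose2[OF that cu]) auto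
  have "C1_space ?V"
    unfolding C1_space_def sp using V(1) has_spartialI(1)[OF d]
    by (auto simp: C1_space_def intro!: r.continuous_on comp)
  moreover have "periodic L ?V" "periodic L (\<lambda>y. f (unlabel y))"
    using V(2) f(2) by (auto simp: periodic_def u.add u.scaleR unlabel_axis)
  ultimately have "(LINT y:cell L|lborel. f (unlabel (y - h *\<^sub>R ?V y))) \<le> (1 + 2 * jacobian_const TYPE('n) K * h) * (LINT y:cell L|lborel. f (unlabel y))"
    using transported_integral_le_wellorder[OF L, of ?V K "\<lambda>y. f (unlabel y)" h] V(3) f h
    by (simp add: J sp norm_relabel comp)
  then show ?thesis
    unfolding cell_integral_relabel[OF f(1)] u.diff u.scaleR relabel_inverse
    by (subst (asm) cell_integral_relabel[of "\<lambda>x. f (x - h *\<^sub>R V x)"])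
       (use V(1) in \<open>auto simp: C1_space_def intro!: continuous_on_compose2[OF f(1)] continuous_intros\<close>)
qed

section \<open>Hoelder continuity of Wiener paths\<close>

text \<open>The dyadic level at which two points at distance \<open>d\<close> lie in the same or in neighbouring
  intervals.\<close>

lemma dyadic_scale:
  fixes d T :: real
  assumes "0 < d" "d \<le> T"
  obtains m :: nat where "T / 2 ^ Suc m < d" "d \<le> T / 2 ^ m"
proof -
  have "\<exists>n::nat. T / d < 2 ^ n" by (rule real_arch_pow) simp
  then have ex: "\<exists>n::nat. T / 2 ^ n < d" using assms by (simp add: field_simps)
  define n where "n = (LEAST n. T / 2 ^ n < d)"
  have n: "T / 2 ^ n < d" unfolding n_def by (rule LeastI_ex[OF ex])
  have "n \<noteq> 0" using n assms by (intro notI) simp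
  then obtain m where m: "n = Suc m" by (cases n) auto
  have "\<not> T / 2 ^ m < d" using not_less_Least[of m "\<lambda>n. T / 2 ^ n < d"] m by (auto simp: n_def)
  then show ?thesis using that[of m] n m by auto
qed

text \<open>Chaining: a point is the limit of its dyadic lower approximations, and consecutive
  approximations are equal or neighbours on the finer grid, so increments sum geometrically.\<close>

lemma hoelder_of_dyadic:
  fixes f :: "real \<Rightarrow> 'b::real_normed_vector"
  assumes cont: "continuous_on {0..T} f" and T: "T > 0" and \<alpha>: "\<alpha> > 0" and K: "K \<ge> 0"
    and dy: "\<And>m j. j < 2 ^ m \<Longrightarrow> norm (f (T * real (Suc j) / 2 ^ m) - f (T * real j / 2 ^ m)) \<le> K * (2 powr (-\<alpha>)) ^ m"
  obtains C where "C \<ge> 0" "\<And>s t. s \<in> {0..T} \<Longrightarrow> t \<in> {0..T} \<Longrightarrow> norm (f t - f s) \<le> C * \<bar>t - s\<bar> powr \<alpha>"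
proof -
  define q where "q = 2 powr (-\<alpha>)"
  have q: "0 < q" "q < 1" using \<alpha> by (auto simp: q_def powr_less_one)
  define g where "g m t = nat \<lfloor>2 ^ m * t / T\<rfloor>" for m :: nat and t
  \<comment> \<open>The lower approximation of \<open>t\<close> on the grid of level \<open>m\<close>.\<close>
  define p where "p m t = T * real (g m t) / 2 ^ m" for m t
  have g: "real (g m t) \<le> 2 ^ m * t / T" "2 ^ m * t / T < real (g m t) + 1" "g m t \<le> 2 ^ m" if "t \<in> {0..T}" for m t
  proof -
    have nn: "0 \<le> 2 ^ m * t / T" using that T by simp
    have le: "2 ^ m * t / T \<le> 2 ^ m" using that T by (simp add: field_simps)
    show 1: "real (g m t) \<le> 2 ^ m * t / T" using nn unfolding g_def by simp
    show "2 ^ m * t / T < real (g m t) + 1" using nn unfolding g_def by linarith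
    have "real (g m t) \<le> 2 ^ m" using 1 le by (rule order.trans)
    then show "g m t \<le> 2 ^ m" by (simp only: of_nat_le_numeral_power_cancel_iff)
  qed
  have p: "p m t \<le> t" "t - T / 2 ^ m < p m t" "p m t \<in> {0..T}" if "t \<in> {0..T}" for m t
  proof -
    show 1: "p m t \<le> t" using g(1)[OF that, of m] T by (simp add: p_def field_simps)
    have "t * 2 ^ m < T * (real (g m t) + 1)"
      using g(2)[OF that, of m] unfolding pos_divide_less_eq[OF T] by (simp only: mult.commute)
    then have "t < T * (real (g m t) + 1) / 2 ^ m" by (simp add: pos_less_divide_eq)
    then show "t - T / 2 ^ m < p m t" by (simp add: p_def distrib_left add_divide_distrib)
    have "0 \<le> p m t" using T by (simp add: p_def)
    then show "p m t \<in> {0..T}" using 1 that by auto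
  qed
  have nb: "norm (f (T * real b / 2 ^ m) - f (T * real a / 2 ^ m)) \<le> K * q ^ m" if "a \<le> b" "b \<le> Suc a" "b \<le> 2 ^ m" for a b m
  proof (cases "b = a")
    case False
    then have "b = Suc a" using that by auto
    then show ?thesis using dy[of a m] that by (simp add: q_def)
  qed (use K q in auto)
  have step: "norm (f (p (Suc m) t) - f (p m t)) \<le> K * q ^ Suc m" if t: "t \<in> {0..T}" for m t
  proof -
    have a: "2 * real (g m t) < real (g (Suc m) t) + 1" using g(1)[OF t, of m] g(2)[OF t, of "Suc m"] by simp
    have b: "real (g (Suc m) t) < 2 * (real (g m t) + 1)" using g(2)[OF t, of m] g(1)[OF t, of "Suc m"] by simp
    have "real (2 * g m t) < real (g (Suc m) t + 1)" "real (g (Suc m) t) < real (2 * g m t + 2)" using a b by simp_all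
    then have "2 * g m t \<le> g (Suc m) t" "g (Suc m) t \<le> Suc (2 * g m t)" by (simp_all only: of_nat_less_iff)
    from nb[OF this g(3)[OF t]] show ?thesis by (simp add: p_def)
  qed
  have chain: "norm (f (p (m + l) t) - f (p m t)) \<le> K * q ^ m / (1 - q)" if t: "t \<in> {0..T}" for m l t
  proof -
    have "norm (f (p (m + l) t) - f (p m t)) \<le> K * q ^ m * (1 - q ^ l) / (1 - q)"
    proof (induction l)
      case (Suc l)
      have "norm (f (p (m + Suc l) t) - f (p m t)) \<le> K * q ^ Suc (m + l) + K * q ^ m * (1 - q ^ l) / (1 - q)"
        using norm_triangle_le[OF add_mono[OF step[OF t, of "m + l"] Suc]] by simp
      also have "K * q ^ Suc (m + l) \<le> K * q ^ (m + l)" using K q by (intro mult_left_mono) (auto simp: mult_left_le_one_le)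
      also have "K * q ^ (m + l) + K * q ^ m * (1 - q ^ l) / (1 - q) = K * q ^ m * (1 - q ^ Suc l) / (1 - q)"
        using q by (simp add: field_simps power_add)
      finally show ?case by simp
    qed simp
    also have "\<dots> \<le> K * q ^ m / (1 - q)"
      using K q by (intro divide_right_mono) (auto simp: mult_left_le)
    finally show ?thesis .
  qed
  have lim: "norm (f t - f (p m t)) \<le> K * q ^ m / (1 - q)" if t: "t \<in> {0..T}" for m t
  proof -
    have "(\<lambda>l. p (m + l) t) \<longlonglongrightarrow> t"
    proof (rule tendsto_sandwich[of "\<lambda>l. t - T / 2 ^ (m + l)" _ _ "\<lambda>l. t"])
      have "(\<lambda>l. t - (T / 2 ^ m) * (1 / 2) ^ l) \<longlonglongrightarrow> t - (T / 2 ^ m) * 0"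
        by (intro tendsto_intros LIMSEQ_realpow_zero) auto
      then show "(\<lambda>l. t - T / 2 ^ (m + l)) \<longlonglongrightarrow> t" by (simp add: power_add power_divide)
    qed (use p[OF t] in \<open>auto intro!: always_eventually less_imp_le\<close>)
    then have "(\<lambda>l. f (p (m + l) t)) \<longlonglongrightarrow> f t"
      using cont p(3)[OF t] t by (intro continuous_on_tendsto_compose[OF cont]) auto
    then have "(\<lambda>l. norm (f (p (m + l) t) - f (p m t))) \<longlonglongrightarrow> norm (f t - f (p m t))"
      by (intro tendsto_intros)
    then show ?thesis by (rule LIMSEQ_le_const2) (use chain[OF t] in auto)
  qed
  \<comment> \<open>Two chains of sum \<open>K q^m / (1 - q)\<close> and one step between neighbours; \<open>(2 / T) powr \<alpha>\<close> converts the level \<open>m\<close> into the distance.\<close>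
  define C where "C = (K * (2 / (1 - q) + 1)) * (2 / T) powr \<alpha>"
  have C: "C \<ge> 0" using K q by (simp add: C_def)
  have main: "norm (f t - f s) \<le> C * (t - s) powr \<alpha>" if st: "s \<in> {0..T}" "t \<in> {0..T}" "s < t" for s t
  proof -
    obtain m where m: "T / 2 ^ Suc m < t - s" "t - s \<le> T / 2 ^ m" using dyadic_scale[of "t - s" T] st by auto
    have le: "g m s \<le> g m t" unfolding g_def using st T by (intro nat_mono floor_mono divide_right_mono mult_left_mono) auto
    have "2 ^ m * t / T - 2 ^ m * s / T \<le> 1" using m(2) T by (simp add: field_simps)
    then have "real (g m t) < real (g m s) + 2" using g(1)[OF st(2), of m] g(2)[OF st(1), of m] by linarith
    then have "norm (f (p m t) - f (p m s)) \<le> K * q ^ m"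
      unfolding p_def by (intro nb le g st) linarith
    then have "norm (f t - f s) \<le> K * q ^ m / (1 - q) + K * q ^ m + K * q ^ m / (1 - q)"
      using lim[OF st(1), of m] lim[OF st(2), of m]
        norm_triangle_ineq[of "f t - f (p m t)" "f (p m t) - f (p m s)"]
        norm_triangle_ineq[of "f t - f (p m s)" "f (p m s) - f s"] norm_minus_commute[of "f s" "f (p m s)"] by simp
    also have "\<dots> = (K * (2 / (1 - q) + 1)) * q ^ m" by (simp add: divide_inverse algebra_simps)
    also have "\<dots> \<le> (K * (2 / (1 - q) + 1)) * ((2 / T) * (t - s)) powr \<alpha>"
    proof (rule mult_left_mono)
      have "q ^ m = (1 / 2 ^ m) powr \<alpha>" unfolding q_def
        by (simp add: powr_realpow[symmetric] powr_powr powr_divide powr_minus_divide mult.commute)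
      also have "\<dots> \<le> ((2 / T) * (t - s)) powr \<alpha>"
        using m(1) T \<alpha> by (intro powr_mono2) (auto simp: field_simps)
      finally show "q ^ m \<le> ((2 / T) * (t - s)) powr \<alpha>" .
    qed (use K q in auto)
    also have "((2 / T) * (t - s)) powr \<alpha> = (2 / T) powr \<alpha> * (t - s) powr \<alpha>"
      using st T by (intro powr_mult; simp)
    also have "(K * (2 / (1 - q) + 1)) * ((2 / T) powr \<alpha> * (t - s) powr \<alpha>) = C * (t - s) powr \<alpha>"
      by (simp add: C_def)
    finally show ?thesis .
  qed
  show ?thesis
  proof (rule that[OF C])
    fix s t assume st: "s \<in> {0..T}" "t \<in> {0..T}"
    show "norm (f t - f s) \<le> C * \<bar>t - s\<bar> powr \<alpha>"
      using main[of s t] main[of t s] st C by (cases s t rule: linorder_cases) (auto simp: norm_minus_commute)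
  qed
qed

lemma normal_even_moment:
  assumes "distributed M lborel Y (normal_density 0 s)" "s > 0"
  shows "(\<integral>\<^sup>+\<omega>. ennreal (Y \<omega> ^ (2 * p)) \<partial>M) = ennreal (fact (2 * p) / (2 ^ p * fact p) * (s\<^sup>2) ^ p)"
proof -
  have "(\<integral>\<^sup>+\<omega>. ennreal (Y \<omega> ^ (2 * p)) \<partial>M) = (\<integral>\<^sup>+x. ennreal (normal_density 0 s x) * ennreal (x ^ (2 * p)) \<partial>lborel)"
    by (rule distributed_nn_integral[OF assms(1), symmetric]) simp
  also have "\<dots> = (\<integral>\<^sup>+x. ennreal (normal_density 0 s x * x ^ (2 * p)) \<partial>lborel)"
    by (simp add: ennreal_mult)
  also have "\<dots> = ennreal (fact (2 * p) / ((2 / s\<^sup>2) ^ p * fact p))"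
  proof -
    have hb: "has_bochner_integral lborel (\<lambda>x. normal_density 0 s x * x ^ (2 * p)) (fact (2 * p) / ((2 / s\<^sup>2) ^ p * fact p))"
      using normal_moment_even[OF assms(2), of 0 p] by (simp only: diff_0_right)
    then have i: "integrable lborel (\<lambda>x. normal_density 0 s x * x ^ (2 * p))"
      "integral\<^sup>L lborel (\<lambda>x. normal_density 0 s x * x ^ (2 * p)) = fact (2 * p) / ((2 / s\<^sup>2) ^ p * fact p)"
      by (auto simp: has_bochner_integral_iff)
    show ?thesis by (subst nn_integral_eq_integral[OF i(1)]) (simp_all add: i(2))
  qed
  finally show ?thesis using assms(2) by (simp add: power_divide field_simps)
qed

text \<open>The weighted sum of the even moments of order \<open>2 p\<close> over all dyadic increments converges as
  soon as \<open>p (1 - 2 \<alpha>) > 1\<close>; then almost surely the sum is finite and dominates the power \<open>2 p\<close> of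
  each weighted increment.\<close>

lemma dyadic_increments_bounded:
  assumes M: "prob_space M" and T: "T > 0" and \<alpha>: "\<alpha> < 1/2"
    and N: "\<And>s t. 0 \<le> s \<Longrightarrow> s < t \<Longrightarrow> t \<le> T \<Longrightarrow> distributed M lborel (\<lambda>\<omega>. W t \<omega> - W s \<omega>) (normal_density 0 (sqrt (t - s)))"
  shows "AE \<omega> in M. \<exists>K\<ge>0. \<forall>m j. j < 2 ^ m \<longrightarrow>
    \<bar>W (T * real (Suc j) / 2 ^ m) \<omega> - W (T * real j / 2 ^ m) \<omega>\<bar> \<le> K * (2 powr (-\<alpha>)) ^ m"
proof -
  obtain p :: nat where p: "1 / (1 - 2 * \<alpha>) < real p" using reals_Archimedean2 by blast
  have p1: "1 < real p * (1 - 2 * \<alpha>)" using p \<alpha> by (simp add: field_simps)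
  have "p \<noteq> 0" using p1 by (intro notI) simp
  then have p0: "p \<ge> 1" by simp
  define D where "D m j \<omega> = W (T * real (Suc j) / 2 ^ m) \<omega> - W (T * real j / 2 ^ m) \<omega>" for m j \<omega>
  define a where "a = 2 powr \<alpha>"
  define c where "c = fact (2 * p) / (2 ^ p * fact p) * T ^ p"
  have c: "c \<ge> 0" using T by (simp add: c_def)
  have dist: "distributed M lborel (D m j) (normal_density 0 (sqrt (T / 2 ^ m)))" if "j < 2 ^ m" for m j
  proof -
    have "real (Suc j) \<le> 2 ^ m" using that by (metis Suc_leI of_nat_le_iff of_nat_numeral of_nat_power)
    then have "T * real (Suc j) / 2 ^ m \<le> T" using mult_left_mono[of "real (Suc j)" "2 ^ m" T] T by (simp add: field_simps)
    moreover have "T * real (Suc j) / 2 ^ m - T * real j / 2 ^ m = T / 2 ^ m" by (simp add: field_simps)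
    ultimately show ?thesis unfolding D_def using N[of "T * real j / 2 ^ m" "T * real (Suc j) / 2 ^ m"] T
      by (simp add: divide_strict_right_mono)
  qed
  have mom: "(\<integral>\<^sup>+\<omega>. ennreal ((a ^ m * D m j \<omega>) ^ (2 * p)) \<partial>M) = ennreal (c * ((a ^ 2 / 2) ^ p) ^ m)" if "j < 2 ^ m" for m j
  proof -
    have [measurable]: "D m j \<in> borel_measurable M" using distributed_measurable[OF dist[OF that]] by simp
    have "(\<integral>\<^sup>+\<omega>. ennreal ((a ^ m * D m j \<omega>) ^ (2 * p)) \<partial>M) = ennreal ((a ^ m) ^ (2 * p)) * (\<integral>\<^sup>+\<omega>. ennreal (D m j \<omega> ^ (2 * p)) \<partial>M)"
      by (subst nn_integral_cmult[symmetric]) (auto simp: power_mult_distrib ennreal_mult a_def)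
    also have "\<dots> = ennreal ((a ^ m) ^ (2 * p)) * ennreal (fact (2 * p) / (2 ^ p * fact p) * (T / 2 ^ m) ^ p)"
      using T by (subst normal_even_moment[OF dist[OF that]]) auto
    also have "\<dots> = ennreal (c * ((a ^ 2 / 2) ^ p) ^ m)"
      using T by (subst ennreal_mult[symmetric])
        (auto simp: c_def power_divide power_mult_distrib power_mult[symmetric] mult.commute mult.left_commute a_def)
    finally show ?thesis .
  qed
  \<comment> \<open>The ratio of the moment sums of consecutive levels: twice as many increments, each moment multiplied by \<open>(a^2 / 2) ^ p\<close>.\<close>
  define r where "r = 2 * (a ^ 2 / 2) ^ p"
  have "a ^ 2 / 2 = 2 powr (2 * \<alpha> - 1)" by (simp add: a_def powr_diff powr_power)
  then have "r = 2 powr (1 + (2 * \<alpha> - 1) * real p)"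
    unfolding r_def by (simp only: powr_power powr_add) (simp add: mult.commute)
  also have "\<dots> < 1" using p1 by (intro powr_less_one) (auto simp: algebra_simps)
  finally have r: "0 \<le> r" "r < 1" by (auto simp: r_def a_def)
  define Y where "Y m j \<omega> = (if j < 2 ^ m then ennreal ((a ^ m * D m j \<omega>) ^ (2 * p)) else 0)" for m j \<omega>
  have [measurable]: "Y m j \<in> borel_measurable M" for m j
  proof (cases "j < 2 ^ m")
    case True
    have [measurable]: "D m j \<in> borel_measurable M" using distributed_measurable[OF dist[OF True]] by simp
    show ?thesis unfolding Y_def[abs_def] by measurable
  qed (simp add: Y_def[abs_def])
  define S where "S \<omega> = (\<Sum>m. \<Sum>j<2^m. Y m j \<omega>)" for \<omega>
  have "(\<integral>\<^sup>+\<omega>. S \<omega> \<partial>M) = (\<Sum>m. \<Sum>j<2^m. \<integral>\<^sup>+\<omega>. Y m j \<omega> \<partial>M)"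
    unfolding S_def by (subst nn_integral_suminf) (auto simp: nn_integral_sum)
  also have "\<dots> = (\<Sum>m. ennreal (c * r ^ m))"
  proof (rule suminf_cong)
    fix m
    have "(\<Sum>j<2^m. \<integral>\<^sup>+\<omega>. Y m j \<omega> \<partial>M)
       = (\<Sum>j<(2::nat)^m. ennreal (c * ((a ^ 2 / 2) ^ p) ^ m))"
      by (intro sum.cong) (auto simp: mom Y_def)
    also have "\<dots> = ennreal (c * r ^ m)"
      using c by (simp add: ennreal_of_nat_eq_real_of_nat ennreal_mult[symmetric] r_def power_mult_distrib a_def mult.left_commute)
    finally show "(\<Sum>j<2^m. \<integral>\<^sup>+\<omega>. Y m j \<omega> \<partial>M) = ennreal (c * r ^ m)" .
  qed
  also have "\<dots> = ennreal (\<Sum>m. c * r ^ m)"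
    using r c by (intro suminf_ennreal2 summable_mult summable_geometric) auto
  also have "\<dots> < top" by simp
  finally have "(\<integral>\<^sup>+\<omega>. S \<omega> \<partial>M) \<noteq> \<infinity>" by simp
  moreover have "S \<in> borel_measurable M" unfolding S_def by measurable
  ultimately have "AE \<omega> in M. S \<omega> \<noteq> \<infinity>" by (intro nn_integral_PInf_AE)
  then show ?thesis
  proof eventually_elim
    fix \<omega> assume fin: "S \<omega> \<noteq> \<infinity>"
    have "\<bar>W (T * real (Suc j) / 2 ^ m) \<omega> - W (T * real j / 2 ^ m) \<omega>\<bar> \<le> max 1 (enn2real (S \<omega>)) * (2 powr (-\<alpha>)) ^ m"
      if j: "j < 2 ^ m" for m j :: nat
    proof -
      let ?y = "a ^ m * D m j \<omega>"
      have "ennreal (?y ^ (2 * p)) \<le> (\<Sum>j<2^m. Y m j \<omega>)"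
        using member_le_sum[of j "{..<2^m}" "\<lambda>j. Y m j \<omega>"] j by (simp add: Y_def)
      also have "\<dots> \<le> S \<omega>" unfolding S_def
        by (rule order.trans[OF _ sum_le_suminf[of _ "{m}"]]) auto
      finally have "?y ^ (2 * p) \<le> enn2real (S \<omega>)"
        using fin ennreal_enn2real[of "S \<omega>"] ennreal_le_iff[OF enn2real_nonneg, of _ "S \<omega>"]
        by (simp add: less_top)
      moreover have "\<bar>?y\<bar> \<le> max 1 (\<bar>?y\<bar> ^ (2 * p))"
        using self_le_power[of "\<bar>?y\<bar>" "2 * p"] p0 by (cases "1 \<le> \<bar>?y\<bar>") auto
      ultimately have "\<bar>?y\<bar> \<le> max 1 (enn2real (S \<omega>))" by (auto simp: power_even_abs)
      then have "a ^ m * \<bar>D m j \<omega>\<bar> \<le> max 1 (enn2real (S \<omega>))" by (simp add: abs_mult a_def)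
      then have "\<bar>D m j \<omega>\<bar> \<le> max 1 (enn2real (S \<omega>)) / a ^ m" by (simp add: field_simps a_def)
      also have "\<dots> = max 1 (enn2real (S \<omega>)) * (2 powr (-\<alpha>)) ^ m"
        by (simp add: a_def powr_minus_divide power_divide)
      finally show ?thesis unfolding D_def .
    qed
    then show "\<exists>K\<ge>0. \<forall>m j. j < 2 ^ m \<longrightarrow>
      \<bar>W (T * real (Suc j) / 2 ^ m) \<omega> - W (T * real j / 2 ^ m) \<omega>\<bar> \<le> K * (2 powr (-\<alpha>)) ^ m"
      by (intro exI[of _ "max 1 (enn2real (S \<omega>))"]) auto
  qed
qed

lemma wiener_paths_hoelder:
  fixes w :: "real \<Rightarrow> 'a \<Rightarrow> real^'q::finite"
  assumes M: "prob_space M" and w: "standard_wiener_process M T w" and T: "T > 0" and \<alpha>: "0 < \<alpha>" "\<alpha> < 1/2"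
  shows "AE \<omega> in M. \<exists>K\<ge>0. \<forall>s\<in>{0..T}. \<forall>t\<in>{0..T}. norm (w t \<omega> - w s \<omega>) \<le> K * \<bar>t - s\<bar> powr \<alpha>"
proof -
  have "AE \<omega> in M. \<exists>K\<ge>0. \<forall>m j. j < 2 ^ m \<longrightarrow>
    \<bar>w (T * real (Suc j) / 2 ^ m) \<omega> $ r - w (T * real j / 2 ^ m) \<omega> $ r\<bar> \<le> K * (2 powr (-\<alpha>)) ^ m" for r
    using w T \<alpha> unfolding standard_wiener_process_def
    by (intro dyadic_increments_bounded[OF M, where W="\<lambda>t \<omega>. w t \<omega> $ r"]) auto
  then have "AE \<omega> in M. \<forall>r. \<exists>K\<ge>0. \<forall>m j. j < 2 ^ m \<longrightarrow>
    \<bar>w (T * real (Suc j) / 2 ^ m) \<omega> $ r - w (T * real j / 2 ^ m) \<omega> $ r\<bar> \<le> K * (2 powr (-\<alpha>)) ^ m"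
    by (simp add: AE_all_countable)
  moreover have "AE \<omega> in M. continuous_on {0..T} (\<lambda>t. w t \<omega>)"
    using w by (simp add: standard_wiener_process_def)
  ultimately show ?thesis
  proof eventually_elim
    fix \<omega> assume 1: "\<forall>r. \<exists>K\<ge>0. \<forall>m j. j < 2 ^ m \<longrightarrow>
      \<bar>w (T * real (Suc j) / 2 ^ m) \<omega> $ r - w (T * real j / 2 ^ m) \<omega> $ r\<bar> \<le> K * (2 powr (-\<alpha>)) ^ m"
      and c: "continuous_on {0..T} (\<lambda>t. w t \<omega>)"
    from 1 obtain K where K: "\<And>r. K r \<ge> 0" "\<And>r m j. j < 2 ^ m \<Longrightarrow>
      \<bar>w (T * real (Suc j) / 2 ^ m) \<omega> $ r - w (T * real j / 2 ^ m) \<omega> $ r\<bar> \<le> K r * (2 powr (-\<alpha>)) ^ m"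
      by metis
    have "norm (w (T * real (Suc j) / 2 ^ m) \<omega> - w (T * real j / 2 ^ m) \<omega>) \<le> (\<Sum>r\<in>UNIV. K r) * (2 powr (-\<alpha>)) ^ m"
      if "j < 2 ^ m" for m j
      using K(2)[OF that] unfolding sum_distrib_right
      by (intro order.trans[OF norm_le_l1_cart] sum_mono) simp
    then obtain C where "C \<ge> 0" "\<And>s t. s \<in> {0..T} \<Longrightarrow> t \<in> {0..T} \<Longrightarrow> norm (w t \<omega> - w s \<omega>) \<le> C * \<bar>t - s\<bar> powr \<alpha>"
      using hoelder_of_dyadic[OF c T \<alpha>(1), of "\<Sum>r\<in>UNIV. K r"] K(1) by (metis sum_nonneg)
    then show "\<exists>K\<ge>0. \<forall>s\<in>{0..T}. \<forall>t\<in>{0..T}. norm (w t \<omega> - w s \<omega>) \<le> K * \<bar>t - s\<bar> powr \<alpha>" by blast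
  qed
qed

section \<open>The Ito integral of a deterministic integrand\<close>

lemma space_natural_filtration [simp]: "space (natural_filtration M w t) = space M"
  unfolding natural_filtration_def by (rule space_measure_of) auto

lemma sets_natural_filtration:
  "sets (natural_filtration M w t) = sigma_sets (space M) (\<Union>s\<in>{0..t}. {w s -` A \<inter> space M | A. A \<in> sets borel})"
  unfolding natural_filtration_def by (rule sets_measure_of) auto

lemma natural_filtration_mono: "s \<le> t \<Longrightarrow> sets (natural_filtration M w s) \<subseteq> sets (natural_filtration M w t)"
  unfolding sets_natural_filtration by (intro sigma_sets_mono') fastforce

lemma natural_filtration_subalgebra:
  assumes "\<And>s. s \<in> {0..t} \<Longrightarrow> w s \<in> borel_measurable M"
  shows "sets (natural_filtration M w t) \<subseteq> sets M"
  unfolding sets_natural_filtration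
  by (rule sets.sigma_sets_subset) (use assms in \<open>auto intro: measurable_sets\<close>)

lemma natural_filtration_adapted:
  assumes "0 \<le> s" "s \<le> t"
  shows "w s \<in> borel_measurable (natural_filtration M w t)"
proof (rule measurableI)
  fix A :: "'b set" assume "A \<in> sets borel"
  then show "w s -` A \<inter> space (natural_filtration M w t) \<in> sets (natural_filtration M w t)"
    unfolding sets_natural_filtration space_natural_filtration using assms
    by (intro sigma_sets.Basic UN_I[of s]) auto
qed simp

lemma natural_filtration_measurable_mono:
  assumes "X \<in> borel_measurable (natural_filtration M w s)" "s \<le> t"
  shows "X \<in> borel_measurable (natural_filtration M w t)"
  using assms(1) natural_filtration_mono[OF assms(2), of M w] unfolding measurable_def by auto

locale wiener_component =
  prob_space M for M :: "'a measure" +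
  fixes T :: real and w :: "real \<Rightarrow> 'a \<Rightarrow> real^'q::finite" and r :: 'q
  assumes wiener: "standard_wiener_process M T w"
begin

abbreviation "F \<equiv> natural_filtration M w"
abbreviation "W s \<omega> \<equiv> w s \<omega> $ r"

lemma w_measurable: "s \<in> {0..T} \<Longrightarrow> w s \<in> borel_measurable M"
  using wiener by (simp add: standard_wiener_process_def)

lemma component_measurable: "(\<lambda>x::real^'q. x $ r) \<in> borel_measurable borel"
  by (intro borel_measurable_continuous_onI continuous_intros)

lemma W_measurable: "s \<in> {0..T} \<Longrightarrow> W s \<in> borel_measurable M"
  by (rule measurable_compose[OF w_measurable component_measurable])

lemma F_subset: "s \<le> T \<Longrightarrow> X \<in> borel_measurable (F s) \<Longrightarrow> X \<in> borel_measurable M"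
  using natural_filtration_subalgebra[of s w M] w_measurable by (auto simp: measurable_def)

lemma W_adapted: "0 \<le> s \<Longrightarrow> s \<le> t \<Longrightarrow> W s \<in> borel_measurable (F t)"
  by (rule measurable_compose[OF natural_filtration_adapted component_measurable])

text \<open>The increment of the whole vector is independent of the past, hence so is every function of one
  of its components.\<close>

lemma increment_indep:
  assumes st: "0 \<le> s" "s < t" "t \<le> T" and X: "X \<in> borel_measurable (F s)" and f: "f \<in> borel_measurable borel"
  shows "indep_var borel X borel (\<lambda>\<omega>. f (W t \<omega> - W s \<omega>) :: real)"
proof -
  have ind: "indep_set (sets (F s)) (sets (vimage_algebra (space M) (\<lambda>\<omega>. w t \<omega> - w s \<omega>) borel))"
    using wiener st by (simp add: standard_wiener_process_def)
  have m: "(\<lambda>\<omega>. w t \<omega> - w s \<omega>) \<in> borel_measurable M" using w_measurable st by simp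
  have Xm: "random_variable borel X" using F_subset[OF _ X] st by simp
  have fm: "(\<lambda>y::real^'q. f (y $ r)) \<in> borel_measurable borel" using f by measurable
  have Ym: "random_variable borel (\<lambda>\<omega>. f (W t \<omega> - W s \<omega>))"
    using measurable_compose[OF m fm] by simp
  have "indep_set (sigma_sets (space M) {X -` A \<inter> space M |A. A \<in> sets borel})
     (sigma_sets (space M) {(\<lambda>\<omega>. f (W t \<omega> - W s \<omega>)) -` A \<inter> space M |A. A \<in> sets borel})"
    using ind unfolding indep_set_def
  proof (rule indep_sets_mono_sets)
    fix b :: bool
    have 1: "sigma_sets (space M) {X -` A \<inter> space M |A. A \<in> sets borel} \<subseteq> sets (F s)"
      using sets.sigma_sets_subset[of "{X -` A \<inter> space M |A. A \<in> sets borel}" "F s"] measurable_sets[OF X] by auto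
    have 2: "sigma_sets (space M) {(\<lambda>\<omega>. f (W t \<omega> - W s \<omega>)) -` A \<inter> space M |A. A \<in> sets borel}
      \<subseteq> sets (vimage_algebra (space M) (\<lambda>\<omega>. w t \<omega> - w s \<omega>) borel)"
    proof -
      have "(\<lambda>\<omega>. f (W t \<omega> - W s \<omega>)) -` A \<inter> space M \<in> sets (vimage_algebra (space M) (\<lambda>\<omega>. w t \<omega> - w s \<omega>) borel)"
        if "A \<in> sets borel" for A
      proof -
        have "(\<lambda>\<omega>. f (W t \<omega> - W s \<omega>)) -` A \<inter> space M = (\<lambda>\<omega>. w t \<omega> - w s \<omega>) -` ((\<lambda>y. f (y $ r)) -` A) \<inter> space M" by auto
        then show ?thesis using measurable_sets[OF fm that] by (auto intro!: in_vimage_algebra)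
      qed
      then show ?thesis
        using sets.sigma_sets_subset[of "{(\<lambda>\<omega>. f (W t \<omega> - W s \<omega>)) -` A \<inter> space M |A. A \<in> sets borel}" "vimage_algebra (space M) (\<lambda>\<omega>. w t \<omega> - w s \<omega>) borel"]
        by auto
    qed
    show "case_bool (sigma_sets (space M) {X -` A \<inter> space M |A. A \<in> sets borel})
        (sigma_sets (space M) {(\<lambda>\<omega>. f (W t \<omega> - W s \<omega>)) -` A \<inter> space M |A. A \<in> sets borel}) b
       \<subseteq> case_bool (sets (F s)) (sets (vimage_algebra (space M) (\<lambda>\<omega>. w t \<omega> - w s \<omega>) borel)) b"
      using 1 2 by (cases b) auto
  qed
  then show ?thesis using Xm Ym by (simp add: indep_var_eq)
qed

lemma increment_moments:
  assumes st: "0 \<le> s" "s < t" "t \<le> T"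
  shows "integrable M (\<lambda>\<omega>. W t \<omega> - W s \<omega>)" "expectation (\<lambda>\<omega>. W t \<omega> - W s \<omega>) = 0"
    "integrable M (\<lambda>\<omega>. (W t \<omega> - W s \<omega>)\<^sup>2)" "expectation (\<lambda>\<omega>. (W t \<omega> - W s \<omega>)\<^sup>2) = t - s"
proof -
  let ?Y = "\<lambda>\<omega>. W t \<omega> - W s \<omega>"
  have D: "distributed M lborel ?Y (normal_density 0 (sqrt (t - s)))"
    using wiener st by (simp add: standard_wiener_process_def)
  have p: "0 < sqrt (t - s)" using st by simp
  show E: "expectation ?Y = 0" using normal_distributed_expectation[OF p D] .
  have V: "variance ?Y = t - s" using normal_distributed_variance[OF p D] st by simp
  then show "expectation (\<lambda>\<omega>. (?Y \<omega>)\<^sup>2) = t - s" by (simp add: E)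
  show "integrable M (\<lambda>\<omega>. (?Y \<omega>)\<^sup>2)"
    using \<open>expectation (\<lambda>\<omega>. (?Y \<omega>)\<^sup>2) = t - s\<close> st not_integrable_integral_eq[of M "\<lambda>\<omega>. (?Y \<omega>)\<^sup>2"] by auto
  have "?Y \<in> borel_measurable M" using W_measurable st by simp
  then show "integrable M ?Y" using \<open>integrable M (\<lambda>\<omega>. (?Y \<omega>)\<^sup>2)\<close> by (rule square_integrable_imp_integrable)
qed

lemma times_increment:
  assumes st: "0 \<le> s" "s \<le> t" "t \<le> T" and X: "X \<in> borel_measurable (F s)" "integrable M X"
  shows "integrable M (\<lambda>\<omega>. X \<omega> * (W t \<omega> - W s \<omega>))" "expectation (\<lambda>\<omega>. X \<omega> * (W t \<omega> - W s \<omega>)) = 0"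
    "integrable M (\<lambda>\<omega>. X \<omega> * (W t \<omega> - W s \<omega>)\<^sup>2)" "expectation (\<lambda>\<omega>. X \<omega> * (W t \<omega> - W s \<omega>)\<^sup>2) = expectation X * (t - s)"
proof -
  have "integrable M (\<lambda>\<omega>. X \<omega> * (W t \<omega> - W s \<omega>)) \<and> expectation (\<lambda>\<omega>. X \<omega> * (W t \<omega> - W s \<omega>)) = 0 \<and>
    integrable M (\<lambda>\<omega>. X \<omega> * (W t \<omega> - W s \<omega>)\<^sup>2) \<and> expectation (\<lambda>\<omega>. X \<omega> * (W t \<omega> - W s \<omega>)\<^sup>2) = expectation X * (t - s)"
  proof (cases "s = t")
    case False
    then have st': "0 \<le> s" "s < t" "t \<le> T" using st by auto
    have i1: "indep_var borel X borel (\<lambda>\<omega>. W t \<omega> - W s \<omega>)" using increment_indep[OF st' X(1), of "\<lambda>x. x"] by simp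
    have i2: "indep_var borel X borel (\<lambda>\<omega>. (W t \<omega> - W s \<omega>)\<^sup>2)" using increment_indep[OF st' X(1), of "\<lambda>x. x\<^sup>2"] by simp
    show ?thesis
      using indep_var_integrable[OF i1 X(2) increment_moments(1)[OF st']] indep_var_lebesgue_integral[OF i1 X(2) increment_moments(1)[OF st']]
        indep_var_integrable[OF i2 X(2) increment_moments(3)[OF st']] indep_var_lebesgue_integral[OF i2 X(2) increment_moments(3)[OF st']]
        increment_moments(2,4)[OF st'] by simp
  qed simp
  then show "integrable M (\<lambda>\<omega>. X \<omega> * (W t \<omega> - W s \<omega>))" "expectation (\<lambda>\<omega>. X \<omega> * (W t \<omega> - W s \<omega>)) = 0"
    "integrable M (\<lambda>\<omega>. X \<omega> * (W t \<omega> - W s \<omega>)\<^sup>2)" "expectation (\<lambda>\<omega>. X \<omega> * (W t \<omega> - W s \<omega>)\<^sup>2) = expectation X * (t - s)"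
    by auto
qed

text \<open>The length of the common part of the intervals from \<open>a\<close> to \<open>b\<close> and from \<open>c\<close> to \<open>d\<close>.\<close>

definition overlap :: "real \<Rightarrow> real \<Rightarrow> real \<Rightarrow> real \<Rightarrow> real" where
  "overlap a b c d = max 0 (min b d - max a c)"

text \<open>Split both increments at the endpoints of the common interval: only its squared increment
  contributes, all other products contain an increment independent of the remaining factors.\<close>

lemma increment_product_ordered:
  assumes t: "0 \<le> a" "a \<le> b" "b \<le> T" "0 \<le> c" "c \<le> d" "d \<le> T" and ac: "a \<le> c"
    and X: "X \<in> borel_measurable (F a)" "\<And>\<omega>. \<omega> \<in> space M \<Longrightarrow> \<bar>X \<omega>\<bar> \<le> K"
    and Y: "Y \<in> borel_measurable (F c)" "\<And>\<omega>. \<omega> \<in> space M \<Longrightarrow> \<bar>Y \<omega>\<bar> \<le> K'"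
  shows "integrable M (\<lambda>\<omega>. (X \<omega> * (W b \<omega> - W a \<omega>)) * (Y \<omega> * (W d \<omega> - W c \<omega>)))"
    "expectation (\<lambda>\<omega>. (X \<omega> * (W b \<omega> - W a \<omega>)) * (Y \<omega> * (W d \<omega> - W c \<omega>))) = expectation (\<lambda>\<omega>. X \<omega> * Y \<omega>) * overlap a b c d"
proof -
  define Z where "Z \<omega> = X \<omega> * Y \<omega>" for \<omega>
  have Xc: "X \<in> borel_measurable (F c)" by (rule natural_filtration_measurable_mono[OF X(1) ac])
  have Z: "Z \<in> borel_measurable (F c)" unfolding Z_def[abs_def] using Xc Y(1) by (rule borel_measurable_times)
  have Zb: "\<bar>Z \<omega>\<bar> \<le> K * K'" if "\<omega> \<in> space M" for \<omega>
    unfolding Z_def abs_mult using X(2)[OF that] Y(2)[OF that] by (intro mult_mono) auto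
  have Zint: "integrable M (\<lambda>\<omega>. Z \<omega> * V \<omega>)" if "integrable M V" for V
  proof (rule Bochner_Integration.integrable_bound[of M "\<lambda>\<omega>. (K * K') * V \<omega>"])
    show "(\<lambda>\<omega>. Z \<omega> * V \<omega>) \<in> borel_measurable M"
      using F_subset[OF _ Z] that t by (intro borel_measurable_times) auto
    show "AE \<omega> in M. norm (Z \<omega> * V \<omega>) \<le> norm (K * K' * V \<omega>)"
    proof (rule AE_I2)
      fix \<omega> assume "\<omega> \<in> space M"
      from Zb[OF this] have "\<bar>Z \<omega>\<bar> \<le> \<bar>K * K'\<bar>" by linarith
      then show "norm (Z \<omega> * V \<omega>) \<le> norm (K * K' * V \<omega>)"
        by (simp only: real_norm_def abs_mult[of "Z \<omega>"] abs_mult[of "K * K'"]) (rule mult_right_mono, auto)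
    qed
  qed (use that in simp)
  \<comment> \<open>The common interval is from \<open>c\<close> to \<open>e\<close>.\<close>
  define e where "e = min b d"
  have ZI: "integrable M Z" using Zint[of "\<lambda>_. 1"] by simp
  have "integrable M (\<lambda>\<omega>. (X \<omega> * (W b \<omega> - W a \<omega>)) * (Y \<omega> * (W d \<omega> - W c \<omega>))) \<and>
    expectation (\<lambda>\<omega>. (X \<omega> * (W b \<omega> - W a \<omega>)) * (Y \<omega> * (W d \<omega> - W c \<omega>))) = expectation Z * overlap a b c d"
  proof (cases "b \<le> c")
    case True
    let ?U = "\<lambda>\<omega>. Z \<omega> * (W b \<omega> - W a \<omega>)"
    have "?U \<in> borel_measurable (F c)"
      using Z W_adapted[of b c] W_adapted[of a c] t True by (intro borel_measurable_times borel_measurable_diff) auto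
    moreover have "integrable M (\<lambda>\<omega>. 1 * (W b \<omega> - W a \<omega>))" by (rule times_increment(1)) (use t in auto)
    then have "integrable M ?U" using Zint by simp
    ultimately have "integrable M (\<lambda>\<omega>. ?U \<omega> * (W d \<omega> - W c \<omega>))" "expectation (\<lambda>\<omega>. ?U \<omega> * (W d \<omega> - W c \<omega>)) = 0"
      using times_increment[of c d ?U] t by auto
    moreover have "overlap a b c d = 0" using True t ac by (simp add: overlap_def)
    moreover have "(\<lambda>\<omega>. (X \<omega> * (W b \<omega> - W a \<omega>)) * (Y \<omega> * (W d \<omega> - W c \<omega>))) = (\<lambda>\<omega>. ?U \<omega> * (W d \<omega> - W c \<omega>))"
      by (simp add: Z_def mult_ac)
    ultimately show ?thesis by simp
  next
    case False
    then have e: "c \<le> e" "e \<le> b" "e \<le> d" "e \<le> T" "0 \<le> e" and cT: "c \<le> T" "a \<le> T" using t ac by (auto simp: e_def)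
    have inc: "integrable M (\<lambda>\<omega>. W v \<omega> - W u \<omega>)" if "0 \<le> u" "u \<le> v" "v \<le> T" for u v
    proof -
      have "integrable M (\<lambda>\<omega>. 1 * (W v \<omega> - W u \<omega>))" by (rule times_increment(1)) (use that in auto)
      then show ?thesis by simp
    qed
    let ?A = "\<lambda>\<omega>. W c \<omega> - W a \<omega>" and ?B = "\<lambda>\<omega>. W e \<omega> - W c \<omega>" and ?C = "\<lambda>\<omega>. W b \<omega> - W e \<omega>" and ?D = "\<lambda>\<omega>. W d \<omega> - W e \<omega>"
    have Zc: "Z \<in> borel_measurable (F e)" by (rule natural_filtration_measurable_mono[OF Z e(1)])
    have mA: "(\<lambda>\<omega>. Z \<omega> * ?A \<omega>) \<in> borel_measurable (F c)"
      using Z W_adapted t ac by (intro borel_measurable_times borel_measurable_diff) auto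
    have mB: "(\<lambda>\<omega>. Z \<omega> * ?B \<omega>) \<in> borel_measurable (F e)"
      using Zc W_adapted t e by (intro borel_measurable_times borel_measurable_diff) auto
    have iA: "integrable M (\<lambda>\<omega>. Z \<omega> * ?A \<omega>)" and iB: "integrable M (\<lambda>\<omega>. Z \<omega> * ?B \<omega>)"
      by (intro Zint inc; use t ac e cT in auto)+
    have AB: "integrable M (\<lambda>\<omega>. Z \<omega> * ?A \<omega> * ?B \<omega>)" "expectation (\<lambda>\<omega>. Z \<omega> * ?A \<omega> * ?B \<omega>) = 0"
      using times_increment[OF _ _ _ mA iA, of e] t e by auto
    have AD: "integrable M (\<lambda>\<omega>. Z \<omega> * ?A \<omega> * ?D \<omega>)" "expectation (\<lambda>\<omega>. Z \<omega> * ?A \<omega> * ?D \<omega>) = 0"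
      using times_increment[OF _ _ _ natural_filtration_measurable_mono[OF mA e(1)] iA, of d] t e by auto
    have BD: "integrable M (\<lambda>\<omega>. Z \<omega> * ?B \<omega> * ?D \<omega>)" "expectation (\<lambda>\<omega>. Z \<omega> * ?B \<omega> * ?D \<omega>) = 0"
      using times_increment[OF _ _ _ mB iB, of d] t e by auto
    have BC: "integrable M (\<lambda>\<omega>. Z \<omega> * ?B \<omega> * ?C \<omega>)" "expectation (\<lambda>\<omega>. Z \<omega> * ?B \<omega> * ?C \<omega>) = 0"
      using times_increment[OF _ _ _ mB iB, of b] t e by auto
    have BB: "integrable M (\<lambda>\<omega>. Z \<omega> * (?B \<omega>)\<^sup>2)" "expectation (\<lambda>\<omega>. Z \<omega> * (?B \<omega>)\<^sup>2) = expectation Z * (e - c)"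
      using times_increment[OF _ _ _ Z ZI, of e] t e by auto
    have zero: "?C \<omega> * ?D \<omega> = 0" for \<omega> by (cases "b \<le> d") (auto simp: e_def min_def)
    have eq: "(\<lambda>\<omega>. (X \<omega> * (W b \<omega> - W a \<omega>)) * (Y \<omega> * (W d \<omega> - W c \<omega>)))
      = (\<lambda>\<omega>. Z \<omega> * ?A \<omega> * ?B \<omega> + Z \<omega> * ?A \<omega> * ?D \<omega> + Z \<omega> * ?B \<omega> * ?D \<omega> + Z \<omega> * ?B \<omega> * ?C \<omega> + Z \<omega> * (?B \<omega>)\<^sup>2)"
    proof
      fix \<omega>
      have "(X \<omega> * (W b \<omega> - W a \<omega>)) * (Y \<omega> * (W d \<omega> - W c \<omega>)) = Z \<omega> * (?A \<omega> + ?B \<omega> + ?C \<omega>) * (?B \<omega> + ?D \<omega>)"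
        by (simp add: Z_def)
      also have "\<dots> = Z \<omega> * ?A \<omega> * ?B \<omega> + Z \<omega> * ?A \<omega> * ?D \<omega> + Z \<omega> * ?B \<omega> * ?D \<omega> + Z \<omega> * ?B \<omega> * ?C \<omega> + Z \<omega> * (?B \<omega>)\<^sup>2 + Z \<omega> * (?C \<omega> * ?D \<omega>)"
        by algebra
      finally show "(X \<omega> * (W b \<omega> - W a \<omega>)) * (Y \<omega> * (W d \<omega> - W c \<omega>))
        = Z \<omega> * ?A \<omega> * ?B \<omega> + Z \<omega> * ?A \<omega> * ?D \<omega> + Z \<omega> * ?B \<omega> * ?D \<omega> + Z \<omega> * ?B \<omega> * ?C \<omega> + Z \<omega> * (?B \<omega>)\<^sup>2"
        unfolding zero by simp
    qed
    have "overlap a b c d = e - c" using False t ac by (simp add: overlap_def e_def)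
    then show ?thesis unfolding eq using AB AD BD BC BB by simp
  qed
  then show "integrable M (\<lambda>\<omega>. (X \<omega> * (W b \<omega> - W a \<omega>)) * (Y \<omega> * (W d \<omega> - W c \<omega>)))"
    "expectation (\<lambda>\<omega>. (X \<omega> * (W b \<omega> - W a \<omega>)) * (Y \<omega> * (W d \<omega> - W c \<omega>))) = expectation (\<lambda>\<omega>. X \<omega> * Y \<omega>) * overlap a b c d"
    by (auto simp: Z_def[abs_def])
qed

lemma increment_product:
  assumes "0 \<le> a" "a \<le> b" "b \<le> T" "0 \<le> c" "c \<le> d" "d \<le> T"
    and "X \<in> borel_measurable (F a)" "\<And>\<omega>. \<omega> \<in> space M \<Longrightarrow> \<bar>X \<omega>\<bar> \<le> K"
    and "Y \<in> borel_measurable (F c)" "\<And>\<omega>. \<omega> \<in> space M \<Longrightarrow> \<bar>Y \<omega>\<bar> \<le> K'"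
  shows "integrable M (\<lambda>\<omega>. (X \<omega> * (W b \<omega> - W a \<omega>)) * (Y \<omega> * (W d \<omega> - W c \<omega>)))"
    "expectation (\<lambda>\<omega>. (X \<omega> * (W b \<omega> - W a \<omega>)) * (Y \<omega> * (W d \<omega> - W c \<omega>))) = expectation (\<lambda>\<omega>. X \<omega> * Y \<omega>) * overlap a b c d"
proof -
  have sym: "overlap a b c d = overlap c d a b" by (simp add: overlap_def min.commute max.commute)
  have com: "(\<lambda>\<omega>. (X \<omega> * (W b \<omega> - W a \<omega>)) * (Y \<omega> * (W d \<omega> - W c \<omega>))) = (\<lambda>\<omega>. (Y \<omega> * (W d \<omega> - W c \<omega>)) * (X \<omega> * (W b \<omega> - W a \<omega>)))"
    "(\<lambda>\<omega>. X \<omega> * Y \<omega>) = (\<lambda>\<omega>. Y \<omega> * X \<omega>)"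
    by (auto intro!: ext mult.commute)
  consider "a \<le> c" | "c \<le> a" by linarith
  then have "integrable M (\<lambda>\<omega>. (X \<omega> * (W b \<omega> - W a \<omega>)) * (Y \<omega> * (W d \<omega> - W c \<omega>))) \<and>
    expectation (\<lambda>\<omega>. (X \<omega> * (W b \<omega> - W a \<omega>)) * (Y \<omega> * (W d \<omega> - W c \<omega>))) = expectation (\<lambda>\<omega>. X \<omega> * Y \<omega>) * overlap a b c d"
  proof cases
    case 1
    from increment_product_ordered[OF assms(1-6) 1 assms(7-10)] show ?thesis by blast
  next
    case 2
    from increment_product_ordered[OF assms(4-6,1-3) 2 assms(9,10,7,8)] show ?thesis unfolding com sym by blast
  qed
  then show "integrable M (\<lambda>\<omega>. (X \<omega> * (W b \<omega> - W a \<omega>)) * (Y \<omega> * (W d \<omega> - W c \<omega>)))"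
    "expectation (\<lambda>\<omega>. (X \<omega> * (W b \<omega> - W a \<omega>)) * (Y \<omega> * (W d \<omega> - W c \<omega>))) = expectation (\<lambda>\<omega>. X \<omega> * Y \<omega>) * overlap a b c d"
    by blast+
qed

text \<open>The intervals may overlap, so that the difference of two elementary processes with
  different partitions is covered.\<close>

lemma ito_isometry:
  assumes I: "finite I" and ab: "\<And>i. i \<in> I \<Longrightarrow> 0 \<le> a i \<and> a i \<le> b i \<and> b i \<le> T"
    and c: "\<And>i. i \<in> I \<Longrightarrow> c i \<in> borel_measurable (F (a i))" "\<And>i. i \<in> I \<Longrightarrow> \<exists>K. \<forall>\<omega>\<in>space M. \<bar>c i \<omega>\<bar> \<le> K"
  shows "(\<integral>\<^sup>+\<omega>. ennreal ((\<Sum>i\<in>I. c i \<omega> * (W (b i) \<omega> - W (a i) \<omega>))\<^sup>2) \<partial>M)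
    = (\<integral>\<^sup>+\<omega>. (\<integral>\<^sup>+s. ennreal ((\<Sum>i\<in>I. indicator {a i<..b i} s * c i \<omega>)\<^sup>2) \<partial>lborel) \<partial>M)"
proof -
  obtain K where K: "\<And>i \<omega>. i \<in> I \<Longrightarrow> \<omega> \<in> space M \<Longrightarrow> \<bar>c i \<omega>\<bar> \<le> K i" using c(2) by metis
  let ?o = "\<lambda>i j. overlap (a i) (b i) (a j) (b j)"
  have P: "integrable M (\<lambda>\<omega>. (c i \<omega> * (W (b i) \<omega> - W (a i) \<omega>)) * (c j \<omega> * (W (b j) \<omega> - W (a j) \<omega>)))"
    "expectation (\<lambda>\<omega>. (c i \<omega> * (W (b i) \<omega> - W (a i) \<omega>)) * (c j \<omega> * (W (b j) \<omega> - W (a j) \<omega>))) = expectation (\<lambda>\<omega>. c i \<omega> * c j \<omega>) * ?o i j"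
    if "i \<in> I" "j \<in> I" for i j
    using increment_product[of "a i" "b i" "a j" "b j" "c i" "K i" "c j" "K j"] ab c(1) K that by auto
  have cm: "c i \<in> borel_measurable M" if "i \<in> I" for i using F_subset[OF _ c(1)[OF that]] ab[OF that] by auto
  have ci: "integrable M (\<lambda>\<omega>. c i \<omega> * c j \<omega>)" if "i \<in> I" "j \<in> I" for i j
  proof (rule integrable_const_bound[of _ "K i * K j"])
    show "AE \<omega> in M. norm (c i \<omega> * c j \<omega>) \<le> K i * K j"
      using K[OF that(1)] K[OF that(2)] by (intro AE_I2) (force simp: abs_mult intro: mult_mono)
  qed (use cm that in simp)
  have sq: "(\<Sum>i\<in>I. f i)\<^sup>2 = (\<Sum>i\<in>I. \<Sum>j\<in>I. f i * f j)" for f :: "_ \<Rightarrow> real"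
    by (simp add: power2_eq_square sum_product)
  have "(\<integral>\<^sup>+\<omega>. ennreal ((\<Sum>i\<in>I. c i \<omega> * (W (b i) \<omega> - W (a i) \<omega>))\<^sup>2) \<partial>M)
     = ennreal (expectation (\<lambda>\<omega>. (\<Sum>i\<in>I. c i \<omega> * (W (b i) \<omega> - W (a i) \<omega>))\<^sup>2))"
  proof (rule nn_integral_eq_integral)
    show "integrable M (\<lambda>\<omega>. (\<Sum>i\<in>I. c i \<omega> * (W (b i) \<omega> - W (a i) \<omega>))\<^sup>2)"
      unfolding sq by (intro Bochner_Integration.integrable_sum P)
  qed simp
  also have "expectation (\<lambda>\<omega>. (\<Sum>i\<in>I. c i \<omega> * (W (b i) \<omega> - W (a i) \<omega>))\<^sup>2) = (\<Sum>i\<in>I. \<Sum>j\<in>I. expectation (\<lambda>\<omega>. c i \<omega> * c j \<omega>) * ?o i j)"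
    unfolding sq by (simp add: Bochner_Integration.integral_sum P)
  finally have lhs: "(\<integral>\<^sup>+\<omega>. ennreal ((\<Sum>i\<in>I. c i \<omega> * (W (b i) \<omega> - W (a i) \<omega>))\<^sup>2) \<partial>M)
     = ennreal (\<Sum>i\<in>I. \<Sum>j\<in>I. expectation (\<lambda>\<omega>. c i \<omega> * c j \<omega>) * ?o i j)" .
  have ov: "integrable lborel (\<lambda>s. indicator {a i<..b i} s * indicator {a j<..b j} s :: real)"
    "(LINT s|lborel. indicator {a i<..b i} s * indicator {a j<..b j} s) = ?o i j" if "i \<in> I" "j \<in> I" for i j
  proof -
    have "(\<lambda>s. indicator {a i<..b i} s * indicator {a j<..b j} s :: real) = indicator {max (a i) (a j)<..min (b i) (b j)}"
      by (auto simp: indicator_def fun_eq_iff)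
    moreover have "emeasure lborel {x<..y} < \<infinity>" for x y :: real by (cases "x \<le> y") auto
    ultimately show "integrable lborel (\<lambda>s. indicator {a i<..b i} s * indicator {a j<..b j} s :: real)"
      "(LINT s|lborel. indicator {a i<..b i} s * indicator {a j<..b j} s) = ?o i j"
      by (auto simp: overlap_def max_def measure_def intro!: integrable_real_indicator)
  qed
  have eq: "(\<lambda>s. (\<Sum>i\<in>I. indicator {a i<..b i} s * c i \<omega>)\<^sup>2) = (\<lambda>s. \<Sum>i\<in>I. \<Sum>j\<in>I. (c i \<omega> * c j \<omega>) * (indicator {a i<..b i} s * indicator {a j<..b j} s))" for \<omega>
    unfolding sq by (intro ext sum.cong refl) (simp only: mult_ac)
  have val: "(LINT s|lborel. (\<Sum>i\<in>I. indicator {a i<..b i} s * c i \<omega>)\<^sup>2) = (\<Sum>i\<in>I. \<Sum>j\<in>I. (c i \<omega> * c j \<omega>) * ?o i j)" for \<omega>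
  proof -
    have "(LINT s|lborel. (\<Sum>i\<in>I. indicator {a i<..b i} s * c i \<omega>)\<^sup>2)
       = (\<Sum>i\<in>I. (LINT s|lborel. (\<Sum>j\<in>I. (c i \<omega> * c j \<omega>) * (indicator {a i<..b i} s * indicator {a j<..b j} s))))"
      unfolding eq by (intro Bochner_Integration.integral_sum Bochner_Integration.integrable_sum integrable_mult_right ov)
    also have "\<dots> = (\<Sum>i\<in>I. \<Sum>j\<in>I. (LINT s|lborel. (c i \<omega> * c j \<omega>) * (indicator {a i<..b i} s * indicator {a j<..b j} s)))"
      by (intro sum.cong refl Bochner_Integration.integral_sum integrable_mult_right ov)
    also have "\<dots> = (\<Sum>i\<in>I. \<Sum>j\<in>I. (c i \<omega> * c j \<omega>) * ?o i j)"
      by (intro sum.cong refl) (simp only: integral_mult_right_zero ov)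
    finally show ?thesis .
  qed
  have inner: "(\<integral>\<^sup>+s. ennreal ((\<Sum>i\<in>I. indicator {a i<..b i} s * c i \<omega>)\<^sup>2) \<partial>lborel) = ennreal (\<Sum>i\<in>I. \<Sum>j\<in>I. (c i \<omega> * c j \<omega>) * ?o i j)"
    for \<omega>
    unfolding val[symmetric]
  proof (rule nn_integral_eq_integral)
    show "integrable lborel (\<lambda>s. (\<Sum>i\<in>I. indicator {a i<..b i} s * c i \<omega>)\<^sup>2)"
      unfolding eq by (intro Bochner_Integration.integrable_sum integrable_mult_right ov)
  qed simp
  have nn: "0 \<le> (\<Sum>i\<in>I. \<Sum>j\<in>I. (c i \<omega> * c j \<omega>) * ?o i j)" for \<omega>
    unfolding val[symmetric] by (rule Bochner_Integration.integral_nonneg) simp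
  have "(\<integral>\<^sup>+\<omega>. (\<integral>\<^sup>+s. ennreal ((\<Sum>i\<in>I. indicator {a i<..b i} s * c i \<omega>)\<^sup>2) \<partial>lborel) \<partial>M)
     = ennreal (expectation (\<lambda>\<omega>. \<Sum>i\<in>I. \<Sum>j\<in>I. (c i \<omega> * c j \<omega>) * ?o i j))"
    unfolding inner by (rule nn_integral_eq_integral) (auto intro!: Bochner_Integration.integrable_sum integrable_mult_left ci nn)
  also have "expectation (\<lambda>\<omega>. \<Sum>i\<in>I. \<Sum>j\<in>I. (c i \<omega> * c j \<omega>) * ?o i j) = (\<Sum>i\<in>I. \<Sum>j\<in>I. expectation (\<lambda>\<omega>. c i \<omega> * c j \<omega>) * ?o i j)"
    by (simp add: Bochner_Integration.integral_sum integrable_mult_left ci)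
  finally show ?thesis unfolding lhs by simp
qed

lemma elementary_mono:
  assumes "elementary G t \<tau> m e" "i \<le> j" "j \<le> m"
  shows "\<tau> i \<le> \<tau> j"
  using assms(2,3)
proof (induction j rule: dec_induct)
  case (step j)
  then have "\<tau> j \<le> \<tau> (Suc j)" using assms(1) by (auto simp: elementary_def)
  then show ?case using step by simp
qed simp

lemma elementary_times:
  assumes "elementary G t \<tau> m e" "i \<le> m"
  shows "0 \<le> \<tau> i" "\<tau> i \<le> t"
  using elementary_mono[OF assms(1), of 0 i] elementary_mono[OF assms(1), of i m] assms by (auto simp: elementary_def)

text \<open>The difference of two elementary processes is a combination of indicators of intervals indexed
  by the disjoint union of both partitions, where intervals of different partitions overlap.\<close>

lemma ito_isometry_difference:
  fixes e e' :: "nat \<Rightarrow> 'a \<Rightarrow> real"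
  assumes t: "t \<le> T" and e: "elementary F t \<tau> m e" and e': "elementary F t \<tau>' m' e'"
  shows "(\<integral>\<^sup>+\<omega>. ennreal ((elementary_integral W \<tau> m e \<omega> - elementary_integral W \<tau>' m' e' \<omega>)\<^sup>2) \<partial>M)
    = (\<integral>\<^sup>+\<omega>. (\<integral>\<^sup>+s\<in>{0..t}. ennreal ((elementary_process \<tau> m e s \<omega> - elementary_process \<tau>' m' e' s \<omega>)\<^sup>2) \<partial>lborel) \<partial>M)"
proof -
  let ?I = "{..<m} <+> {..<m'}"
  define a where "a = case_sum \<tau> \<tau>'"
  define b where "b = case_sum (\<lambda>i. \<tau> (Suc i)) (\<lambda>i. \<tau>' (Suc i))"
  define c where "c = case_sum e (\<lambda>i \<omega>. - e' i \<omega>)"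
  have ab: "0 \<le> a i \<and> a i \<le> b i \<and> b i \<le> T" if "i \<in> ?I" for i
    using that elementary_times[OF e] elementary_times[OF e'] e e' t
    by (auto simp: a_def b_def elementary_def intro: order.trans[of _ t T])
  have c1: "c i \<in> borel_measurable (F (a i))" if "i \<in> ?I" for i
    using that e e' by (auto simp: a_def c_def elementary_def)
  have c2: "\<exists>K. \<forall>\<omega>\<in>space M. \<bar>c i \<omega>\<bar> \<le> K" if "i \<in> ?I" for i
    using that e e' by (auto simp: c_def elementary_def)
  have eqi: "elementary_integral W \<tau> m e \<omega> - elementary_integral W \<tau>' m' e' \<omega> = (\<Sum>i\<in>?I. c i \<omega> * (W (b i) \<omega> - W (a i) \<omega>))" for \<omega>
    by (simp add: sum.Plus elementary_integral_def a_def b_def c_def sum_negf mult.commute)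
  have eqp: "elementary_process \<tau> m e s \<omega> - elementary_process \<tau>' m' e' s \<omega> = (\<Sum>i\<in>?I. indicator {a i<..b i} s * c i \<omega>)" for s \<omega>
    unfolding sum.Plus[OF finite_lessThan finite_lessThan] elementary_process_def by (simp add: a_def b_def c_def sum_negf)
  have supp: "elementary_process \<tau> m e s \<omega> - elementary_process \<tau>' m' e' s \<omega> = 0" if "s \<notin> {0..t}" for s \<omega>
  proof -
    have "s \<notin> {\<tau> i<..\<tau> (Suc i)}" if "i < m" for i
      using elementary_times[OF e, of i] elementary_times[OF e, of "Suc i"] that \<open>s \<notin> {0..t}\<close> by auto
    moreover have "s \<notin> {\<tau>' i<..\<tau>' (Suc i)}" if "i < m'" for i
      using elementary_times[OF e', of i] elementary_times[OF e', of "Suc i"] that \<open>s \<notin> {0..t}\<close> by auto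
    ultimately show ?thesis by (simp add: elementary_process_def)
  qed
  have "(\<integral>\<^sup>+s. ennreal ((elementary_process \<tau> m e s \<omega> - elementary_process \<tau>' m' e' s \<omega>)\<^sup>2) \<partial>lborel)
      = (\<integral>\<^sup>+s\<in>{0..t}. ennreal ((elementary_process \<tau> m e s \<omega> - elementary_process \<tau>' m' e' s \<omega>)\<^sup>2) \<partial>lborel)" for \<omega>
  proof (rule nn_integral_cong)
    fix s
    show "ennreal ((elementary_process \<tau> m e s \<omega> - elementary_process \<tau>' m' e' s \<omega>)\<^sup>2)
      = ennreal ((elementary_process \<tau> m e s \<omega> - elementary_process \<tau>' m' e' s \<omega>)\<^sup>2) * indicator {0..t} s"
      using supp[of s \<omega>] by (cases "s \<in> {0..t}") auto
  qed
  then show ?thesis using ito_isometry[of ?I a b c] ab c1 c2 unfolding eqi[symmetric] eqp[symmetric] by simp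
qed

lemma elementary_process_error_measurable:
  fixes e :: "nat \<Rightarrow> 'a \<Rightarrow> real"
  assumes t: "t \<le> T" and e: "elementary F t \<tau> m e" and G: "G \<in> borel_measurable borel"
  shows "(\<lambda>(\<omega>, s). ennreal ((G s - elementary_process \<tau> m e s \<omega>)\<^sup>2) * indicator {0..t} s) \<in> borel_measurable (M \<Otimes>\<^sub>M lborel)"
proof -
  have em: "e i \<in> borel_measurable M" if "i < m" for i
    using F_subset[of "\<tau> i" "e i"] elementary_times[OF e, of i] e t that by (auto simp: elementary_def)
  have "(\<lambda>z. elementary_process \<tau> m e (snd z) (fst z)) \<in> borel_measurable (M \<Otimes>\<^sub>M lborel)"
    unfolding elementary_process_def
    by (intro borel_measurable_sum borel_measurable_scaleR measurable_compose[OF measurable_fst em] measurable_compose[OF measurable_snd borel_measurable_indicator])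
       auto
  moreover have "(\<lambda>z. G (snd z)) \<in> borel_measurable (M \<Otimes>\<^sub>M lborel)"
    by (rule measurable_compose[OF measurable_snd]) (use G in simp)
  moreover have "(\<lambda>z. indicator {0..t} (snd z) :: ennreal) \<in> borel_measurable (M \<Otimes>\<^sub>M lborel)"
    by (rule measurable_compose[OF measurable_snd borel_measurable_indicator]) simp
  ultimately show ?thesis unfolding case_prod_unfold by measurable
qed

lemma square_sum_ennreal: "ennreal ((x - z)\<^sup>2) \<le> 2 * ennreal ((x - y)\<^sup>2) + 2 * ennreal ((y - z)\<^sup>2)"
proof -
  have "(x - z)\<^sup>2 \<le> 2 * (x - y)\<^sup>2 + 2 * (y - z)\<^sup>2"
    using zero_le_power2[of "(x - y) - (y - z)"] by (simp add: power2_eq_square algebra_simps)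
  then have "ennreal ((x - z)\<^sup>2) \<le> ennreal (2 * (x - y)\<^sup>2 + 2 * (y - z)\<^sup>2)" by (rule ennreal_leI)
  also have "\<dots> = 2 * ennreal ((x - y)\<^sup>2) + 2 * ennreal ((y - z)\<^sup>2)" by (simp add: ennreal_plus ennreal_mult)
  finally show ?thesis .
qed

text \<open>The isometry makes the mean-square limit independent of the approximating elementary
  processes; if one of the approximations also converges pointwise, Fatou's lemma identifies it.\<close>

lemma ito_integral_pointwise_limit:
  fixes e d :: "nat \<Rightarrow> nat \<Rightarrow> 'a \<Rightarrow> real"
  assumes t: "t \<le> T" and G: "G \<in> borel_measurable borel" and I: "I \<in> borel_measurable M"
    and e: "\<And>k. elementary F t (\<tau> k) (m k) (e k)" and d: "\<And>k. elementary F t (\<rho> k) (l k) (d k)"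
    and eH: "(\<lambda>k. \<integral>\<^sup>+\<omega>. (\<integral>\<^sup>+s\<in>{0..t}. ennreal ((G s - elementary_process (\<tau> k) (m k) (e k) s \<omega>)\<^sup>2) \<partial>lborel) \<partial>M) \<longlonglongrightarrow> 0"
    and eI: "(\<lambda>k. \<integral>\<^sup>+\<omega>. ennreal ((I \<omega> - elementary_integral W (\<tau> k) (m k) (e k) \<omega>)\<^sup>2) \<partial>M) \<longlonglongrightarrow> 0"
    and dH: "(\<lambda>k. \<integral>\<^sup>+\<omega>. (\<integral>\<^sup>+s\<in>{0..t}. ennreal ((G s - elementary_process (\<rho> k) (l k) (d k) s \<omega>)\<^sup>2) \<partial>lborel) \<partial>M) \<longlonglongrightarrow> 0"
    and dJ: "AE \<omega> in M. (\<lambda>k. elementary_integral W (\<rho> k) (l k) (d k) \<omega>) \<longlonglongrightarrow> J \<omega>"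
  shows "AE \<omega> in M. I \<omega> = J \<omega>"
proof -
  let ?E = "\<lambda>k s \<omega>. elementary_process (\<tau> k) (m k) (e k) s \<omega>" and ?D = "\<lambda>k s \<omega>. elementary_process (\<rho> k) (l k) (d k) s \<omega>"
  let ?ie = "\<lambda>k \<omega>. elementary_integral W (\<tau> k) (m k) (e k) \<omega>" and ?id = "\<lambda>k \<omega>. elementary_integral W (\<rho> k) (l k) (d k) \<omega>"
  define A where "A k = (\<integral>\<^sup>+\<omega>. (\<integral>\<^sup>+s\<in>{0..t}. ennreal ((G s - ?E k s \<omega>)\<^sup>2) \<partial>lborel) \<partial>M)" for k
  define B where "B k = (\<integral>\<^sup>+\<omega>. ennreal ((I \<omega> - ?ie k \<omega>)\<^sup>2) \<partial>M)" for k
  define C where "C k = (\<integral>\<^sup>+\<omega>. (\<integral>\<^sup>+s\<in>{0..t}. ennreal ((G s - ?D k s \<omega>)\<^sup>2) \<partial>lborel) \<partial>M)" for k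
  have int_meas: "elementary_integral W \<tau>' m' e' \<in> borel_measurable M" if el: "elementary F t \<tau>' m' e'" for \<tau>' m' and e' :: "nat \<Rightarrow> 'a \<Rightarrow> real"
  proof -
    have "e' i \<in> borel_measurable M" "W (\<tau>' (Suc i)) \<in> borel_measurable M" "W (\<tau>' i) \<in> borel_measurable M" if "i < m'" for i
      using F_subset[of "\<tau>' i" "e' i"] W_measurable elementary_times[OF el, of i] elementary_times[OF el, of "Suc i"] el t that
      by (auto simp: elementary_def)
    then show ?thesis unfolding elementary_integral_def[abs_def]
      by (intro borel_measurable_sum borel_measurable_scaleR borel_measurable_diff) auto
  qed
  note [measurable] = int_meas[OF e] int_meas[OF d] I
  have key: "(\<integral>\<^sup>+\<omega>. ennreal ((I \<omega> - ?id n \<omega>)\<^sup>2) \<partial>M) \<le> 2 * B k + 2 * (2 * A k + 2 * C n)" for k n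
  proof -
    have "(\<integral>\<^sup>+\<omega>. ennreal ((I \<omega> - ?id n \<omega>)\<^sup>2) \<partial>M) \<le> (\<integral>\<^sup>+\<omega>. 2 * ennreal ((I \<omega> - ?ie k \<omega>)\<^sup>2) + 2 * ennreal ((?ie k \<omega> - ?id n \<omega>)\<^sup>2) \<partial>M)"
      by (intro nn_integral_mono square_sum_ennreal)
    also have "\<dots> = 2 * B k + 2 * (\<integral>\<^sup>+\<omega>. ennreal ((?ie k \<omega> - ?id n \<omega>)\<^sup>2) \<partial>M)"
      by (simp add: nn_integral_add nn_integral_cmult B_def)
    also have "(\<integral>\<^sup>+\<omega>. ennreal ((?ie k \<omega> - ?id n \<omega>)\<^sup>2) \<partial>M) = (\<integral>\<^sup>+\<omega>. (\<integral>\<^sup>+s\<in>{0..t}. ennreal ((?E k s \<omega> - ?D n s \<omega>)\<^sup>2) \<partial>lborel) \<partial>M)"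
      by (rule ito_isometry_difference[OF t e d])
    also have "\<dots> \<le> (\<integral>\<^sup>+\<omega>. 2 * (\<integral>\<^sup>+s\<in>{0..t}. ennreal ((G s - ?E k s \<omega>)\<^sup>2) \<partial>lborel) + 2 * (\<integral>\<^sup>+s\<in>{0..t}. ennreal ((G s - ?D n s \<omega>)\<^sup>2) \<partial>lborel) \<partial>M)"
    proof (rule nn_integral_mono)
      fix \<omega> assume w: "\<omega> \<in> space M"
      have m1: "(\<lambda>s. ennreal ((G s - ?E k s \<omega>)\<^sup>2) * indicator {0..t} s) \<in> borel_measurable lborel"
        and m2: "(\<lambda>s. ennreal ((G s - ?D n s \<omega>)\<^sup>2) * indicator {0..t} s) \<in> borel_measurable lborel"
        using measurable_Pair2[OF elementary_process_error_measurable[OF t e G] w] measurable_Pair2[OF elementary_process_error_measurable[OF t d G] w]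
        by simp_all
      have "(\<integral>\<^sup>+s\<in>{0..t}. ennreal ((?E k s \<omega> - ?D n s \<omega>)\<^sup>2) \<partial>lborel)
        \<le> (\<integral>\<^sup>+s. 2 * (ennreal ((G s - ?E k s \<omega>)\<^sup>2) * indicator {0..t} s) + 2 * (ennreal ((G s - ?D n s \<omega>)\<^sup>2) * indicator {0..t} s) \<partial>lborel)"
        by (intro nn_integral_mono)
           (use square_sum_ennreal[of "?E k _ \<omega>" "?D n _ \<omega>" "G _"] in \<open>auto simp: indicator_def power2_commute\<close>)
      also have "\<dots> = 2 * (\<integral>\<^sup>+s\<in>{0..t}. ennreal ((G s - ?E k s \<omega>)\<^sup>2) \<partial>lborel) + 2 * (\<integral>\<^sup>+s\<in>{0..t}. ennreal ((G s - ?D n s \<omega>)\<^sup>2) \<partial>lborel)"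
        using m1 m2 by (simp add: nn_integral_add nn_integral_cmult)
      finally show "(\<integral>\<^sup>+s\<in>{0..t}. ennreal ((?E k s \<omega> - ?D n s \<omega>)\<^sup>2) \<partial>lborel)
        \<le> 2 * (\<integral>\<^sup>+s\<in>{0..t}. ennreal ((G s - ?E k s \<omega>)\<^sup>2) \<partial>lborel) + 2 * (\<integral>\<^sup>+s\<in>{0..t}. ennreal ((G s - ?D n s \<omega>)\<^sup>2) \<partial>lborel)" .
    qed
    also have "\<dots> = 2 * A k + 2 * C n"
      using lborel.borel_measurable_nn_integral[OF elementary_process_error_measurable[OF t e G, of k]]
        lborel.borel_measurable_nn_integral[OF elementary_process_error_measurable[OF t d G, of n]]
      unfolding A_def C_def by (simp add: nn_integral_add nn_integral_cmult)
    finally show ?thesis by (simp add: add_left_mono mult_left_mono)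
  qed
  have le: "(\<integral>\<^sup>+\<omega>. ennreal ((I \<omega> - ?id n \<omega>)\<^sup>2) \<partial>M) \<le> 2 * (2 * C n)" for n
  proof -
    have "(\<lambda>k. 2 * B k + 2 * (2 * A k + 2 * C n)) \<longlonglongrightarrow> 2 * 0 + 2 * (2 * 0 + 2 * C n)"
      using eH eI unfolding A_def[symmetric] B_def[symmetric]
      by (intro tendsto_add ennreal_tendsto_cmult tendsto_const) auto
    from LIMSEQ_le_const[OF this] key show ?thesis by simp
  qed
  have "(\<lambda>n. 2 * (2 * C n)) \<longlonglongrightarrow> 2 * (2 * 0)"
    using dH unfolding C_def[symmetric] by (intro ennreal_tendsto_cmult) auto
  then have lim0: "liminf (\<lambda>n. 2 * (2 * C n)) = 0" by (simp add: lim_imp_Liminf)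
  have "(\<integral>\<^sup>+\<omega>. ennreal ((I \<omega> - J \<omega>)\<^sup>2) \<partial>M) = (\<integral>\<^sup>+\<omega>. liminf (\<lambda>n. ennreal ((I \<omega> - ?id n \<omega>)\<^sup>2)) \<partial>M)"
  proof (rule nn_integral_cong_AE, use dJ in eventually_elim)
    fix \<omega> assume "(\<lambda>n. ?id n \<omega>) \<longlonglongrightarrow> J \<omega>"
    then have "(\<lambda>n. ennreal ((I \<omega> - ?id n \<omega>)\<^sup>2)) \<longlonglongrightarrow> ennreal ((I \<omega> - J \<omega>)\<^sup>2)"
      by (intro tendsto_ennrealI tendsto_intros)
    from lim_imp_Liminf[OF sequentially_bot this]
    show "ennreal ((I \<omega> - J \<omega>)\<^sup>2) = liminf (\<lambda>n. ennreal ((I \<omega> - ?id n \<omega>)\<^sup>2))" by simp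
  qed
  also have "\<dots> \<le> liminf (\<lambda>n. \<integral>\<^sup>+\<omega>. ennreal ((I \<omega> - ?id n \<omega>)\<^sup>2) \<partial>M)"
    by (rule nn_integral_liminf) measurable
  also have "\<dots> \<le> liminf (\<lambda>n. 2 * (2 * C n))" by (rule Liminf_mono) (intro always_eventually allI le)
  finally have z: "(\<integral>\<^sup>+\<omega>. ennreal ((I \<omega> - J \<omega>)\<^sup>2) \<partial>M) = 0" using lim0 by simp
  \<comment> \<open>\<open>J\<close> is a limit only almost everywhere, so measurability is read off from the limit itself.\<close>
  have lm: "(\<lambda>\<omega>. lim (\<lambda>n. ?id n \<omega>)) \<in> borel_measurable M" by measurable
  have "AE \<omega> in M. J \<omega> = lim (\<lambda>n. ?id n \<omega>)" using dJ by eventually_elim (simp add: limI)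
  moreover from this have "(\<integral>\<^sup>+\<omega>. ennreal ((I \<omega> - lim (\<lambda>n. ?id n \<omega>))\<^sup>2) \<partial>M) = 0"
    unfolding z[symmetric] by (intro nn_integral_cong_AE) auto
  then have "AE \<omega> in M. ennreal ((I \<omega> - lim (\<lambda>n. ?id n \<omega>))\<^sup>2) = 0"
    using lm by (subst (asm) nn_integral_0_iff_AE) auto
  ultimately show ?thesis by eventually_elim simp
qed

end

text \<open>For an integrand with continuous derivative the Riemann sums of the stochastic integral can
  be summed by parts, which makes them converge along each continuous path.\<close>

lemma step_sum_by_parts:
  fixes W g g' :: "real \<Rightarrow> real"
  assumes t: "0 \<le> t" and W: "continuous_on {0..t} W" and g': "continuous_on {0..t} g'"
    and g: "\<And>s. s \<in> {0..t} \<Longrightarrow> (g has_vector_derivative g' s) (at s within {0..t})"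
  shows "(\<lambda>n. \<Sum>j<Suc n. (W (t * real (Suc j) / real (Suc n)) - W (t * real j / real (Suc n))) * g (t * real j / real (Suc n)))
    \<longlonglongrightarrow> W t * g t - W 0 * g 0 - integral {0..t} (\<lambda>s. W s * g' s)"
proof (rule LIMSEQ_I)
  fix e :: real assume e: "e > 0"
  obtain K where K: "K > 0" "\<And>s. s \<in> {0..t} \<Longrightarrow> \<bar>g' s\<bar> \<le> K"
    using compact_imp_bounded[OF compact_continuous_image[OF g' compact_Icc]] by (force simp: bounded_pos)
  define \<eta> where "\<eta> = e / (2 * K * (t + 1))"
  have \<eta>: "\<eta> > 0" using e K t by (simp add: \<eta>_def)
  have "uniformly_continuous_on {0..t} W" by (rule compact_uniformly_continuous[OF W compact_Icc])
  then obtain \<delta> where \<delta>: "\<delta> > 0" "\<And>s s'. s \<in> {0..t} \<Longrightarrow> s' \<in> {0..t} \<Longrightarrow> \<bar>s' - s\<bar> < \<delta> \<Longrightarrow> \<bar>W s' - W s\<bar> < \<eta>"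
    using \<eta> unfolding uniformly_continuous_on_def dist_real_def by metis
  obtain N :: nat where N: "t / \<delta> < real N" using reals_Archimedean2 by blast
  show "\<exists>n0. \<forall>n\<ge>n0. norm ((\<Sum>j<Suc n. (W (t * real (Suc j) / real (Suc n)) - W (t * real j / real (Suc n))) * g (t * real j / real (Suc n)))
     - (W t * g t - W 0 * g 0 - integral {0..t} (\<lambda>s. W s * g' s))) < e"
  proof (intro exI[of _ N] allI impI)
    fix n assume n: "N \<le> n"
    define p where "p j = t * real j / real (Suc n)" for j
    have p0: "p 0 = 0" and pn: "p (Suc n) = t" by (simp_all add: p_def del: of_nat_Suc)
    have step: "p (Suc j) - p j = t / real (Suc n)" for j by (simp add: p_def distrib_left add_divide_distrib)
    have small: "t / real (Suc n) < \<delta>"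
    proof -
      have "t / \<delta> < real (Suc n)" using N n by linarith
      then show ?thesis using \<delta>(1) by (simp add: field_simps del: of_nat_Suc)
    qed
    have pm: "p j \<le> p (Suc j)" for j using step[of j] t by (metis diff_ge_0_iff_ge divide_nonneg_nonneg of_nat_0_le_iff)
    have pI: "0 \<le> p j" "p j \<le> t" if "j \<le> Suc n" for j
    proof -
      show "0 \<le> p j" using t by (simp add: p_def)
      have "t * real j \<le> t * real (Suc n)" using t that by (intro mult_left_mono) auto
      then show "p j \<le> t" by (simp add: p_def pos_divide_le_eq del: of_nat_Suc)
    qed
    have ftc: "(g' has_integral g (p (Suc j)) - g (p j)) {p j..p (Suc j)}" if "j < Suc n" for j
    proof (rule fundamental_theorem_of_calculus[OF pm])
      fix s assume "s \<in> {p j..p (Suc j)}"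
      then show "(g has_vector_derivative g' s) (at s within {p j..p (Suc j)})"
        using pI[of j] pI[of "Suc j"] that by (intro has_vector_derivative_within_subset[OF g]) auto
    qed
    have ci: "(\<lambda>s. W s * g' s) integrable_on {u..v}" if "0 \<le> u" "v \<le> t" for u v
      by (intro integrable_continuous_interval continuous_on_mult continuous_on_subset[OF W] continuous_on_subset[OF g']) (use that in auto)
    have piece: "\<bar>integral {p j..p (Suc j)} (\<lambda>s. W s * g' s) - W (p (Suc j)) * (g (p (Suc j)) - g (p j))\<bar> \<le> \<eta> * K * (p (Suc j) - p j)"
      if j: "j < Suc n" for j
    proof -
      have sub: "{p j..p (Suc j)} \<subseteq> {0..t}" using pI[of j] pI[of "Suc j"] j by auto
      have "integral {p j..p (Suc j)} (\<lambda>s. W s * g' s) - W (p (Suc j)) * (g (p (Suc j)) - g (p j))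
        = integral {p j..p (Suc j)} (\<lambda>s. W s * g' s) - integral {p j..p (Suc j)} (\<lambda>s. W (p (Suc j)) * g' s)"
        using ftc[OF j] by (simp add: integral_unique)
      also have "\<dots> = integral {p j..p (Suc j)} (\<lambda>s. W s * g' s - W (p (Suc j)) * g' s)"
        by (rule Henstock_Kurzweil_Integration.integral_diff[symmetric])
           (use ci[of "p j" "p (Suc j)"] pI[of j] pI[of "Suc j"] j has_integral_integrable[OF has_integral_mult_right[OF ftc[OF j]]] in auto)
      also have "\<dots> = integral {p j..p (Suc j)} (\<lambda>s. (W s - W (p (Suc j))) * g' s)" by (simp add: left_diff_distrib)
      finally have eq: "integral {p j..p (Suc j)} (\<lambda>s. W s * g' s) - W (p (Suc j)) * (g (p (Suc j)) - g (p j))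
         = integral {p j..p (Suc j)} (\<lambda>s. (W s - W (p (Suc j))) * g' s)" .
      have "norm (integral {p j..p (Suc j)} (\<lambda>s. (W s - W (p (Suc j))) * g' s)) \<le> \<eta> * K * (p (Suc j) - p j)"
      proof (rule integral_bound[OF pm])
        show "continuous_on {p j..p (Suc j)} (\<lambda>s. (W s - W (p (Suc j))) * g' s)"
          by (intro continuous_intros continuous_on_subset[OF W sub] continuous_on_subset[OF g' sub])
        fix s assume s: "s \<in> {p j..p (Suc j)}"
        have "\<bar>s - p (Suc j)\<bar> < \<delta>" using s step[of j] small by auto
        then have "\<bar>W s - W (p (Suc j))\<bar> < \<eta>" using s sub pI[of "Suc j"] j by (intro \<delta>(2)) auto
        moreover have "\<bar>g' s\<bar> \<le> K" using s sub by (intro K) auto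
        ultimately show "norm ((W s - W (p (Suc j))) * g' s) \<le> \<eta> * K"
          unfolding real_norm_def abs_mult using \<eta> by (intro mult_mono) auto
      qed
      then show ?thesis unfolding eq by simp
    qed
    have ind: "\<bar>integral {0..p m} (\<lambda>s. W s * g' s) - (\<Sum>j<m. W (p (Suc j)) * (g (p (Suc j)) - g (p j)))\<bar> \<le> \<eta> * K * p m"
      if "m \<le> Suc n" for m
      using that
    proof (induction m)
      case 0
      then show ?case by (simp add: p0)
    next
      case (Suc m)
      have "integral {0..p m} (\<lambda>s. W s * g' s) + integral {p m..p (Suc m)} (\<lambda>s. W s * g' s) = integral {0..p (Suc m)} (\<lambda>s. W s * g' s)"
        by (rule Henstock_Kurzweil_Integration.integral_combine) (use pI[of m] pI[of "Suc m"] pm[of m] Suc.prems ci[of 0 "p (Suc m)"] in auto)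
      moreover have "\<eta> * K * p (Suc m) = \<eta> * K * p m + \<eta> * K * (p (Suc m) - p m)" by (simp add: algebra_simps)
      ultimately show ?case using Suc.IH Suc.prems piece[of m] by (simp only: sum.lessThan_Suc) linarith
    qed
    have parts: "(\<Sum>j<m. (W (p (Suc j)) - W (p j)) * g (p j)) = W (p m) * g (p m) - W (p 0) * g (p 0) - (\<Sum>j<m. W (p (Suc j)) * (g (p (Suc j)) - g (p j)))" for m
      by (induction m) (simp_all add: algebra_simps)
    have "\<eta> * K * t < e"
    proof -
      have "\<eta> * K = e / (2 * (t + 1))" using K(1) by (simp add: \<eta>_def)
      then have "\<eta> * K * t = e * (t / (2 * (t + 1)))" by simp
      also have "\<dots> < e * 1" using e t by (intro mult_strict_left_mono) (auto simp: field_simps)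
      finally show ?thesis by simp
    qed
    then have "\<bar>(\<Sum>j<Suc n. (W (p (Suc j)) - W (p j)) * g (p j)) - (W t * g t - W 0 * g 0 - integral {0..t} (\<lambda>s. W s * g' s))\<bar> < e"
      using ind[of "Suc n"] unfolding parts p0 pn by linarith
    then show "norm ((\<Sum>j<Suc n. (W (t * real (Suc j) / real (Suc n)) - W (t * real j / real (Suc n))) * g (t * real j / real (Suc n)))
     - (W t * g t - W 0 * g 0 - integral {0..t} (\<lambda>s. W s * g' s))) < e"
      unfolding p_def real_norm_def .
  qed
qed

context wiener_component
begin

text \<open>The left-point step functions on the uniform partition approximate the integrand in mean square,
  and their integrals converge along each continuous path by summation by parts.\<close>

lemma ito_integral_by_parts_real:
  fixes g g' :: "real \<Rightarrow> real"
  assumes t: "0 \<le> t" "t \<le> T" and g': "continuous_on {0..t} g'"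
    and g: "\<And>s. s \<in> {0..t} \<Longrightarrow> (g has_vector_derivative g' s) (at s within {0..t})"
    and I: "I \<in> borel_measurable M" and e: "\<And>k. elementary F t (\<tau> k) (m k) (e k)"
    and eH: "(\<lambda>k. \<integral>\<^sup>+\<omega>. (\<integral>\<^sup>+s\<in>{0..t}. ennreal ((g s - elementary_process (\<tau> k) (m k) (e k) s \<omega>)\<^sup>2) \<partial>lborel) \<partial>M) \<longlonglongrightarrow> 0"
    and eI: "(\<lambda>k. \<integral>\<^sup>+\<omega>. ennreal ((I \<omega> - elementary_integral W (\<tau> k) (m k) (e k) \<omega>)\<^sup>2) \<partial>M) \<longlonglongrightarrow> 0"
  shows "AE \<omega> in M. I \<omega> = W t \<omega> * g t - W 0 \<omega> * g 0 - integral {0..t} (\<lambda>s. W s \<omega> * g' s)"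
proof -
  have cg: "continuous_on {0..t} g" by (rule has_derivative_continuous_on[OF g[unfolded has_vector_derivative_def]])
  \<comment> \<open>\<open>g\<close> is continuous only on the interval; its extension by zero is Borel measurable on the line.\<close>
  define G where "G s = indicator {0..t} s *\<^sub>R g s" for s
  have G: "G \<in> borel_measurable borel" unfolding G_def[abs_def]
    by (rule borel_measurable_continuous_on_indicator[OF _ cg]) simp
  have Gg: "ennreal ((G s - x)\<^sup>2) * indicator {0..t} s = ennreal ((g s - x)\<^sup>2) * indicator {0..t} s" for s x
    by (auto simp: G_def indicator_def)
  define \<rho> where "\<rho> n j = t * real j / real (Suc n)" for n j :: nat
  define d where "d n j = (\<lambda>\<omega>::'a. g (\<rho> n j))" for n j
  have \<rho>: "0 \<le> \<rho> n j" "\<rho> n j \<le> \<rho> n (Suc j)" "\<rho> n (Suc n) = t" "\<rho> n (Suc j) - \<rho> n j = t / real (Suc n)" for n j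
  proof -
    show "0 \<le> \<rho> n j" "\<rho> n (Suc n) = t" using t by (simp_all add: \<rho>_def del: of_nat_Suc)
    show 1: "\<rho> n (Suc j) - \<rho> n j = t / real (Suc n)" by (simp add: \<rho>_def distrib_left add_divide_distrib)
    have "0 \<le> t / real (Suc n)" using t by simp
    then show "\<rho> n j \<le> \<rho> n (Suc j)" using 1 by linarith
  qed
  have d_el: "elementary F t (\<rho> n) (Suc n) (d n)" for n
    unfolding elementary_def using \<rho>[of n] by (auto simp: d_def)
  have cover: "\<exists>!j. j < Suc n \<and> s \<in> {\<rho> n j<..\<rho> n (Suc j)}" if s: "0 < s" "s \<le> t" for n s
  proof -
    have ex: "\<exists>j. s \<le> \<rho> n j" using s \<rho>(3)[of n] by auto
    define j where "j = (LEAST j. s \<le> \<rho> n j)"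
    have 1: "s \<le> \<rho> n j" unfolding j_def by (rule LeastI_ex[OF ex])
    have le: "j \<le> Suc n" unfolding j_def by (rule Least_le) (use s \<rho>(3)[of n] in simp)
    have "j \<noteq> 0" using 1 s by (intro notI) (simp add: \<rho>_def)
    then obtain i where i: "j = Suc i" by (cases j) auto
    have "\<not> s \<le> \<rho> n i" using not_less_Least[of i "\<lambda>j. s \<le> \<rho> n j"] i by (simp add: j_def)
    then have P: "i < Suc n \<and> s \<in> {\<rho> n i<..\<rho> n (Suc i)}" using 1 i le by auto
    show ?thesis
    proof (rule ex1I[of _ i], rule P)
      fix i' assume P': "i' < Suc n \<and> s \<in> {\<rho> n i'<..\<rho> n (Suc i')}"
      have mono: "a \<le> b \<Longrightarrow> \<rho> n a \<le> \<rho> n b" for a b by (rule lift_Suc_mono_le[of "\<rho> n"]) (auto intro: \<rho>)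
      show "i' = i"
      proof (rule ccontr)
        assume "i' \<noteq> i"
        then consider "Suc i' \<le> i" | "Suc i \<le> i'" by linarith
        then show False using P P' mono[of "Suc i'" i] mono[of "Suc i" i'] by cases auto
      qed
    qed
  qed
  have proc: "elementary_process (\<rho> n) (Suc n) (d n) s \<omega> = g (\<rho> n j)"
    if jn: "j < Suc n" and sj: "s \<in> {\<rho> n j<..\<rho> n (Suc j)}" and s: "0 < s" "s \<le> t" for n s j \<omega>
  proof -
    have "indicator {\<rho> n i<..\<rho> n (Suc i)} s *\<^sub>R d n i \<omega> = (if i = j then g (\<rho> n j) else 0)" if i: "i < Suc n" for i
    proof (cases "i = j")
      case True
      then show ?thesis using sj by (simp add: d_def)
    next
      case False
      then have "s \<notin> {\<rho> n i<..\<rho> n (Suc i)}" using cover[OF s, of n] jn sj i by blast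
      then show ?thesis using False by simp
    qed
    then have "elementary_process (\<rho> n) (Suc n) (d n) s \<omega> = (\<Sum>i<Suc n. if i = j then g (\<rho> n j) else 0)"
      unfolding elementary_process_def by (intro sum.cong) auto
    then show ?thesis using jn by simp
  qed
  have dH: "(\<lambda>n. \<integral>\<^sup>+\<omega>. (\<integral>\<^sup>+s\<in>{0..t}. ennreal ((G s - elementary_process (\<rho> n) (Suc n) (d n) s \<omega>)\<^sup>2) \<partial>lborel) \<partial>M) \<longlonglongrightarrow> 0"
  proof (rule order_tendstoI)
    fix x :: ennreal assume x: "0 < x"
    obtain z where z: "0 < z" "z < x" using dense[OF x] by blast
    then obtain y where y: "0 < y" "ennreal y < x" by (cases z) auto
    define \<eta> where "\<eta> = sqrt (y / (t + 1))"
    have \<eta>: "\<eta> > 0" "\<eta>\<^sup>2 = y / (t + 1)" using y t by (auto simp: \<eta>_def)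
    have "uniformly_continuous_on {0..t} g" by (rule compact_uniformly_continuous[OF cg compact_Icc])
    then obtain \<delta> where \<delta>: "\<delta> > 0" "\<And>s s'. s \<in> {0..t} \<Longrightarrow> s' \<in> {0..t} \<Longrightarrow> \<bar>s' - s\<bar> < \<delta> \<Longrightarrow> \<bar>g s' - g s\<bar> < \<eta>"
      using \<eta>(1) unfolding uniformly_continuous_on_def dist_real_def by metis
    obtain N :: nat where N: "t / \<delta> < real N" using reals_Archimedean2 by blast
    show "eventually (\<lambda>n. (\<integral>\<^sup>+\<omega>. (\<integral>\<^sup>+s\<in>{0..t}. ennreal ((G s - elementary_process (\<rho> n) (Suc n) (d n) s \<omega>)\<^sup>2) \<partial>lborel) \<partial>M) < x) sequentially"
    proof (rule eventually_sequentiallyI[of N])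
      fix n assume n: "N \<le> n"
      have "t / \<delta> < real (Suc n)" using N n by linarith
      then have small: "t / real (Suc n) < \<delta>" using \<delta>(1) by (simp add: field_simps del: of_nat_Suc)
      have pt: "ennreal ((g s - elementary_process (\<rho> n) (Suc n) (d n) s \<omega>)\<^sup>2) \<le> ennreal (\<eta>\<^sup>2)" if s: "0 < s" "s \<le> t" for s \<omega>
      proof -
        obtain j where j: "j < Suc n" "s \<in> {\<rho> n j<..\<rho> n (Suc j)}" using cover[OF s] by blast
        have "\<bar>s - \<rho> n j\<bar> < \<delta>" using j(2) \<rho>(4)[of n j] small by auto
        then have "\<bar>g s - g (\<rho> n j)\<bar> < \<eta>" using j(2) \<rho>(1)[of n j] s by (intro \<delta>(2)) auto
        then have "(g s - g (\<rho> n j))\<^sup>2 \<le> \<eta>\<^sup>2" by (intro abs_le_square_iff[THEN iffD1]) (use \<eta> in auto)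
        then show ?thesis unfolding proc[OF j s] by (rule ennreal_leI)
      qed
      have "(\<integral>\<^sup>+s\<in>{0..t}. ennreal ((G s - elementary_process (\<rho> n) (Suc n) (d n) s \<omega>)\<^sup>2) \<partial>lborel) \<le> ennreal y" for \<omega>
      proof -
        have "(\<integral>\<^sup>+s\<in>{0..t}. ennreal ((g s - elementary_process (\<rho> n) (Suc n) (d n) s \<omega>)\<^sup>2) \<partial>lborel) \<le> (\<integral>\<^sup>+s\<in>{0..t}. ennreal (\<eta>\<^sup>2) \<partial>lborel)"
        \<comment> \<open>The intervals of an elementary process are open on the left, so the point \<open>0\<close> is not covered.\<close>
        proof (rule nn_integral_mono_AE, rule AE_mp[OF AE_lborel_singleton[of 0]], rule AE_I2, rule impI)
          fix s :: real assume "s \<noteq> 0"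
          then show "ennreal ((g s - elementary_process (\<rho> n) (Suc n) (d n) s \<omega>)\<^sup>2) * indicator {0..t} s \<le> ennreal (\<eta>\<^sup>2) * indicator {0..t} s"
            using pt[of s \<omega>] by (auto simp: indicator_def)
        qed
        also have "\<dots> = ennreal (\<eta>\<^sup>2) * ennreal t" using t by (simp add: nn_integral_cmult_indicator)
        also have "\<dots> = ennreal (\<eta>\<^sup>2 * t)" using t by (simp add: ennreal_mult)
        also have "\<dots> \<le> ennreal y" using y t by (intro ennreal_leI) (simp add: \<eta>(2) field_simps)
        finally show ?thesis unfolding Gg .
      qed
      then have "(\<integral>\<^sup>+\<omega>. (\<integral>\<^sup>+s\<in>{0..t}. ennreal ((G s - elementary_process (\<rho> n) (Suc n) (d n) s \<omega>)\<^sup>2) \<partial>lborel) \<partial>M) \<le> (\<integral>\<^sup>+\<omega>. ennreal y \<partial>M)"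
        by (intro nn_integral_mono)
      also have "\<dots> = ennreal y" by (simp add: emeasure_space_1)
      finally show "(\<integral>\<^sup>+\<omega>. (\<integral>\<^sup>+s\<in>{0..t}. ennreal ((G s - elementary_process (\<rho> n) (Suc n) (d n) s \<omega>)\<^sup>2) \<partial>lborel) \<partial>M) < x"
        using y(2) by (rule order.strict_trans1)
    qed
  qed simp
  have dJ: "AE \<omega> in M. (\<lambda>n. elementary_integral W (\<rho> n) (Suc n) (d n) \<omega>) \<longlonglongrightarrow> W t \<omega> * g t - W 0 \<omega> * g 0 - integral {0..t} (\<lambda>s. W s \<omega> * g' s)"
  proof -
    have "AE \<omega> in M. continuous_on {0..T} (\<lambda>s. w s \<omega>)" using wiener by (simp add: standard_wiener_process_def)
    then show ?thesis
    proof eventually_elim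
      fix \<omega> assume "continuous_on {0..T} (\<lambda>s. w s \<omega>)"
      then have "continuous_on {0..t} (\<lambda>s. W s \<omega>)"
        using t by (intro continuous_intros continuous_on_subset[of "{0..T}" _ "{0..t}"]) auto
      from step_sum_by_parts[OF t(1) this g' g]
      show "(\<lambda>n. elementary_integral W (\<rho> n) (Suc n) (d n) \<omega>) \<longlonglongrightarrow> W t \<omega> * g t - W 0 \<omega> * g 0 - integral {0..t} (\<lambda>s. W s \<omega> * g' s)"
        by (simp add: elementary_integral_def \<rho>_def d_def)
    qed
  qed
  show ?thesis
    by (rule ito_integral_pointwise_limit[OF t(2) G I e d_el _ eI dH dJ]) (use eH in \<open>simp add: Gg\<close>)
qed

lemma ito_integral_by_parts:
  fixes g g' :: "real \<Rightarrow> real^'n::finite"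
  assumes t: "0 \<le> t" "t \<le> T" and g': "continuous_on {0..t} g'"
    and g: "\<And>s. s \<in> {0..t} \<Longrightarrow> (g has_vector_derivative g' s) (at s within {0..t})"
    and ito: "has_ito_integral M F W t (\<lambda>s _. g s) I"
  shows "AE \<omega> in M. I \<omega> = W t \<omega> *\<^sub>R g t - W 0 \<omega> *\<^sub>R g 0 - integral {0..t} (\<lambda>s. W s \<omega> *\<^sub>R g' s)"
proof -
  obtain \<tau> m e where I: "I \<in> borel_measurable M" and e: "\<And>k::nat. elementary F t (\<tau> k) (m k) (e k)"
    and eH: "(\<lambda>k. \<integral>\<^sup>+\<omega>. (\<integral>\<^sup>+s\<in>{0..t}. ennreal ((norm (g s - elementary_process (\<tau> k) (m k) (e k) s \<omega>))\<^sup>2) \<partial>lborel) \<partial>M) \<longlonglongrightarrow> 0"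
    and eI: "(\<lambda>k. \<integral>\<^sup>+\<omega>. ennreal ((norm (I \<omega> - elementary_integral W (\<tau> k) (m k) (e k) \<omega>))\<^sup>2) \<partial>M) \<longlonglongrightarrow> 0"
    using ito unfolding has_ito_integral_def by blast
  have nth_meas: "(\<lambda>x::real^'n. x $ j) \<in> borel_measurable borel" for j
    by (intro borel_measurable_continuous_onI continuous_intros)
  have sq: "ennreal ((x $ j)\<^sup>2) \<le> ennreal ((norm x)\<^sup>2)" for x :: "real^'n" and j
    by (intro ennreal_leI abs_le_square_iff[THEN iffD1]) (simp add: component_le_norm_cart)
  have comp: "AE \<omega> in M. I \<omega> $ j = W t \<omega> * g t $ j - W 0 \<omega> * g 0 $ j - integral {0..t} (\<lambda>s. W s \<omega> * g' s $ j)" for j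
  proof (rule ito_integral_by_parts_real[OF t])
    show "continuous_on {0..t} (\<lambda>s. g' s $ j)" by (intro continuous_intros g')
    show "((\<lambda>s. g s $ j) has_vector_derivative g' s $ j) (at s within {0..t})" if "s \<in> {0..t}" for s
      by (rule bounded_linear.has_vector_derivative[OF bounded_linear_vec_nth g[OF that]])
    show "(\<lambda>\<omega>. I \<omega> $ j) \<in> borel_measurable M" by (rule measurable_compose[OF I nth_meas])
    show "elementary F t (\<tau> k) (m k) (\<lambda>i \<omega>. e k i \<omega> $ j)" for k
      unfolding elementary_def
    proof (intro conjI allI impI)
      fix i assume i: "i < m k"
      have ei: "e k i \<in> borel_measurable (F (\<tau> k i))" and "\<exists>K. \<forall>\<omega>\<in>space (F (\<tau> k i)). norm (e k i \<omega>) \<le> K"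
        using e[of k] i by (auto simp: elementary_def)
      then obtain K where "\<forall>\<omega>\<in>space (F (\<tau> k i)). norm (e k i \<omega>) \<le> K" by blast
      then have "\<forall>\<omega>\<in>space (F (\<tau> k i)). norm (e k i \<omega> $ j) \<le> K"
        using component_le_norm_cart order.trans by (metis real_norm_def)
      then show "\<exists>K. \<forall>\<omega>\<in>space (F (\<tau> k i)). norm (e k i \<omega> $ j) \<le> K" by blast
      show "(\<lambda>\<omega>. e k i \<omega> $ j) \<in> borel_measurable (F (\<tau> k i))" by (rule measurable_compose[OF ei nth_meas])
    qed (use e[of k] in \<open>auto simp: elementary_def\<close>)
    have ep: "g s $ j - elementary_process (\<tau> k) (m k) (\<lambda>i \<omega>. e k i \<omega> $ j) s \<omega> = (g s - elementary_process (\<tau> k) (m k) (e k) s \<omega>) $ j" for k s \<omega>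
      by (simp add: elementary_process_def)
    show "(\<lambda>k. \<integral>\<^sup>+\<omega>. (\<integral>\<^sup>+s\<in>{0..t}. ennreal ((g s $ j - elementary_process (\<tau> k) (m k) (\<lambda>i \<omega>. e k i \<omega> $ j) s \<omega>)\<^sup>2) \<partial>lborel) \<partial>M) \<longlonglongrightarrow> 0"
      unfolding ep
      by (rule tendsto_sandwich[OF _ _ tendsto_const eH])
         (auto intro!: always_eventually nn_integral_mono mult_right_mono sq simp del: vector_minus_component)
    have ei: "I \<omega> $ j - elementary_integral W (\<tau> k) (m k) (\<lambda>i \<omega>. e k i \<omega> $ j) \<omega> = (I \<omega> - elementary_integral W (\<tau> k) (m k) (e k) \<omega>) $ j" for k \<omega>
      by (simp add: elementary_integral_def)
    show "(\<lambda>k. \<integral>\<^sup>+\<omega>. ennreal ((I \<omega> $ j - elementary_integral W (\<tau> k) (m k) (\<lambda>i \<omega>. e k i \<omega> $ j) \<omega>)\<^sup>2) \<partial>M) \<longlonglongrightarrow> 0"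
      unfolding ei
      by (rule tendsto_sandwich[OF _ _ tendsto_const eI])
         (auto intro!: always_eventually nn_integral_mono sq simp del: vector_minus_component)
  qed
  have all: "AE \<omega> in M. \<forall>j. I \<omega> $ j = W t \<omega> * g t $ j - W 0 \<omega> * g 0 $ j - integral {0..t} (\<lambda>s. W s \<omega> * g' s $ j)"
    using comp by (simp add: AE_all_countable)
  have "AE \<omega> in M. continuous_on {0..T} (\<lambda>s. w s \<omega>)" using wiener by (simp add: standard_wiener_process_def)
  with all show ?thesis
  proof eventually_elim
    fix \<omega> assume 1: "\<forall>j. I \<omega> $ j = W t \<omega> * g t $ j - W 0 \<omega> * g 0 $ j - integral {0..t} (\<lambda>s. W s \<omega> * g' s $ j)"
      and "continuous_on {0..T} (\<lambda>s. w s \<omega>)"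
    then have "continuous_on {0..t} (\<lambda>s. W s \<omega>)"
      using t by (intro continuous_intros continuous_on_subset[of "{0..T}" _ "{0..t}"]) auto
    then have "(\<lambda>s. W s \<omega> *\<^sub>R g' s) integrable_on {0..t}"
      by (intro integrable_continuous_interval continuous_on_scaleR g')
    from integral_component_eq_cart[OF this]
    have "integral {0..t} (\<lambda>s. W s \<omega> * g' s $ j) = integral {0..t} (\<lambda>s. W s \<omega> *\<^sub>R g' s) $ j" for j by simp
    then show "I \<omega> = W t \<omega> *\<^sub>R g t - W 0 \<omega> *\<^sub>R g 0 - integral {0..t} (\<lambda>s. W s \<omega> *\<^sub>R g' s)"
      using 1 by (simp add: vec_eq_iff)
  qed
qed

end

section \<open>The pathwise error recursion\<close>

text \<open>The order of the error of freezing exceeds the Hoelder exponent by one, because the deviation is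
  integrated over the step.\<close>

lemma integral_frozen_integrand:
  fixes u :: "real \<Rightarrow> 'b::euclidean_space"
  assumes ts: "t \<le> s" and u: "continuous_on {t..s} u"
    and K: "\<And>r. r \<in> {t..s} \<Longrightarrow> norm (u r - u0) \<le> K * (s - t) powr \<alpha>"
  shows "norm (integral {t..s} u - (s - t) *\<^sub>R u0) \<le> K * (s - t) powr (1 + \<alpha>)"
proof -
  have "integral {t..s} u - (s - t) *\<^sub>R u0 = integral {t..s} (\<lambda>r. u r - u0)"
    using ts u by (subst Henstock_Kurzweil_Integration.integral_diff) (auto intro: integrable_continuous_interval)
  also have "norm \<dots> \<le> K * (s - t) powr \<alpha> * (s - t)"
    by (rule integral_bound[OF ts]) (auto intro!: continuous_intros u K)
  also have "\<dots> = K * (s - t) powr (1 + \<alpha>)" using ts by (simp add: powr_add powr_one_gt_zero_iff mult_ac)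
  finally show ?thesis .
qed

lemma time_integral_continuous:
  fixes H :: "real \<Rightarrow> real^'n::finite \<Rightarrow> 'b::euclidean_space"
  assumes H: "hoelder_field \<alpha> T H" and ts: "0 \<le> t" "s \<le> T"
  shows "continuous_on UNIV (\<lambda>x. integral {t..s} (\<lambda>r. H r x))"
proof -
  have "continuous_on (UNIV \<times> cbox t s) (\<lambda>z. (\<lambda>(r, y). H r y) (snd z, fst z))"
    by (rule continuous_on_compose2[OF hoelder_field_continuous[OF H]]) (use ts in \<open>auto intro!: continuous_intros\<close>)
  then have "continuous_on (UNIV \<times> cbox t s) (\<lambda>(y, r). H r y)" by (simp add: case_prod_unfold)
  from integral_continuous_on_param[OF this] show ?thesis by simp
qed

lemma time_integral_C1_space:
  fixes H :: "real \<Rightarrow> real^'n::finite \<Rightarrow> 'b::euclidean_space"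
  assumes H: "hoelder_jet 0 T (Suc 0) H" and ts: "0 \<le> t" "s \<le> T"
  shows "C1_space (\<lambda>x. integral {t..s} (\<lambda>r. H r x))"
    "spartial i (\<lambda>x. integral {t..s} (\<lambda>r. H r x)) = (\<lambda>x. integral {t..s} (\<lambda>r. spartial i (H r) x))"
proof -
  show eq: "spartial i (\<lambda>x. integral {t..s} (\<lambda>r. H r x)) = (\<lambda>x. integral {t..s} (\<lambda>r. spartial i (H r) x))" for i
    using has_spartialI(2)[OF spartial_time_integral[OF assms]] by (simp add: fun_eq_iff)
  show "C1_space (\<lambda>x. integral {t..s} (\<lambda>r. H r x))"
    unfolding C1_space_def eq using has_spartialI(1)[OF spartial_time_integral[OF assms]]
      time_integral_continuous[OF hoelder_jet_field[OF H] ts] time_integral_continuous[OF hoelder_jet_field[OF hoelder_jet_spartial[OF H]] ts]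
    by auto
qed

lemma average_square_le:
  "((1 / 2 ^ CARD('n)) * (\<Sum>\<xi>\<in>(signs::(real^'n::finite) set). f \<xi>))\<^sup>2 \<le> (1 / 2 ^ CARD('n)) * (\<Sum>\<xi>\<in>(signs::(real^'n) set). (f \<xi>)\<^sup>2 :: real)"
proof -
  let ?N = "2 ^ CARD('n) :: real"
  have "(\<Sum>\<xi>\<in>(signs::(real^'n) set). f \<xi>)\<^sup>2 \<le> (\<Sum>\<xi>\<in>(signs::(real^'n) set). (f \<xi>)\<^sup>2) * ?N"
    using sum_squared_le_sum_of_squares[of f "signs::(real^'n) set"] by (simp add: finite_signs_card(2))
  then have "(1 / ?N)\<^sup>2 * (\<Sum>\<xi>\<in>(signs::(real^'n) set). f \<xi>)\<^sup>2 \<le> (1 / ?N)\<^sup>2 * ((\<Sum>\<xi>\<in>(signs::(real^'n) set). (f \<xi>)\<^sup>2) * ?N)"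
    by (intro mult_left_mono) auto
  also have "\<dots> = (1 / ?N) * (\<Sum>\<xi>\<in>(signs::(real^'n) set). (f \<xi>)\<^sup>2)" by (simp add: power2_eq_square)
  finally show ?thesis by (simp only: power_mult_distrib)
qed

text \<open>Replacing the approximate velocity by the exact one under the average transports the error
  along the approximate characteristics and adds a term of order \<open>h\<close> times the error.\<close>

lemma layer_average_difference:
  fixes U V :: "real^'n::finite \<Rightarrow> real^'n"
  assumes U: "C1_space U" "\<And>i x. norm (spartial i U x) \<le> K" and h: "0 \<le> h"
  shows "norm (layer_average \<sigma> h V x - layer_average \<sigma> h U x)
    \<le> (1 / 2 ^ CARD('n)) * (\<Sum>\<xi>\<in>(signs::(real^'n) set). norm (V (x - h *\<^sub>R V x + (\<sigma> * sqrt h) *\<^sub>R \<xi>) - U (x - h *\<^sub>R V x + (\<sigma> * sqrt h) *\<^sub>R \<xi>)))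
      + real CARD('n) * K * h * norm (V x - U x)"
proof -
  let ?N = "2 ^ CARD('n) :: real"
  let ?y = "\<lambda>\<xi>. x - h *\<^sub>R V x + (\<sigma> * sqrt h) *\<^sub>R \<xi>" and ?z = "\<lambda>\<xi>. x - h *\<^sub>R U x + (\<sigma> * sqrt h) *\<^sub>R \<xi>"
  have "norm (V (?y \<xi>) - U (?z \<xi>)) \<le> norm (V (?y \<xi>) - U (?y \<xi>)) + real CARD('n) * K * (h * norm (V x - U x))" for \<xi>
  proof -
    have "?y \<xi> - ?z \<xi> = h *\<^sub>R (U x - V x)" by (simp add: algebra_simps)
    then have "norm (?y \<xi> - ?z \<xi>) = h * norm (V x - U x)" using h by (simp add: norm_minus_commute)
    then have "norm (U (?y \<xi>) - U (?z \<xi>)) \<le> real CARD('n) * K * (h * norm (V x - U x))"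
      using C1_space_lipschitz[OF U, of "?y \<xi>" "?z \<xi>"] by simp
    then show ?thesis using norm_triangle_ineq[of "V (?y \<xi>) - U (?y \<xi>)" "U (?y \<xi>) - U (?z \<xi>)"] by simp
  qed
  then have "norm (\<Sum>\<xi>\<in>signs. V (?y \<xi>) - U (?z \<xi>)) \<le> (\<Sum>\<xi>\<in>(signs::(real^'n) set). norm (V (?y \<xi>) - U (?y \<xi>)) + real CARD('n) * K * (h * norm (V x - U x)))"
    by (intro sum_norm_le)
  also have "\<dots> = (\<Sum>\<xi>\<in>(signs::(real^'n) set). norm (V (?y \<xi>) - U (?y \<xi>))) + ?N * (real CARD('n) * K * (h * norm (V x - U x)))"
    by (simp add: sum.distrib finite_signs_card(2))
  finally have "(1 / ?N) * norm (\<Sum>\<xi>\<in>signs. V (?y \<xi>) - U (?z \<xi>)) \<le> (1 / ?N) * ((\<Sum>\<xi>\<in>(signs::(real^'n) set). norm (V (?y \<xi>) - U (?y \<xi>))) + ?N * (real CARD('n) * K * (h * norm (V x - U x))))"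
    by (intro mult_left_mono) auto
  moreover have "layer_average \<sigma> h V x - layer_average \<sigma> h U x = (1 / ?N) *\<^sub>R (\<Sum>\<xi>\<in>signs. V (?y \<xi>) - U (?z \<xi>))"
    by (simp add: layer_average_def sum_subtractf scaleR_diff_right)
  ultimately show ?thesis by (simp add: distrib_left mult.assoc)
qed

text \<open>The weight \<open>h\<close> of the transported error \<open>a\<close> keeps its growth per step at \<open>1 + O(h)\<close>; the price is
  a division by \<open>h\<close> of the squares of the other two terms, each of which is itself small of order
  \<open>h\<close>.\<close>

lemma three_term_square:
  fixes a b c h :: real
  assumes "h > 0"
  shows "(a + (b + c))\<^sup>2 \<le> (1 + h) * a\<^sup>2 + (1 + 1 / h) * (2 * b\<^sup>2 + 2 * c\<^sup>2)"
proof -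
  have "(a + d)\<^sup>2 \<le> (1 + h) * a\<^sup>2 + (1 + 1 / h) * d\<^sup>2" for d
  proof -
    have "0 \<le> (h * a - d)\<^sup>2 / h" using assms by simp
    also have "\<dots> = h * a\<^sup>2 - 2 * a * d + d\<^sup>2 / h" using assms by (simp add: power2_eq_square field_simps)
    finally show ?thesis by (simp add: power2_eq_square algebra_simps)
  qed
  from this[of "b + c"] have "(a + (b + c))\<^sup>2 \<le> (1 + h) * a\<^sup>2 + (1 + 1 / h) * (b + c)\<^sup>2" .
  also have "(b + c)\<^sup>2 \<le> 2 * b\<^sup>2 + 2 * c\<^sup>2" using zero_le_power2[of "b - c"] by (simp add: power2_eq_square algebra_simps)
  then have "(1 + 1 / h) * (b + c)\<^sup>2 \<le> (1 + 1 / h) * (2 * b\<^sup>2 + 2 * c\<^sup>2)" using assms by (intro mult_left_mono) auto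
  finally show ?thesis by simp
qed

lemma continuous_layer_average:
  assumes "continuous_on UNIV (V :: real^'n::finite \<Rightarrow> real^'n)"
  shows "continuous_on UNIV (layer_average \<sigma> h V)"
  unfolding layer_average_def[abs_def]
  by (intro continuous_on_scaleR continuous_on_const continuous_on_sum continuous_on_compose2[OF assms, of _ "\<lambda>x. x - h *\<^sub>R V x + (\<sigma> * sqrt h) *\<^sub>R \<xi>" for \<xi>])
     (auto intro!: continuous_intros assms)

text \<open>The energy of one step: the transport part is controlled by the change of variables and
  by translation invariance.\<close>

lemma one_step_energy:
  fixes U V :: "real^'n::finite \<Rightarrow> real^'n"
  assumes L: "L > 0" and U: "C1_space U" "periodic L U" "\<And>i x. norm (spartial i U x) \<le> K"
    and V: "C1_space V" "periodic L V" "\<And>i x. norm (spartial i V x) \<le> K"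
    and h: "0 < h" "h \<le> T" "jacobian_const TYPE('n) K * h \<le> 1/2" and \<beta>: "\<beta> \<ge> 0"
    and D: "continuous_on UNIV D" "\<And>x. norm (D x - (layer_average \<sigma> h V x - layer_average \<sigma> h U x)) \<le> \<beta> * h"
  shows "(LINT x:cell L|lborel. (norm (D x))\<^sup>2)
     \<le> (1 + (1 + 2 * jacobian_const TYPE('n) K * (1 + T) + 2 * (real CARD('n) * K)\<^sup>2 * (1 + T)) * h) * (LINT x:cell L|lborel. (norm (V x - U x))\<^sup>2)
       + 2 * (1 + T) * L ^ CARD('n) * \<beta>\<^sup>2 * h"
proof -
  let ?N = "2 ^ CARD('n) :: real"
  let ?J = "jacobian_const TYPE('n) K"
  let ?n = "real CARD('n)"
  define R where "R x = V x - U x" for x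
  let ?E = "LINT x:cell L|lborel. (norm (R x))\<^sup>2"
  define f where "f \<xi> y = (norm (R (y + (\<sigma> * sqrt h) *\<^sub>R \<xi>)))\<^sup>2" for \<xi> y :: "real^'n"
  have cV: "continuous_on UNIV V" and cU: "continuous_on UNIV U" using U V by (auto simp: C1_space_def)
  have cR: "continuous_on UNIV R" unfolding R_def[abs_def] by (intro continuous_intros cV cU)
  have pR: "periodic L R" using U(2) V(2) by (simp add: periodic_def R_def)
  have K: "K \<ge> 0" using U(3)[of undefined undefined] norm_ge_zero[of "spartial undefined U undefined"] by linarith
  have J: "?J \<ge> 0" using jacobian_const_ge(2)[OF K, where 'n='n] K by linarith
  have cf: "continuous_on UNIV (f \<xi>)" for \<xi> unfolding f_def[abs_def]
    by (intro continuous_intros continuous_on_compose2[OF cR, of _ "\<lambda>x. x + (\<sigma> * sqrt h) *\<^sub>R \<xi>"]) auto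
  have pf: "periodic L (f \<xi>)" for \<xi> using periodic_shift[OF pR, of "(\<sigma> * sqrt h) *\<^sub>R \<xi>"] by (simp add: periodic_def f_def)
  have cfV: "continuous_on UNIV (\<lambda>x. f \<xi> (x - h *\<^sub>R V x))" for \<xi>
    by (rule continuous_on_compose2[OF cf]) (auto intro!: continuous_intros cV)
  have transport: "(LINT x:cell L|lborel. f \<xi> (x - h *\<^sub>R V x)) \<le> (1 + 2 * ?J * h) * ?E" for \<xi>
  proof -
    have "(LINT x:cell L|lborel. f \<xi> (x - h *\<^sub>R V x)) \<le> (1 + 2 * ?J * h) * (LINT x:cell L|lborel. f \<xi> x)"
      by (rule transported_integral_le[OF L V cf pf _ h(1,3)]) (simp add: f_def)
    also have "(LINT x:cell L|lborel. f \<xi> x) = ?E"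
      unfolding f_def using pR by (intro cell_integral_shift_real[OF L]) (auto intro!: continuous_intros cR simp: periodic_def)
    finally show ?thesis .
  qed
  have pw: "(norm (D x))\<^sup>2 \<le> (1 + h) * ((1 / ?N) * (\<Sum>\<xi>\<in>(signs::(real^'n) set). f \<xi> (x - h *\<^sub>R V x))) + (1 + 1 / h) * (2 * (?n * K * h)\<^sup>2 * (norm (R x))\<^sup>2 + 2 * (\<beta> * h)\<^sup>2)" for x
  proof -
    let ?y = "\<lambda>\<xi>. x - h *\<^sub>R V x + (\<sigma> * sqrt h) *\<^sub>R \<xi>"
    let ?a = "(1 / ?N) * (\<Sum>\<xi>\<in>(signs::(real^'n) set). norm (R (?y \<xi>)))"
    have "norm (D x) \<le> norm (layer_average \<sigma> h V x - layer_average \<sigma> h U x) + \<beta> * h"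
      using D(2)[of x] norm_triangle_sub[of "D x" "layer_average \<sigma> h V x - layer_average \<sigma> h U x"] by linarith
    then have "norm (D x) \<le> ?a + (?n * K * h * norm (R x) + \<beta> * h)"
      using layer_average_difference[OF U(1,3) less_imp_le[OF h(1)], of \<sigma> V x] unfolding R_def by linarith
    then have "(norm (D x))\<^sup>2 \<le> (?a + (?n * K * h * norm (R x) + \<beta> * h))\<^sup>2" by (intro power_mono) auto
    also have "\<dots> \<le> (1 + h) * ?a\<^sup>2 + (1 + 1 / h) * (2 * (?n * K * h * norm (R x))\<^sup>2 + 2 * (\<beta> * h)\<^sup>2)"
      by (rule three_term_square[OF h(1)])
    also have "(1 + h) * ?a\<^sup>2 \<le> (1 + h) * ((1 / ?N) * (\<Sum>\<xi>\<in>(signs::(real^'n) set). f \<xi> (x - h *\<^sub>R V x)))"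
      using h(1) unfolding f_def by (intro mult_left_mono average_square_le) auto
    finally show ?thesis by (simp add: power_mult_distrib mult.assoc)
  qed
  have i1: "set_integrable lborel (cell L) (\<lambda>x. (1 + h) * ((1 / ?N) * (\<Sum>\<xi>\<in>(signs::(real^'n) set). f \<xi> (x - h *\<^sub>R V x))))"
    and i2: "set_integrable lborel (cell L) (\<lambda>x. (1 + 1 / h) * (2 * (?n * K * h)\<^sup>2 * (norm (R x))\<^sup>2 + 2 * (\<beta> * h)\<^sup>2))"
    by (intro continuous_cell_integrable continuous_on_mult continuous_on_add continuous_on_const continuous_on_sum cfV continuous_on_power continuous_on_norm cR)+
  have "(LINT x:cell L|lborel. (norm (D x))\<^sup>2) \<le> (LINT x:cell L|lborel. (1 + h) * ((1 / ?N) * (\<Sum>\<xi>\<in>(signs::(real^'n) set). f \<xi> (x - h *\<^sub>R V x)))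
      + (1 + 1 / h) * (2 * (?n * K * h)\<^sup>2 * (norm (R x))\<^sup>2 + 2 * (\<beta> * h)\<^sup>2))"
    by (rule set_integral_mono[OF _ set_integral_add(1)[OF i1 i2] pw])
       (intro continuous_cell_integrable continuous_intros D(1))
  also have "\<dots> = (LINT x:cell L|lborel. (1 + h) * ((1 / ?N) * (\<Sum>\<xi>\<in>(signs::(real^'n) set). f \<xi> (x - h *\<^sub>R V x))))
      + (LINT x:cell L|lborel. (1 + 1 / h) * (2 * (?n * K * h)\<^sup>2 * (norm (R x))\<^sup>2 + 2 * (\<beta> * h)\<^sup>2))"
    by (rule set_integral_add(2)[OF i1 i2])
  also have "(LINT x:cell L|lborel. (1 + h) * ((1 / ?N) * (\<Sum>\<xi>\<in>(signs::(real^'n) set). f \<xi> (x - h *\<^sub>R V x))))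
      = (1 + h) * ((1 / ?N) * (\<Sum>\<xi>\<in>(signs::(real^'n) set). LINT x:cell L|lborel. f \<xi> (x - h *\<^sub>R V x)))"
  proof -
    have "(LINT x:cell L|lborel. (\<Sum>\<xi>\<in>(signs::(real^'n) set). f \<xi> (x - h *\<^sub>R V x))) = (\<Sum>\<xi>\<in>(signs::(real^'n) set). LINT x:cell L|lborel. f \<xi> (x - h *\<^sub>R V x))"
      unfolding set_lebesgue_integral_def scaleR_sum_right
      by (rule Bochner_Integration.integral_sum) (use continuous_cell_integrable[OF cfV] in \<open>simp add: set_integrable_def\<close>)
    then show ?thesis by (simp only: set_integral_mult_right)
  qed
  also have "\<dots> \<le> (1 + h) * ((1 / ?N) * (\<Sum>\<xi>\<in>(signs::(real^'n) set). (1 + 2 * ?J * h) * ?E))"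
    using h(1) by (intro mult_left_mono sum_mono transport) auto
  also have "\<dots> = (1 + h) * (1 + 2 * ?J * h) * ?E" by (simp add: finite_signs_card(2))
  also have "(LINT x:cell L|lborel. (1 + 1 / h) * (2 * (?n * K * h)\<^sup>2 * (norm (R x))\<^sup>2 + 2 * (\<beta> * h)\<^sup>2))
     = (1 + 1 / h) * (2 * (?n * K * h)\<^sup>2 * ?E + 2 * (\<beta> * h)\<^sup>2 * L ^ CARD('n))"
  proof -
    have "(LINT x:cell L|lborel. 2 * (?n * K * h)\<^sup>2 * (norm (R x))\<^sup>2 + 2 * (\<beta> * h)\<^sup>2)
      = (LINT x:cell L|lborel. 2 * (?n * K * h)\<^sup>2 * (norm (R x))\<^sup>2) + (LINT x:(cell L::(real^'n) set)|lborel. 2 * (\<beta> * h)\<^sup>2)"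
      by (rule set_integral_add(2)) (intro continuous_cell_integrable continuous_on_mult continuous_on_const continuous_on_power continuous_on_norm cR)+
    also have "(LINT x:(cell L::(real^'n) set)|lborel. 2 * (\<beta> * h)\<^sup>2) = 2 * (\<beta> * h)\<^sup>2 * L ^ CARD('n)"
      using measure_cell[OF L, where 'n='n] by (simp add: set_lebesgue_integral_def)
    finally show ?thesis by (simp only: set_integral_mult_right)
  qed
  finally have main: "(LINT x:cell L|lborel. (norm (D x))\<^sup>2) \<le> (1 + h) * (1 + 2 * ?J * h) * ?E + (1 + 1 / h) * (2 * (?n * K * h)\<^sup>2 * ?E + 2 * (\<beta> * h)\<^sup>2 * L ^ CARD('n))"
    by simp
  have E0: "?E \<ge> 0" by (auto simp: set_lebesgue_integral_def intro!: Bochner_Integration.integral_nonneg)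
  have "(1 + h) * (1 + 2 * ?J * h) = 1 + h + 2 * ?J * h * (1 + h)" by (simp add: algebra_simps)
  also have "\<dots> \<le> 1 + h + 2 * ?J * h * (1 + T)" using h J by (intro add_left_mono mult_left_mono) auto
  finally have g1: "(1 + h) * (1 + 2 * ?J * h) \<le> 1 + (1 + 2 * ?J * (1 + T)) * h" by (simp add: algebra_simps)
  have h1: "(1 + 1 / h) * h\<^sup>2 \<le> (1 + T) * h"
  proof -
    have "(1 + 1 / h) * h\<^sup>2 = (1 + h) * h" using h(1) by (simp add: power2_eq_square field_simps)
    also have "\<dots> \<le> (1 + T) * h" using h by (intro mult_right_mono) auto
    finally show ?thesis .
  qed
  have g2: "(1 + 1 / h) * (2 * (?n * K * h)\<^sup>2 * ?E) \<le> (2 * (?n * K)\<^sup>2 * (1 + T) * h) * ?E"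
    using mult_right_mono[OF h1, of "2 * (?n * K)\<^sup>2 * ?E"] E0 by (simp add: power_mult_distrib mult_ac)
  have g3: "(1 + 1 / h) * (2 * (\<beta> * h)\<^sup>2 * L ^ CARD('n)) \<le> 2 * (1 + T) * L ^ CARD('n) * \<beta>\<^sup>2 * h"
  proof -
    have "(1 + 1 / h) * (2 * (\<beta> * h)\<^sup>2 * L ^ CARD('n)) = ((1 + 1 / h) * h\<^sup>2) * (2 * \<beta>\<^sup>2 * L ^ CARD('n))"
      by (simp only: power_mult_distrib mult_ac)
    also have "\<dots> \<le> ((1 + T) * h) * (2 * \<beta>\<^sup>2 * L ^ CARD('n))" using L by (intro mult_right_mono h1) auto
    finally show ?thesis by (simp only: mult_ac)
  qed
  have "(LINT x:cell L|lborel. (norm (D x))\<^sup>2) \<le> (1 + (1 + 2 * ?J * (1 + T)) * h) * ?E + (2 * (?n * K)\<^sup>2 * (1 + T) * h) * ?E + 2 * (1 + T) * L ^ CARD('n) * \<beta>\<^sup>2 * h"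
    using main mult_right_mono[OF g1 E0] g2 g3 by (simp only: distrib_left[of "1 + 1 / h"])
  then show ?thesis unfolding R_def by (simp add: algebra_simps)
qed

text \<open>The weaker bound \<open>k X\<close> in place of the geometric sum is enough, because \<open>k h\<close> is bounded by the
  final time.\<close>

lemma discrete_gronwall:
  fixes e :: "nat \<Rightarrow> real"
  assumes e0: "e 0 \<le> 0" and step: "\<And>k. k < N \<Longrightarrow> e (Suc k) \<le> (1 + D * h) * e k + X" and D: "0 \<le> D * h" and X: "0 \<le> X" and k: "k \<le> N"
  shows "e k \<le> exp (D * h * real k) * (real k * X)"
proof -
  have "e k \<le> (1 + D * h) ^ k * (real k * X)" using k
  proof (induction k)
    case (Suc k)
    have "e (Suc k) \<le> (1 + D * h) * e k + X" using step Suc.prems by simp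
    also have "\<dots> \<le> (1 + D * h) * ((1 + D * h) ^ k * (real k * X)) + (1 + D * h) ^ Suc k * X"
    proof (intro add_mono mult_left_mono)
      have "1 * X \<le> (1 + D * h) ^ Suc k * X" using X D by (intro mult_right_mono one_le_power) auto
      then show "X \<le> (1 + D * h) ^ Suc k * X" by simp
    qed (use Suc D in auto)
    also have "\<dots> = (1 + D * h) ^ Suc k * (real (Suc k) * X)" by (simp add: algebra_simps)
    finally show ?case .
  qed (use e0 in simp)
  also have "(1 + D * h) ^ k \<le> exp (D * h) ^ k" using D by (intro power_mono exp_ge_add_one_self) auto
  then have "(1 + D * h) ^ k * (real k * X) \<le> exp (D * h) ^ k * (real k * X)" using X by (intro mult_right_mono) auto
  also have "exp (D * h) ^ k = exp (D * h * real k)" by (simp add: exp_of_nat_mult[symmetric] mult.commute)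
  finally show ?thesis .
qed

lemma C1_space_diff:
  assumes "C1_space u" "C1_space v"
  shows "C1_space (\<lambda>x. u x - v x)" "spartial i (\<lambda>x. u x - v x) = (\<lambda>x. spartial i u x - spartial i v x)"
proof -
  have d: "((\<lambda>s. u (x + s *\<^sub>R axis i 1) - v (x + s *\<^sub>R axis i 1)) has_vector_derivative spartial i u x - spartial i v x) (at 0)" for x i
    by (intro has_vector_derivative_diff has_spartialD) (use assms in \<open>auto simp: C1_space_def\<close>)
  show eq: "spartial i (\<lambda>x. u x - v x) = (\<lambda>x. spartial i u x - spartial i v x)" for i
    using has_spartialI(2)[OF d] by (simp add: fun_eq_iff)
  show "C1_space (\<lambda>x. u x - v x)"
    unfolding C1_space_def eq using assms has_spartialI(1)[OF d] by (auto simp: C1_space_def intro: continuous_on_diff)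
qed

lemma hoelder_jet_drift:
  assumes "hoelder_jet \<alpha> T (Suc (Suc k)) v"
  shows "hoelder_jet \<alpha> T k (\<lambda>t x. c *\<^sub>R laplacian (v t) x - convection (v t) x)"
  unfolding laplacian_def convection_def
  by (intro hoelder_jet_diff hoelder_jet_scaleR hoelder_jet_sum hoelder_jet_bilinear[OF bounded_bilinear_scaleR]
        hoelder_jet_linear[OF bounded_linear_vec_nth] finite)
     (use assms hoelder_jet_mono[OF assms, of k] hoelder_jet_Suc_lower[OF hoelder_jet_spartial[OF assms]] in auto)

lemma hoelder_fields_uniform_bound:
  fixes u :: "'i::finite \<Rightarrow> real \<Rightarrow> real^'n::finite \<Rightarrow> 'b::real_normed_vector"
  assumes "\<And>i. hoelder_field \<alpha> T (u i)"
  obtains K where "\<And>i t x. t \<in> {0..T} \<Longrightarrow> norm (u i t x) \<le> K"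
proof -
  have "\<forall>i. \<exists>K. \<forall>t\<in>{0..T}. \<forall>x. norm (u i t x) \<le> K" using assms unfolding hoelder_field_def by blast
  then obtain K where K: "\<And>i t x. t \<in> {0..T} \<Longrightarrow> norm (u i t x) \<le> K i" by (metis choice)
  have "K i \<le> (\<Sum>i\<in>UNIV. \<bar>K i\<bar>)" for i
    using member_le_sum[of i UNIV "\<lambda>i. \<bar>K i\<bar>"] by force
  then show ?thesis using that K order.trans by metis
qed

text \<open>The pathwise problem. The equation is recorded through increments with the stochastic integral
  already integrated by parts; \<open>v\<close> has three bounded space derivatives for Taylor's formula, and the
  first two of them are Hoelder continuous in time for freezing the operator.\<close>

locale navier_stokes_path =
  fixes \<sigma> T L \<alpha> :: real
    and f :: "real \<Rightarrow> real^'n::finite \<Rightarrow> real^'n" and \<gamma> \<gamma>' :: "'q::finite \<Rightarrow> real \<Rightarrow> real^'n \<Rightarrow> real^'n"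
    and v :: "real \<Rightarrow> real^'n \<Rightarrow> real^'n" and p :: "real \<Rightarrow> real^'n \<Rightarrow> real" and w :: "real \<Rightarrow> real^'q"
  assumes pos: "\<sigma> > 0" "T > 0" "L > 0" and \<alpha>: "0 < \<alpha>" "\<alpha> < 1/2"
    and v3: "hoelder_jet 0 T (Suc (Suc (Suc 0))) v" and v2: "hoelder_jet \<alpha> T (Suc (Suc 0)) v"
    and p1: "hoelder_jet 0 T (Suc 0) p" and f0: "hoelder_field \<alpha> T f"
    and \<gamma>1: "\<And>r. hoelder_jet 0 T (Suc 0) (\<gamma> r)" and \<gamma>'0: "\<And>r. hoelder_field 0 T (\<gamma>' r)"
    and \<gamma>_increment: "\<And>r t s x. 0 \<le> t \<Longrightarrow> t \<le> s \<Longrightarrow> s \<le> T \<Longrightarrow> \<gamma> r s x - \<gamma> r t x = integral {t..s} (\<lambda>u. \<gamma>' r u x)"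
    and w_continuous: "continuous_on {0..T} w"
    and w_hoelder: "\<exists>K\<ge>0. \<forall>s\<in>{0..T}. \<forall>t\<in>{0..T}. norm (w t - w s) \<le> K * \<bar>t - s\<bar> powr \<alpha>"
    and increment: "\<And>t s x. 0 \<le> t \<Longrightarrow> t \<le> s \<Longrightarrow> s \<le> T \<Longrightarrow>
        v s x - v t x = integral {t..s} (\<lambda>u. (\<sigma>\<^sup>2 / 2) *\<^sub>R laplacian (v u) x - convection (v u) x - grad (p u) x + f u x)
          + (\<Sum>r\<in>UNIV. w s $ r *\<^sub>R \<gamma> r s x - w t $ r *\<^sub>R \<gamma> r t x - integral {t..s} (\<lambda>u. w u $ r *\<^sub>R \<gamma>' r u x))"
    and periodic_v: "\<And>t. t \<in> {0..T} \<Longrightarrow> periodic L (v t)" and periodic_p: "\<And>t. t \<in> {0..T} \<Longrightarrow> periodic L (p t)"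
    and periodic_\<gamma>: "\<And>r t. t \<in> {0..T} \<Longrightarrow> periodic L (\<gamma> r t)"
    and div_v: "\<And>t x. t \<in> {0..T} \<Longrightarrow> divergence (v t) x = 0" and div_\<gamma>: "\<And>r t x. t \<in> {0..T} \<Longrightarrow> divergence (\<gamma> r t) x = 0"
begin

text \<open>The exact velocity after one step without the frozen noise increment, which the scheme
  reproduces exactly, and the time integral of the pressure, which the projection removes.\<close>

definition noise_free :: "real \<Rightarrow> real \<Rightarrow> real^'n \<Rightarrow> real^'n" where
  "noise_free t s x = v s x - (\<Sum>r\<in>UNIV. (w s $ r - w t $ r) *\<^sub>R \<gamma> r t x)"

definition pressure_impulse :: "real \<Rightarrow> real \<Rightarrow> real^'n \<Rightarrow> real" where
  "pressure_impulse t s x = integral {t..s} (\<lambda>u. p u x)"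

text \<open>The noise coefficients are divergence-free and periodic, so the projection fixes this field.\<close>

lemma noise_free_properties:
  assumes "0 \<le> t" "t \<le> s" "s \<le> T"
  shows "C1_space (noise_free t s)" "periodic L (noise_free t s)" "divergence (noise_free t s) x = 0"
proof -
  have ts: "t \<in> {0..T}" "s \<in> {0..T}" using assms by auto
  have cv: "C1_space (v s)" by (rule hoelder_jet_C1_space[OF v3 ts(2)])
  have c\<gamma>: "C1_space (\<gamma> r t)" for r by (rule hoelder_jet_C1_space[OF \<gamma>1 ts(1)])
  note l = C1_space_lincomb[where g="\<lambda>r. \<gamma> r t" and c="\<lambda>r. w s $ r - w t $ r", OF c\<gamma>]
  note d = C1_space_diff[OF cv l(1)]
  have nf: "noise_free t s = (\<lambda>x. v s x - (\<Sum>r\<in>UNIV. (w s $ r - w t $ r) *\<^sub>R \<gamma> r t x))"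
    by (simp add: noise_free_def fun_eq_iff)
  show "C1_space (noise_free t s)" unfolding nf by (rule d(1))
  show "periodic L (noise_free t s)" using periodic_v[OF ts(2)] periodic_\<gamma>[OF ts(1)] by (simp add: periodic_def noise_free_def)
  have "divergence (noise_free t s) x = divergence (v s) x - (\<Sum>r\<in>UNIV. (w s $ r - w t $ r) * divergence (\<gamma> r t) x)"
    unfolding divergence_def nf d(2) l(2)
    by (simp add: sum_subtractf sum_distrib_left) (rule sum.swap)
  then show "divergence (noise_free t s) x = 0" using div_v[OF ts(2)] div_\<gamma>[OF ts(1)] by simp
qed

lemma pressure_impulse_properties:
  assumes "0 \<le> t" "t \<le> s" "s \<le> T"
  shows "C1_space (pressure_impulse t s)" "periodic L (pressure_impulse t s)"
    "grad (pressure_impulse t s) x = integral {t..s} (\<lambda>u. grad (p u) x)"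
    "continuous_on {t..s} (\<lambda>u. grad (p u) x)"
proof -
  have pf: "pressure_impulse t s = (\<lambda>x. integral {t..s} (\<lambda>u. p u x))" by (simp add: pressure_impulse_def fun_eq_iff)
  note c = time_integral_C1_space[OF p1 assms(1,3)]
  show "C1_space (pressure_impulse t s)" unfolding pf by (rule c(1))
  have "integral {t..s} (\<lambda>u. p u (x + L *\<^sub>R axis i 1)) = integral {t..s} (\<lambda>u. p u x)" for x i
    by (rule integral_cong) (use periodic_p assms in \<open>auto simp: periodic_def\<close>)
  then show "periodic L (pressure_impulse t s)" by (simp add: periodic_def pressure_impulse_def)
  show ct: "continuous_on {t..s} (\<lambda>u. grad (p u) x)"
    unfolding grad_def using assms
    by (intro continuous_on_vec_lambda hoelder_field_time_continuous[OF hoelder_jet_field[OF hoelder_jet_spartial[OF p1]]]) auto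
  have "integral {t..s} (\<lambda>u. spartial i (p u) x) = integral {t..s} (\<lambda>u. grad (p u) x) $ i" for i
    by (subst integral_component_eq_cart[symmetric, OF integrable_continuous_interval[OF ct]]) (simp add: grad_def)
  moreover have "grad (pressure_impulse t s) x $ i = integral {t..s} (\<lambda>u. spartial i (p u) x)" for i
    by (simp only: grad_def vec_lambda_beta pf c(2))
  ultimately show "grad (pressure_impulse t s) x = integral {t..s} (\<lambda>u. grad (p u) x)" by (simp add: vec_eq_iff)
qed

text \<open>Undoing the integration by parts with frozen \<open>\<gamma>\<close>: the remainder is the integral of
  \<open>(w(s) - w(u)) \<gamma>'(u)\<close> over the step, and the path increment is of order \<open>h^\<alpha>\<close>.\<close>

lemma noise_remainder:
  "\<exists>C\<ge>0. \<forall>r t s x. 0 \<le> t \<and> t \<le> s \<and> s \<le> T \<longrightarrow>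
     norm (w s $ r *\<^sub>R \<gamma> r s x - w t $ r *\<^sub>R \<gamma> r t x - integral {t..s} (\<lambda>u. w u $ r *\<^sub>R \<gamma>' r u x) - (w s $ r - w t $ r) *\<^sub>R \<gamma> r t x)
       \<le> C * (s - t) powr (1 + \<alpha>)"
proof -
  obtain Kw where Kw: "Kw \<ge> 0" "\<And>s t. s \<in> {0..T} \<Longrightarrow> t \<in> {0..T} \<Longrightarrow> norm (w t - w s) \<le> Kw * \<bar>t - s\<bar> powr \<alpha>"
    using w_hoelder by blast
  have "\<exists>K>0. \<forall>t\<in>{0..T}. \<forall>x. norm (\<gamma>' r t x) \<le> K" for r using hoelder_fieldD[OF \<gamma>'0[of r]] by metis
  then obtain K where K: "\<And>r. K r > 0" "\<And>r t x. t \<in> {0..T} \<Longrightarrow> norm (\<gamma>' r t x) \<le> K r" by metis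
  define C where "C = Kw * (\<Sum>r\<in>UNIV. K r)"
  have C0: "C \<ge> 0" using Kw(1) K(1) by (simp add: C_def sum_nonneg less_imp_le)
  have CK: "Kw * K r \<le> C" for r
    unfolding C_def using Kw(1) K(1) by (intro mult_left_mono member_le_sum) (auto simp: less_imp_le)
  have "norm (w s $ r *\<^sub>R \<gamma> r s x - w t $ r *\<^sub>R \<gamma> r t x - integral {t..s} (\<lambda>u. w u $ r *\<^sub>R \<gamma>' r u x) - (w s $ r - w t $ r) *\<^sub>R \<gamma> r t x)
       \<le> C * (s - t) powr (1 + \<alpha>)" if ts: "0 \<le> t" "t \<le> s" "s \<le> T" for r t s x
  proof -
    have cw: "continuous_on {t..s} (\<lambda>u. w u $ r)"
      by (intro continuous_intros continuous_on_subset[OF w_continuous]) (use ts in auto)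
    have c\<gamma>: "continuous_on {t..s} (\<lambda>u. \<gamma>' r u x)" by (rule hoelder_field_time_continuous[OF \<gamma>'0]) (use ts in auto)
    have i1: "(\<lambda>u. w s $ r *\<^sub>R \<gamma>' r u x) integrable_on {t..s}" "(\<lambda>u. w u $ r *\<^sub>R \<gamma>' r u x) integrable_on {t..s}"
      by (intro integrable_continuous_interval continuous_on_scaleR continuous_on_const cw c\<gamma>)+
    have "w s $ r *\<^sub>R \<gamma> r s x - w t $ r *\<^sub>R \<gamma> r t x - integral {t..s} (\<lambda>u. w u $ r *\<^sub>R \<gamma>' r u x) - (w s $ r - w t $ r) *\<^sub>R \<gamma> r t x
      = w s $ r *\<^sub>R (\<gamma> r s x - \<gamma> r t x) - integral {t..s} (\<lambda>u. w u $ r *\<^sub>R \<gamma>' r u x)"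
      by (simp add: algebra_simps)
    also have "\<dots> = integral {t..s} (\<lambda>u. w s $ r *\<^sub>R \<gamma>' r u x) - integral {t..s} (\<lambda>u. w u $ r *\<^sub>R \<gamma>' r u x)"
      unfolding \<gamma>_increment[OF ts] by simp
    also have "\<dots> = integral {t..s} (\<lambda>u. (w s $ r - w u $ r) *\<^sub>R \<gamma>' r u x)"
      by (subst Henstock_Kurzweil_Integration.integral_diff[OF i1, symmetric]) (simp add: scaleR_diff_left)
    also have "norm \<dots> \<le> Kw * K r * (s - t) powr \<alpha> * (s - t)"
    proof (rule integral_bound[OF ts(2)])
      fix u assume u: "u \<in> {t..s}"
      have "\<bar>w s $ r - w u $ r\<bar> \<le> norm (w s - w u)" using component_le_norm_cart[of "w s - w u" r] by simp
      also have "\<dots> \<le> Kw * \<bar>s - u\<bar> powr \<alpha>" using u ts by (intro Kw) auto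
      also have "\<dots> \<le> Kw * (s - t) powr \<alpha>" using u \<alpha> Kw(1) by (intro mult_left_mono powr_mono2) auto
      finally have "\<bar>w s $ r - w u $ r\<bar> * norm (\<gamma>' r u x) \<le> (Kw * (s - t) powr \<alpha>) * K r"
        using K(2)[of u r x] u ts Kw(1) by (intro mult_mono) auto
      then show "norm ((w s $ r - w u $ r) *\<^sub>R \<gamma>' r u x) \<le> Kw * K r * (s - t) powr \<alpha>" by (simp add: mult_ac)
    qed (intro continuous_intros cw c\<gamma>)
    also have "\<dots> = (Kw * K r) * (s - t) powr (1 + \<alpha>)" using ts by (simp add: powr_add powr_one_gt_zero_iff mult_ac)
    also have "\<dots> \<le> C * (s - t) powr (1 + \<alpha>)" by (intro mult_right_mono CK) auto
    finally show ?thesis .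
  qed
  then show ?thesis using C0 by blast
qed

text \<open>The four contributions are the expansion of the layer average (\<open>e1\<close>), freezing the operator
  (\<open>e2\<close>) and the force (\<open>e3\<close>) over the step, and the noise remainder (\<open>e4\<close>). The pressure appears
  only through the gradient of its time integral and is left unestimated.\<close>

lemma local_error:
  "\<exists>C\<ge>0. \<forall>t s x. 0 \<le> t \<and> t < s \<and> s \<le> T \<longrightarrow>
     norm (layer_average \<sigma> (s - t) (v t) x + (s - t) *\<^sub>R f t x - (noise_free t s x + grad (pressure_impulse t s) x))
       \<le> C * (s - t) powr (1 + \<alpha>)"
proof -
  let ?A = "\<lambda>u x. (\<sigma>\<^sup>2 / 2) *\<^sub>R laplacian (v u) x - convection (v u) x"
  have A0: "hoelder_field \<alpha> T ?A" using hoelder_jet_drift[of \<alpha> T 0 v] v2 by simp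
  obtain CA where CA: "CA > 0" "\<And>s t x. s \<in> {0..T} \<Longrightarrow> t \<in> {0..T} \<Longrightarrow> norm (?A s x - ?A t x) \<le> CA * \<bar>s - t\<bar> powr \<alpha>"
    using hoelder_fieldD[OF A0] by metis
  obtain Cf where Cf: "Cf > 0" "\<And>s t x. s \<in> {0..T} \<Longrightarrow> t \<in> {0..T} \<Longrightarrow> norm (f s x - f t x) \<le> Cf * \<bar>s - t\<bar> powr \<alpha>"
    using hoelder_fieldD[OF f0] by metis
  obtain Cn where Cn: "Cn \<ge> 0" "\<And>r t s x. 0 \<le> t \<Longrightarrow> t \<le> s \<Longrightarrow> s \<le> T \<Longrightarrow>
     norm (w s $ r *\<^sub>R \<gamma> r s x - w t $ r *\<^sub>R \<gamma> r t x - integral {t..s} (\<lambda>u. w u $ r *\<^sub>R \<gamma>' r u x) - (w s $ r - w t $ r) *\<^sub>R \<gamma> r t x)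
       \<le> Cn * (s - t) powr (1 + \<alpha>)"
    using noise_remainder by blast
  have d2: "hoelder_jet 0 T (Suc 0) (\<lambda>t. spartial j (spartial i (v t)))" for i j
    by (intro hoelder_jet_spartial v3)
  obtain K where K: "K \<ge> 0" "\<And>t x. t \<in> {0..T} \<Longrightarrow> norm (v t x) \<le> K"
    "\<And>i j t x. t \<in> {0..T} \<Longrightarrow> norm (spartial j (spartial i (v t)) x) \<le> K"
    "\<And>i j k t x. t \<in> {0..T} \<Longrightarrow> norm (spartial k (spartial j (spartial i (v t))) x) \<le> K"
  proof -
    obtain K1 where K1: "K1 > 0" "\<And>t x. t \<in> {0..T} \<Longrightarrow> norm (v t x) \<le> K1" using hoelder_fieldD[OF hoelder_jet_field[OF v3]] by metis
    obtain K2 where K2: "\<And>ij t x. t \<in> {0..T} \<Longrightarrow> norm ((\<lambda>(i, j) t. spartial j (spartial i (v t))) ij t x) \<le> K2"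
      by (rule hoelder_fields_uniform_bound[of 0 T "\<lambda>(i, j) t. spartial j (spartial i (v t))"])
         (use hoelder_jet_field[OF d2] in auto)
    obtain K3 where K3: "\<And>ijk t x. t \<in> {0..T} \<Longrightarrow> norm ((\<lambda>(i, j, k) t. spartial k (spartial j (spartial i (v t)))) ijk t x) \<le> K3"
      by (rule hoelder_fields_uniform_bound[of 0 T "\<lambda>(i, j, k) t. spartial k (spartial j (spartial i (v t)))"])
         (use hoelder_jet_field[OF hoelder_jet_spartial[OF d2]] in auto)
    show ?thesis
      by (rule that[of "max K1 (max K2 K3)"])
         (use K1 K2[of _ "(i, j)" for i j] K3[of _ "(i, j, k)" for i j k] in \<open>auto simp: le_max_iff_disj\<close>)
  qed
  define CL where "CL = (real CARD('n) * (sqrt T * K + \<sigma> * real CARD('n))) ^ 3 * K + sqrt T * (real CARD('n) * K)\<^sup>2 * K"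
  have CL: "CL \<ge> 0" using K(1) pos by (simp add: CL_def)
  \<comment> \<open>\<open>T powr (1/2 - \<alpha>)\<close> turns the order \<open>3/2\<close> of the layer expansion into \<open>1 + \<alpha>\<close>.\<close>
  define C where "C = CL * T powr (1/2 - \<alpha>) + CA + Cf + real CARD('q) * Cn"
  have C: "C \<ge> 0" using CL CA Cf Cn by (simp add: C_def)
  have "norm (layer_average \<sigma> (s - t) (v t) x + (s - t) *\<^sub>R f t x - (noise_free t s x + grad (pressure_impulse t s) x))
       \<le> C * (s - t) powr (1 + \<alpha>)" if ts: "0 \<le> t" "t < s" "s \<le> T" for t s x
  proof -
    let ?h = "s - t" and ?P = "(s - t) powr (1 + \<alpha>)"
    have ts': "0 \<le> t" "t \<le> s" "s \<le> T" and tT: "t \<in> {0..T}" using ts by auto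
    have sub: "{t..s} \<subseteq> {0..T}" using ts by auto
    let ?nz = "\<lambda>r. w s $ r *\<^sub>R \<gamma> r s x - w t $ r *\<^sub>R \<gamma> r t x - integral {t..s} (\<lambda>u. w u $ r *\<^sub>R \<gamma>' r u x)"
    have cA: "continuous_on {t..s} (\<lambda>u. ?A u x)" by (rule hoelder_field_time_continuous[OF A0 sub])
    have cf: "continuous_on {t..s} (\<lambda>u. f u x)" by (rule hoelder_field_time_continuous[OF f0 sub])
    note cp = pressure_impulse_properties(4)[OF ts', of x]
    have int: "integral {t..s} (\<lambda>u. ?A u x - grad (p u) x + f u x) = integral {t..s} (\<lambda>u. ?A u x) - integral {t..s} (\<lambda>u. grad (p u) x) + integral {t..s} (\<lambda>u. f u x)"
    proof -
      note i = cA[THEN integrable_continuous_interval] cp[THEN integrable_continuous_interval] cf[THEN integrable_continuous_interval]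
      show ?thesis
        unfolding Henstock_Kurzweil_Integration.integral_add[OF integrable_diff[OF i(1,2)] i(3)]
          Henstock_Kurzweil_Integration.integral_diff[OF i(1,2)] ..
    qed
    define e1 where "e1 = layer_average \<sigma> ?h (v t) x - v t x - ?h *\<^sub>R ?A t x"
    define e2 where "e2 = integral {t..s} (\<lambda>u. ?A u x) - ?h *\<^sub>R ?A t x"
    define e3 where "e3 = integral {t..s} (\<lambda>u. f u x) - ?h *\<^sub>R f t x"
    define e4 where "e4 = (\<Sum>r\<in>UNIV. ?nz r - (w s $ r - w t $ r) *\<^sub>R \<gamma> r t x)"
    have eq: "layer_average \<sigma> ?h (v t) x + ?h *\<^sub>R f t x - (noise_free t s x + grad (pressure_impulse t s) x) = e1 - e2 - e3 - e4"
    proof -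
      have "v s x = v t x + (integral {t..s} (\<lambda>u. ?A u x) - integral {t..s} (\<lambda>u. grad (p u) x) + integral {t..s} (\<lambda>u. f u x)) + (\<Sum>r\<in>UNIV. ?nz r)"
        using increment[OF ts', of x] unfolding int by (simp only: diff_eq_eq add_ac)
      moreover have "e4 = (\<Sum>r\<in>UNIV. ?nz r) - (\<Sum>r\<in>UNIV. (w s $ r - w t $ r) *\<^sub>R \<gamma> r t x)"
        unfolding e4_def by (rule sum_subtractf)
      ultimately show ?thesis
        unfolding noise_free_def pressure_impulse_properties(3)[OF ts'] e1_def e2_def e3_def by simp
    qed
    have b1: "norm e1 \<le> CL * T powr (1/2 - \<alpha>) * ?P"
    proof -
      have "norm e1 \<le> CL * ?h powr (3/2)"
        unfolding e1_def CL_def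
        by (rule layer_average_expansion)
           (use K tT ts pos in \<open>auto intro: hoelder_jet_C1_space[OF v3] hoelder_jet_C1_space[OF hoelder_jet_spartial[OF v3]] hoelder_jet_C1_space[OF d2]\<close>)
      also have "?h powr (3/2) = ?h powr (1/2 - \<alpha>) * ?P" by (simp add: powr_add[symmetric])
      also have "\<dots> \<le> T powr (1/2 - \<alpha>) * ?P" using ts \<alpha> by (intro mult_right_mono powr_mono2) auto
      finally show ?thesis using CL by (simp add: mult_left_mono mult.assoc)
    qed
    have near: "C' * \<bar>u - t\<bar> powr \<alpha> \<le> C' * ?h powr \<alpha>" if "u \<in> {t..s}" "C' > 0" for u C'
      using that \<alpha> by (intro mult_left_mono powr_mono2) auto
    have b2: "norm e2 \<le> CA * ?P" unfolding e2_def
      by (rule integral_frozen_integrand[OF ts'(2) cA]) (rule order.trans[OF CA(2) near[OF _ CA(1)]]; use sub tT in auto)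
    have b3: "norm e3 \<le> Cf * ?P" unfolding e3_def
      by (rule integral_frozen_integrand[OF ts'(2) cf]) (rule order.trans[OF Cf(2) near[OF _ Cf(1)]]; use sub tT in auto)
    have "norm e4 \<le> (\<Sum>r\<in>(UNIV::'q set). Cn * ?P)" unfolding e4_def by (intro sum_norm_le Cn(2) ts')
    then have b4: "norm e4 \<le> real CARD('q) * Cn * ?P" by simp
    have "norm (e1 - e2 - e3 - e4) \<le> norm e1 + norm e2 + norm e3 + norm e4"
      using norm_triangle_ineq4[of "e1 - e2 - e3" e4] norm_triangle_ineq4[of "e1 - e2" e3] norm_triangle_ineq4[of e1 e2] by linarith
    also have "\<dots> \<le> C * ?P" using b1 b2 b3 b4 by (simp add: C_def algebra_simps)
    finally show ?thesis unfolding eq .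
  qed
  then show ?thesis using C by blast
qed

text \<open>One step: the recursion for the energy of the error. The projection is a contraction and
  recovers the exact velocity from its sum with a pressure gradient, so only the transported error and the local error remain.\<close>

lemma energy_step:
  assumes lm: "layer_method \<sigma> T L f \<gamma> \<phi> w N V" and N: "N \<ge> 1" and k: "k < N"
    and V: "C1_space (V k)" "C1_space (V (Suc k))" "periodic L (V k)" "\<And>i x. norm (spartial i (V k) x) \<le> K"
    and K: "\<And>i t x. t \<in> {0..T} \<Longrightarrow> norm (spartial i (v t) x) \<le> K"
    and J: "jacobian_const TYPE('n) K * (T / real N) \<le> 1/2"
    and C: "C \<ge> 0" "\<And>t s x. 0 \<le> t \<Longrightarrow> t < s \<Longrightarrow> s \<le> T \<Longrightarrow>
     norm (layer_average \<sigma> (s - t) (v t) x + (s - t) *\<^sub>R f t x - (noise_free t s x + grad (pressure_impulse t s) x))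
       \<le> C * (s - t) powr (1 + \<alpha>)"
    and h: "h = T / real N"
  shows "(LINT x:cell L|lborel. (norm (V (Suc k) x - v (real (Suc k) * h) x))\<^sup>2)
    \<le> (1 + (1 + 2 * jacobian_const TYPE('n) K * (1 + T) + 2 * (real CARD('n) * K)\<^sup>2 * (1 + T)) * h)
        * (LINT x:cell L|lborel. (norm (V k x - v (real k * h) x))\<^sup>2)
      + 2 * (1 + T) * L ^ CARD('n) * (C * h powr \<alpha>)\<^sup>2 * h"
proof -
  define t where "t = real k * h"
  define s where "s = real (Suc k) * h"
  have hp: "0 < h" "h \<le> T" using pos N by (auto simp: h field_simps)
  have st: "s - t = h" by (simp add: s_def t_def algebra_simps)
  have "real (Suc k) * h \<le> real N * h" using hp k by (intro mult_right_mono) auto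
  also have "\<dots> = T" using N by (simp add: h)
  finally have sT: "s \<le> T" by (simp add: s_def)
  have t0: "0 \<le> t" "t < s" "t \<le> s" using hp st by (auto simp: t_def)
  have tT: "t \<in> {0..T}" "s \<in> {0..T}" using t0 sT by auto
  obtain Pu Pf where P: "leray_projection L (layer_average \<sigma> h (V k)) Pu" "leray_projection L (f t) Pf"
    "\<And>x. V (Suc k) x = Pu x + h *\<^sub>R Pf x + (\<Sum>r\<in>UNIV. (w s $ r - w t $ r) *\<^sub>R \<gamma> r t x)"
    using lm k unfolding layer_method_def Let_def h[symmetric] t_def s_def by blast
  have cv: "continuous_on UNIV (v t)" "continuous_on UNIV (v s)"
    by (intro hoelder_field_space_continuous[OF hoelder_jet_field[OF v3]] tT)+
  have cV: "continuous_on UNIV (V k)" "continuous_on UNIV (V (Suc k))" using V by (auto simp: C1_space_def)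
  have cf: "continuous_on UNIV (f t)" by (intro hoelder_field_space_continuous[OF f0] tT)
  note nf = noise_free_properties[OF t0(1,3) sT] and pi = pressure_impulse_properties[OF t0(1,3) sT]
  have eqV: "Pu x + h *\<^sub>R Pf x = V (Suc k) x - v s x + noise_free t s x" for x
    by (simp add: P(3) noise_free_def)
  have cP: "continuous_on UNIV (\<lambda>x. Pu x + h *\<^sub>R Pf x)"
    unfolding eqV using nf(1) by (intro continuous_on_add continuous_on_diff cV cv) (simp add: C1_space_def)
  let ?D = "\<lambda>x. layer_average \<sigma> h (V k) x + h *\<^sub>R f t x - (noise_free t s x + grad (pressure_impulse t s) x)"
  have "(LINT x:cell L|lborel. (norm (V (Suc k) x - v s x))\<^sup>2) = (LINT x:cell L|lborel. (norm (Pu x + h *\<^sub>R Pf x - noise_free t s x))\<^sup>2)"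
    by (simp add: eqV)
  also have "\<dots> \<le> (LINT x:cell L|lborel. (norm (?D x))\<^sup>2)"
    by (rule leray_step[OF pos(3) continuous_layer_average[OF cV(1)] cf P(1,2) cP nf pi(1,2)])
  also have "\<dots> \<le> (1 + (1 + 2 * jacobian_const TYPE('n) K * (1 + T) + 2 * (real CARD('n) * K)\<^sup>2 * (1 + T)) * h) * (LINT x:cell L|lborel. (norm (V k x - v t x))\<^sup>2)
       + 2 * (1 + T) * L ^ CARD('n) * (C * h powr \<alpha>)\<^sup>2 * h"
  proof (rule one_step_energy[OF pos(3)])
    show "C1_space (v t)" by (rule hoelder_jet_C1_space[OF v3 tT(1)])
    show "periodic L (v t)" by (rule periodic_v[OF tT(1)])
    show "jacobian_const TYPE('n) K * h \<le> 1/2" using J by (simp add: h)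
    have "continuous_on UNIV (grad (pressure_impulse t s))"
      using pi(1) unfolding C1_space_def grad_def[abs_def] by (intro continuous_on_vec_lambda) auto
    then show "continuous_on UNIV ?D"
      using nf(1) by (intro continuous_on_add continuous_on_diff continuous_on_scaleR continuous_on_const cf continuous_layer_average cV)
        (simp_all add: C1_space_def)
    fix x
    have "?D x - (layer_average \<sigma> h (V k) x - layer_average \<sigma> h (v t) x)
      = layer_average \<sigma> (s - t) (v t) x + (s - t) *\<^sub>R f t x - (noise_free t s x + grad (pressure_impulse t s) x)"
      unfolding st by simp
    also have "norm \<dots> \<le> C * (s - t) powr (1 + \<alpha>)" by (rule C(2)[OF t0(1,2) sT])
    also have "\<dots> = C * h powr \<alpha> * h" unfolding st using hp by (simp add: powr_add)
    finally show "norm (?D x - (layer_average \<sigma> h (V k) x - layer_average \<sigma> h (v t) x)) \<le> C * h powr \<alpha> * h" .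
  qed (use V K tT hp C(1) in auto)
  finally show ?thesis unfolding s_def t_def .
qed

lemma layer_method_periodic:
  assumes lm: "layer_method \<sigma> T L f \<gamma> (v 0) w N V" and N: "N \<ge> 1" and k: "k \<le> N"
  shows "periodic L (V k)"
proof (cases k)
  case 0
  have "V 0 = v 0" using lm by (auto simp: layer_method_def Let_def)
  then show ?thesis using 0 periodic_v[of 0] pos by simp
next
  case (Suc j)
  have j: "real j * (T / real N) \<in> {0..T}"
  proof -
    have "real j * (T / real N) \<le> real N * (T / real N)" using pos k Suc by (intro mult_right_mono) auto
    then show ?thesis using pos N by auto
  qed
  have jN: "j < N" using k Suc by simp
  obtain Pu Pf where P: "leray_projection L (layer_average \<sigma> (T / real N) (V j)) Pu" "leray_projection L (f (real j * (T / real N))) Pf"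
    "\<And>x. V (Suc j) x = Pu x + (T / real N) *\<^sub>R Pf x + (\<Sum>r\<in>UNIV. (w (real (Suc j) * (T / real N)) $ r - w (real j * (T / real N)) $ r) *\<^sub>R \<gamma> r (real j * (T / real N)) x)"
    using lm jN unfolding layer_method_def Let_def by blast
  have "periodic L Pu" "periodic L Pf" using P(1,2) by (simp_all add: leray_projection_def L2_periodic_def)
  with P(3) show ?thesis unfolding Suc using periodic_\<gamma>[OF j] by (simp add: periodic_def)
qed

text \<open>The stability estimate requires \<open>h \<le> h0\<close>, so that the Jacobian stays away from zero. For larger
  steps the error is bounded anyway, and a bound is of order \<open>h^\<alpha>\<close> when \<open>h \<ge> h0\<close>.\<close>

lemma layer_method_convergence:
  fixes V :: "nat \<Rightarrow> nat \<Rightarrow> real^'n \<Rightarrow> real^'n"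
  assumes lm: "\<And>N. N \<ge> 1 \<Longrightarrow> layer_method \<sigma> T L f \<gamma> (v 0) w N (V N)"
    and C1: "\<And>N k. N \<ge> 1 \<Longrightarrow> k \<le> N \<Longrightarrow> C1_space (V N k)"
    and bd: "\<And>N k x. N \<ge> 1 \<Longrightarrow> k \<le> N \<Longrightarrow> norm (V N k x) \<le> C0"
    and dbd: "\<And>N k x i. N \<ge> 1 \<Longrightarrow> k \<le> N \<Longrightarrow> norm (spartial i (V N k) x) \<le> C0"
  shows "\<exists>C>0. \<forall>N\<ge>1. \<forall>k\<le>N. L2_norm L (\<lambda>x. V N k x - v (real k * (T / real N)) x) \<le> C * (T / real N) powr \<alpha>"
proof -
  obtain Kv where Kv: "Kv > 0" "\<And>t x. t \<in> {0..T} \<Longrightarrow> norm (v t x) \<le> Kv"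
    using hoelder_fieldD[OF hoelder_jet_field[OF v3]] by metis
  obtain Kd where Kd: "\<And>i t x. t \<in> {0..T} \<Longrightarrow> norm ((\<lambda>i t. spartial i (v t)) i t x) \<le> Kd"
    by (rule hoelder_fields_uniform_bound[of 0 T "\<lambda>i t. spartial i (v t)"])
       (use hoelder_jet_field[OF hoelder_jet_spartial[OF v3]] in auto)
  obtain C where C: "C \<ge> 0" "\<And>t s x. 0 \<le> t \<Longrightarrow> t < s \<Longrightarrow> s \<le> T \<Longrightarrow>
     norm (layer_average \<sigma> (s - t) (v t) x + (s - t) *\<^sub>R f t x - (noise_free t s x + grad (pressure_impulse t s) x))
       \<le> C * (s - t) powr (1 + \<alpha>)"
    using local_error by blast
  define K where "K = max 1 (max C0 Kd)"
  have K: "K > 0" "C0 \<le> K" "Kd \<le> K" by (auto simp: K_def)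
  define J where "J = jacobian_const TYPE('n) K"
  have J: "J > 0" using jacobian_const_ge(2)[of K, where 'n='n] K by (simp add: J_def)
  define D where "D = 1 + 2 * J * (1 + T) + 2 * (real CARD('n) * K)\<^sup>2 * (1 + T)"
  have D: "D > 0" using J pos by (simp add: D_def add_pos_nonneg)
  define X where "X = 2 * (1 + T) * L ^ CARD('n) * C\<^sup>2"
  have X: "X \<ge> 0" using pos by (simp add: X_def)
  \<comment> \<open>The largest step for which the transport estimate applies.\<close>
  define h0 where "h0 = 1 / (2 * J)"
  have h0: "h0 > 0" using J by (simp add: h0_def)
  define B where "B = sqrt (L ^ CARD('n)) * (\<bar>C0\<bar> + Kv)"
  have B: "B \<ge> 0" using pos Kv by (simp add: B_def)
  define R where "R = 1 + sqrt (exp (D * T) * (T * X)) + B / h0 powr \<alpha>"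
  have R: "R > 0" using B h0 X pos by (simp add: R_def add_pos_nonneg)
  have "L2_norm L (\<lambda>x. V N k x - v (real k * (T / real N)) x) \<le> R * (T / real N) powr \<alpha>" if N: "N \<ge> 1" and k: "k \<le> N" for N k
  proof -
    define h where "h = T / real N"
    have hp: "h > 0" using pos N by (simp add: h_def)
    have hk: "real k * h \<le> T" if "k \<le> N" for k
    proof -
      have "real k * h \<le> real N * h" using hp that by (intro mult_right_mono) auto
      then show ?thesis using N by (simp add: h_def)
    qed
    define e where "e k = (LINT x:cell L|lborel. (norm (V N k x - v (real k * h) x))\<^sup>2)" for k
    have L2: "L2_norm L (\<lambda>x. V N k x - v (real k * h) x) = sqrt (e k)"
      by (simp add: L2_norm_def e_def norm_vec_square)
    have pw: "0 < h powr \<alpha>" using hp by simp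
    show ?thesis
    proof (cases "h \<le> h0")
      case True
      have Jh: "J * h \<le> 1/2" using mult_left_mono[OF True, of J] J by (simp add: h0_def)
      have step: "e (Suc j) \<le> (1 + D * h) * e j + X * (h powr \<alpha>)\<^sup>2 * h" if "j < N" for j
      proof -
        have "e (Suc j) \<le> (1 + (1 + 2 * jacobian_const TYPE('n) K * (1 + T) + 2 * (real CARD('n) * K)\<^sup>2 * (1 + T)) * h) * e j
           + 2 * (1 + T) * L ^ CARD('n) * (C * h powr \<alpha>)\<^sup>2 * h"
          unfolding e_def
        proof (rule energy_step[OF lm[OF N] N that])
          show "jacobian_const TYPE('n) K * (T / real N) \<le> 1 / 2" using Jh by (simp add: J_def h_def)
          show "norm (spartial i (V N j) x) \<le> K" for i x using dbd[OF N, of j i x] that K by simp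
          show "norm (spartial i (v t) x) \<le> K" if "t \<in> {0..T}" for i t x using Kd[OF that, of i x] K by simp
        qed (use C1[OF N] layer_method_periodic[OF lm[OF N] N] that C h_def in auto)
        then show ?thesis by (simp add: D_def J_def X_def power_mult_distrib mult.assoc)
      qed
      have "V N 0 = v 0" using lm[OF N] by (auto simp: layer_method_def Let_def)
      then have e0: "e 0 \<le> 0" by (simp add: e_def set_lebesgue_integral_def)
      have "e k \<le> exp (D * h * real k) * (real k * (X * (h powr \<alpha>)\<^sup>2 * h))"
        by (rule discrete_gronwall[OF e0 step _ _ k]) (use D X hp in auto)
      also have "\<dots> = exp (D * (real k * h)) * ((real k * h) * (X * (h powr \<alpha>)\<^sup>2))" by (simp add: mult_ac)
      also have "\<dots> \<le> exp (D * T) * (T * (X * (h powr \<alpha>)\<^sup>2))"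
        using D X hp hk[OF k] pos by (intro mult_mono) auto
      finally have "e k \<le> exp (D * T) * (T * X) * (h powr \<alpha>)\<^sup>2" by (simp add: mult.assoc)
      then have "sqrt (e k) \<le> sqrt (exp (D * T) * (T * X) * (h powr \<alpha>)\<^sup>2)" by (rule real_sqrt_le_mono)
      also have "\<dots> = sqrt (exp (D * T) * (T * X)) * h powr \<alpha>" using pw by (simp add: real_sqrt_mult)
      also have "\<dots> \<le> R * h powr \<alpha>" using B h0 by (intro mult_right_mono) (auto simp: R_def)
      finally show ?thesis unfolding L2[symmetric] h_def .
    next
      case False
      have tT: "real k * h \<in> {0..T}" using hk[OF k] hp by simp
      have cD: "continuous_on UNIV (\<lambda>x. V N k x - v (real k * h) x)"
        using C1[OF N k] hoelder_field_space_continuous[OF hoelder_jet_field[OF v3] tT] by (intro continuous_on_diff) (auto simp: C1_space_def)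
      have "norm (V N k x - v (real k * h) x) \<le> \<bar>C0\<bar> + Kv" for x
        using norm_triangle_ineq4[of "V N k x" "v (real k * h) x"] bd[OF N k, of x] Kv(2)[OF tT, of x] by linarith
      then have "e k \<le> (LINT x:(cell L::(real^'n) set)|lborel. (\<bar>C0\<bar> + Kv)\<^sup>2)"
        unfolding e_def
        by (intro set_integral_mono continuous_cell_integrable continuous_on_power continuous_on_norm cD continuous_on_const power_mono) auto
      also have "\<dots> = L ^ CARD('n) * (\<bar>C0\<bar> + Kv)\<^sup>2"
        using measure_cell[OF pos(3), where 'n='n] by (simp add: set_lebesgue_integral_def)
      finally have "sqrt (e k) \<le> sqrt (L ^ CARD('n) * (\<bar>C0\<bar> + Kv)\<^sup>2)" by (rule real_sqrt_le_mono)
      also have "\<dots> = B" using Kv by (simp add: B_def real_sqrt_mult)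
      also have "B = B / h0 powr \<alpha> * h0 powr \<alpha>" using h0 by simp
      also have "\<dots> \<le> R * h powr \<alpha>"
        using False B h0 \<alpha> X pos R by (intro mult_mono powr_mono2) (auto simp: R_def intro!: add_nonneg_nonneg)
      finally show ?thesis unfolding L2[symmetric] h_def .
    qed
  qed
  then show ?thesis using R by blast
qed

end

section \<open>From the stochastic problem to its paths\<close>

lemma continuous_on_eq_of_dense:
  fixes f g :: "'a::metric_space \<Rightarrow> 'b::metric_space"
  assumes f: "continuous_on S f" and g: "continuous_on S g" and D: "D \<subseteq> S" "S \<subseteq> closure D" and eq: "\<And>x. x \<in> D \<Longrightarrow> f x = g x" and x: "x \<in> S"
  shows "f x = g x"
proof -
  obtain y where y: "\<And>n. y n \<in> D" "y \<longlonglongrightarrow> x" using x D(2) closure_sequential by blast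
  have ev: "eventually (\<lambda>n. y n \<in> S) sequentially" by (rule always_eventually) (use y(1) D(1) in blast)
  have "(\<lambda>n. f (y n)) \<longlonglongrightarrow> f x" by (rule continuous_on_tendsto_compose[OF f y(2) x ev])
  moreover have "(\<lambda>n. g (y n)) \<longlonglongrightarrow> g x" by (rule continuous_on_tendsto_compose[OF g y(2) x ev])
  ultimately show ?thesis using eq[OF y(1)] by (simp add: LIMSEQ_unique)
qed

text \<open>One derivative is spent on time: the time derivative is bounded with one space derivative less,
  and integrating it gives Lipschitz continuity in time.\<close>

lemma smooth_tx_time_regularity:
  fixes u :: "real \<Rightarrow> real^'n::finite \<Rightarrow> 'b::euclidean_space"
  assumes s: "smooth_tx (Suc k) T u" and per: "\<And>t. t \<in> {0..T} \<Longrightarrow> periodic L (u t)" and pos: "L > 0" "T > 0" and \<alpha>: "\<alpha> \<le> 1"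
  shows "hoelder_jet \<alpha> T k u" "hoelder_jet 0 T k (tpartial T None u)"
    "\<And>t x. t \<in> {0..T} \<Longrightarrow> ((\<lambda>s. u s x) has_vector_derivative tpartial T None u t x) (at t within {0..T})"
    "\<And>s t x. 0 \<le> t \<Longrightarrow> t \<le> s \<Longrightarrow> s \<le> T \<Longrightarrow> u s x - u t x = integral {t..s} (\<lambda>r. tpartial T None u r x)"
proof -
  show d: "((\<lambda>s. u s x) has_vector_derivative tpartial T None u t x) (at t within {0..T})" if "t \<in> {0..T}" for t x
    using smooth_in_deriv(2)[OF s, of None t x] that by (simp add: vector_derivative_works)
  have perH: "periodic L (tpartial T None u t)" if t: "t \<in> {0..T}" for t
    unfolding periodic_def
  proof (intro allI)
    fix x i
    have "((\<lambda>s. u s x) has_vector_derivative tpartial T None u t (x + L *\<^sub>R axis i 1)) (at t within {0..T})"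
      by (rule has_vector_derivative_transform[OF t _ d[OF t, of "x + L *\<^sub>R axis i 1"]]) (use per in \<open>simp add: periodic_def\<close>)
    then show "tpartial T None u t (x + L *\<^sub>R axis i 1) = tpartial T None u t x"
      using vector_derivative_unique_within[OF _ d[OF t, of x]] t pos(2) by (simp add: trivial_limit_within islimpt_Icc)
  qed
  show H: "hoelder_jet 0 T k (tpartial T None u)"
    by (rule smooth_in_hoelder_jet[OF smooth_in_deriv(1)[OF s UNIV_I] _ perH pos(1)]) auto
  show inc: "u s x - u t x = integral {t..s} (\<lambda>r. tpartial T None u r x)" if "0 \<le> t" "t \<le> s" "s \<le> T" for s t x
  proof -
    have "((\<lambda>r. tpartial T None u r x) has_integral u s x - u t x) {t..s}"
      by (rule fundamental_theorem_of_calculus[OF that(2)])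
         (rule has_vector_derivative_within_subset[OF d]; use that in auto)
    then show ?thesis by (simp add: integral_unique)
  qed
  have "hoelder_jet 0 T (Suc k) u" by (rule smooth_in_hoelder_jet[OF s _ per pos(1)]) auto
  then show "hoelder_jet \<alpha> T k u"
    by (intro hoelder_jet_of_integral[OF hoelder_jet_Suc_lower H \<alpha> pos(2) inc])
qed

lemma hoelder_jet_grad:
  assumes "hoelder_jet \<alpha> T (Suc k) p"
  shows "hoelder_jet \<alpha> T k (\<lambda>t x. grad (p t) x :: real^'n::finite)"
proof -
  have "(\<lambda>t x. grad (p t) x) = (\<lambda>t x. \<Sum>i\<in>UNIV. spartial i (p t) x *\<^sub>R axis i 1)"
    by (auto simp: fun_eq_iff vec_eq_iff grad_def axis_def if_distrib cong: if_cong)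
  then show ?thesis
    by (simp only:) (intro hoelder_jet_sum hoelder_jet_linear[OF bounded_linear_scaleR_left] hoelder_jet_spartial[OF assms] finite)
qed

text \<open>For a fixed time and place the equation holds almost surely, and the stochastic integral can be
  replaced by its integrated form, in which both sides are continuous in each variable. A countable
  dense set of times and places therefore yields one null set for all.\<close>

lemma solution_path_representation:
  fixes w :: "real \<Rightarrow> 'a \<Rightarrow> real^'q::finite" and v :: "real \<Rightarrow> real^'n::finite \<Rightarrow> 'a \<Rightarrow> real^'n" and p :: "real \<Rightarrow> real^'n \<Rightarrow> 'a \<Rightarrow> real"
  assumes M: "prob_space M" and w: "standard_wiener_process M T w" and pos: "T > 0" "L > 0"
    and f: "hoelder_field \<alpha> T f"
    and \<gamma>: "\<And>r. hoelder_field \<alpha> T (\<gamma> r)" and \<gamma>': "\<And>r. hoelder_field 0 T (\<gamma>' r)"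
    and d\<gamma>: "\<And>r t x. t \<in> {0..T} \<Longrightarrow> ((\<lambda>s. \<gamma> r s x) has_vector_derivative \<gamma>' r t x) (at t within {0..T})"
    and sol: "classical_solution M w \<sigma> T L f \<gamma> \<phi> v p"
    and vj: "AE \<omega> in M. hoelder_jet 0 T (Suc (Suc 0)) (\<lambda>t x. v t x \<omega>)" and pj: "AE \<omega> in M. hoelder_jet 0 T (Suc 0) (\<lambda>t x. p t x \<omega>)"
  shows "AE \<omega> in M. \<forall>t\<in>{0..T}. \<forall>x. v t x \<omega> = \<phi> x +
      integral {0..t} (\<lambda>s. (\<sigma>\<^sup>2 / 2) *\<^sub>R laplacian (\<lambda>y. v s y \<omega>) x - convection (\<lambda>y. v s y \<omega>) x - grad (\<lambda>y. p s y \<omega>) x + f s x)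
      + (\<Sum>r\<in>UNIV. w t \<omega> $ r *\<^sub>R \<gamma> r t x - integral {0..t} (\<lambda>s. w s \<omega> $ r *\<^sub>R \<gamma>' r s x))"
proof -
  let ?H = "\<lambda>\<omega> s x. (\<sigma>\<^sup>2 / 2) *\<^sub>R laplacian (\<lambda>y. v s y \<omega>) x - convection (\<lambda>y. v s y \<omega>) x - grad (\<lambda>y. p s y \<omega>) x + f s x"
  let ?\<Phi> = "\<lambda>\<omega> t x. \<phi> x + integral {0..t} (\<lambda>s. ?H \<omega> s x) + (\<Sum>r\<in>UNIV. w t \<omega> $ r *\<^sub>R \<gamma> r t x - integral {0..t} (\<lambda>s. w s \<omega> $ r *\<^sub>R \<gamma>' r s x))"
  have w0: "AE \<omega> in M. w 0 \<omega> = 0" and wc: "AE \<omega> in M. continuous_on {0..T} (\<lambda>t. w t \<omega>)"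
    using w by (auto simp: standard_wiener_process_def)
  have pt: "AE \<omega> in M. v t x \<omega> = ?\<Phi> \<omega> t x" if t: "t \<in> {0..T}" for t x
  proof -
    obtain I where I: "\<And>r. has_ito_integral M (natural_filtration M w) (\<lambda>s \<omega>. w s \<omega> $ r) t (\<lambda>s _. \<gamma> r s x) (I r)"
      and eq: "AE \<omega> in M. v t x \<omega> = \<phi> x + integral {0..t} (\<lambda>s. ?H \<omega> s x) + (\<Sum>r\<in>UNIV. I r \<omega>)"
      using sol t unfolding classical_solution_def by blast
    have "AE \<omega> in M. I r \<omega> = w t \<omega> $ r *\<^sub>R \<gamma> r t x - w 0 \<omega> $ r *\<^sub>R \<gamma> r 0 x - integral {0..t} (\<lambda>s. w s \<omega> $ r *\<^sub>R \<gamma>' r s x)" for r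
    proof -
      interpret W: wiener_component M T w r
        by (intro wiener_component.intro M wiener_component_axioms.intro w)
      show ?thesis
      proof (rule W.ito_integral_by_parts[OF _ _ _ _ I])
        show "continuous_on {0..t} (\<lambda>s. \<gamma>' r s x)" by (rule hoelder_field_time_continuous[OF \<gamma>']) (use t in auto)
        show "((\<lambda>s. \<gamma> r s x) has_vector_derivative \<gamma>' r s x) (at s within {0..t})" if "s \<in> {0..t}" for s
          by (rule has_vector_derivative_within_subset[OF d\<gamma>]) (use t that in auto)
      qed (use t in auto)
    qed
    then have "AE \<omega> in M. \<forall>r. I r \<omega> = w t \<omega> $ r *\<^sub>R \<gamma> r t x - w 0 \<omega> $ r *\<^sub>R \<gamma> r 0 x - integral {0..t} (\<lambda>s. w s \<omega> $ r *\<^sub>R \<gamma>' r s x)"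
      by (simp add: AE_all_countable)
    with eq w0 show ?thesis by eventually_elim simp
  qed
  obtain D1 :: "real set" where D1: "countable D1" "D1 \<subseteq> {0..T}" "{0..T} \<subseteq> closure D1" by (rule separable)
  obtain D2 :: "(real^'n) set" where D2: "countable D2" "D2 \<subseteq> UNIV" "UNIV \<subseteq> closure D2" by (rule separable)
  have "AE \<omega> in M. \<forall>z\<in>D1 \<times> D2. v (fst z) (snd z) \<omega> = ?\<Phi> \<omega> (fst z) (snd z)"
    using D1 D2 pt by (subst AE_ball_countable) auto
  moreover have "AE \<omega> in M. \<forall>x. v 0 x \<omega> = \<phi> x"
    using sol unfolding classical_solution_def by (auto elim: AE_mp)
  ultimately show ?thesis using wc vj pj
  proof eventually_elim
    fix \<omega> assume D: "\<forall>z\<in>D1 \<times> D2. v (fst z) (snd z) \<omega> = ?\<Phi> \<omega> (fst z) (snd z)"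
      and init: "\<forall>x. v 0 x \<omega> = \<phi> x" and wc: "continuous_on {0..T} (\<lambda>t. w t \<omega>)"
      and vj: "hoelder_jet 0 T (Suc (Suc 0)) (\<lambda>t x. v t x \<omega>)" and pj: "hoelder_jet 0 T (Suc 0) (\<lambda>t x. p t x \<omega>)"
    have vf: "hoelder_field 0 T (\<lambda>t x. v t x \<omega>)" by (rule hoelder_jet_field[OF vj])
    have phi: "continuous_on UNIV \<phi>"
      using hoelder_field_space_continuous[OF vf, of 0 UNIV] init pos by simp
    have "continuous_on ({0..T} \<times> UNIV) (\<lambda>(t, x). ?H \<omega> t x)"
    proof -
      have 1: "continuous_on ({0..T} \<times> UNIV) (\<lambda>(t, x). (\<sigma>\<^sup>2 / 2) *\<^sub>R laplacian (\<lambda>y. v t y \<omega>) x - convection (\<lambda>y. v t y \<omega>) x)"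
        using hoelder_jet_drift[OF vj, of "\<sigma>\<^sup>2 / 2"] by (simp add: hoelder_field_def)
      have 2: "continuous_on ({0..T} \<times> UNIV) (\<lambda>(t, x). grad (\<lambda>y. p t y \<omega>) x)"
        using hoelder_jet_grad[OF pj] by (simp add: hoelder_field_def)
      show ?thesis using continuous_on_add[OF continuous_on_diff[OF 1 2] hoelder_field_continuous[OF f]]
        by (simp add: case_prod_unfold)
    qed
    note cH = this
    have cHx: "continuous_on UNIV (\<lambda>x. integral {0..t} (\<lambda>s. ?H \<omega> s x))" if t: "t \<in> {0..T}" for t
    proof -
      have "continuous_on (UNIV \<times> cbox 0 t) (\<lambda>z. (\<lambda>(r, y). ?H \<omega> r y) (snd z, fst z))"
        by (rule continuous_on_compose2[OF cH]) (use t in \<open>auto intro!: continuous_intros\<close>)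
      then have "continuous_on (UNIV \<times> cbox 0 t) (\<lambda>(y, r). ?H \<omega> r y)" by (simp add: case_prod_unfold)
      from integral_continuous_on_param[OF this] show ?thesis by simp
    qed
    have cHt: "continuous_on {0..T} (\<lambda>t. integral {0..t} (\<lambda>s. ?H \<omega> s x))" for x
    proof -
      have "continuous_on {0..T} (\<lambda>t. (\<lambda>(t, x). ?H \<omega> t x) (t, x))"
        by (rule continuous_on_compose2[OF cH]) (auto intro!: continuous_intros)
      then show ?thesis by (intro indefinite_integral_continuous_1 integrable_continuous_interval) simp
    qed
    have cw: "continuous_on {0..T} (\<lambda>t. w t \<omega> $ r)" for r by (intro continuous_intros wc)
    have cG: "continuous_on ({0..T} \<times> UNIV) (\<lambda>(s, x). w s \<omega> $ r *\<^sub>R \<gamma>' r s x)" for r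
    proof -
      have "continuous_on ({0..T} \<times> UNIV) (\<lambda>z::real \<times> (real^'n). w (fst z) \<omega> $ r)"
        by (rule continuous_on_compose2[OF cw]) (auto intro!: continuous_intros)
      from continuous_on_scaleR[OF this hoelder_field_continuous[OF \<gamma>'[of r]]] show ?thesis by (simp add: case_prod_unfold)
    qed
    have cGx: "continuous_on UNIV (\<lambda>x. integral {0..t} (\<lambda>s. w s \<omega> $ r *\<^sub>R \<gamma>' r s x))" if t: "t \<in> {0..T}" for t r
    proof -
      have "continuous_on (UNIV \<times> cbox 0 t) (\<lambda>z. (\<lambda>(s, x). w s \<omega> $ r *\<^sub>R \<gamma>' r s x) (snd z, fst z))"
        by (rule continuous_on_compose2[OF cG]) (use t in \<open>auto intro!: continuous_intros\<close>)
      then have "continuous_on (UNIV \<times> cbox 0 t) (\<lambda>(y, s). w s \<omega> $ r *\<^sub>R \<gamma>' r s y)" by (simp add: case_prod_unfold)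
      from integral_continuous_on_param[OF this] show ?thesis by simp
    qed
    have cGt: "continuous_on {0..T} (\<lambda>t. integral {0..t} (\<lambda>s. w s \<omega> $ r *\<^sub>R \<gamma>' r s x))" for x r
    proof -
      have "continuous_on {0..T} (\<lambda>t. (\<lambda>(s, x). w s \<omega> $ r *\<^sub>R \<gamma>' r s x) (t, x))"
        by (rule continuous_on_compose2[OF cG]) (auto intro!: continuous_intros)
      then show ?thesis by (intro indefinite_integral_continuous_1 integrable_continuous_interval) simp
    qed
    have c\<Phi>x: "continuous_on UNIV (?\<Phi> \<omega> t)" if t: "t \<in> {0..T}" for t
      by (intro continuous_on_add continuous_on_sum continuous_on_diff continuous_on_scaleR continuous_on_const phi cHx[OF t] cGx[OF t]
            hoelder_field_space_continuous[OF \<gamma> t])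
    have c\<Phi>t: "continuous_on {0..T} (\<lambda>t. ?\<Phi> \<omega> t x)" for x
      by (intro continuous_on_add continuous_on_sum continuous_on_diff continuous_on_scaleR continuous_on_const cHt cGt cw
            hoelder_field_time_continuous[OF \<gamma>] order_refl)
    have 1: "v t x \<omega> = ?\<Phi> \<omega> t x" if t: "t \<in> D1" for t x
    proof (rule continuous_on_eq_of_dense[OF _ c\<Phi>x D2(2,3) _ UNIV_I])
      show "continuous_on UNIV (\<lambda>x. v t x \<omega>)" using hoelder_field_space_continuous[OF vf] t D1(2) by auto
    qed (use t D1(2) D in auto)
    show "\<forall>t\<in>{0..T}. \<forall>x. v t x \<omega> = ?\<Phi> \<omega> t x"
    proof (intro ballI allI)
      fix t x assume t: "t \<in> {0..T}"
      show "v t x \<omega> = ?\<Phi> \<omega> t x"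
        by (rule continuous_on_eq_of_dense[OF hoelder_field_time_continuous[OF vf order_refl] c\<Phi>t D1(2,3) 1 t])
    qed
  qed
qed

text \<open>Subtracting the noise leaves a field with bounded time derivative, so the velocity and its
  derivatives inherit the Hoelder exponent of the Wiener path.\<close>

lemma path_satisfies_locale:
  fixes w :: "real \<Rightarrow> real^'q::finite" and v :: "real \<Rightarrow> real^'n::finite \<Rightarrow> real^'n"
  assumes pos: "\<sigma> > 0" "T > 0" "L > 0" and \<alpha>: "0 < \<alpha>" "\<alpha> < 1/2"
    and v4: "hoelder_jet 0 T (Suc (Suc (Suc (Suc 0)))) v" and p3: "hoelder_jet 0 T (Suc (Suc (Suc 0))) p"
    and f: "hoelder_jet \<alpha> T (Suc (Suc 0)) f"
    and \<gamma>: "\<And>r. hoelder_jet \<alpha> T (Suc (Suc 0)) (\<gamma> r)" and \<gamma>': "\<And>r. hoelder_jet 0 T (Suc (Suc 0)) (\<gamma>' r)"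
    and \<gamma>_inc: "\<And>r t s x. 0 \<le> t \<Longrightarrow> t \<le> s \<Longrightarrow> s \<le> T \<Longrightarrow> \<gamma> r s x - \<gamma> r t x = integral {t..s} (\<lambda>u. \<gamma>' r u x)"
    and wc: "continuous_on {0..T} w"
    and wh: "\<exists>K\<ge>0. \<forall>s\<in>{0..T}. \<forall>t\<in>{0..T}. norm (w t - w s) \<le> K * \<bar>t - s\<bar> powr \<alpha>"
    and rep: "\<And>t x. t \<in> {0..T} \<Longrightarrow> v t x = \<phi> x +
      integral {0..t} (\<lambda>s. (\<sigma>\<^sup>2 / 2) *\<^sub>R laplacian (v s) x - convection (v s) x - grad (p s) x + f s x)
      + (\<Sum>r\<in>UNIV. w t $ r *\<^sub>R \<gamma> r t x - integral {0..t} (\<lambda>s. w s $ r *\<^sub>R \<gamma>' r s x))"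
    and per: "\<And>t. t \<in> {0..T} \<Longrightarrow> periodic L (v t)" "\<And>t. t \<in> {0..T} \<Longrightarrow> periodic L (p t)" "\<And>r t. t \<in> {0..T} \<Longrightarrow> periodic L (\<gamma> r t)"
    and div: "\<And>t x. t \<in> {0..T} \<Longrightarrow> divergence (v t) x = 0" "\<And>r t x. t \<in> {0..T} \<Longrightarrow> divergence (\<gamma> r t) x = 0"
  shows "navier_stokes_path \<sigma> T L \<alpha> f \<gamma> \<gamma>' v p w"
proof -
  let ?H = "\<lambda>s x. (\<sigma>\<^sup>2 / 2) *\<^sub>R laplacian (v s) x - convection (v s) x - grad (p s) x + f s x"
  let ?N = "\<lambda>r s x. w s $ r *\<^sub>R \<gamma>' r s x"
  have w\<alpha>: "hoelder_field \<alpha> T (\<lambda>t (x::real^'n). w t $ r)" for r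
  proof -
    obtain K where K: "\<And>s t. s \<in> {0..T} \<Longrightarrow> t \<in> {0..T} \<Longrightarrow> norm (w t - w s) \<le> K * \<bar>t - s\<bar> powr \<alpha>" using wh by blast
    have "bounded (w ` {0..T})" by (rule compact_imp_bounded[OF compact_continuous_image[OF wc compact_Icc]])
    then obtain B where "\<forall>z\<in>w ` {0..T}. norm z \<le> B" unfolding bounded_iff by blast
    then have B: "norm (w t) \<le> B" if "t \<in> {0..T}" for t using that by blast
    show ?thesis
    proof (rule hoelder_fieldI)
      have "continuous_on ({0..T} \<times> UNIV) (\<lambda>z::real \<times> (real^'n). w (fst z) $ r)"
        by (intro continuous_intros continuous_on_compose2[OF wc]) auto
      then show "continuous_on ({0..T} \<times> UNIV) (\<lambda>(t, x::real^'n). w t $ r)" by (simp add: case_prod_unfold)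
      show "norm (w t $ r) \<le> B" if "t \<in> {0..T}" for t
        using component_le_norm_cart[of "w t" r] B[OF that] by simp
      show "norm (w s $ r - w t $ r) \<le> K * \<bar>s - t\<bar> powr \<alpha>" if "s \<in> {0..T}" "t \<in> {0..T}" for s t
        using component_le_norm_cart[of "w s - w t" r] K[OF that(2,1)] by simp
    qed
  qed
  have w0: "hoelder_field 0 T (\<lambda>t (x::real^'n). w t $ r)" for r
    by (rule hoelder_field_weaken[OF w\<alpha>]) (use \<alpha> pos in auto)
  have w\<gamma>: "hoelder_jet \<alpha> T (Suc (Suc 0)) (\<lambda>t x. \<Sum>r\<in>UNIV. w t $ r *\<^sub>R \<gamma> r t x)"
    by (intro hoelder_jet_sum hoelder_jet_bilinear[OF bounded_bilinear_scaleR] hoelder_jet_space_const w\<alpha> \<gamma> finite)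
  have N: "hoelder_jet 0 T (Suc (Suc 0)) (?N r)" for r
    by (intro hoelder_jet_bilinear[OF bounded_bilinear_scaleR] hoelder_jet_space_const w0 \<gamma>')
  have f0: "hoelder_jet 0 T (Suc (Suc 0)) f" by (rule hoelder_jet_weaken[OF f]) (use \<alpha> pos in auto)
  have H: "hoelder_jet 0 T (Suc (Suc 0)) ?H"
    by (intro hoelder_jet_add hoelder_jet_diff[of _ _ _ "\<lambda>s x. (\<sigma>\<^sup>2 / 2) *\<^sub>R laplacian (v s) x - convection (v s) x"] hoelder_jet_drift v4 hoelder_jet_grad p3 f0)
  have int: "(\<lambda>s. ?H s x) integrable_on {t..s}" "(\<lambda>s. ?N r s x) integrable_on {t..s}" if "0 \<le> t" "s \<le> T" for t s x r
    using that by (auto intro!: integrable_continuous_interval hoelder_field_time_continuous[OF hoelder_jet_field[OF H]] hoelder_field_time_continuous[OF hoelder_jet_field[OF N]])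
  have inc: "v s x - v t x = integral {t..s} (\<lambda>u. ?H u x)
      + (\<Sum>r\<in>UNIV. w s $ r *\<^sub>R \<gamma> r s x - w t $ r *\<^sub>R \<gamma> r t x - integral {t..s} (\<lambda>u. ?N r u x))" if ts: "0 \<le> t" "t \<le> s" "s \<le> T" for t s x
  proof -
    have "integral {0..s} (\<lambda>u. ?H u x) = integral {0..t} (\<lambda>u. ?H u x) + integral {t..s} (\<lambda>u. ?H u x)"
      by (rule Henstock_Kurzweil_Integration.integral_combine[symmetric]) (use ts int in auto)
    moreover have "integral {0..s} (\<lambda>u. ?N r u x) = integral {0..t} (\<lambda>u. ?N r u x) + integral {t..s} (\<lambda>u. ?N r u x)" for r
      by (rule Henstock_Kurzweil_Integration.integral_combine[symmetric]) (use ts int in auto)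
    moreover have "v s x - v t x = (\<phi> x + integral {0..s} (\<lambda>u. ?H u x) + (\<Sum>r\<in>UNIV. w s $ r *\<^sub>R \<gamma> r s x - integral {0..s} (\<lambda>u. ?N r u x)))
        - (\<phi> x + integral {0..t} (\<lambda>u. ?H u x) + (\<Sum>r\<in>UNIV. w t $ r *\<^sub>R \<gamma> r t x - integral {0..t} (\<lambda>u. ?N r u x)))"
    proof -
      have ps: "s \<in> {0..T}" "t \<in> {0..T}" using ts by auto
      show ?thesis by (simp only: rep[OF ps(1), of x] rep[OF ps(2), of x])
    qed
    ultimately show ?thesis by (simp only: sum_subtractf sum.distrib) simp
  qed
  \<comment> \<open>The part of the velocity that is Lipschitz in time.\<close>
  let ?Z = "\<lambda>t x. v t x - (\<Sum>r\<in>UNIV. w t $ r *\<^sub>R \<gamma> r t x)"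
  have "hoelder_jet \<alpha> T (Suc (Suc 0)) ?Z"
  proof (rule hoelder_jet_of_integral[where H="\<lambda>s x. ?H s x - (\<Sum>r\<in>UNIV. ?N r s x)"])
    have "hoelder_jet 0 T (Suc (Suc 0)) v" by (rule hoelder_jet_mono[OF v4]) simp
    moreover have "hoelder_jet 0 T (Suc (Suc 0)) (\<lambda>t x. \<Sum>r\<in>UNIV. w t $ r *\<^sub>R \<gamma> r t x)"
      by (rule hoelder_jet_weaken[OF w\<gamma>]) (use \<alpha> pos in auto)
    ultimately show "hoelder_jet 0 T (Suc (Suc 0)) ?Z" by (rule hoelder_jet_diff)
    show "hoelder_jet 0 T (Suc (Suc 0)) (\<lambda>s x. ?H s x - (\<Sum>r\<in>UNIV. ?N r s x))"
      by (intro hoelder_jet_diff[OF H] hoelder_jet_sum N finite)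
    fix s t x assume ts: "0 \<le> t" "t \<le> s" "s \<le> T"
    have "integral {t..s} (\<lambda>u. ?H u x - (\<Sum>r\<in>UNIV. ?N r u x)) = integral {t..s} (\<lambda>u. ?H u x) - (\<Sum>r\<in>UNIV. integral {t..s} (\<lambda>u. ?N r u x))"
      by (subst Henstock_Kurzweil_Integration.integral_diff, use ts int in \<open>auto intro!: integrable_sum simp: integral_sum\<close>)
    moreover have "a - c - (b - d) = A - e" if "a - b = A + (c - d - e)" for a b c d e A :: "real^'n"
      using that by (simp add: algebra_simps)
    ultimately show "?Z s x - ?Z t x = integral {t..s} (\<lambda>u. ?H u x - (\<Sum>r\<in>UNIV. ?N r u x))"
      using inc[OF ts, of x, unfolded sum_subtractf] by (simp only:)
  qed (use \<alpha> pos in auto)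
  from hoelder_jet_add[OF this w\<gamma>] have v2: "hoelder_jet \<alpha> T (Suc (Suc 0)) v" by simp
  show ?thesis
  proof
    show "hoelder_jet 0 T (Suc (Suc (Suc 0))) v" by (rule hoelder_jet_mono[OF v4]) simp
    show "hoelder_jet 0 T (Suc 0) p" by (rule hoelder_jet_mono[OF p3]) simp
    show "hoelder_field \<alpha> T f" by (rule hoelder_jet_field[OF f])
    show "hoelder_field 0 T (\<gamma>' r)" for r by (rule hoelder_jet_field[OF \<gamma>'])
    show "hoelder_jet 0 T (Suc 0) (\<gamma> r)" for r
      by (rule hoelder_jet_weaken[OF hoelder_jet_mono[OF \<gamma>]]) (use \<alpha> pos in auto)
  qed (use pos \<alpha> v2 \<gamma>_inc wc wh inc per div in auto)
qed

theorem theorem4p2: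
  shows "\<exists>smoothness_order :: nat.
    \<forall>(M :: 'a measure) (w :: real \<Rightarrow> 'a \<Rightarrow> real^'q::finite) (\<sigma> :: real) (T :: real) (L :: real)
     (f :: real \<Rightarrow> real^'n::finite \<Rightarrow> real^'n) (\<gamma> :: 'q \<Rightarrow> real \<Rightarrow> real^'n \<Rightarrow> real^'n)
     (\<phi> :: real^'n \<Rightarrow> real^'n)
     (v :: real \<Rightarrow> real^'n \<Rightarrow> 'a \<Rightarrow> real^'n) (p :: real \<Rightarrow> real^'n \<Rightarrow> 'a \<Rightarrow> real)
     (vbar :: nat \<Rightarrow> nat \<Rightarrow> real^'n \<Rightarrow> 'a \<Rightarrow> real^'n).
      prob_space M \<and> standard_wiener_process M T w \<and> \<sigma> > 0 \<and> T > 0 \<and> L > 0 \<and>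
      smooth_tx smoothness_order T f \<and> (\<forall>t\<in>{0..T}. periodic L (f t)) \<and>
      (\<forall>r. smooth_tx smoothness_order T (\<gamma> r) \<and>
           (\<forall>t\<in>{0..T}. periodic L (\<gamma> r t) \<and> (\<forall>x. divergence (\<gamma> r t) x = 0))) \<and>
      periodic L \<phi> \<and>
      unique_classical_solution M w \<sigma> T L f \<gamma> \<phi> v p \<and>
      (AE \<omega> in M. smooth_x 4 T (\<lambda>t x. v t x \<omega>) \<and> smooth_x 3 T (\<lambda>t x. p t x \<omega>)) \<and>
      bounded_moments M 4 T v \<and> bounded_moments M 3 T p \<and>
      (AE \<omega> in M. \<forall>N\<ge>1. layer_method \<sigma> T L f \<gamma> \<phi> (\<lambda>t. w t \<omega>) N (\<lambda>k x. vbar N k x \<omega>)) \<and>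
      (AE \<omega> in M. \<forall>N\<ge>1. \<forall>k\<le>N. C1_space (\<lambda>x. vbar N k x \<omega>)) \<and>
      (AE \<omega> in M. \<exists>C0>0. \<forall>N\<ge>1. \<forall>k\<le>N. \<forall>x.
         norm (vbar N k x \<omega>) \<le> C0 \<and>
         (\<forall>i. norm (spartial i (\<lambda>y. vbar N k y \<omega>) x) \<le> C0))
      \<longrightarrow>
      (AE \<omega> in M. \<forall>\<epsilon>. 0 < \<epsilon> \<and> \<epsilon> < 1/2 \<longrightarrow>
         (\<exists>C>0. \<forall>N\<ge>1. \<forall>k\<le>N.
            L2_norm L (\<lambda>x. vbar N k x \<omega> - v (real k * (T / real N)) x \<omega>)
              \<le> C * (T / real N) powr (1/2 - \<epsilon>)))"
proof (intro exI[of _ 3] allI impI, elim conjE)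
  \<comment> \<open>Three derivatives of the data: one in time for the Hoelder exponent, and two in space that the velocity inherits from the noise coefficients.\<close>
  fix M :: "'a measure" and w :: "real \<Rightarrow> 'a \<Rightarrow> real^'q" and \<sigma> T L :: real
    and f :: "real \<Rightarrow> real^'n \<Rightarrow> real^'n" and \<gamma> :: "'q \<Rightarrow> real \<Rightarrow> real^'n \<Rightarrow> real^'n" and \<phi> :: "real^'n \<Rightarrow> real^'n"
    and v :: "real \<Rightarrow> real^'n \<Rightarrow> 'a \<Rightarrow> real^'n" and p :: "real \<Rightarrow> real^'n \<Rightarrow> 'a \<Rightarrow> real"
    and vbar :: "nat \<Rightarrow> nat \<Rightarrow> real^'n \<Rightarrow> 'a \<Rightarrow> real^'n"
  assume M: "prob_space M" and w: "standard_wiener_process M T w" and pos: "\<sigma> > 0" "T > 0" "L > 0"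
    and fs: "smooth_tx 3 T f" and fp: "\<forall>t\<in>{0..T}. periodic L (f t)"
    and \<gamma>: "\<forall>r. smooth_tx 3 T (\<gamma> r) \<and> (\<forall>t\<in>{0..T}. periodic L (\<gamma> r t) \<and> (\<forall>x. divergence (\<gamma> r t) x = 0))"
    and usol: "unique_classical_solution M w \<sigma> T L f \<gamma> \<phi> v p"
    and sm: "AE \<omega> in M. smooth_x 4 T (\<lambda>t x. v t x \<omega>) \<and> smooth_x 3 T (\<lambda>t x. p t x \<omega>)"
    and lm: "AE \<omega> in M. \<forall>N\<ge>1. layer_method \<sigma> T L f \<gamma> \<phi> (\<lambda>t. w t \<omega>) N (\<lambda>k x. vbar N k x \<omega>)"
    and C1: "AE \<omega> in M. \<forall>N\<ge>1. \<forall>k\<le>N. C1_space (\<lambda>x. vbar N k x \<omega>)"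
    and bd: "AE \<omega> in M. \<exists>C0>0. \<forall>N\<ge>1. \<forall>k\<le>N. \<forall>x.
         norm (vbar N k x \<omega>) \<le> C0 \<and> (\<forall>i. norm (spartial i (\<lambda>y. vbar N k y \<omega>) x) \<le> C0)"
  define \<gamma>' where "\<gamma>' r = tpartial T None (\<gamma> r)" for r
  \<comment> \<open>Countably many exponents; the offset \<open>3\<close> keeps them positive.\<close>
  define a where "a m = 1/2 - 1 / real (m + 3)" for m :: nat
  have a: "0 < a m" "a m < 1/2" for m by (auto simp: a_def field_simps)
  have three: "3 = Suc (Suc (Suc 0))" and four: "4 = Suc (Suc (Suc (Suc 0)))" by simp_all
  have sol: "classical_solution M w \<sigma> T L f \<gamma> \<phi> v p" using usol by (simp add: unique_classical_solution_def)
  have fj: "hoelder_jet (a m) T (Suc (Suc 0)) f" for m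
    using smooth_tx_time_regularity(1)[OF fs[unfolded three] _ pos(3,2), of "a m"] fp a[of m] by simp
  have \<gamma>s: "smooth_tx (Suc (Suc (Suc 0))) T (\<gamma> r)" and \<gamma>p: "\<And>t. t \<in> {0..T} \<Longrightarrow> periodic L (\<gamma> r t)" for r
    using \<gamma> by (auto simp: three)
  note \<gamma>r = smooth_tx_time_regularity[OF \<gamma>s \<gamma>p pos(3,2), folded \<gamma>'_def]
  have \<gamma>j: "hoelder_jet (a m) T (Suc (Suc 0)) (\<gamma> r)" for m r using \<gamma>r(1)[of "a m"] a[of m] by simp
  have \<gamma>'j: "hoelder_jet 0 T (Suc (Suc 0)) (\<gamma>' r)" for r using \<gamma>r(2)[of 0] by simp
  have reg: "AE \<omega> in M. (\<forall>x. v 0 x \<omega> = \<phi> x) \<and> (\<forall>t\<in>{0..T}. (\<forall>x. divergence (\<lambda>y. v t y \<omega>) x = 0) \<and>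
           periodic L (\<lambda>x. v t x \<omega>) \<and> periodic L (\<lambda>x. p t x \<omega>))"
    using sol unfolding classical_solution_def by (auto elim!: AE_mp)
  with sm have jets: "AE \<omega> in M. hoelder_jet 0 T (Suc (Suc (Suc (Suc 0)))) (\<lambda>t x. v t x \<omega>) \<and> hoelder_jet 0 T (Suc (Suc (Suc 0))) (\<lambda>t x. p t x \<omega>)"
  proof eventually_elim
    fix \<omega> assume s: "smooth_x 4 T (\<lambda>t x. v t x \<omega>) \<and> smooth_x 3 T (\<lambda>t x. p t x \<omega>)"
      and r: "(\<forall>x. v 0 x \<omega> = \<phi> x) \<and> (\<forall>t\<in>{0..T}. (\<forall>x. divergence (\<lambda>y. v t y \<omega>) x = 0) \<and>
           periodic L (\<lambda>x. v t x \<omega>) \<and> periodic L (\<lambda>x. p t x \<omega>))"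
    have "hoelder_jet 0 T 4 (\<lambda>t x. v t x \<omega>)" "hoelder_jet 0 T 3 (\<lambda>t x. p t x \<omega>)"
      by (rule smooth_in_hoelder_jet[OF _ order_refl _ pos(3)]; use s r in auto)+
    then show "hoelder_jet 0 T (Suc (Suc (Suc (Suc 0)))) (\<lambda>t x. v t x \<omega>) \<and> hoelder_jet 0 T (Suc (Suc (Suc 0))) (\<lambda>t x. p t x \<omega>)"
      by (simp only: three four simp_thms)
  qed
  have rep: "AE \<omega> in M. \<forall>t\<in>{0..T}. \<forall>x. v t x \<omega> = \<phi> x +
      integral {0..t} (\<lambda>s. (\<sigma>\<^sup>2 / 2) *\<^sub>R laplacian (\<lambda>y. v s y \<omega>) x - convection (\<lambda>y. v s y \<omega>) x - grad (\<lambda>y. p s y \<omega>) x + f s x)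
      + (\<Sum>r\<in>UNIV. w t \<omega> $ r *\<^sub>R \<gamma> r t x - integral {0..t} (\<lambda>s. w s \<omega> $ r *\<^sub>R \<gamma>' r s x))"
  proof (rule solution_path_representation[OF M w pos(2,3) hoelder_jet_field[OF fj[of 0]] hoelder_jet_field[OF \<gamma>j[of 0]] hoelder_jet_field[OF \<gamma>'j] \<gamma>r(3)[of 0] sol])
    show "AE \<omega> in M. hoelder_jet 0 T (Suc (Suc 0)) (\<lambda>t x. v t x \<omega>)"
      using jets by eventually_elim (auto intro: hoelder_jet_mono simp del: hoelder_jet.simps)
    show "AE \<omega> in M. hoelder_jet 0 T (Suc 0) (\<lambda>t x. p t x \<omega>)"
      using jets by eventually_elim (auto intro: hoelder_jet_mono simp del: hoelder_jet.simps)
  qed auto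
  have "AE \<omega> in M. \<exists>K\<ge>0. \<forall>s\<in>{0..T}. \<forall>t\<in>{0..T}. norm (w t \<omega> - w s \<omega>) \<le> K * \<bar>t - s\<bar> powr a m" for m
    by (rule wiener_paths_hoelder[OF M w pos(2) a])
  then have wh: "AE \<omega> in M. \<forall>m. \<exists>K\<ge>0. \<forall>s\<in>{0..T}. \<forall>t\<in>{0..T}. norm (w t \<omega> - w s \<omega>) \<le> K * \<bar>t - s\<bar> powr a m"
    by (simp add: AE_all_countable)
  have wc: "AE \<omega> in M. continuous_on {0..T} (\<lambda>t. w t \<omega>)" using w by (simp add: standard_wiener_process_def)
  show "AE \<omega> in M. \<forall>\<epsilon>. 0 < \<epsilon> \<and> \<epsilon> < 1/2 \<longrightarrow>
         (\<exists>C>0. \<forall>N\<ge>1. \<forall>k\<le>N.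
            L2_norm L (\<lambda>x. vbar N k x \<omega> - v (real k * (T / real N)) x \<omega>)
              \<le> C * (T / real N) powr (1/2 - \<epsilon>))"
    using reg jets rep wh wc lm C1 bd
  proof (eventually_elim, intro allI impI)
    fix \<omega> and \<epsilon> :: real
    assume reg: "(\<forall>x. v 0 x \<omega> = \<phi> x) \<and> (\<forall>t\<in>{0..T}. (\<forall>x. divergence (\<lambda>y. v t y \<omega>) x = 0) \<and>
           periodic L (\<lambda>x. v t x \<omega>) \<and> periodic L (\<lambda>x. p t x \<omega>))"
      and jets: "hoelder_jet 0 T (Suc (Suc (Suc (Suc 0)))) (\<lambda>t x. v t x \<omega>) \<and> hoelder_jet 0 T (Suc (Suc (Suc 0))) (\<lambda>t x. p t x \<omega>)"
      and rep: "\<forall>t\<in>{0..T}. \<forall>x. v t x \<omega> = \<phi> x +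
      integral {0..t} (\<lambda>s. (\<sigma>\<^sup>2 / 2) *\<^sub>R laplacian (\<lambda>y. v s y \<omega>) x - convection (\<lambda>y. v s y \<omega>) x - grad (\<lambda>y. p s y \<omega>) x + f s x)
      + (\<Sum>r\<in>UNIV. w t \<omega> $ r *\<^sub>R \<gamma> r t x - integral {0..t} (\<lambda>s. w s \<omega> $ r *\<^sub>R \<gamma>' r s x))"
      and wh: "\<forall>m. \<exists>K\<ge>0. \<forall>s\<in>{0..T}. \<forall>t\<in>{0..T}. norm (w t \<omega> - w s \<omega>) \<le> K * \<bar>t - s\<bar> powr a m"
      and wc: "continuous_on {0..T} (\<lambda>t. w t \<omega>)"
      and lm: "\<forall>N\<ge>1. layer_method \<sigma> T L f \<gamma> \<phi> (\<lambda>t. w t \<omega>) N (\<lambda>k x. vbar N k x \<omega>)"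
      and C1: "\<forall>N\<ge>1. \<forall>k\<le>N. C1_space (\<lambda>x. vbar N k x \<omega>)"
      and bd: "\<exists>C0>0. \<forall>N\<ge>1. \<forall>k\<le>N. \<forall>x.
         norm (vbar N k x \<omega>) \<le> C0 \<and> (\<forall>i. norm (spartial i (\<lambda>y. vbar N k y \<omega>) x) \<le> C0)"
      and \<epsilon>: "0 < \<epsilon> \<and> \<epsilon> < 1/2"
    obtain m :: nat where m: "1 / \<epsilon> < real m" using reals_Archimedean2 by blast
    have "1 / real (m + 3) \<le> \<epsilon>" using m \<epsilon> by (simp add: field_simps)
    then have am: "1/2 - \<epsilon> \<le> a m" by (simp add: a_def)
    interpret navier_stokes_path \<sigma> T L "a m" f \<gamma> \<gamma>' "\<lambda>t x. v t x \<omega>" "\<lambda>t x. p t x \<omega>" "\<lambda>t. w t \<omega>"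
    proof (rule path_satisfies_locale[OF pos a _ _ fj \<gamma>j \<gamma>'j \<gamma>r(4)[of 0] wc])
      show "\<exists>K\<ge>0. \<forall>s\<in>{0..T}. \<forall>t\<in>{0..T}. norm (w t \<omega> - w s \<omega>) \<le> K * \<bar>t - s\<bar> powr a m" using wh by blast
    qed (use reg jets rep \<gamma> in auto)
    obtain C0 where C0: "\<And>N k x. N \<ge> 1 \<Longrightarrow> k \<le> N \<Longrightarrow> norm (vbar N k x \<omega>) \<le> C0"
      "\<And>N k x i. N \<ge> 1 \<Longrightarrow> k \<le> N \<Longrightarrow> norm (spartial i (\<lambda>y. vbar N k y \<omega>) x) \<le> C0" using bd by blast
    have "(\<lambda>x. v 0 x \<omega>) = \<phi>" using reg by auto
    then have "\<exists>C>0. \<forall>N\<ge>1. \<forall>k\<le>N. L2_norm L (\<lambda>x. vbar N k x \<omega> - v (real k * (T / real N)) x \<omega>) \<le> C * (T / real N) powr a m"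
      by (intro layer_method_convergence[where V="\<lambda>N k x. vbar N k x \<omega>"]) (use lm C1 C0 in auto)
    then obtain C where C: "C > 0" "\<And>N k. N \<ge> 1 \<Longrightarrow> k \<le> N \<Longrightarrow> L2_norm L (\<lambda>x. vbar N k x \<omega> - v (real k * (T / real N)) x \<omega>) \<le> C * (T / real N) powr a m"
      by blast
    \<comment> \<open>The exponent \<open>a m\<close> may exceed \<open>1/2 - \<epsilon>\<close>; the excess power of \<open>h \<le> T\<close> goes into the constant.\<close>
    let ?R = "C * T powr (a m - (1/2 - \<epsilon>))"
    have "L2_norm L (\<lambda>x. vbar N k x \<omega> - v (real k * (T / real N)) x \<omega>) \<le> ?R * (T / real N) powr (1/2 - \<epsilon>)" if N: "N \<ge> 1" and k: "k \<le> N" for N k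
    proof -
      have h: "0 < T / real N" "T / real N \<le> T" using pos N by (auto simp: field_simps)
      have "(T / real N) powr a m = (T / real N) powr (a m - (1/2 - \<epsilon>)) * (T / real N) powr (1/2 - \<epsilon>)" by (simp add: powr_add[symmetric])
      also have "\<dots> \<le> T powr (a m - (1/2 - \<epsilon>)) * (T / real N) powr (1/2 - \<epsilon>)"
        using h am by (intro mult_right_mono powr_mono2) auto
      finally have "C * (T / real N) powr a m \<le> C * (T powr (a m - (1/2 - \<epsilon>)) * (T / real N) powr (1/2 - \<epsilon>))"
        using C(1) by (intro mult_left_mono) auto
      then show ?thesis using C(2)[OF N k] by (simp add: mult.assoc)
    qed
    moreover have "?R > 0" using C(1) pos by simp
    ultimately show "\<exists>C>0. \<forall>N\<ge>1. \<forall>k\<le>N.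
            L2_norm L (\<lambda>x. vbar N k x \<omega> - v (real k * (T / real N)) x \<omega>) \<le> C * (T / real N) powr (1/2 - \<epsilon>)" by blast
  qed
qed

end
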